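(* Let $\Omega=B_1\subset\mathbb{R}^d$, $d\ge2$, be the unit ball, and let $0\le V\in C(\overline{B_1})$. Assume that ${\rm supp}\,V=\overline{B_c}$ for some $c\in(0,1)$, and that for any $\delta\in(0,c)$ we have $\inf_{x\in B_\delta}V(x)>0$. Then, for each choice of sign, $$\lim_{\lambda\downarrow0}|\ln\lambda|^{-d+1}\,\mathcal{N}_\pm(\lambda)=\frac{2^{-d+2}}{(d-1)!\,|\ln c|^{d-1}}.$$
   Context: $B_R=\{x\in\mathbb{R}^d:|x|<R\}$. $\mathcal{H}(\Omega)=\{u\in L^2(\Omega):\Delta u=0\text{ in }\Omega\}$ and $H^2_0(\Omega)$ is the closure of $C_0^\infty(\Omega)$ in $H^2(\Omega)$. The Krein Laplacian $K=-\Delta$ with ${\rm Dom}\,K=\mathcal{H}(\Omega)\dotplus H^2_0(\Omega)$ is self-adjoint and non-negative in $L^2(\Omega)$, and ${\rm Ker}\,K=\mathcal{H}(\Omega)$. $L$ is the restriction of $K$ to ${\rm Dom}\,K\cap\mathcal{H}(\Omega)^\perp$, self-adjoint in $\mathcal{H}(\Omega)^\perp=L^2(\Omega)\ominus\mathcal{H}(\Omega)$; its spectrum is purely discrete and positive, and $\lambda_0=\inf\sigma(L)>0$. The operators $K\pm V$ are self-adjoint on ${\rm Dom}\,K$. With $\mathbf{1}_{\mathcal I}(T)$ the spectral projection of the self-adjoint operator $T$ for the interval $\mathcal I$, $$\mathcal{N}_-(\lambda)={\rm Tr}\,\mathbf{1}_{(-\infty,-\lambda)}(K-V)\ (\lambda>0),\qquad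 \mathcal{N}_+(\lambda)={\rm Tr}\,\mathbf{1}_{(\lambda,\lambda_0)}(K+V)\ (\lambda\in(0,\lambda_0)).$$ *)

theory Defs
  imports "HOL-Analysis.Analysis"
begin

text \<open>Elements are represented by square-integrable functions; equality in the Hilbert space is
  almost-everywhere equality. An unbounded operator is given by its graph, a set of pairs of
  representatives that is closed under almost-everywhere equality.\<close>

definition L2 :: "'a measure \<Rightarrow> ('a \<Rightarrow> complex) set" where
  "L2 M = {u. u \<in> borel_measurable M \<and> integrable M (\<lambda>x. (cmod (u x))\<^sup>2)}"

definition L2_inner :: "'a measure \<Rightarrow> ('a \<Rightarrow> complex) \<Rightarrow> ('a \<Rightarrow> complex) \<Rightarrow> complex" where
  "L2_inner M u v = (LINT x|M. u x * cnj (v x))"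

definition L2_norm :: "'a measure \<Rightarrow> ('a \<Rightarrow> complex) \<Rightarrow> real" where
  "L2_norm M u = sqrt (LINT x|M. (cmod (u x))\<^sup>2)"

definition orth_compl :: "'a measure \<Rightarrow> ('a \<Rightarrow> complex) set \<Rightarrow> ('a \<Rightarrow> complex) set" where
  "orth_compl M S = {u \<in> L2 M. \<forall>v\<in>S. L2_inner M u v = 0}"

definition L2_orthonormal_basis :: "'a measure \<Rightarrow> ('a \<Rightarrow> complex) set \<Rightarrow> bool" where
  "L2_orthonormal_basis M B \<longleftrightarrow> B \<subseteq> L2 M
     \<and> (\<forall>e\<in>B. \<forall>f\<in>B. L2_inner M e f = (if e = f then 1 else 0))
     \<and> (\<forall>u\<in>L2 M. (\<forall>e\<in>B. L2_inner M u e = 0) \<longrightarrow> (AE x in M. u x = 0))"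

text \<open>Trace of a non-negative bounded operator, possibly infinite. The value does not depend on
  the orthonormal basis.\<close>

definition L2_trace :: "'a measure \<Rightarrow> (('a \<Rightarrow> complex) \<Rightarrow> ('a \<Rightarrow> complex)) \<Rightarrow> ennreal" where
  "L2_trace M P = (\<Sum>\<^sub>\<infinity>e\<in>(SOME B. L2_orthonormal_basis M B). ennreal (Re (L2_inner M (P e) e)))"

text \<open>The operator \<open>T\<close> acts in the closed subspace \<open>X\<close> of L2. The second conjunct states that
  \<open>T - z\<close> is injective with bounded inverse.\<close>

definition resolvent_set ::
  "'a measure \<Rightarrow> ('a \<Rightarrow> complex) set \<Rightarrow> (('a \<Rightarrow> complex) \<times> ('a \<Rightarrow> complex)) set \<Rightarrow> complex set" where
  "resolvent_set M X T =
     {z. (\<forall>g\<in>X. \<exists>(u, f)\<in>T. AE x in M. f x - z * u x = g x)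
       \<and> (\<exists>C. \<forall>(u, f)\<in>T. L2_norm M u \<le> C * L2_norm M (\<lambda>x. f x - z * u x))}"

definition op_spectrum ::
  "'a measure \<Rightarrow> ('a \<Rightarrow> complex) set \<Rightarrow> (('a \<Rightarrow> complex) \<times> ('a \<Rightarrow> complex)) set \<Rightarrow> complex set" where
  "op_spectrum M X T = - resolvent_set M X T"

definition orth_projection :: "'a measure \<Rightarrow> (('a \<Rightarrow> complex) \<Rightarrow> ('a \<Rightarrow> complex)) \<Rightarrow> bool" where
  "orth_projection M P \<longleftrightarrow>
     (\<forall>u\<in>L2 M. P u \<in> L2 M)
     \<and> (\<forall>u\<in>L2 M. \<forall>v\<in>L2 M. \<forall>a b.
          AE x in M. P (\<lambda>y. a * u y + b * v y) x = a * P u x + b * P v x)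
     \<and> (\<forall>u\<in>L2 M. AE x in M. P (P u) x = P u x)
     \<and> (\<forall>u\<in>L2 M. \<forall>v\<in>L2 M. L2_inner M (P u) v = L2_inner M u (P v))"

definition projection_valued_measure ::
  "'a measure \<Rightarrow> (real set \<Rightarrow> ('a \<Rightarrow> complex) \<Rightarrow> ('a \<Rightarrow> complex)) \<Rightarrow> bool" where
  "projection_valued_measure M E \<longleftrightarrow>
     (\<forall>A\<in>sets borel. orth_projection M (E A))
     \<and> (\<forall>u\<in>L2 M. AE x in M. E UNIV u x = u x)
     \<and> (\<forall>A :: nat \<Rightarrow> real set. range A \<subseteq> sets borel \<longrightarrow> disjoint_family A \<longrightarrow>
          (\<forall>u\<in>L2 M. (\<lambda>n. L2_norm M (\<lambda>x. E (\<Union>k. A k) u x - (\<Sum>k<n. E (A k) u x)))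
             \<longlonglongrightarrow> 0))"

definition scalar_spectral_measure ::
  "'a measure \<Rightarrow> (real set \<Rightarrow> ('a \<Rightarrow> complex) \<Rightarrow> ('a \<Rightarrow> complex)) \<Rightarrow> ('a \<Rightarrow> complex) \<Rightarrow> real measure" where
  "scalar_spectral_measure M E u =
     measure_of UNIV (sets borel) (\<lambda>A. ennreal (Re (L2_inner M (E A u) u)))"

text \<open>\<open>E\<close> is the resolution of the identity of \<open>T\<close>: the domain of \<open>T\<close> consists of the \<open>u\<close> with
  \<open>\<integral> t\<^sup>2 d(E(t)u,u) < \<infinity>\<close>, and \<open>(Tu,u) = \<integral> t d(E(t)u,u)\<close> there. By polarization the latter
  determines \<open>T\<close>.\<close>

definition spectral_resolution ::
  "'a measure \<Rightarrow> (('a \<Rightarrow> complex) \<times> ('a \<Rightarrow> complex)) set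
     \<Rightarrow> (real set \<Rightarrow> ('a \<Rightarrow> complex) \<Rightarrow> ('a \<Rightarrow> complex)) \<Rightarrow> bool" where
  "spectral_resolution M T E \<longleftrightarrow>
     projection_valued_measure M E
     \<and> Domain T = {u \<in> L2 M. (\<integral>\<^sup>+ t. ennreal (t\<^sup>2) \<partial>scalar_spectral_measure M E u) < \<infinity>}
     \<and> (\<forall>(u, f)\<in>T. L2_inner M f u
          = complex_of_real (LINT t|scalar_spectral_measure M E u. t))"

text \<open>For self-adjoint \<open>T\<close> a resolution exists and each \<open>E A\<close> (\<open>A\<close> Borel) is unique up to
  almost-everywhere equality.\<close>

definition spectral_projection ::
  "'a measure \<Rightarrow> (('a \<Rightarrow> complex) \<times> ('a \<Rightarrow> complex)) set
     \<Rightarrow> real set \<Rightarrow> ('a \<Rightarrow> complex) \<Rightarrow> ('a \<Rightarrow> complex)" where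
  "spectral_projection M T I = (SOME E. spectral_resolution M T E) I"

text \<open>A list of basis vectors plays the role of a multi-index.\<close>

primrec partials :: "'a list \<Rightarrow> ('a::euclidean_space \<Rightarrow> complex) \<Rightarrow> 'a \<Rightarrow> complex" where
  "partials [] f = f"
| "partials (b # bs) f = (\<lambda>x. frechet_derivative (partials bs f) (at x) b)"

definition smooth :: "('a::euclidean_space \<Rightarrow> complex) \<Rightarrow> bool" where
  "smooth f \<longleftrightarrow> (\<forall>bs. set bs \<subseteq> Basis \<longrightarrow> (\<forall>x. partials bs f differentiable at x))"

definition test_functions :: "'a::euclidean_space set \<Rightarrow> ('a \<Rightarrow> complex) set" where
  "test_functions \<Omega> =
     {\<phi>. smooth \<phi> \<and> compact (closure {x. \<phi> x \<noteq> 0}) \<and> closure {x. \<phi> x \<noteq> 0} \<subseteq> \<Omega>}"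

definition is_weak_deriv ::
  "'a::euclidean_space set \<Rightarrow> 'a list \<Rightarrow> ('a \<Rightarrow> complex) \<Rightarrow> ('a \<Rightarrow> complex) \<Rightarrow> bool" where
  "is_weak_deriv \<Omega> bs u g \<longleftrightarrow> (\<forall>\<phi>\<in>test_functions \<Omega>.
     (LINT x|lebesgue_on \<Omega>. u x * partials bs \<phi> x)
       = (- 1) ^ length bs * (LINT x|lebesgue_on \<Omega>. g x * \<phi> x))"

definition weak_deriv :: "'a::euclidean_space set \<Rightarrow> 'a list \<Rightarrow> ('a \<Rightarrow> complex) \<Rightarrow> 'a \<Rightarrow> complex" where
  "weak_deriv \<Omega> bs u = (SOME g. g \<in> L2 (lebesgue_on \<Omega>) \<and> is_weak_deriv \<Omega> bs u g)"

definition multi_indices2 :: "'a::euclidean_space list set" where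
  "multi_indices2 = {bs. set bs \<subseteq> Basis \<and> length bs \<le> 2}"

definition H2 :: "'a::euclidean_space set \<Rightarrow> ('a \<Rightarrow> complex) set" where
  "H2 \<Omega> = {u \<in> L2 (lebesgue_on \<Omega>).
     \<forall>bs\<in>multi_indices2. \<exists>g\<in>L2 (lebesgue_on \<Omega>). is_weak_deriv \<Omega> bs u g}"

definition H2_norm :: "'a::euclidean_space set \<Rightarrow> ('a \<Rightarrow> complex) \<Rightarrow> real" where
  "H2_norm \<Omega> u = sqrt (\<Sum>bs\<in>multi_indices2. (L2_norm (lebesgue_on \<Omega>) (weak_deriv \<Omega> bs u))\<^sup>2)"

definition H2_0 :: "'a::euclidean_space set \<Rightarrow> ('a \<Rightarrow> complex) set" where
  "H2_0 \<Omega> = {u \<in> H2 \<Omega>. \<forall>\<epsilon>>0. \<exists>\<phi>\<in>test_functions \<Omega>. H2_norm \<Omega> (\<lambda>x. u x - \<phi> x) < \<epsilon>}"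

text \<open>\<open>\<Delta>u = f\<close> in \<open>\<Omega>\<close> in the sense of distributions.\<close>

definition is_laplacian ::
  "'a::euclidean_space set \<Rightarrow> ('a \<Rightarrow> complex) \<Rightarrow> ('a \<Rightarrow> complex) \<Rightarrow> bool" where
  "is_laplacian \<Omega> u f \<longleftrightarrow> (\<forall>\<phi>\<in>test_functions \<Omega>.
     (LINT x|lebesgue_on \<Omega>. u x * (\<Sum>b\<in>Basis. partials [b, b] \<phi> x))
       = (LINT x|lebesgue_on \<Omega>. f x * \<phi> x))"

definition harmonic_L2 :: "'a::euclidean_space set \<Rightarrow> ('a \<Rightarrow> complex) set" where
  "harmonic_L2 \<Omega> = {u \<in> L2 (lebesgue_on \<Omega>). is_laplacian \<Omega> u (\<lambda>_. 0)}"

definition krein_dom :: "'a::euclidean_space set \<Rightarrow> ('a \<Rightarrow> complex) set" where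
  "krein_dom \<Omega> = {\<lambda>x. h x + w x | h w. h \<in> harmonic_L2 \<Omega> \<and> w \<in> H2_0 \<Omega>}"

definition krein_laplacian ::
  "'a::euclidean_space set \<Rightarrow> (('a \<Rightarrow> complex) \<times> ('a \<Rightarrow> complex)) set" where
  "krein_laplacian \<Omega> = {(u, f). u \<in> krein_dom \<Omega> \<and> f \<in> L2 (lebesgue_on \<Omega>)
     \<and> is_laplacian \<Omega> u (\<lambda>x. - f x)}"

definition krein_perturbed ::
  "'a::euclidean_space set \<Rightarrow> ('a \<Rightarrow> real) \<Rightarrow> (('a \<Rightarrow> complex) \<times> ('a \<Rightarrow> complex)) set" where
  "krein_perturbed \<Omega> W =
     {(u, \<lambda>x. f x + complex_of_real (W x) * u x) | u f. (u, f) \<in> krein_laplacian \<Omega>}"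

definition krein_reduced ::
  "'a::euclidean_space set \<Rightarrow> (('a \<Rightarrow> complex) \<times> ('a \<Rightarrow> complex)) set" where
  "krein_reduced \<Omega> =
     {(u, f) \<in> krein_laplacian \<Omega>. u \<in> orth_compl (lebesgue_on \<Omega>) (harmonic_L2 \<Omega>)}"

definition lambda0 :: "'a::euclidean_space set \<Rightarrow> real" where
  "lambda0 \<Omega> = Inf {t. complex_of_real t \<in>
     op_spectrum (lebesgue_on \<Omega>) (orth_compl (lebesgue_on \<Omega>) (harmonic_L2 \<Omega>)) (krein_reduced \<Omega>)}"

definition N_minus :: "'a::euclidean_space set \<Rightarrow> ('a \<Rightarrow> real) \<Rightarrow> real \<Rightarrow> ennreal" where
  "N_minus \<Omega> V l = L2_trace (lebesgue_on \<Omega>)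
     (spectral_projection (lebesgue_on \<Omega>) (krein_perturbed \<Omega> (\<lambda>x. - V x)) {..< - l})"

definition N_plus :: "'a::euclidean_space set \<Rightarrow> ('a \<Rightarrow> real) \<Rightarrow> real \<Rightarrow> ennreal" where
  "N_plus \<Omega> V l = L2_trace (lebesgue_on \<Omega>)
     (spectral_projection (lebesgue_on \<Omega>) (krein_perturbed \<Omega> V) {l <..< lambda0 \<Omega>})"

end

theory Submission
 imports Defs
begin

text \<open>
Write u in the domain of K as h + w with h harmonic and w in the closure of the test functions for the
graph norm. Since w depends compactly on K u, an eigenfunction of K - V or K + V with eigenvalue near 0 is,
up to finitely many linear constraints independent of \<open>l\<close>, governed by the form (V h, h) on harmonic h, so the
counting functions are compared with the number of directions in which this form exceeds a multiple of \<open>l\<close>.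
Homogeneous harmonic polynomials of different degrees are orthogonal on every ball about 0, and the mass of
degree k in the ball of radius r is r^(2k + d) times the full one; hence the count is the dimension of the
harmonic polynomials of degree about |ln l| / (2 |ln c|). Finally, spectral projections are determined by an
orthonormal eigenbasis. L^2 is treated as a real Hilbert space with complex structure J, so real dimensions
are twice the complex ones.
\<close>

text \<open>The kernel of K is infinite-dimensional, so 0 lies in the essential spectrum, and the
  counts near 0 concern the compact operator that V induces on this kernel. Only |ln l| enters the
  answer: replacing l by a constant multiple shifts the critical degree by a bounded amount, and
  boundedly many constraints change a count by a bounded amount. All comparisons may therefore lose
  fixed factors and fixed dimensions, and V may be compared with multiples of the indicator of B_c
  from above and of B_delta, delta < c, from below; delta tends to c only at the end. The constant
  comes from the complex dimension C(m+d,d) - C(m+d-2,d) of the harmonic polynomials of degree at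
  most m, which grows like 2 m^(d-1)/(d-1)!, taken at m = |ln l| / (2 |ln c|). No integral over a
  sphere occurs: the weight (1-|x|^2)^2 puts polynomials into H^2_0, and pairing with Laplacians of
  such products gives both the orthogonality of different degrees and the dimension.\<close>

type_synonym 'a cf = "'a \<Rightarrow> complex"
abbreviation cor where "cor \<equiv> complex_of_real"
abbreviation seq_tends ("(_)/ ----> (_)" [60, 60] 60) where "X ----> L \<equiv> X \<longlonglongrightarrow> L"

section \<open>Hilbert space preliminaries\<close>

text \<open>A minimising sequence for the distance from \<open>u\<close> to \<open>X\<close> is
  Cauchy by the parallelogram identity \<open>par\<close>, because midpoints stay in
  \<open>X\<close>. At the limit \<open>p\<close>, moving along any \<open>y\<close> of
  \<open>X\<close> cannot decrease the distance, which forces orthogonality.\<close>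

lemma orth_decomposition_exists:
 fixes X :: "'h::{real_inner,complete_space} set"
 assumes X: "subspace X" "closed X"
 shows "EX p:X. ALL x:X. inner (u - p) x = 0"
proof -
 define d where "d = Inf ((%x. norm (u - x)) ` X)"
 have bdd: "bdd_below ((%x. norm (u - x)) ` X)" by (rule bdd_belowI[of _ 0]) auto
 have ne: "X ~= {}" using X subspace_0 by blast
 have d_le: "d <= norm (u - x)" if "x \<in> X" for x unfolding d_def using bdd that by (auto intro: cInf_lower)
 have d0: "d >= 0" unfolding d_def using ne by (intro cInf_greatest) auto
 have "EX x:X. norm (u - x) < d + 1 / Suc n" for n using cInf_lessD[of "(%x. norm (u - x)) ` X" "d + 1 / Suc n"] ne unfolding d_def by auto
 then obtain x where xX: "!!n. x n \<in> X" and xn: "!!n. norm (u - x n) < d + 1 / Suc n" by metis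
 have par: "(norm (x m - x n))^2 <= 2 * ((norm (u - x m))^2 + (norm (u - x n))^2) - 4 * d^2" for m n
 proof -
  have "(1/2) *\<^sub>R (x m + x n) \<in> X" using xX X by (intro subspace_mul subspace_add) auto
  hence "d <= norm (u - (1/2) *\<^sub>R (x m + x n))" by (rule d_le)
  hence "d^2 <= (norm (u - (1/2) *\<^sub>R (x m + x n)))^2" using d0 by (simp add: power_mono)
  moreover have "(norm (x m - x n))^2 + 4 * (norm (u - (1/2) *\<^sub>R (x m + x n)))^2
   = 2 * ((norm (u - x m))^2 + (norm (u - x n))^2)" unfolding power2_norm_eq_inner by (simp add: inner_diff_left inner_diff_right inner_add_left inner_add_right algebra_simps inner_commute)
  ultimately show ?thesis by linarith
 qed
 have "Cauchy x"
 proof (rule metric_CauchyI)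
  fix e :: real assume "e > 0"
  define ep where "ep = e^2"
  have "(%n. 4 * (d + 1 / Suc n)^2 - 4 * d^2) ----> 4 * (d + 0)^2 - 4 * d^2" by (intro tendsto_intros LIMSEQ_Suc lim_1_over_n)
  hence "\<forall>\<^sub>F n in sequentially. 4 * (d + 1 / Suc n)^2 - 4 * d^2 < ep" using \<open>e > 0\<close> by (intro order_tendstoD(2)) (auto simp: ep_def)
  then obtain N where N: "4 * (d + 1 / Suc N)^2 - 4 * d^2 < ep" by (auto simp: eventually_sequentially)
  have bnd: "(norm (u - x m))^2 <= (d + 1 / Suc N)^2" if "m >= N" for m
  proof -
   have "norm (u - x m) <= d + 1 / Suc m" using xn[of m] by simp
   also have "... <= d + 1 / Suc N" using that by (simp add: frac_le)
   finally show ?thesis by (rule power_mono) simp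
  qed
  show "EX M. ALL m>=M. ALL n>=M. dist (x m) (x n) < e"
  proof (intro exI allI impI)
   fix m n assume "m >= N" "n >= N"
   hence "(norm (x m - x n))^2 < e^2" using par[of m n] bnd[OF \<open>m >= N\<close>] bnd[OF \<open>n >= N\<close>] N unfolding ep_def by argo
   thus "dist (x m) (x n) < e" unfolding dist_norm by (rule power2_less_imp_less) (use \<open>e > 0\<close> in simp)
  qed
 qed
 then obtain p where p: "x ----> p" using Cauchy_convergent convergent_def by blast
 have pX: "p \<in> X" using closed_sequentially[OF X(2)] xX p by blast
 have "(%n. norm (u - x n)) ----> norm (u - p)" by (intro tendsto_intros p)
 moreover have "(%n. d + 1 / Suc n) ----> d + 0" by (intro tendsto_intros LIMSEQ_Suc lim_1_over_n)
 ultimately have pd: "norm (u - p) <= d" using LIMSEQ_le[of "%n. norm (u - x n)" _ "%n. d + 1 / Suc n" "d+0"] less_imp_le[OF xn] by auto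
 have "inner (u - p) y = 0" if y: "y \<in> X" for y
 proof (cases "y = 0")
  case False
  \<comment> \<open>The value of \<open>a\<close> at which the distance from \<open>u\<close> to
    \<open>p + a *\<^sub>R y\<close> is smallest.\<close>
  define a where "a = inner (u - p) y / inner y y"
  have yy: "inner y y > 0" using False by simp
  have "p + a *\<^sub>R y \<in> X" using pX y X by (intro subspace_mul subspace_add) auto
  hence "d <= norm (u - (p + a *\<^sub>R y))" by (rule d_le)
  hence "(norm (u - p))^2 <= (norm (u - (p + a *\<^sub>R y)))^2" using pd d0 by (intro power_mono) auto
  also have "(norm (u - (p + a *\<^sub>R y)))^2 = (norm (u - p))^2 - 2 * a * inner (u - p) y + a^2 * inner y y" unfolding power2_norm_eq_inner
   by (simp add: inner_diff_left inner_diff_right inner_add_left inner_add_right algebra_simps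
     inner_commute power2_eq_square)
  also have "... = (norm (u - p))^2 - (inner (u - p) y)^2 / inner y y" using yy unfolding a_def by (simp add: field_simps power2_eq_square)
  finally have "(inner (u - p) y)^2 / inner y y <= 0" by linarith
  thus ?thesis using yy by (simp add: field_simps power2_less_eq_zero_iff)
 qed simp
 thus ?thesis using pX by blast
qed

section \<open>Orthogonal projections onto closed subspaces\<close>

definition proj :: "'h::{real_inner,complete_space} set => 'h => 'h" where
 "proj X u = (SOME p. p \<in> X & (ALL x:X. inner (u - p) x = 0))"

lemma
 assumes "subspace X" "closed X"
 shows proj_in: "proj X u \<in> X" and proj_orth: "x \<in> X ==> inner (u - proj X u) x = 0"
proof -
 have "EX p. p \<in> X & (ALL x:X. inner (u - p) x = 0)" using orth_decomposition_exists[OF assms] by blast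
 from someI_ex[OF this] show "proj X u \<in> X" "x \<in> X ==> inner (u - proj X u) x = 0" unfolding proj_def by auto
qed

lemma proj_unique:
 assumes "subspace X" "closed X" "p \<in> X" "!!x. x \<in> X ==> inner (u - p) x = 0"
 shows "proj X u = p"
proof -
 have d: "p - proj X u \<in> X" using assms proj_in subspace_diff by blast
 have "inner (p - proj X u) (p - proj X u)
   = inner (u - proj X u) (p - proj X u) - inner (u - p) (p - proj X u)" by (simp add: inner_diff_left)
 hence "inner (p - proj X u) (p - proj X u) = 0" using proj_orth[OF assms(1,2) d] assms(4)[OF d] by simp
 thus ?thesis by simp
qed

lemma proj_id: "subspace X ==> closed X ==> u \<in> X ==> proj X u = u" by (rule proj_unique) auto

lemma inner_proj_left:
 assumes "subspace X" "closed X" "v \<in> X" shows "inner (proj X u) v = inner u v" using proj_orth[OF assms, of u] by (simp add: inner_diff_left)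

lemma proj_sym:
 assumes "subspace X" "closed X" shows "inner (proj X u) v = inner u (proj X v)"
proof -
 have "inner (proj X u) v = inner (proj X u) (proj X v)" using inner_proj_left[OF assms proj_in[OF assms], of v u] by (simp add: inner_commute)
 also have "... = inner u (proj X v)" by (rule inner_proj_left[OF assms proj_in[OF assms]])
 finally show ?thesis .
qed

lemma inner_proj_self:
 assumes "subspace X" "closed X" shows "inner (proj X u) u = (norm (proj X u))^2" using inner_proj_left[OF assms proj_in[OF assms], of u u] by (simp add: inner_commute power2_norm_eq_inner)

lemma proj_pythagoras:
 assumes "subspace X" "closed X" shows "(norm u)^2 = (norm (proj X u))^2 + (norm (u - proj X u))^2" using inner_proj_self[OF assms, of u] by (simp add: power2_norm_eq_inner inner_diff_left inner_diff_right inner_commute)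

lemma norm_proj_le:
 assumes "subspace X" "closed X" shows "norm (proj X u) <= norm u"
proof -
 have "(norm (proj X u))^2 <= (norm u)^2" using proj_pythagoras[OF assms, of u] by simp
 thus ?thesis by (rule power2_le_imp_le) simp
qed

lemma bounded_linear_proj:
 assumes "subspace X" "closed X" shows "bounded_linear (proj X)"
proof (rule bounded_linear_intro[where K=1])
 fix u v :: 'a and r :: real
 show "proj X (u + v) = proj X u + proj X v" by (rule proj_unique[OF assms])
   (auto simp: assms proj_in subspace_add inner_add_left inner_diff_left inner_proj_left)
 show "proj X (r *\<^sub>R u) = r *\<^sub>R proj X u" by (rule proj_unique[OF assms])
   (auto simp: assms proj_in subspace_mul inner_diff_left inner_proj_left)
 show "norm (proj X u) <= norm u * 1" using norm_proj_le[OF assms] by simp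
qed

lemma subspace_closure:
 fixes X :: "'h::real_normed_vector set"
 assumes "subspace X" shows "subspace (closure X)" unfolding subspace_def
proof (intro conjI ballI allI)
 show "0 \<in> closure X" using assms closure_subset subspace_0 by blast
 fix x y and c :: real assume "x \<in> closure X"
 then obtain f where f: "!!n. f n \<in> X" "f ----> x" using closure_sequential by metis
 have "(%n. c *\<^sub>R f n) ----> c *\<^sub>R x" by (intro tendsto_intros f)
 thus "c *\<^sub>R x \<in> closure X" using f assms closure_sequential subspace_mul by metis
 assume "y \<in> closure X"
 then obtain g where g: "!!n. g n \<in> X" "g ----> y" using closure_sequential by metis
 have "(%n. f n + g n) ----> x + y" by (intro tendsto_intros f g)
 thus "x + y \<in> closure X" unfolding closure_sequential using f(1) g(1) subspace_add[OF assms] by (intro exI[of _ "%n. f n + g n"]) auto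
qed

lemma dense_if_orth_trivial:
 fixes X :: "'h::{real_inner,complete_space} set"
 assumes "subspace X" "!!u. (ALL x:X. inner u x = 0) ==> u = 0"
 shows "closure X = UNIV"
proof -
 have c: "subspace (closure X)" "closed (closure X)" using assms by (auto simp: subspace_closure)
 have "u - proj (closure X) u = 0" for u using assms(2) proj_orth[OF c] closure_subset by blast
 thus ?thesis using proj_in[OF c] by (metis eq_iff_diff_eq_0 UNIV_eq_I)
qed

text \<open>The estimate makes preimages of a Cauchy sequence Cauchy, and closedness of the graph
  then puts the limit into the range. It serves the minimal operator, coercive operators and the
  resolvent of the perturbed operator alike.\<close>

lemma closed_range_of_graph:
 fixes A :: "('h::{real_inner,complete_space} \<times> 'h) set"
 assumes A: "subspace A" "closed A" and bnd: "!!u g. (u, g) \<in> A ==> norm u <= C * norm g"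
 shows "closed (snd ` A)" unfolding closed_sequential_limits
proof (intro allI impI, elim conjE)
 fix s l assume s: "ALL n. s n \<in> snd ` A" and l: "s ----> l"
 have "ALL n. EX x. (x, s n) \<in> A" using s by force
 then obtain x where x: "!!n. (x n, s n) \<in> A" by metis
 \<comment> \<open>\<open>C\<close> may be zero or negative, so a positive majorant is used for
   dividing.\<close>
 define D where "D = \<bar>C\<bar> + 1"
 have D: "D > 0" "C <= D" by (auto simp: D_def)
 have "Cauchy x"
 proof (rule metric_CauchyI)
  fix e :: real assume e: "e > 0"
  hence "e / D > 0" using D by simp
  then obtain N where N: "!!m n. m >= N ==> n >= N ==> dist (s m) (s n) < e / D" using LIMSEQ_imp_Cauchy[OF l] by (meson metric_CauchyD)
  have "dist (x m) (x n) < e" if "m >= N" "n >= N" for m n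
  proof -
   have "(x m - x n, s m - s n) \<in> A" using subspace_diff[OF A(1) x x, of m n] by simp
   hence "dist (x m) (x n) <= C * dist (s m) (s n)" unfolding dist_norm by (rule bnd)
   also have "... <= D * dist (s m) (s n)" using D by (intro mult_right_mono) auto
   also have "... < D * (e / D)" using N[OF that] D by (intro mult_strict_left_mono)
   finally show ?thesis using D by simp
  qed
  thus "EX M. ALL m>=M. ALL n>=M. dist (x m) (x n) < e" by blast
 qed
 then obtain p where p: "x ----> p" using Cauchy_convergent convergent_def by blast
 have "(%n. (x n, s n)) ----> (p, l)" by (intro tendsto_Pair p l)
 from closed_sequentially[OF A(2) _ this] x have "(p, l) \<in> A" by blast
 thus "l \<in> snd ` A" by force
qed

text \<open>Coercivity bounds \<open>norm x\<close> by \<open>norm (B x)\<close>, so the range is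
  closed; a vector \<open>u\<close> orthogonal to it satisfies \<open>inner (B u) u = 0\<close>,
  hence vanishes, so the range is also dense.\<close>

lemma coercive_bij:
 fixes B :: "'h::{real_inner,complete_space} => 'h"
 assumes B: "bounded_linear B" and sym: "!!x y. inner (B x) y = inner x (B y)"
  and c: "c > 0" "!!x. c * (norm x)^2 <= inner (B x) x"
 shows "EX x. B x = y" and "c * norm x <= norm (B x)"
proof -
 interpret bounded_linear B by (rule B)
 show le: "c * norm x <= norm (B x)" for x
 proof (cases "x = 0")
  case False
  have "c * (norm x)^2 <= norm (B x) * norm x" using c(2)[of x] norm_cauchy_schwarz[of "B x" x] by linarith
  thus ?thesis using False by (simp add: power2_eq_square)
 qed (simp add: zero)
 have ran: "subspace (range B)" by (rule linear_subspace_image[OF bounded_linear.linear[OF B] subspace_UNIV])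
 have "closed (snd ` {p. snd p = B (fst p)})"
 proof (rule closed_range_of_graph[where C="1/c"])
  show "subspace {p. snd p = B (fst p)}" by (auto simp: subspace_def add scaleR zero)
  show "closed {p. snd p = B (fst p)}" by (intro closed_Collect_eq continuous_on_snd continuous_on_id continuous_on continuous_on_fst)
  show "norm u <= 1 / c * norm g" if "(u, g) \<in> {p. snd p = B (fst p)}" for u g using le[of u] that c(1) by (simp add: field_simps)
 qed
 also have "snd ` {p. snd p = B (fst p)} = range B"
 proof (intro equalityI subsetI)
  fix y assume "y \<in> range B"
  then obtain x where "y = B x" by blast
  hence "(x, y) \<in> {p. snd p = B (fst p)}" by simp
  thus "y \<in> snd ` {p. snd p = B (fst p)}" by (metis image_eqI snd_conv)
 qed auto
 finally have "closed (range B)" .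
 moreover have "closure (range B) = UNIV"
 proof (rule dense_if_orth_trivial[OF ran])
  fix u assume "ALL x:range B. inner u x = 0"
  hence "inner (B u) u = 0" by (simp add: inner_commute)
  hence "(norm u)^2 <= 0" using c(2)[of u] c(1) by (simp add: mult_le_0_iff)
  thus "u = 0" by simp
 qed
 ultimately show "EX x. B x = y" by (metis closure_closed rangeE UNIV_I)
qed

subsection \<open>Compact operators\<close>

text \<open>Compactness as an Ehrling inequality: up to \<open>ep\<close> times the norm, the
  operator is controlled by finitely many functionals. Rellich's theorem and the smallness of the
  potential on harmonic functions arrive in this form, and it passes through sums and compositions
  without sequences.\<close>

definition compact_op :: "('h::real_inner => 'h) => bool" where
 "compact_op C \<longleftrightarrow> (ALL ep>0. EX Ph. finite Ph & (ALL fi:Ph. bounded_linear (fi :: 'h => real)) &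
  (ALL x. norm (C x) <= ep * norm x + (\<Sum>fi\<in>Ph. \<bar>fi x\<bar>)))"

lemma compact_opI:
 assumes "!!ep. ep > 0 ==> EX (I :: 'i set) fi de. finite I & de <= ep & (ALL i:I. bounded_linear (fi i :: 'h::real_inner => real)) &
  (ALL x. norm (C x) <= de * norm x + (\<Sum>i\<in>I. \<bar>fi i x\<bar>))"
 shows "compact_op C" unfolding compact_op_def
proof (intro allI impI)
 fix ep :: real assume "ep > 0"
 from assms[OF this] obtain I :: "'i set" and fi de where *: "finite I" "de <= ep" "!!i. i\<in>I ==> bounded_linear (fi i)"
  "!!x. norm (C x) <= de * norm x + (\<Sum>i\<in>I. \<bar>fi i x\<bar>)" by blast
 define n where "n = real (card I)"
 \<comment> \<open>Equal functionals with different indices collapse in the image, so each is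
   multiplied by the number of indices.\<close>
 define Ph where "Ph = (%i x. n * fi i x) ` I"
 have "(\<Sum>i\<in>I. \<bar>fi i x\<bar>) <= (\<Sum>ps\<in>Ph. \<bar>ps x\<bar>)" for x
 proof -
  have "\<bar>fi i x\<bar> * n <= (\<Sum>ps\<in>Ph. \<bar>ps x\<bar>)" if "i \<in> I" for i
  proof -
   have "\<bar>(%x. n * fi i x) x\<bar> <= (\<Sum>ps\<in>Ph. \<bar>ps x\<bar>)" by (rule member_le_sum[where f="%ps. \<bar>ps x\<bar>"]) (use that * in \<open>auto simp: Ph_def\<close>)
   thus ?thesis by (simp add: abs_mult n_def mult.commute)
  qed
  hence "(\<Sum>i\<in>I. \<bar>fi i x\<bar> * n) <= of_nat (card I) * (\<Sum>ps\<in>Ph. \<bar>ps x\<bar>)" by (rule sum_bounded_above)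
  hence le: "n * (\<Sum>i\<in>I. \<bar>fi i x\<bar>) <= n * (\<Sum>ps\<in>Ph. \<bar>ps x\<bar>)" by (simp add: n_def sum_distrib_left mult.commute)
  show ?thesis
  proof (cases "I = {}")
   case False
   hence "n > 0" using * by (simp add: n_def card_gt_0_iff)
   thus ?thesis using le by simp
  qed (simp add: Ph_def)
 qed
 moreover have "de * norm x <= ep * norm x" for x :: 'h using * by (simp add: mult_right_mono)
 ultimately have "norm (C x) <= ep * norm x + (\<Sum>fi\<in>Ph. \<bar>fi x\<bar>)" for x using *(4)[of x] by (meson add_mono order_trans)
 moreover have "finite Ph" "ALL ps:Ph. bounded_linear ps" using * by (auto simp: Ph_def intro: bounded_linear_const_mult)
 ultimately show "EX Ph. finite Ph & (ALL fi:Ph. bounded_linear fi) &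
  (ALL x. norm (C x) <= ep * norm x + (\<Sum>fi\<in>Ph. \<bar>fi x\<bar>))" by blast
qed

lemma compact_op_add:
 fixes C D :: "'h::real_inner => 'h"
 assumes "compact_op C" "compact_op D" shows "compact_op (%x. C x + D x)"
proof (rule compact_opI)
 fix ep :: real assume "ep > 0"
 hence e2: "ep/2 > 0" by simp
 obtain Ph where Ph: "finite Ph" "!!fi. fi\<in>Ph ==> bounded_linear fi"
  "!!x. norm (C x) <= ep/2 * norm x + (\<Sum>fi\<in>Ph. \<bar>fi x\<bar>)" using assms(1) e2 unfolding compact_op_def by meson
 obtain Ps where Ps: "finite Ps" "!!fi. fi\<in>Ps ==> bounded_linear fi"
  "!!x. norm (D x) <= ep/2 * norm x + (\<Sum>fi\<in>Ps. \<bar>fi x\<bar>)" using assms(2) e2 unfolding compact_op_def by meson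
 have "norm (C x + D x) <= ep * norm x + (\<Sum>i\<in>Ph <+> Ps. \<bar>case_sum id id i x\<bar>)" for x using norm_triangle_ineq[of "C x" "D x"] Ph(3)[of x] Ps(3)[of x] Ph(1) Ps(1) by (simp add: sum.Plus)
 thus "EX (I :: (('h => real) + ('h => real)) set) fi de. finite I & de <= ep & (ALL i:I. bounded_linear (fi i)) &
  (ALL x. norm (C x + D x) <= de * norm x + (\<Sum>i\<in>I. \<bar>fi i x\<bar>))" using Ph Ps by (intro exI[of _ "Ph <+> Ps"] exI[of _ "case_sum id id"] exI[of _ ep]) auto
qed

lemma compact_op_comp_left:
 fixes C B :: "'h::real_inner => 'h"
 assumes "compact_op C" "bounded_linear B" shows "compact_op (%x. B (C x))"
proof (rule compact_opI)
 fix ep :: real assume e: "ep > 0"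
 interpret B: bounded_linear B by fact
 obtain K where K: "K > 0" "!!x. norm (B x) <= norm x * K" using B.pos_bounded by blast
 obtain Ph where Ph: "finite Ph" "!!fi. fi\<in>Ph ==> bounded_linear fi"
  "!!x. norm (C x) <= ep/K * norm x + (\<Sum>fi\<in>Ph. \<bar>fi x\<bar>)" using assms(1) e K(1) unfolding compact_op_def by (meson divide_pos_pos)
 have "norm (B (C x)) <= ep * norm x + (\<Sum>fi\<in>Ph. \<bar>K * fi x\<bar>)" for x
 proof -
  have "norm (B (C x)) <= (ep/K * norm x + (\<Sum>fi\<in>Ph. \<bar>fi x\<bar>)) * K" using K(2)[of "C x"] mult_right_mono[OF Ph(3)[of x], of K] K(1) by linarith
  also have "... = ep * norm x + (\<Sum>fi\<in>Ph. \<bar>K * fi x\<bar>)" using K(1) by (simp add: field_simps abs_mult sum_distrib_left)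
  finally show ?thesis .
 qed
 thus "EX (I :: ('h => real) set) fi de. finite I & de <= ep & (ALL i:I. bounded_linear (fi i)) &
  (ALL x. norm (B (C x)) <= de * norm x + (\<Sum>i\<in>I. \<bar>fi i x\<bar>))" using Ph by (intro exI[of _ Ph] exI[of _ "%fi x. K * fi x"] exI[of _ ep])
   (auto intro: bounded_linear_const_mult)
qed

lemma compact_op_comp_right:
 fixes C B :: "'h::real_inner => 'h"
 assumes "compact_op C" "bounded_linear B" shows "compact_op (%x. C (B x))"
proof (rule compact_opI)
 fix ep :: real assume e: "ep > 0"
 interpret B: bounded_linear B by fact
 obtain K where K: "K > 0" "!!x. norm (B x) <= norm x * K" using B.pos_bounded by blast
 obtain Ph where Ph: "finite Ph" "!!fi. fi\<in>Ph ==> bounded_linear fi"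
  "!!x. norm (C x) <= ep/K * norm x + (\<Sum>fi\<in>Ph. \<bar>fi x\<bar>)" using assms(1) e K(1) unfolding compact_op_def by (meson divide_pos_pos)
 have "norm (C (B x)) <= ep * norm x + (\<Sum>fi\<in>Ph. \<bar>fi (B x)\<bar>)" for x
 proof -
  have "ep/K * norm (B x) <= ep/K * (norm x * K)" using K e by (intro mult_left_mono) auto
  also have "... = ep * norm x" using K(1) by simp
  finally show ?thesis using Ph(3)[of "B x"] by linarith
 qed
 thus "EX (I :: ('h => real) set) fi de. finite I & de <= ep & (ALL i:I. bounded_linear (fi i)) &
  (ALL x. norm (C (B x)) <= de * norm x + (\<Sum>i\<in>I. \<bar>fi i x\<bar>))" using Ph by (intro exI[of _ Ph] exI[of _ "%fi x. fi (B x)"] exI[of _ ep])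
   (auto intro: bounded_linear_compose assms)
qed

text \<open>Total boundedness: the integer parts of \<open>fi x / et\<close>, for \<open>fi\<close>
  in \<open>Ph\<close>, sort the unit ball into finitely many cells, and two points of one cell have
  images at distance at most \<open>e/2\<close>.\<close>

lemma compact_closure_image_ball:
 fixes C :: "'h::{real_inner,complete_space} => 'h"
 assumes "compact_op C" "bounded_linear C"
 shows "compact (closure (C ` cball 0 1))" unfolding compact_eq_totally_bounded
proof (intro conjI allI impI)
 interpret bounded_linear C by fact
 show "complete (closure (C ` cball 0 1))" by (simp add: complete_eq_closed)
 fix e :: real assume e: "e > 0"
 hence e8: "e/8 > 0" by simp
 obtain Ph where Ph: "finite Ph" "!!fi. fi\<in>Ph ==> bounded_linear fi"
  "!!x. norm (C x) <= e/8 * norm x + (\<Sum>fi\<in>Ph. \<bar>fi x\<bar>)" using assms(1) e8 unfolding compact_op_def by meson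
 \<comment> \<open>The functionals in \<open>Ph\<close> together then contribute at most
   \<open>e/4\<close> on a cell.\<close>
 define et where "et = e / (4 * (real (card Ph) + 1))"
 have et: "et > 0" using e by (simp add: et_def add_nonneg_pos)
 define key where "key x = (\<lambda>fi\<in>Ph. \<lfloor>fi x / et\<rfloor>)" for x
 have "EX N. ALL x:cball 0 1. \<lfloor>fi x / et\<rfloor> \<in> {-N..N}" if "fi \<in> Ph" for fi
 proof -
  obtain K where K: "!!x. norm (fi x) <= norm x * K" "K > 0" using bounded_linear.pos_bounded[OF Ph(2)[OF \<open>fi \<in> Ph\<close>]] by blast
  have "\<lfloor>fi x / et\<rfloor> \<in> {-\<lceil>K/et\<rceil>..\<lceil>K/et\<rceil>}" if "x \<in> cball 0 1" for x
  proof -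
   have "norm x * K <= 1 * K" using that K by (intro mult_right_mono) auto
   hence "\<bar>fi x\<bar> <= K" using K(1)[of x] by simp
   hence "- (K/et) <= fi x / et" "fi x / et <= K / et" using et by (auto simp: field_simps)
   thus ?thesis by (simp add: floor_le_iff le_floor_iff; linarith)
  qed
  thus ?thesis by blast
 qed
 then obtain N where N: "!!fi x. fi \<in> Ph ==> x \<in> cball 0 1 ==> \<lfloor>fi x / et\<rfloor> \<in> {-N fi..N fi}" by metis
 have "key ` cball 0 1 \<subseteq> (\<Pi>\<^sub>E fi\<in>Ph. {-N fi..N fi})" using N by (auto simp: key_def)
 hence fin: "finite (key ` cball 0 1)" using Ph(1) by (meson finite_PiE finite_atLeastAtMost_int finite_subset)
 obtain F where F: "F \<subseteq> cball 0 1" "finite F" "key ` F = key ` cball 0 1" using finite_subset_image[OF fin subset_refl] by metis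
 have "EX y:F. dist (C y) (C x) <= e/2" if "x \<in> cball 0 1" for x
 proof -
  have "key x \<in> key ` F" unfolding F(3) using that by blast
  then obtain y where y: "y \<in> F" "key y = key x" by force
  have "\<bar>fi (x - y)\<bar> <= et" if "fi \<in> Ph" for fi
  proof -
   have "\<lfloor>fi x / et\<rfloor> = \<lfloor>fi y / et\<rfloor>" using fun_cong[OF y(2), of fi] that by (simp add: key_def)
   hence "\<bar>fi x / et - fi y / et\<bar> <= 1" by linarith
   hence "\<bar>fi x - fi y\<bar> <= et" using et by (simp add: field_simps flip: diff_divide_distrib)
   thus ?thesis using linear_diff[OF bounded_linear.linear[OF Ph(2)[OF that]]] by simp
  qed
  hence "(\<Sum>fi\<in>Ph. \<bar>fi (x - y)\<bar>) <= card Ph * et" by (rule sum_bounded_above)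
  also have "... <= e/4" using e by (simp add: et_def field_simps add_nonneg_pos)
  finally have s: "(\<Sum>fi\<in>Ph. \<bar>fi (x - y)\<bar>) <= e/4" .
  have "norm (x - y) <= 2" using that F y norm_triangle_ineq4[of x y] by force
  hence "e/8 * norm (x - y) <= e/4" using e by (simp add: field_simps)
  hence "norm (C (x - y)) <= e/2" using Ph(3)[of "x - y"] s by linarith
  thus ?thesis using y(1) by (auto simp: diff dist_norm norm_minus_commute)
 qed
 hence "C ` cball 0 1 \<subseteq> (\<Union>y\<in>F. cball (C y) (e/2))" by (auto simp: dist_commute)
 moreover have "closed (\<Union>y\<in>F. cball (C y) (e/2))" using F by blast
 ultimately have "closure (C ` cball 0 1) \<subseteq> (\<Union>y\<in>F. cball (C y) (e/2))" by (rule closure_minimal)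
 also have "... \<subseteq> (\<Union>y\<in>C ` F. ball y e)" using e by fastforce
 finally show "EX k. finite k & closure (C ` cball 0 1) \<subseteq> (\<Union>x\<in>k. ball x e)" using F by blast
qed

text \<open>A maximising sequence for \<open>norm (C x)\<close> on the unit ball of \<open>N\<close>
  satisfies \<open>C (C (x n)) - s^2 *\<^sub>R x n ----> 0\<close>, where \<open>s\<close> is the
  supremum. Compactness yields a limit \<open>p\<close> that is an eigenvector of the square of
  \<open>C\<close>, and factoring that square minus \<open>s^2\<close> into \<open>C - s\<close> and
  \<open>C + s\<close> yields one of \<open>C\<close>.\<close>

lemma compact_sym_eigenvector:
 fixes C :: "'h::{real_inner,complete_space} => 'h"
 assumes cmp: "compact_op C" and bl: "bounded_linear C" and sym: "!!x y. inner (C x) y = inner x (C y)"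
  and N: "subspace N" "closed N" "!!x. x \<in> N ==> C x \<in> N" and z: "z \<in> N" "z ~= 0"
 shows "EX x:N. x ~= 0 & (EX nv. C x = nv *\<^sub>R x)"
proof -
 interpret bounded_linear C by fact
 define U where "U = N \<inter> cball 0 1"
 define s where "s = Sup ((%x. norm (C x)) ` U)"
 obtain K where K: "K > 0" "!!x. norm (C x) <= norm x * K" using pos_bounded by blast
 have "norm (C x) <= K" if "x \<in> U" for x using K(2)[of x] that K(1) mult_right_mono[of "norm x" 1 K] by (auto simp: U_def intro: order_trans)
 hence bdd: "bdd_above ((%x. norm (C x)) ` U)" by (auto intro!: bdd_aboveI2)
 have U0: "0 \<in> U" using N subspace_0 by (auto simp: U_def)
 have s_ge: "norm (C x) <= s" if "x \<in> U" for x unfolding s_def using bdd that by (auto intro: cSup_upper)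
 have s0: "s >= 0" using s_ge[OF U0] norm_ge_zero order_trans by blast
 have bnd: "norm (C x) <= s * norm x" if "x \<in> N" for x
 proof (cases "x = 0")
  case False
  have "(1 / norm x) *\<^sub>R x \<in> U" using that N False by (auto simp: U_def subspace_mul)
  from s_ge[OF this] show ?thesis using False by (simp add: scaleR field_simps)
 qed (simp add: zero)
 show ?thesis
 proof (cases "s = 0")
  case True
  hence "C z = 0 *\<^sub>R z" using bnd[OF z(1)] by simp
  thus ?thesis using z by blast
 next
  case False
  with s0 have sp: "s > 0" by simp
  have "EX x:U. s - 1 / Suc n < norm (C x)" for n using less_cSupD[of "(%x. norm (C x)) ` U" "s - 1 / Suc n"] U0 unfolding s_def by auto
  hence "EX x. ALL n. x n \<in> U & s - 1 / Suc n < norm (C (x n))" by (intro choice) blast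
  then obtain x where xU: "!!n. x n \<in> U" and xs: "!!n. s - 1 / Suc n < norm (C (x n))" by blast
  have mem: "ALL n. C (x n) \<in> closure (C ` cball 0 1)" using xU closure_subset unfolding U_def by blast
  have cpt: "seq_compact (closure (C ` cball 0 1))" using compact_closure_image_ball[OF cmp bl] by (simp add: compact_eq_seq_compact_metric)
  obtain y r where r: "strict_mono (r :: nat => nat)" "(%n. C (x (r n))) ----> y" using seq_compactE[OF cpt, of "%n. C (x n)"] mem unfolding comp_def by blast
  have lim: "(%n. norm (C (x n))) ----> s"
  proof (rule tendsto_sandwich[of "%n. s - 1 / Suc n" _ _ "%_. s"])
   show "(%n. s - 1 / Suc n) ----> s" using tendsto_diff[OF tendsto_const LIMSEQ_Suc[OF lim_1_over_n], of s] by simp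
  qed (use less_imp_le[OF xs] s_ge xU in auto)
  \<comment> \<open>Symmetry turns the cross term into \<open>(norm (C (x n)))^2\<close>; the
    right-hand side tends to 0 because \<open>norm (C (x n))\<close> tends to
    \<open>s\<close>.\<close>
  have sq: "(norm (C (C (x n)) - s^2 *\<^sub>R x n))^2 <= s^2 * (s^2 - (norm (C (x n)))^2)" for n
  proof -
   have N': "x n \<in> N" "norm (x n) <= 1" using xU by (auto simp: U_def)
   have "(norm (C (C (x n)) - s^2 *\<^sub>R x n))^2
     = (norm (C (C (x n))))^2 - 2 * s^2 * (norm (C (x n)))^2 + (s^2)^2 * (norm (x n))^2" using sym[of "C (x n)" "x n"] unfolding power2_norm_eq_inner
    by (simp add: inner_diff_left inner_diff_right inner_commute power2_eq_square algebra_simps)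
   moreover have "(norm (C (C (x n))))^2 <= s^2 * (norm (C (x n)))^2" using bnd[OF N(3)[OF N'(1)]] by (metis norm_ge_zero power_mono power_mult_distrib)
   moreover have "(s^2)^2 * (norm (x n))^2 <= (s^2)^2 * 1" using N' by (intro mult_left_mono) (auto simp: power_le_one)
   ultimately show ?thesis by (simp add: algebra_simps power2_eq_square)
  qed
  have "(%n. s^2 * (s^2 - (norm (C (x n)))^2)) ----> s^2 * (s^2 - s^2)" by (intro tendsto_intros lim)
  hence z: "(%n. s^2 * (s^2 - (norm (C (x n)))^2)) ----> 0" by (simp only: diff_self mult_zero_right)
  have "(%n. (norm (C (C (x n)) - s^2 *\<^sub>R x n))^2) ----> 0" by (rule tendsto_sandwich[OF _ _ tendsto_const z]; intro always_eventually allI zero_le_power2 sq)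
  hence "(%n. sqrt ((norm (C (C (x n)) - s^2 *\<^sub>R x n))^2)) ----> sqrt 0" by (rule tendsto_real_sqrt)
  hence "(%n. C (C (x n)) - s^2 *\<^sub>R x n) ----> 0" by (simp add: tendsto_norm_zero_iff)
  hence l1: "(%n. C (C (x (r n))) - s^2 *\<^sub>R x (r n)) ----> 0" using LIMSEQ_subseq_LIMSEQ[OF _ r(1)] by (force simp: comp_def)
  define p where "p = (1/s^2) *\<^sub>R C y"
  have "(%n. (1/s^2) *\<^sub>R (C (C (x (r n))) - (C (C (x (r n))) - s^2 *\<^sub>R x (r n)))) ----> (1/s^2) *\<^sub>R (C y - 0)" by (intro tendsto_intros l1 tendsto r(2))
  hence xp: "(%n. x (r n)) ----> p" using sp by (simp add: p_def)
  have pN: "p \<in> N" using closed_sequentially[OF N(2) _ xp] xU by (auto simp: U_def)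
  have "(%n. norm (C (x (r n)))) ----> norm (C p)" by (intro tendsto_norm tendsto xp)
  moreover have "(%n. norm (C (x (r n)))) ----> s" using LIMSEQ_subseq_LIMSEQ[OF lim r(1)] by (simp add: comp_def)
  ultimately have "norm (C p) = s" using LIMSEQ_unique by blast
  hence p0: "p ~= 0" using sp zero by auto
  have "(%n. C (C (x (r n))) - s^2 *\<^sub>R x (r n)) ----> C (C p) - s^2 *\<^sub>R p" by (intro tendsto_intros tendsto xp)
  hence CC: "C (C p) = s^2 *\<^sub>R p" using l1 LIMSEQ_unique by fastforce
  show ?thesis
  proof (cases "C p = (- s) *\<^sub>R p")
   case False
   define q where "q = C p + s *\<^sub>R p"
   have "C q = s *\<^sub>R q" by (simp add: q_def add scaleR CC algebra_simps power2_eq_square)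
   moreover have "q ~= 0" using False by (simp add: q_def eq_neg_iff_add_eq_0)
   moreover have "q \<in> N" using pN N by (simp add: q_def subspace_add subspace_mul)
   ultimately show ?thesis by blast
  qed (use pN p0 in blast)
 qed
qed

subsection \<open>Orthonormal bases\<close>

definition onb :: "'h::real_inner set => bool" where
 "onb B \<longleftrightarrow> (ALL e:B. ALL f:B. inner e f = (if e = f then 1 else 0)) & (ALL u. (ALL e:B. inner u e = 0) --> u = 0)"

lemma onbD:
 assumes "onb B" shows "e \<in> B ==> f \<in> B ==> inner e f = (if e = f then 1 else 0)"
  "(!!e. e \<in> B ==> inner u e = 0) ==> u = 0" using assms by (auto simp: onb_def)

text \<open>Zorn's lemma for an abstract symmetric relation, so that one argument yields both an
  orthonormal set of eigenvectors in a real Hilbert space and an orthonormal basis for the complex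
  inner product.\<close>

lemma maximal_pairwise:
 assumes "!!x y. R x y ==> R y x"
 shows "EX B. B \<subseteq> D & (ALL x:B. ALL y:B. x ~= y --> R x y) & (ALL x:D. (ALL y:B. R x y) --> x \<in> B)"
proof -
 let ?A = "{B. B \<subseteq> D & (ALL x:B. ALL y:B. x ~= y --> R x y)}"
 have "EX M:?A. ALL X:?A. M \<subseteq> X --> X = M"
 proof (rule Zorn_Lemma)
  show "ALL C:chains ?A. \<Union> C \<in> ?A"
  proof
   fix C assume C: "C \<in> chains ?A"
   have sub: "C \<subseteq> ?A" using C by (auto simp: chains_def)
   have "R x y" if "x \<in> X" "X \<in> C" "y \<in> Y" "Y \<in> C" "x ~= y" for x y X Y
   proof -
    have "X \<subseteq> Y | Y \<subseteq> X" using C that by (auto simp: chains_def chain_subset_def)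
    thus ?thesis using that sub by blast
   qed
   thus "\<Union> C \<in> ?A" using sub by blast
  qed
 qed
 then obtain M where M: "M \<in> ?A" "ALL X:?A. M \<subseteq> X --> X = M" ..
 have "x \<in> M" if x: "x \<in> D" "ALL y:M. R x y" for x
 proof -
  have "insert x M \<in> ?A" using M(1) x assms by simp
  hence "M \<subseteq> insert x M --> insert x M = M" by (rule M(2)[rule_format, THEN impI])
  thus ?thesis by auto
 qed
 thus ?thesis using M(1) by (intro exI[of _ M]) simp
qed

lemma inner_onb_sum:
 assumes "onb B" "finite F" "F \<subseteq> B" "e \<in> B"
 shows "inner (\<Sum>f\<in>F. a f *\<^sub>R f) e = (if e \<in> F then a e else 0)"
proof -
 have "inner (\<Sum>f\<in>F. a f *\<^sub>R f) e = (\<Sum>f\<in>F. if f = e then a f else 0)" unfolding inner_sum_left by (intro sum.cong) (use assms onbD(1)[OF assms(1)] in auto)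
 thus ?thesis using assms(2) by (simp)
qed

lemma norm_onb_sum:
 assumes "onb B" "finite F" "F \<subseteq> B"
 shows "(norm (\<Sum>f\<in>F. a f *\<^sub>R f))^2 = (\<Sum>f\<in>F. (a f)^2)" unfolding power2_norm_eq_inner
 by (subst inner_sum_right) (use assms in \<open>auto simp: inner_onb_sum power2_eq_square subset_iff intro!: sum.cong\<close>)

text \<open>The span is dense, and among all combinations over \<open>G\<close> the sum of
  \<open>inner u e *\<^sub>R e\<close> is closest to \<open>u\<close>. Once \<open>G\<close>
  contains the vectors used by an approximant \<open>v\<close>, it is at least as close as
  \<open>v\<close>.\<close>

lemma onb_expansion:
 fixes u :: "'h::{real_inner,complete_space}"
 assumes B: "onb B"
 shows "((%e. inner u e *\<^sub>R e) has_sum u) B"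
proof -
 have "closure (span B) = UNIV"
 proof (rule dense_if_orth_trivial)
  show "subspace (span B)" by simp
  show "u = 0" if "ALL x:span B. inner u x = 0" for u using onbD(2)[OF B] that span_base by blast
 qed
 have "EX F. finite F & F \<subseteq> B & (ALL G. finite G & F \<subseteq> G & G \<subseteq> B --> dist (\<Sum>e\<in>G. inner u e *\<^sub>R e) u < ep)"
  if "ep > 0" for ep
 proof -
  obtain v where v: "v \<in> span B" "dist v u < ep" using \<open>closure (span B) = UNIV\<close> \<open>ep > 0\<close> closure_approachable by blast
  obtain F a where F: "finite F" "F \<subseteq> B" "v = (\<Sum>e\<in>F. a e *\<^sub>R e)" using v(1) unfolding span_explicit by blast
  have "dist (\<Sum>e\<in>G. inner u e *\<^sub>R e) u < ep" if G: "finite G" "F \<subseteq> G" "G \<subseteq> B" for G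
  proof -
   define w where "w = (\<Sum>e\<in>G. inner u e *\<^sub>R e)"
   define b where "b e = (if e \<in> F then a e else 0)" for e
   have vb: "v = (\<Sum>e\<in>G. b e *\<^sub>R e)" unfolding F b_def using G by (intro sum.mono_neutral_cong_left) auto
   have wv: "w - v = (\<Sum>e\<in>G. (inner u e - b e) *\<^sub>R e)" unfolding vb w_def by (simp add: sum_subtractf scaleR_left_diff_distrib)
   have "inner (u - w) (w - v) = 0" unfolding wv inner_sum_right inner_scaleR_right by (intro sum.neutral ballI) (use G inner_onb_sum[OF B G(1,3)] in \<open>auto simp: w_def inner_diff_left subset_iff\<close>)
   hence "(norm (u - v))^2 = (norm (u - w))^2 + (norm (w - v))^2" using norm_add_Pythagorean[of "u - w" "w - v"] by (simp add: orthogonal_def)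
   hence "(norm (u - w))^2 <= (norm (u - v))^2" by simp
   hence "norm (u - w) <= norm (u - v)" by (rule power2_le_imp_le) simp
   thus ?thesis using v(2) by (simp add: w_def dist_norm norm_minus_commute)
  qed
  thus ?thesis using F by blast
 qed
 thus ?thesis unfolding has_sum_def by (intro tendstoI) (auto simp: eventually_finite_subsets_at_top)
qed

lemma parseval_inner:
 fixes u v :: "'h::{real_inner,complete_space}"
 assumes B: "onb B"
 shows "((%e. inner u e * inner v e) has_sum inner u v) B" using has_sum_bounded_linear[OF bounded_linear_inner_left[of v] onb_expansion[OF B, of u]] by (simp add: comp_def inner_commute[of _ v])

lemma parseval_norm:
 fixes u :: "'h::{real_inner,complete_space}"
 assumes B: "onb B"
 shows "((%e. (inner u e)^2) has_sum (norm u)^2) B" using parseval_inner[OF B, of u u] by (simp add: power2_eq_square power2_norm_eq_inner[symmetric])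

text \<open>Increasing finite sets \<open>G n\<close> are chosen that leave less than
  \<open>(1/2)^n\<close> of the total \<open>L\<close>; the partial sums over them form a Cauchy
  sequence.\<close>

lemma riesz_fischer_onb:
 fixes B :: "'h::{real_inner,complete_space} set"
 assumes B: "onb B" and sm: "(%e. (a e)^2) summable_on B"
 shows "EX u. ALL e:B. inner u e = a e"
proof -
 obtain L where L: "(sum (%e. (a e)^2) \<longlongrightarrow> L) (finite_subsets_at_top B)" using sm unfolding has_sum_def summable_on_def by blast
 have le_L: "(\<Sum>e\<in>F. (a e)^2) <= L" if "finite F" "F \<subseteq> B" for F by (rule has_sum_mono_neutral[OF has_sum_finite[OF that(1)]]) (use L that in \<open>auto simp: has_sum_def\<close>)
 have "EX F. finite F & F \<subseteq> B & L - (1/2)^n < (\<Sum>e\<in>F. (a e)^2)" for n :: nat using order_tendstoD(1)[OF L, of "L - (1/2)^n"] by (auto simp: eventually_finite_subsets_at_top)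
 then obtain F where F: "!!n::nat. finite (F n)" "!!n. F n \<subseteq> B" "!!n. L - (1/2)^n < (\<Sum>e\<in>F n. (a e)^2)" by metis
 define G where "G n = (\<Union>k\<le>n. F k)" for n
 have G: "finite (G n)" "G n \<subseteq> B" "F n \<subseteq> G n" "m <= n ==> G m \<subseteq> G n" for m n using F by (auto simp: G_def intro: order_trans)
 have LG: "L - (1/2)^n < (\<Sum>e\<in>G n. (a e)^2)" for n using F(3)[of n] sum_mono2[OF G(1)[of n] G(3)[of n], of "%e. (a e)^2"] by (simp add: less_le_trans)
 define s where "s n = (\<Sum>e\<in>G n. a e *\<^sub>R e)" for n
 have ds: "(dist (s m) (s n))^2 <= (1/2)^m" if "m <= n" for m n
 proof -
  have "s n - s m = (\<Sum>e\<in>G n - G m. a e *\<^sub>R e)" unfolding s_def using G that by (simp add: sum_diff)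
  hence "(dist (s m) (s n))^2 = (\<Sum>e\<in>G n - G m. (a e)^2)" using norm_onb_sum[OF B, of "G n - G m" a] G(1,2)[of n] by (simp add: dist_norm norm_minus_commute[of "s m"] Diff_subset[THEN subset_trans])
  also have "... = (\<Sum>e\<in>G n. (a e)^2) - (\<Sum>e\<in>G m. (a e)^2)" using G that by (simp add: sum_diff)
  also have "... <= (1/2)^m" using le_L[OF G(1,2), of n] LG[of m] by linarith
  finally show ?thesis .
 qed
 have "Cauchy s"
 proof (rule CauchyI')
  fix e :: real assume "e > 0"
  then obtain N where N: "(1/2::real)^N < e^2" using real_arch_pow_inv[of "e^2" "1/2"] by auto
  have "dist (s m) (s n) < e" if "m >= N" "n > m" for m n
  proof -
   have "(dist (s m) (s n))^2 <= (1/2)^m" using that by (intro ds) simp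
   also have "... <= (1/2)^N" using that by (intro power_decreasing) auto
   finally have "(dist (s m) (s n))^2 < e^2" using N by simp
   thus ?thesis by (rule power2_less_imp_less) (use \<open>e > 0\<close> in simp)
  qed
  thus "EX M. ALL m>=M. ALL n>m. dist (s m) (s n) < e" by blast
 qed
 then obtain u where u: "s ----> u" using Cauchy_convergent convergent_def by blast
 have "inner u e = a e" if e: "e \<in> B" for e
 proof -
  have lim: "(%n. inner (s n) e) ----> inner u e" by (intro tendsto_intros u)
  have in_eq: "inner (s n) e = (if e \<in> G n then a e else 0)" for n unfolding s_def by (rule inner_onb_sum[OF B G(1,2) e])
  show ?thesis
  proof (cases "EX n. e \<in> G n")
   case True
   then obtain n where "e \<in> G n" by blast
   hence "inner (s m) e = a e" if "m >= n" for m using in_eq G(4)[OF that] by auto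
   hence "(%n. inner (s n) e) ----> a e" by (intro tendsto_eventually) (auto simp: eventually_sequentially)
   thus ?thesis using lim LIMSEQ_unique by blast
  next
   case False
   \<comment> \<open>No \<open>G n\<close> contains \<open>e\<close>, yet adding \<open>e\<close> to
     it still stays below \<open>L\<close>, so this coefficient fits into every remainder.\<close>
   have "(a e)^2 <= (1/2)^n" for n using le_L[of "insert e (G n)"] G(1,2)[of n] e False LG[of n] by simp
   moreover have "(%n. (1/2::real)^n) ----> 0" by (simp add: LIMSEQ_realpow_zero)
   ultimately have "(a e)^2 <= 0" by (intro LIMSEQ_le_const) auto
   hence "a e = 0" by simp
   moreover have "inner u e = 0" using lim in_eq False by (simp add: LIMSEQ_const_iff)
   ultimately show ?thesis by simp
  qed
 qed
 thus ?thesis by blast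
qed

text \<open>Only the square of \<open>R\<close>, up to a multiple of the identity, is compact. On
  the orthogonal complement \<open>N\<close> of a maximal orthonormal set of eigenvectors that
  compact operator has an eigenvector; it is one of the square of \<open>R\<close>, and the
  factorisation into \<open>R - s\<close> and \<open>R + s\<close> produces one of \<open>R\<close>,
  contradicting maximality.\<close>

lemma sym_eigenbasis:
 fixes R :: "'h::{real_inner,complete_space} => 'h"
 assumes R: "bounded_linear R" and sym: "!!x y. inner (R x) y = inner x (R y)"
  and C: "compact_op (%x. R (R x) - c *\<^sub>R x)"
 shows "EX B. onb B & (ALL e:B. EX nv. R e = nv *\<^sub>R e)"
proof -
 interpret bounded_linear R by fact
 define D where "D = {x. norm x = 1 & (EX nv. R x = nv *\<^sub>R x)}"
 obtain B where B: "B \<subseteq> D" "!!x y. x\<in>B ==> y\<in>B ==> x ~= y ==> inner x y = 0"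
  "!!x. x\<in>D ==> (!!y. y \<in>B ==> inner x y = 0) ==> x \<in> B" using maximal_pairwise[of "%x y. inner x y = 0" D] by (metis inner_commute)
 define N where "N = {u. ALL e:B. inner u e = 0}"
 have subN: "subspace N" by (auto simp: N_def subspace_def inner_add_left)
 have N': "N = (\<Inter>e\<in>B. {u. inner u e = 0})" by (auto simp: N_def)
 have clN: "closed N" unfolding N' by (intro closed_INT ballI closed_Collect_eq continuous_intros)
 have RN: "R x \<in> N" if "x \<in> N" for x
 proof -
  have "inner (R x) e = 0" if "e \<in> B" for e
  proof -
   obtain nv where "R e = nv *\<^sub>R e" using \<open>e \<in> B\<close> B(1) by (auto simp: D_def)
   thus ?thesis using sym[of x e] \<open>x \<in> N\<close> \<open>e \<in> B\<close> by (simp add: N_def)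
  qed
  thus ?thesis by (simp add: N_def)
 qed
 have "N = {0}"
 proof (rule ccontr)
  assume "N ~= {0}"
  then obtain z where z: "z \<in> N" "z ~= 0" using subspace_0[OF subN] by blast
  let ?C = "%x. R (R x) - c *\<^sub>R x"
  have bl: "bounded_linear ?C" by (intro bounded_linear_sub bounded_linear_compose[OF R R] bounded_linear_scaleR_right)
  have "EX x:N. x ~= 0 & (EX nv. ?C x = nv *\<^sub>R x)" by (rule compact_sym_eigenvector[OF C bl _ subN clN _ z])
    (auto simp: inner_diff_left inner_diff_right sym intro!: subspace_diff subN subspace_mul RN)
  then obtain x nv where x: "x \<in> N" "x ~= 0" "R (R x) - c *\<^sub>R x = nv *\<^sub>R x" by blast
  define ta where "ta = nv + c"
  have RR: "R (R x) = ta *\<^sub>R x" using x(3) by (simp add: ta_def scaleR_left_distrib algebra_simps)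
  have "ta * inner x x = inner (R x) (R x)" using sym[of "R x" x] RR by simp
  hence "ta >= 0" using x(2) by (metis inner_ge_zero inner_gt_zero_iff zero_le_mult_iff not_less)
  define s where "s = sqrt ta"
  have ss: "s * s = ta" using \<open>ta >= 0\<close> by (simp add: s_def)
  have "EX y:N. y ~= 0 & (EX nv. R y = nv *\<^sub>R y)"
  proof (cases "R x = (- s) *\<^sub>R x")
   case False
   define q where "q = R x + s *\<^sub>R x"
   have "R q = s *\<^sub>R q" by (simp add: q_def add scaleR RR ss algebra_simps)
   moreover have "q ~= 0" using False by (simp add: q_def eq_neg_iff_add_eq_0)
   moreover have "q \<in> N" using x RN subN by (simp add: q_def subspace_add subspace_mul)
   ultimately show ?thesis by blast
  qed (use x in blast)
  then obtain y nv' where y: "y \<in> N" "y ~= 0" "R y = nv' *\<^sub>R y" by blast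
  define y' where "y' = (1 / norm y) *\<^sub>R y"
  have "y' \<in> D" using y by (auto simp: D_def y'_def scaleR intro!: exI[of _ nv'])
  moreover have y'N: "inner y' e = 0" if "e \<in> B" for e using y that by (simp add: y'_def N_def)
  ultimately have "y' \<in> B" using B(3) by blast
  hence "inner y' y' = 0" using y'N by blast
  thus False using y by (simp add: y'_def)
 qed
 hence "onb B" unfolding onb_def using B(1,2) by (auto simp: N_def D_def dot_square_norm)
 thus ?thesis using B(1) by (auto simp: D_def)
qed

text \<open>Gaussian elimination. The variational comparisons of dimensions below rest on it: a span
  of larger dimension contains a nontrivial vector that satisfies a smaller number of linear
  constraints.\<close>

lemma exists_nontrivial_solution:
 fixes a :: "'j => 'i => real"
 assumes "finite J" "finite I" "card J < card I"
 shows "EX x. (EX i:I. x i ~= 0) & (ALL j:J. (\<Sum>i\<in>I. x i * a j i) = 0)" using assms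
proof (induction J arbitrary: I a rule: finite_induct)
 case empty
 hence "I ~= {}" by auto
 thus ?case by (auto intro!: exI[of _ "%_. 1"])
next
 case (insert j J)
 show ?case
 proof (cases "ALL i:I. a j i = 0")
  case True
  obtain x where "EX i:I. x i ~= 0" "ALL j:J. (\<Sum>i\<in>I. x i * a j i) = 0" using insert.IH[of I a] insert.prems insert.hyps by auto
  thus ?thesis using True by (intro exI[of _ x]) auto
 next
  case False
  then obtain k where k: "k \<in> I" "a j k ~= 0" by blast
  define I' where "I' = I - {k}"
  \<comment> \<open>Equation \<open>j\<close> is solved for the unknown \<open>k\<close> and
    substituted into the others.\<close>
  define a' where "a' l i = a l i - a l k * a j i / a j k" for l i
  have "card J < card I'" using insert k by (simp add: I'_def)
  then obtain x where x: "EX i:I'. x i ~= 0" "ALL l:J. (\<Sum>i\<in>I'. x i * a' l i) = 0" using insert.IH[of I' a'] insert.prems by (auto simp: I'_def)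
  define y where "y = x(k := - (\<Sum>i\<in>I'. x i * a j i) / a j k)"
  have sum_I: "(\<Sum>i\<in>I. y i * a l i) = y k * a l k + (\<Sum>i\<in>I'. x i * a l i)" for l
  proof -
   have "(\<Sum>i\<in>I. y i * a l i) = y k * a l k + (\<Sum>i\<in>I'. y i * a l i)" unfolding I'_def using insert.prems k by (simp add: sum.remove)
   also have "(\<Sum>i\<in>I'. y i * a l i) = (\<Sum>i\<in>I'. x i * a l i)" by (intro sum.cong) (auto simp: y_def I'_def)
   finally show ?thesis .
  qed
  have "(\<Sum>i\<in>I. y i * a l i) = 0" if "l \<in> J" for l
  proof -
   have "(\<Sum>i\<in>I'. x i * a' l i) = (\<Sum>i\<in>I'. x i * a l i) - a l k / a j k * (\<Sum>i\<in>I'. x i * a j i)" by (simp add: a'_def sum_subtractf right_diff_distrib sum_distrib_left mult_ac)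
   moreover have "(\<Sum>i\<in>I'. x i * a' l i) = 0" using x(2) that by blast
   ultimately show ?thesis unfolding sum_I by (simp add: y_def field_simps)
  qed
  moreover have "(\<Sum>i\<in>I. y i * a j i) = 0" unfolding sum_I using k by (simp add: y_def)
  moreover have "EX i:I. y i ~= 0" using x(1) by (auto simp: y_def I'_def)
  ultimately show ?thesis by blast
 qed
qed

section \<open>The abstract Krein extension\<close>

text \<open>\<open>S\<close> plays the graph of minus the Laplacian on H^2_0, the closed symmetric
  minimal operator. There \<open>inner w f\<close> is the squared norm of the gradient of
  \<open>w\<close>, so \<open>S_ehrling\<close> is Rellich's theorem with the form of the operator
  on the right-hand side.\<close>

locale krein_graph =
 fixes S :: "('h::{real_inner,complete_space} \<times> 'h) set" and C :: real
 assumes S_sub: "subspace S" and S_closed: "closed S"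
  and S_sym: "!!w f w' f'. (w, f) \<in> S ==> (w', f') \<in> S ==> inner w f' = inner f w'"
  and S_pos: "!!w f. (w, f) \<in> S ==> 0 <= inner w f"
  and S_dense: "!!g. (!!w f. (w, f) \<in> S ==> inner w g = 0) ==> g = 0"
  and S_bound: "!!w f. (w, f) \<in> S ==> norm w <= C * norm f"
  and S_ehrling: "!!ep. ep > 0 ==> EX Ph. finite Ph & (ALL fi:Ph. bounded_linear (fi :: 'h => real)) &
    (ALL w f. (w, f) \<in> S --> (norm w)^2 <= ep * inner w f + (\<Sum>fi\<in>Ph. (fi w)^2))"
begin

definition "H = {h. ALL (w, f):S. inner h f = 0}"
definition "Rn = snd ` S"
definition "P = proj H"
definition "Q = proj Rn"
definition "G f = (SOME w. (w, f) \<in> S)"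
text \<open>The inverse of the reduced operator \<open>L\<close> on \<open>Rn\<close>, extended by 0
  to \<open>H\<close>: \<open>G\<close> inverts the minimal operator, and the outer \<open>Q\<close>
  removes the harmonic part of the result.\<close>

definition "T f = Q (G (Q f))"
definition "K = {(h + w, f) | h w f. h \<in> H & (w, f) \<in> S}"

lemma Rn_sub: "subspace Rn" unfolding Rn_def by (intro linear_subspace_image S_sub linear_snd)

lemma Rn_closed: "closed Rn" unfolding Rn_def by (rule closed_range_of_graph[OF S_sub S_closed S_bound])

lemmas Rn = Rn_sub Rn_closed

lemma H_iff: "h \<in> H \<longleftrightarrow> (ALL f:Rn. inner h f = 0)" unfolding H_def Rn_def by auto

lemma H_sub: "subspace H" by (auto simp: subspace_def H_iff inner_add_left)

lemma H_closed: "closed H"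
proof -
 have "H = (\<Inter>f\<in>Rn. {h. inner h f = 0})" by (auto simp: H_iff)
 thus ?thesis by (auto intro!: closed_INT closed_Collect_eq continuous_intros)
qed

lemmas H = H_sub H_closed

lemma Q_in: "Q u \<in> Rn" and P_in: "P u \<in> H" unfolding Q_def P_def by (auto intro: proj_in Rn H)

lemma Q_id: "f \<in> Rn ==> Q f = f" unfolding Q_def by (rule proj_id[OF Rn])

lemma H_Rn: "h \<in> H ==> f \<in> Rn ==> inner h f = 0" "h \<in> H ==> f \<in> Rn ==> inner f h = 0" by (auto simp: H_iff inner_commute)

lemma P_eq: "P u = u - Q u" unfolding P_def
proof (rule proj_unique[OF H])
 show "u - Q u \<in> H" unfolding H_iff Q_def using proj_orth[OF Rn] by blast
 show "inner (u - (u - Q u)) x = 0" if "x \<in> H" for x using H_Rn[OF that Q_in] by simp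
qed

lemma PQ: "P u + Q u = u" by (simp add: P_eq)

lemma P_id: "h \<in> H ==> P h = h" unfolding P_def by (rule proj_id[OF H])

lemma Q_H: "h \<in> H ==> Q h = 0" using PQ[of h] P_id[of h] by simp

lemma P_bl: "bounded_linear P" and Q_bl: "bounded_linear Q" unfolding P_def Q_def by (intro bounded_linear_proj H Rn)+

lemma Q_sym: "inner (Q u) v = inner u (Q v)" and P_sym: "inner (P u) v = inner u (P v)" unfolding P_def Q_def by (intro proj_sym H Rn)+

lemma norm_P_le: "norm (P u) <= norm u" unfolding P_def by (rule norm_proj_le[OF H])

lemma S_single: "(w, f) \<in> S ==> (w', f) \<in> S ==> w = w'" using S_bound[of "w - w'" 0] subspace_diff[OF S_sub, of "(w, f)" "(w', f)"] by simp

lemma S_Rn: "(w, f) \<in> S ==> f \<in> Rn" unfolding Rn_def by force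

lemma G_in: assumes "f \<in> Rn" shows "(G f, f) \<in> S"
proof -
 obtain w where "(w, f) \<in> S" using assms unfolding Rn_def by auto
 thus ?thesis unfolding G_def by (rule someI)
qed

lemma G_eq: "(w, f) \<in> S ==> G f = w" by (rule S_single[OF G_in[OF S_Rn]])

lemma GQ_bl: "bounded_linear (%f. G (Q f))"
proof (rule bounded_linear_intro[where K="\<bar>C\<bar>"])
 interpret Q: bounded_linear Q by (rule Q_bl)
 fix x y :: 'h and r :: real
 have "(G (Q x), Q x) + (G (Q y), Q y) \<in> S" by (intro subspace_add S_sub G_in Q_in)
 thus "G (Q (x + y)) = G (Q x) + G (Q y)" by (intro G_eq) (simp add: Q.add)
 have "r *\<^sub>R (G (Q x), Q x) \<in> S" by (intro subspace_mul S_sub G_in Q_in)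
 thus "G (Q (r *\<^sub>R x)) = r *\<^sub>R G (Q x)" by (intro G_eq) (simp add: Q.scaleR)
 have "norm (G (Q x)) <= C * norm (Q x)" by (rule S_bound[OF G_in[OF Q_in]])
 also have "... <= \<bar>C\<bar> * norm x" by (intro mult_mono) (auto simp: Q_def intro: norm_proj_le[OF Rn])
 finally show "norm (G (Q x)) <= norm x * \<bar>C\<bar>" by (simp add: mult.commute)
qed

lemma T_bl: "bounded_linear T" unfolding T_def by (rule bounded_linear_compose[OF Q_bl GQ_bl])

lemma inner_T: "inner (T f) g = inner (G (Q f)) (Q g)" unfolding T_def by (rule Q_sym)

lemma T_sym: "inner (T f) g = inner f (T g)" using S_sym[OF G_in[OF Q_in[of f]] G_in[OF Q_in[of g]]] inner_T[of f g] inner_T[of g f] by (simp add: inner_commute)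

lemma T_pos: "0 <= inner (T f) f" unfolding inner_T by (rule S_pos[OF G_in[OF Q_in]])

lemma T_in: "T f \<in> Rn" unfolding T_def by (rule Q_in)
lemma T_Q: "T (Q f) = T f" unfolding T_def by (simp add: Q_id[OF Q_in])

lemma T_ehrling:
 assumes "ep > 0"
 shows "EX Ph. finite Ph & (ALL fi:Ph. bounded_linear (fi :: 'h => real)) &
  (ALL f. (norm (T f))^2 <= ep * inner (T f) f + (\<Sum>fi\<in>Ph. (fi (G (Q f)))^2))"
proof -
 obtain Ph where Ph: "finite Ph" "ALL fi:Ph. bounded_linear (fi :: 'h => real)"
  "ALL w f. (w, f) \<in> S --> (norm w)^2 <= ep * inner w f + (\<Sum>fi\<in>Ph. (fi w)^2)" using S_ehrling[OF assms] by blast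
 have "(norm (T f))^2 <= ep * inner (T f) f + (\<Sum>fi\<in>Ph. (fi (G (Q f)))^2)" for f
 proof -
  have "(norm (T f))^2 <= (norm (G (Q f)))^2" unfolding T_def Q_def by (intro power_mono norm_proj_le Rn) simp
  also have "... <= ep * inner (G (Q f)) (Q f) + (\<Sum>fi\<in>Ph. (fi (G (Q f)))^2)" using Ph(3) G_in[OF Q_in] by blast
  finally show ?thesis unfolding inner_T .
 qed
 thus ?thesis using Ph by blast
qed

text \<open>Vanishing of finitely many functionals removes the error term of the Ehrling inequality.
  These functionals are the constraints that do not depend on the spectral parameter.\<close>

lemma T_small:
 assumes "ep > 0"
 shows "EX Ph. finite Ph & (ALL fi:Ph. bounded_linear (fi :: 'h => real)) &
  (ALL f. (ALL fi:Ph. fi f = 0) --> (norm (T f))^2 <= ep * inner (T f) f)"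
proof -
 obtain Ph where Ph: "finite Ph" "ALL fi:Ph. bounded_linear (fi :: 'h => real)"
  "ALL f. (norm (T f))^2 <= ep * inner (T f) f + (\<Sum>fi\<in>Ph. (fi (G (Q f)))^2)" using T_ehrling[OF assms] by blast
 show ?thesis
 proof (intro exI[of _ "(%fi f. fi (G (Q f))) ` Ph"] conjI allI impI ballI)
  show "finite ((%fi f. fi (G (Q f))) ` Ph)" using Ph by simp
  show "bounded_linear ps" if "ps \<in> (%fi f. fi (G (Q f))) ` Ph" for ps using that Ph(2) bounded_linear_compose[OF _ GQ_bl] by auto
  show "(norm (T f))^2 <= ep * inner (T f) f"
   if z: "ALL ps:(%fi f. fi (G (Q f))) ` Ph. ps f = 0" for f
  proof -
   have "(\<Sum>fi\<in>Ph. (fi (G (Q f)))^2) = 0" using z by (intro sum.neutral) auto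
   thus ?thesis using Ph(3)[rule_format, of f] by simp
  qed
 qed
qed

lemma sum_squares_le_square_sum:
 fixes a :: "'i => real"
 assumes "finite I" shows "(\<Sum>i\<in>I. (a i)^2) <= (\<Sum>i\<in>I. \<bar>a i\<bar>)^2" using assms
proof (induction I rule: finite_induct)
 case (insert i I)
 have "0 <= \<bar>a i\<bar> * (\<Sum>i\<in>I. \<bar>a i\<bar>)" by (intro mult_nonneg_nonneg sum_nonneg) auto
 hence "0 <= 2 * \<bar>a i\<bar> * (\<Sum>i\<in>I. \<bar>a i\<bar>)" by simp
 hence "(a i)^2 + (\<Sum>i\<in>I. \<bar>a i\<bar>)^2 <= (\<bar>a i\<bar> + (\<Sum>i\<in>I. \<bar>a i\<bar>))^2" unfolding power2_sum power2_abs by linarith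
 thus ?case using insert by simp
qed simp

lemma T_compact: "compact_op T"
 proof (rule compact_opI)
  fix ep :: real assume e: "ep > 0"
  obtain Ph where Ph: "finite Ph" "ALL fi:Ph. bounded_linear (fi :: 'h => real)"
   "ALL f. (norm (T f))^2 <= ep * inner (T f) f + (\<Sum>fi\<in>Ph. (fi (G (Q f)))^2)" using T_ehrling[OF e] by blast
  have "norm (T f) <= ep * norm f + (\<Sum>fi\<in>Ph. \<bar>fi (G (Q f))\<bar>)" for f
  proof (rule ccontr)
   define X where "X = norm (T f)"
   define Z where "Z = (\<Sum>fi\<in>Ph. \<bar>fi (G (Q f))\<bar>)"
   have Z: "Z >= 0" unfolding Z_def by (simp add: sum_nonneg)
   have ef: "0 <= ep * norm f" using e by simp
   assume "~ norm (T f) <= ep * norm f + (\<Sum>fi\<in>Ph. \<bar>fi (G (Q f))\<bar>)"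
   hence gt: "ep * norm f + Z < X" by (simp add: X_def Z_def)
   \<comment> \<open>This contradicts \<open>X > ep * norm f + Z\<close>: multiplying that by
     \<open>X\<close> and using \<open>Z <= X\<close> makes \<open>X * X\<close> exceed the
     right-hand side.\<close>
   have "X * X <= ep * (X * norm f) + Z * Z"
   proof -
    have "ep * inner (T f) f <= ep * (X * norm f)" unfolding X_def using e norm_cauchy_schwarz[of "T f" f] by (intro mult_left_mono) auto
    thus ?thesis using Ph(3)[rule_format, of f] sum_squares_le_square_sum[OF Ph(1), of "%fi. fi (G (Q f))"] unfolding X_def Z_def power2_eq_square by linarith
   qed
   moreover have "(ep * norm f + Z) * X < X * X" using gt Z ef by (intro mult_strict_right_mono) auto
   moreover have "Z * Z <= Z * X" using gt Z ef by (intro mult_left_mono) auto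
   ultimately show False by (simp add: algebra_simps)
  qed
  thus "EX (I :: ('h => real) set) fi de. finite I & de <= ep & (ALL i:I. bounded_linear (fi i)) &
  (ALL x. norm (T x) <= de * norm x + (\<Sum>i\<in>I. \<bar>fi i x\<bar>))" using Ph(1,2) by (intro exI[of _ Ph] exI[of _ "%fi f. fi (G (Q f))"] exI[of _ ep])
    (auto intro: bounded_linear_compose[OF _ GQ_bl])
 qed

text \<open>\<open>T f = 0\<close> means that \<open>G (Q f)\<close> lies in \<open>H\<close>. By
  symmetry of \<open>S\<close>, pairing \<open>Q f\<close> with the domain of \<open>S\<close> is
  then pairing \<open>H\<close> with \<open>Rn\<close>, which gives 0, and the domain is
  dense.\<close>

lemma T_inj: assumes "T f = 0" shows "Q f = 0"
proof -
 let ?w = "G (Q f)"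
 have wS: "(?w, Q f) \<in> S" by (rule G_in[OF Q_in])
 have "P ?w = ?w" using assms by (simp add: P_eq T_def)
 hence "?w \<in> H" using P_in[of ?w] by simp
 show ?thesis
 proof (rule S_dense)
  fix x g assume xg: "(x, g) \<in> S"
  show "inner x (Q f) = 0" using S_sym[OF xg wS] H_Rn(2)[OF \<open>?w \<in> H\<close> S_Rn[OF xg]] by simp
 qed
qed

text \<open>For \<open>f\<close> in \<open>Rn\<close>, \<open>G f\<close> and \<open>T f\<close>
  differ by a vector of \<open>H\<close>, so the kernel plus the minimal domain is the kernel plus
  the range of \<open>T\<close>. The later estimates use this splitting \<open>u = h + T f\<close>,
  whose summands are orthogonal.\<close>

lemma K_iff: "(u, f) \<in> K \<longleftrightarrow> f \<in> Rn & u - T f \<in> H"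
proof
 assume "(u, f) \<in> K"
 then obtain h w where u: "u = h + w" "h \<in> H" "(w, f) \<in> S" unfolding K_def by blast
 have f: "f \<in> Rn" by (rule S_Rn[OF u(3)])
 have "G f = w" by (rule G_eq[OF u(3)])
 hence "u - T f = h + P w" using u Q_id[OF f] by (simp add: T_def P_eq)
 thus "f \<in> Rn & u - T f \<in> H" using f subspace_add[OF H_sub u(2) P_in[of w]] by simp
next
 assume *: "f \<in> Rn & u - T f \<in> H"
 let ?w = "G f"
 have "u - ?w = (u - T f) - P ?w" using * Q_id by (simp add: T_def P_eq)
 also have "... \<in> H" using * subspace_diff[OF H_sub _ P_in[of ?w]] by blast
 finally have "u - ?w \<in> H" .
 thus "(u, f) \<in> K" unfolding K_def using G_in[of f] * by (intro CollectI exI[of _ "u - ?w"] exI[of _ ?w] exI[of _ f]) auto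
qed

text \<open>For \<open>t\<close> below \<open>1 / (2 * k)\<close> the operator
  \<open>1 - t T\<close> is coercive, as \<open>T\<close> is bounded by \<open>k\<close> and
  nonnegative, the latter covering \<open>t <= 0\<close>. In terms of \<open>u = T f\<close> such
  \<open>t\<close> are in the resolvent set of \<open>L\<close>, so its spectrum stays away from
  0.\<close>

lemma reduced_resolvent:
 "EX mm>0. ALL t<mm. (ALL g:Rn. EX f:Rn. f - t *\<^sub>R T f = g) & (EX D. ALL f:Rn. norm (T f) <= D * norm (f - t *\<^sub>R T f))"
proof -
 interpret T: bounded_linear T by (rule T_bl)
 obtain k where k: "k > 0" "!!x. norm (T x) <= norm x * k" using T.pos_bounded by blast
 have main: "(ALL g:Rn. EX f:Rn. f - t *\<^sub>R T f = g) & (EX D. ALL f:Rn. norm (T f) <= D * norm (f - t *\<^sub>R T f))"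
  if t: "t < 1 / (2 * k)" for t
 proof -
  let ?B = "%f. f - t *\<^sub>R T f"
  have bl: "bounded_linear ?B" by (intro bounded_linear_sub bounded_linear_ident bounded_linear_compose[OF bounded_linear_scaleR_right T_bl])
  have sym: "inner (?B x) y = inner x (?B y)" for x y by (simp add: inner_diff_left inner_diff_right T_sym)
  have co: "1/2 * (norm x)^2 <= inner (?B x) x" for x
  proof -
   have "t * inner (T x) x <= 1/2 * (norm x)^2"
   proof (cases "t <= 0")
    case True
    hence "t * inner (T x) x <= 0" using T_pos[of x] by (simp add: mult_nonpos_nonneg)
    also have "... <= 1/2 * (norm x)^2" by simp
    finally show ?thesis .
   next
    case False
    have "inner (T x) x <= (norm x * k) * norm x" using norm_cauchy_schwarz[of "T x" x] mult_right_mono[OF k(2)[of x] norm_ge_zero[of x]] by linarith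
    hence "t * inner (T x) x <= t * (norm x * k * norm x)" using False by (intro mult_left_mono) auto
    also have "... = (t * k) * (norm x)^2" by (simp add: power2_eq_square)
    also have "... <= 1/2 * (norm x)^2" using t k(1) by (intro mult_right_mono) (auto simp: field_simps)
    finally show ?thesis .
   qed
   thus ?thesis by (simp add: inner_diff_left power2_norm_eq_inner)
  qed
  have half: "(1/2::real) > 0" by simp
  note cb = coercive_bij[OF bl sym half co]
  have "EX f:Rn. ?B f = g" if g: "g \<in> Rn" for g
  proof -
   obtain f where f: "?B f = g" using cb(1)[of g] by blast
   have "f = g + t *\<^sub>R T f" using f by (simp add: algebra_simps)
   hence "f \<in> Rn" using subspace_add[OF Rn_sub g subspace_mul[OF Rn_sub T_in[of f], of t]] by simp
   thus ?thesis using f by blast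
  qed
  moreover have "norm (T f) <= (2 * k) * norm (?B f)" for f
  proof -
   have "norm (T f) <= k * norm f" using k(2)[of f] by (simp add: mult.commute)
   also have "... <= k * (2 * norm (?B f))" using cb(2)[of f] k(1) by (intro mult_left_mono) auto
   finally show ?thesis by (simp add: mult_ac)
  qed
  ultimately show ?thesis by blast
 qed
 show ?thesis using main k(1) by (intro exI[of _ "1 / (2 * k)"]) auto
qed

text \<open>The inverse of this eigenvalue will be a point of the spectrum of \<open>L\<close>, so
  that the infimum defining lambda_0 is one over a nonempty set.\<close>

lemma T_eigenvector:
 assumes "EX x::'h. x ~= 0"
 shows "EX s>0. EX x:Rn. x ~= 0 & T x = s *\<^sub>R x"
proof -
 have "EX z:Rn. z ~= 0"
 proof (rule ccontr)
  assume n: "~ ?thesis"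
  have "w = 0" if "(w, f) \<in> S" for w f
  proof -
   have "f = 0" using S_Rn[OF that] n by blast
   thus ?thesis using S_bound[OF that] by simp
  qed
  hence "g = 0" for g :: 'h by (intro S_dense[of g]) force
  thus False using assms by blast
 qed
 then obtain z where z: "z \<in> Rn" "z ~= 0" by blast
 obtain x nv where x: "x \<in> Rn" "x ~= 0" "T x = nv *\<^sub>R x" using compact_sym_eigenvector[OF T_compact T_bl T_sym Rn T_in z] by blast
 have "nv ~= 0" using x T_inj[of x] Q_id by auto
 have "nv * inner x x >= 0" using T_pos[of x] x(3) by simp
 moreover have "inner x x > 0" using x(2) by simp
 ultimately have "nv >= 0" by (metis zero_le_mult_iff not_less)
 with \<open>nv ~= 0\<close> show ?thesis using x by (intro exI[of _ nv]) auto
qed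

end

section \<open>Perturbations of the Krein extension\<close>

text \<open>\<open>V_le\<close> is what multiplication by a function with values in the interval
  from 0 to \<open>b\<close> satisfies. \<open>V_small\<close> says that the form of
  \<open>V\<close> is compact on the kernel of \<open>K\<close>; a potential that vanishes near the
  boundary supplies it.\<close>

locale krein_perturbation = krein_graph S C for S :: "('h::{real_inner,complete_space} \<times> 'h) set" and C +
 fixes V :: "'h => 'h" and b :: real
 assumes V_bl: "bounded_linear V" and V_sym: "!!u v. inner (V u) v = inner u (V v)"
  and V_pos: "!!u. 0 <= inner (V u) u" and b_pos: "b > 0"
  and V_le: "!!u. (norm (V u))^2 <= b * inner (V u) u"
  and V_small: "!!ep. ep > 0 ==> EX Ph. finite Ph & (ALL fi:Ph. bounded_linear (fi :: 'h => real)) &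
    (ALL h:H. inner (V h) h <= ep * (norm h)^2 + (\<Sum>fi\<in>Ph. (fi h)^2))"
begin

sublocale T: bounded_linear T by (rule T_bl)
sublocale Q: bounded_linear Q by (rule Q_bl)
sublocale P: bounded_linear P by (rule P_bl)
sublocale V: bounded_linear V by (rule V_bl)

section \<open>The graphs of K - V and K + V, for \<open>sg = -1\<close> and
  \<open>sg = 1\<close>\<close>

definition "A sg = {(u, f + sg *\<^sub>R V u) | u f. (u, f) \<in> K}"

lemma A_iff: "(u, g) \<in> A sg \<longleftrightarrow> (u, g - sg *\<^sub>R V u) \<in> K" unfolding A_def by force

lemma norm_V_le: "norm (V u) <= b * norm u"
proof (cases "V u = 0")
 case True
 thus ?thesis using b_pos by simp
next
 case False
 have "norm (V u) * norm (V u) <= b * inner (V u) u" using V_le[of u] by (simp add: power2_eq_square)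
 also have "... <= b * (norm (V u) * norm u)" using b_pos by (intro mult_left_mono norm_cauchy_schwarz) auto
 finally have "norm (V u) * norm (V u) <= norm (V u) * (b * norm u)" by (simp add: mult_ac)
 thus ?thesis using False by simp
qed

lemma V_form_le: "inner (V u) u <= b * (norm u)^2"
proof -
 have "inner (V u) u <= norm (V u) * norm u" by (rule norm_cauchy_schwarz)
 also have "... <= b * norm u * norm u" by (intro mult_right_mono norm_V_le) auto
 finally show ?thesis by (simp add: power2_eq_square mult_ac)
qed

lemma V_form_add: "inner (V (u + v)) (u + v) <= 2 * inner (V u) u + 2 * inner (V v) v" using V_pos[of "u - v"] V_sym[of u v]
 by (simp add: V.add V.diff inner_add_left inner_add_right inner_diff_left inner_diff_right inner_commute)

lemma A_sub: "subspace (A sg)"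
proof -
 have K: "f + f' \<in> Rn & (u + u') - T (f + f') \<in> H" if "(u, f) \<in> K" "(u', f') \<in> K" for u u' f f'
 proof -
  have "(u - T f) + (u' - T f') \<in> H" using that by (intro subspace_add H_sub) (auto simp: K_iff)
  thus ?thesis using that Rn_sub by (simp add: K_iff T.add algebra_simps subspace_add)
 qed
 have K': "r *\<^sub>R f \<in> Rn & r *\<^sub>R u - T (r *\<^sub>R f) \<in> H" if "(u, f) \<in> K" for u f r
 proof -
  have "r *\<^sub>R (u - T f) \<in> H" using that by (intro subspace_mul H_sub) (auto simp: K_iff)
  thus ?thesis using that Rn_sub by (simp add: K_iff T.scaleR algebra_simps subspace_mul)
 qed
 show ?thesis unfolding subspace_def
 proof (intro conjI ballI allI)
  show "0 \<in> A sg" unfolding zero_prod_def A_iff by (simp add: K_iff V.zero T.zero subspace_0 H_sub Rn_sub)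
  fix x y assume "x \<in> A sg" "y \<in> A sg"
  thus "x + y \<in> A sg" using K[of "fst x" "snd x - sg *\<^sub>R V (fst x)" "fst y" "snd y - sg *\<^sub>R V (fst y)"] by (cases x; cases y) (simp add: A_iff K_iff V.add algebra_simps)
 next
  fix r x assume "x \<in> A sg"
  thus "r *\<^sub>R x \<in> A sg" using K'[of "fst x" "snd x - sg *\<^sub>R V (fst x)" r] by (cases x) (simp add: A_iff K_iff V.scaleR algebra_simps)
 qed
qed

text \<open>The harmonic parts drop out because they are orthogonal to \<open>f\<close> and
  \<open>f'\<close>: the form of \<open>K\<close> sees only \<open>T f\<close>.\<close>

lemma K_form:
 assumes "(u, f) \<in> K" "(u', f') \<in> K" shows "inner f u' = inner (T f) f'" "inner (T f) f' = inner u f'"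
proof -
 have "inner f u' = inner f (T f') + inner f (u' - T f')" by (simp add: inner_diff_right)
 thus "inner f u' = inner (T f) f'" using assms H_Rn by (simp add: K_iff T_sym)
 have "inner u f' = inner (T f) f' + inner (u - T f) f'" by (simp add: inner_diff_left)
 thus "inner (T f) f' = inner u f'" using assms H_Rn by (simp add: K_iff)
qed

lemma A_sym: "(u, g) \<in> A sg ==> (u', g') \<in> A sg ==> inner g u' = inner u g'" using K_form[of u "g - sg *\<^sub>R V u" u' "g' - sg *\<^sub>R V u'"] V_sym[of u u']
 by (simp add: A_iff inner_diff_left inner_diff_right)

text \<open>Testing against \<open>u\<close> in \<open>H\<close>, where \<open>f = 0\<close>, shows
  that \<open>y\<close> is orthogonal to the kernel; testing against \<open>u = T f\<close> shows
  that \<open>v - T y\<close> is orthogonal to \<open>Rn\<close>. This maximality yields closedness,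
  the dense range behind the resolvent, and the description of the domain.\<close>

lemma A_selfadj:
 assumes "!!u g. (u, g) \<in> A sg ==> inner g v = inner u v'"
 shows "(v, v') \<in> A sg"
proof -
 define y where "y = v' - sg *\<^sub>R V v"
 have *: "inner f v = inner u y" if "(u, f) \<in> K" for u f
 proof -
  have "(u, f + sg *\<^sub>R V u) \<in> A sg" using that by (simp add: A_iff)
  from assms[OF this] show ?thesis by (simp add: y_def inner_add_left inner_diff_right V_sym)
 qed
 have "inner h y = 0" if "h \<in> H" for h using *[of h 0] that by (simp add: K_iff T.zero subspace_0 Rn_sub)
 hence "P y = 0" unfolding P_def by (intro proj_unique H) (auto simp: subspace_0 H_sub inner_commute)
 hence yR: "y \<in> Rn" using PQ[of y] Q_in[of y] by simp
 have "v - T y \<in> H" unfolding H_iff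
 proof
  fix f assume f: "f \<in> Rn"
  have "(T f, f) \<in> K" using f by (simp add: K_iff subspace_0 H_sub)
  from *[OF this] have "inner v f = inner y (T f)" by (simp add: inner_commute)
  thus "inner (v - T y) f = 0" by (simp add: inner_diff_left T_sym)
 qed
 thus ?thesis using yR by (simp add: A_iff K_iff y_def)
qed

lemma A_closed: "closed (A sg)" unfolding closed_sequential_limits
proof (intro allI impI, elim conjE)
 fix s l assume s: "ALL n. s n \<in> A sg" and l: "s ----> l"
 obtain v v' where lv: "l = (v, v')" by (cases l)
 have 1: "(%n. fst (s n)) ----> v" and 2: "(%n. snd (s n)) ----> v'" using tendsto_fst[OF l] tendsto_snd[OF l] by (auto simp: lv)
 have "(v, v') \<in> A sg"
 proof (rule A_selfadj)
  fix u g assume ug: "(u, g) \<in> A sg"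
  have "(%n. inner g (fst (s n))) ----> inner g v" by (intro tendsto_intros 1)
  moreover have "inner g (fst (s n)) = inner u (snd (s n))" for n using A_sym[OF ug, of "fst (s n)" "snd (s n)"] s by simp
  moreover have "(%n. inner u (snd (s n))) ----> inner u v'" by (intro tendsto_intros 2)
  ultimately show "inner g v = inner u v'" using LIMSEQ_unique by simp
 qed
 thus "l \<in> A sg" by (simp add: lv)
qed

lemma A_lower:
 assumes "(u, g) \<in> A sg" "\<bar>sg\<bar> = 1" shows "- b * (norm u)^2 <= inner g u"
proof -
 let ?f = "g - sg *\<^sub>R V u"
 have "(u, ?f) \<in> K" by (rule A_iff[THEN iffD1, OF assms(1)])
 from K_form(1)[OF this this] have "inner ?f u = inner (T ?f) ?f" .
 hence "0 <= inner ?f u" using T_pos by simp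
 moreover have "\<bar>sg * inner (V u) u\<bar> <= b * (norm u)^2" using V_form_le[of u] V_pos[of u] assms(2) by (simp add: abs_mult)
 ultimately show ?thesis by (simp add: inner_diff_left)
qed

lemma VP_compact: "compact_op (%x. V (P x))"
proof (rule compact_opI)
 fix ep :: real assume e: "ep > 0"
 \<comment> \<open>\<open>V_le\<close> turns a bound on the form by \<open>de\<close> into one on
   the squared norm by \<open>b * de\<close>, which is to be \<open>ep^2\<close>.\<close>
 define de where "de = ep^2 / b"
 have d: "de > 0" using e b_pos by (simp add: de_def)
 obtain Ph where Ph: "finite Ph" "ALL fi:Ph. bounded_linear (fi :: 'h => real)"
    "ALL h:H. inner (V h) h <= de * (norm h)^2 + (\<Sum>fi\<in>Ph. (fi h)^2)" using V_small[OF d] by blast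
 have "norm (V (P x)) <= ep * norm x + (\<Sum>fi\<in>Ph. \<bar>sqrt b * fi (P x)\<bar>)" for x
 proof (rule power2_le_imp_le)
  define Z where "Z = (\<Sum>fi\<in>Ph. \<bar>fi (P x)\<bar>)"
  have Z: "Z >= 0" unfolding Z_def by (simp add: sum_nonneg)
  have "(norm (V (P x)))^2 <= b * inner (V (P x)) (P x)" by (rule V_le)
  also have "... <= b * (de * (norm (P x))^2 + (\<Sum>fi\<in>Ph. (fi (P x))^2))" using Ph(3) P_in b_pos by (intro mult_left_mono) auto
  also have "... <= b * (de * (norm x)^2 + Z^2)" unfolding Z_def using b_pos d norm_P_le[of x] sum_squares_le_square_sum[OF Ph(1), of "%fi. fi (P x)"] by (intro mult_left_mono add_mono power_mono) auto
  also have "... = (ep * norm x)^2 + (sqrt b * Z)^2" using b_pos by (simp add: de_def power_mult_distrib algebra_simps)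
  also have "... <= (ep * norm x + sqrt b * Z)^2" using e Z b_pos by (simp add: power2_sum)
  finally show "(norm (V (P x)))^2 <= (ep * norm x + (\<Sum>fi\<in>Ph. \<bar>sqrt b * fi (P x)\<bar>))^2" using b_pos by (simp add: Z_def abs_mult sum_distrib_left)
  show "0 <= ep * norm x + (\<Sum>fi\<in>Ph. \<bar>sqrt b * fi (P x)\<bar>)" using e by (intro add_nonneg_nonneg sum_nonneg) auto
 qed
 thus "EX (I :: ('h => real) set) fi de. finite I & de <= ep & (ALL i:I. bounded_linear (fi i)) &
  (ALL x. norm (V (P x)) <= de * norm x + (\<Sum>i\<in>I. \<bar>fi i x\<bar>))" using Ph by (intro exI[of _ Ph] exI[of _ "%fi x. sqrt b * fi (P x)"] exI[of _ ep])
   (auto intro!: bounded_linear_const_mult[OF bounded_linear_compose[OF _ P_bl]])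
qed

text \<open>\<open>(A + gz)\<^sup>-\<^sup>1\<close> is itself not compact up to a constant: the kernel of \<open>K\<close> and the range of
 \<open>L\<close> contribute the two essential values \<open>1/gz\<close> and \<open>0\<close>. The quadratic polynomial vanishing at both
 values makes it compact.\<close>

lemma A_resolvent:
 assumes sg: "\<bar>sg\<bar> = 1"
 shows "EX R gz. bounded_linear R & (ALL x y. inner (R x) y = inner x (R y)) &
  (ALL x. (R x, x - gz *\<^sub>R R x) \<in> A sg) & compact_op (%x. R (R x) - (1/gz) *\<^sub>R R x)"
proof -
 \<comment> \<open>By \<open>A_lower\<close> the operator shifted by \<open>gz\<close> is bounded
   below by 1.\<close>
 define gz where "gz = b + 1"
 have g0: "gz > 0" using b_pos by (simp add: gz_def)
 define A' where "A' = (%p. (fst p, snd p + gz *\<^sub>R fst p)) ` A sg"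
 have A'_iff: "(u, y) \<in> A' \<longleftrightarrow> (u, y - gz *\<^sub>R u) \<in> A sg" for u y unfolding A'_def by (force simp: image_iff)
 have lin: "linear (%p :: 'h \<times> 'h. (fst p, snd p + gz *\<^sub>R fst p))" by (rule linearI) (auto simp: algebra_simps)
 have sub: "subspace A'" unfolding A'_def by (intro linear_subspace_image lin A_sub)
 have "A' = (%p. (fst p, snd p - gz *\<^sub>R fst p)) -` A sg" using A'_iff by auto
 moreover have "closed ((%p :: 'h \<times> 'h. (fst p, snd p - gz *\<^sub>R fst p)) -` A sg)" by (intro closed_vimage A_closed continuous_intros)
 ultimately have cl: "closed A'" by simp
 have bnd: "norm u <= 1 * norm y" if "(u, y) \<in> A'" for u y
 proof -
  have "- b * (norm u)^2 <= inner (y - gz *\<^sub>R u) u" using that A_lower[OF _ sg] A'_iff by blast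
  hence "norm u * norm u <= inner y u" by (simp add: gz_def inner_diff_left power2_norm_eq_inner algebra_simps flip: power2_eq_square)
  also have "... <= norm y * norm u" by (rule norm_cauchy_schwarz)
  finally show ?thesis by (cases "u = 0") auto
 qed
 have "closed (snd ` A')" by (rule closed_range_of_graph[OF sub cl bnd])
 moreover have "closure (snd ` A') = UNIV"
 proof (rule dense_if_orth_trivial)
  show "subspace (snd ` A')" by (intro linear_subspace_image linear_snd sub)
  fix v assume v: "ALL x:snd ` A'. inner v x = 0"
  \<comment> \<open>A vector orthogonal to the range is an eigenvector with eigenvalue
    \<open>- gz\<close>, below the lower bound \<open>- b\<close>.\<close>
  have "(v, - gz *\<^sub>R v) \<in> A sg"
  proof (rule A_selfadj)
   fix u g assume "(u, g) \<in> A sg"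
   hence "(u, g + gz *\<^sub>R u) \<in> A'" by (simp add: A'_iff)
   hence "inner v (g + gz *\<^sub>R u) = 0" using v by force
   thus "inner g v = inner u (- gz *\<^sub>R v)" by (simp add: inner_add_right inner_commute)
  qed
  hence "- b * (norm v)^2 <= - gz * (norm v)^2" using A_lower[OF _ sg] by (force simp: power2_norm_eq_inner)
  thus "v = 0" by (simp add: gz_def algebra_simps)
 qed
 ultimately have surj: "snd ` A' = UNIV" by (simp add: closure_closed)
 have "EX u. (u, x) \<in> A'" for x
 proof -
  have "x \<in> snd ` A'" using surj by simp
  thus ?thesis by auto
 qed
 then obtain R where R: "!!x. (R x, x) \<in> A'" by metis
 have uniq: "u = R y" if "(u, y) \<in> A'" for u y using subspace_diff[OF sub that R[of y]] bnd[of "u - R y" 0] by simp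
 have R_bl: "bounded_linear R"
 proof (rule bounded_linear_intro[where K=1])
  fix x y :: 'h and r :: real
  have "(R x + R y, x + y) \<in> A'" using subspace_add[OF sub R[of x] R[of y]] by simp
  thus "R (x + y) = R x + R y" by (rule uniq[symmetric])
  have "(r *\<^sub>R R x, r *\<^sub>R x) \<in> A'" using subspace_mul[OF sub R[of x], of r] by simp
  thus "R (r *\<^sub>R x) = r *\<^sub>R R x" by (rule uniq[symmetric])
  show "norm (R x) <= norm x * 1" using bnd[OF R[of x]] by simp
 qed
 have RA: "(R x, x - gz *\<^sub>R R x) \<in> A sg" for x using R A'_iff by blast
 have R_sym: "inner (R x) y = inner x (R y)" for x y using A_sym[OF RA[of x] RA[of y]] by (simp add: inner_diff_left inner_diff_right inner_commute)
 \<comment> \<open>\<open>F x\<close> is \<open>K\<close> applied to \<open>R x\<close>.\<close>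
 define F where "F x = x - gz *\<^sub>R R x - sg *\<^sub>R V (R x)" for x
 have F_bl: "bounded_linear F" unfolding F_def by (intro bounded_linear_sub bounded_linear_ident bounded_linear_compose[OF bounded_linear_scaleR_right]
    bounded_linear_compose[OF V_bl R_bl] R_bl)
 have FK: "(R x, F x) \<in> K" for x using RA[of x] by (simp add: A_iff F_def)
 have QR: "Q (R x) = T (F x)" for x
 proof -
  have "R x - T (F x) \<in> H" using FK K_iff by blast
  hence "Q (R x - T (F x)) = 0" by (rule Q_H)
  thus ?thesis by (simp add: Q.diff T_def Q_id[OF Q_in])
 qed
 define D where "D x = V (R (R x))" for x
 have D_eq: "D x = V (P (R (R x))) + V (T (F (R x)))" for x unfolding D_def QR[of "R x", symmetric] V.add[symmetric] PQ ..
 note RR = bounded_linear_compose[OF R_bl R_bl] and FR = bounded_linear_compose[OF F_bl R_bl]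
 have D_cmp: "compact_op D" unfolding D_eq[abs_def] by (intro compact_op_add compact_op_comp_right[OF VP_compact RR]
    compact_op_comp_left[OF compact_op_comp_right[OF T_compact FR] V_bl])
 \<comment> \<open>\<open>F (R x)\<close> lies in \<open>Rn\<close>, so applying \<open>Q\<close> to
   its formula changes nothing, while \<open>Q\<close> after \<open>R\<close> is the compact
   \<open>T\<close> after \<open>F\<close>. The other terms contain \<open>D\<close>, which is
   compact because \<open>V\<close> is compact on harmonic vectors and the remaining part passes
   through \<open>T\<close>.\<close>
 have eq: "R (R x) - (1/gz) *\<^sub>R R x
  = - (1/gz) *\<^sub>R (T (F x) + (- gz) *\<^sub>R T (F (R x)) + ((- sg) *\<^sub>R Q (D x) + sg *\<^sub>R D x))" for x
 proof -
  have f: "F (R x) = R x - gz *\<^sub>R R (R x) - sg *\<^sub>R D x" by (simp add: F_def D_def)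
  have "F (R x) \<in> Rn" using FK K_iff by blast
  hence "F (R x) = Q (F (R x))" by (simp add: Q_id)
  also have "... = Q (R x - gz *\<^sub>R R (R x) - sg *\<^sub>R D x)" by (simp only: f)
  also have "... = T (F x) - gz *\<^sub>R T (F (R x)) - sg *\<^sub>R Q (D x)" by (simp add: Q.diff Q.scaleR QR)
  finally have e: "F (R x) = T (F x) - gz *\<^sub>R T (F (R x)) - sg *\<^sub>R Q (D x)" .
  have "R x - gz *\<^sub>R R (R x) = F (R x) + sg *\<^sub>R D x" by (simp add: f)
  also note e
  finally have "R x - gz *\<^sub>R R (R x) = T (F x) - gz *\<^sub>R T (F (R x)) - sg *\<^sub>R Q (D x) + sg *\<^sub>R D x" .
  hence r: "T (F x) + (- gz) *\<^sub>R T (F (R x)) + ((- sg) *\<^sub>R Q (D x) + sg *\<^sub>R D x) = R x - gz *\<^sub>R R (R x)" by (simp add: algebra_simps)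
  thus ?thesis unfolding r using g0 by (simp add: algebra_simps)
 qed
 have "compact_op (%x. R (R x) - (1/gz) *\<^sub>R R x)" unfolding eq by (intro compact_op_comp_left[OF _ bounded_linear_scaleR_right] compact_op_add
    compact_op_comp_right[OF T_compact F_bl] compact_op_comp_right[OF T_compact FR]
    compact_op_comp_left[OF D_cmp Q_bl] D_cmp)
 thus ?thesis using R_bl R_sym RA by (intro exI[of _ R] exI[of _ gz]) simp
qed

text \<open>Completing the square: \<open>R^2 - c R\<close> is \<open>(R - c/2)^2\<close> minus the
  constant \<open>(c/2)^2\<close>, and the shifted operator has the same eigenvectors.\<close>

lemma sym_eigenbasis':
 fixes R :: "'h => 'h"
 assumes R: "bounded_linear R" and sym: "!!x y. inner (R x) y = inner x (R y)"
  and C: "compact_op (%x. R (R x) - c *\<^sub>R R x)"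
 shows "EX B. onb B & (ALL e:B. EX nv. R e = nv *\<^sub>R e)"
proof -
 interpret R: bounded_linear R by fact
 let ?R' = "%x. R x - (c/2) *\<^sub>R x"
 have "EX B. onb B & (ALL e:B. EX nv. ?R' e = nv *\<^sub>R e)"
 proof (rule sym_eigenbasis[where c="(c/2)^2"])
  show "bounded_linear ?R'" by (intro bounded_linear_sub R bounded_linear_scaleR_right)
  show "inner (?R' x) y = inner x (?R' y)" for x y by (simp add: inner_diff_left inner_diff_right sym)
  have "?R' (?R' x) - (c/2)^2 *\<^sub>R x = R (R x) - c *\<^sub>R R x" for x by (simp add: R.diff R.scaleR algebra_simps power2_eq_square flip: scaleR_add_left)
  thus "compact_op (%x. ?R' (?R' x) - (c/2)^2 *\<^sub>R x)" using C by simp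
 qed
 then obtain B where B: "onb B" "ALL e:B. EX nv. ?R' e = nv *\<^sub>R e" by blast
 have "EX nv. R e = nv *\<^sub>R e" if e: "e \<in> B" for e
 proof -
  obtain nv where "?R' e = nv *\<^sub>R e" using bspec[OF B(2) e] by (elim exE)
  hence "R e = nv *\<^sub>R e + (c/2) *\<^sub>R e" by (simp only: diff_eq_eq)
  hence "R e = (nv + c/2) *\<^sub>R e" by (simp only: scaleR_add_left)
  thus ?thesis by blast
 qed
 thus ?thesis using B(1) by (intro exI[of _ B]) simp
qed

text \<open>Injectivity of \<open>T\<close> on \<open>Rn\<close> makes the graph single-valued.
  Consequently the resolvent has no kernel, and each of its eigenvalues \<open>nv\<close> gives the
  eigenvalue \<open>1/nv - gz\<close> of the operator.\<close>

lemma A_single: assumes "(0, g) \<in> A sg" shows "g = 0"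
proof -
 have "(0, g) \<in> K" using assms by (simp add: A_iff V.zero)
 hence g: "g \<in> Rn" "- T g \<in> H" by (auto simp: K_iff)
 hence "Q (- T g) = 0" by (intro Q_H)
 hence "T g = 0" by (simp add: Q.neg T_def Q_id[OF Q_in])
 from T_inj[OF this] show ?thesis using Q_id g by simp
qed

lemma A_eigenbasis:
 assumes "\<bar>sg\<bar> = 1"
 shows "EX B ev. onb B & (ALL e:B. (e, ev e *\<^sub>R e) \<in> A sg)"
proof -
 obtain R gz where R: "bounded_linear R" "ALL x y. inner (R x) y = inner x (R y)"
  "ALL x. (R x, x - gz *\<^sub>R R x) \<in> A sg" "compact_op (%x. R (R x) - (1/gz) *\<^sub>R R x)" using A_resolvent[OF assms] by (elim exE conjE)
 obtain B where B: "onb B" "ALL e:B. EX nv. R e = nv *\<^sub>R e" using sym_eigenbasis'[OF R(1) _ R(4)] R(2) by blast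
 have "EX t. (e, t *\<^sub>R e) \<in> A sg" if e: "e \<in> B" for e
 proof -
  obtain nv where nv: "R e = nv *\<^sub>R e" using bspec[OF B(2) e] by (elim exE)
  have e0: "e ~= 0" using onbD(1)[OF B(1) e e] by auto
  have "nv ~= 0"
  proof
   assume "nv = 0"
   hence "(0, e) \<in> A sg" using R(3)[rule_format, of e] nv by simp
   thus False using A_single e0 by blast
  qed
  moreover have "(1/nv) *\<^sub>R (nv *\<^sub>R e, e - gz *\<^sub>R nv *\<^sub>R e) \<in> A sg" using subspace_mul[OF A_sub R(3)[rule_format, of e], of "1/nv"] nv by simp
  ultimately have "(e, (1/nv - gz) *\<^sub>R e) \<in> A sg" by (simp add: scaleR_diff_left scaleR_diff_right)
  thus ?thesis by blast
 qed
 hence "EX ev. ALL e:B. (e, ev e *\<^sub>R e) \<in> A sg" by (rule bchoice[OF ballI])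
 thus ?thesis using B(1) by blast
qed

subsection \<open>Eigenfunction expansions\<close>

definition eigenbasis :: "real => 'h set => ('h => real) => bool" where
 "eigenbasis sg B ev \<longleftrightarrow> onb B & (ALL e:B. (e, ev e *\<^sub>R e) \<in> A sg)"

context
 fixes sg B ev assumes EB: "eigenbasis sg B ev"
begin

lemma EB_onb: "onb B" using EB by (simp add: eigenbasis_def)
lemma EB_A: "e \<in> B ==> (e, ev e *\<^sub>R e) \<in> A sg" using EB by (simp add: eigenbasis_def)

lemma A_coeff: "(u, g) \<in> A sg ==> e \<in> B ==> inner g e = ev e * inner u e" using A_sym[OF _ EB_A] by simp

lemma A_norm: "(u, g) \<in> A sg ==> ((%e. (ev e)^2 * (inner u e)^2) has_sum (norm g)^2) B" using parseval_norm[OF EB_onb, of g] by (simp add: A_coeff power_mult_distrib cong: has_sum_cong)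

lemma A_form: "(u, g) \<in> A sg ==> ((%e. ev e * (inner u e)^2) has_sum inner g u) B" using parseval_inner[OF EB_onb, of g u] by (simp add: A_coeff power2_eq_square mult.assoc cong: has_sum_cong)

text \<open>Square summability of the candidate coefficients \<open>ev e * inner u e\<close>
  produces \<open>g\<close> by Riesz-Fischer, and Parseval together with \<open>A_selfadj\<close>
  puts \<open>(u, g)\<close> into the graph.\<close>

lemma A_domain: "(EX g. (u, g) \<in> A sg) \<longleftrightarrow> (%e. (ev e)^2 * (inner u e)^2) summable_on B"
proof
 assume "EX g. (u, g) \<in> A sg"
 thus "(%e. (ev e)^2 * (inner u e)^2) summable_on B" using A_norm by (auto simp: summable_on_def)
next
 assume "(%e. (ev e)^2 * (inner u e)^2) summable_on B"
 hence "(%e. (ev e * inner u e)^2) summable_on B" by (simp add: power_mult_distrib)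
 from riesz_fischer_onb[OF EB_onb this] obtain g where g: "ALL e:B. inner g e = ev e * inner u e" by blast
 have "(u, g) \<in> A sg"
 proof (rule A_selfadj)
  fix v y assume vy: "(v, y) \<in> A sg"
  have "inner y e * inner u e = inner v e * inner g e" if "e \<in> B" for e using A_coeff[OF vy that] g that by simp
  hence "((%e. inner y e * inner u e) has_sum inner v g) B" using parseval_inner[OF EB_onb, of v g] by (simp cong: has_sum_cong)
  with parseval_inner[OF EB_onb] show "inner y u = inner v g" by (rule has_sum_unique)
 qed
 thus "EX g. (u, g) \<in> A sg" by blast
qed

text \<open>The constraints act on the pair \<open>(u, g)\<close>, so they may involve
  \<open>K u\<close> as well as \<open>u\<close>. With fewer constraints than eigenvectors,
  elimination leaves a nontrivial combination whose norms and form are sums weighted by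
  eigenvalues.\<close>

lemma constrained_combination:
 fixes ps :: "'j => 'h \<times> 'h => real"
 assumes Z: "finite Z" "Z \<subseteq> B" and J: "finite J" "ALL j:J. linear (ps j)" "card J < card Z"
 shows "EX x u g. (u, g) \<in> A sg & (ALL j:J. ps j (u, g) = 0) & (EX e:Z. x e ~= 0) &
  (norm u)^2 = (\<Sum>e\<in>Z. (x e)^2) & inner g u = (\<Sum>e\<in>Z. ev e * (x e)^2) &
  (norm g)^2 = (\<Sum>e\<in>Z. (ev e)^2 * (x e)^2)"
proof -
 obtain x where x: "EX e:Z. x e ~= 0" "ALL j:J. (\<Sum>e\<in>Z. x e * ps j (e, ev e *\<^sub>R e)) = 0" using exists_nontrivial_solution[OF J(1) Z(1) J(3), of "%j e. ps j (e, ev e *\<^sub>R e)"] by blast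
 define u where "u = (\<Sum>e\<in>Z. x e *\<^sub>R e)"
 define g where "g = (\<Sum>e\<in>Z. (x e * ev e) *\<^sub>R e)"
 have ug: "(u, g) = (\<Sum>e\<in>Z. x e *\<^sub>R (e, ev e *\<^sub>R e))" unfolding u_def g_def by (rule prod_eqI) (simp_all add: fst_sum snd_sum)
 have A: "(u, g) \<in> A sg" unfolding ug by (intro subspace_sum A_sub subspace_mul EB_A) (use Z in auto)
 have "ps j (u, g) = 0" if "j \<in> J" for j
 proof -
  have "ps j (u, g) = (\<Sum>e\<in>Z. x e * ps j (e, ev e *\<^sub>R e))" unfolding ug using bspec[OF J(2) that] by (simp add: linear_sum linear_cmul del: scaleR_Pair)
  thus ?thesis using x(2) that by simp
 qed
 moreover have "(norm u)^2 = (\<Sum>e\<in>Z. (x e)^2)" unfolding u_def by (rule norm_onb_sum[OF EB_onb Z])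
 moreover have "(norm g)^2 = (\<Sum>e\<in>Z. (ev e)^2 * (x e)^2)" unfolding g_def using norm_onb_sum[OF EB_onb Z, of "%e. x e * ev e"] by (simp add: power_mult_distrib mult.commute)
 moreover have "inner g u = (\<Sum>e\<in>Z. ev e * (x e)^2)"
 proof -
  have "inner g u = (\<Sum>e\<in>Z. x e * inner g e)" unfolding u_def by (simp add: inner_sum_right)
  also have "... = (\<Sum>e\<in>Z. ev e * (x e)^2)" by (intro sum.cong refl) (use Z inner_onb_sum[OF EB_onb Z] in \<open>auto simp: g_def power2_eq_square\<close>)
  finally show ?thesis .
 qed
 ultimately show ?thesis using A x(1) by (intro exI[of _ x] exI[of _ u] exI[of _ g]) simp
qed

end

end

subsection \<open>Eigenvalue counting\<close>

context krein_perturbation begin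

lemma constrained_split:
 fixes G :: "'h set"
 assumes EB: "eigenbasis s B ev" and Y: "finite Y" "Y \<subseteq> H"
  and Ph: "finite Ph" "ALL fi:Ph. bounded_linear (fi :: 'h => real)"
  and G: "finite G" "G \<subseteq> B" and ncd: "~ card G <= card Y + card Ph"
 shows "EX x u f h. (u, f) \<in> K & h \<in> H & u = h + T f & (norm u)^2 = (norm h)^2 + (norm (T f))^2 &
  (ALL fi:Ph. fi f = 0) & (ALL y:Y. inner h y = 0) & (EX e:G. x e ~= 0) & (norm u)^2 = (\<Sum>e\<in>G. (x e)^2) &
  inner (f + s *\<^sub>R V u) u = (\<Sum>e\<in>G. ev e * (x e)^2) & (norm (f + s *\<^sub>R V u))^2 = (\<Sum>e\<in>G. (ev e)^2 * (x e)^2)"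
proof -
 \<comment> \<open>The constraints of type \<open>Inl\<close> make the harmonic part orthogonal to
   \<open>Y\<close>: pairing with \<open>u\<close> suffices, since \<open>T f\<close> is orthogonal
   to \<open>H\<close>. Those of type \<open>Inr\<close> make the functionals in \<open>Ph\<close>
   vanish at \<open>f = g - s *\<^sub>R V u\<close>.\<close>
 define ps :: "'h + ('h => real) => 'h \<times> 'h => real" where
  "ps j = (case j of Inl y => (%p. inner (fst p) y) | Inr fi => (%p. fi (snd p - s *\<^sub>R V (fst p))))" for j
 have fin: "finite (Y <+> Ph)" using Y Ph by simp
 have cd: "card (Y <+> Ph) < card G" using Y Ph ncd by (simp add: card_Plus)
 have lin: "linear (ps j)" if "j \<in> Y <+> Ph" for j
 proof (cases j)
  case (Inl y)
  thus ?thesis by (auto simp: ps_def inner_add_left intro!: linearI)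
 next
  case (Inr fi)
  hence "linear fi" using that Ph(2) bounded_linear.linear by blast
  thus ?thesis using Inr by (auto simp: ps_def linear_add linear_diff linear_cmul V.add V.scaleR algebra_simps intro!: linearI)
 qed
 have lin': "ALL j:Y <+> Ph. linear (ps j)" using lin by blast
 obtain x u g where ug: "(u, g) \<in> A s" and cond: "ALL j:Y <+> Ph. ps j (u, g) = 0"
  and x: "EX e:G. x e ~= 0" "(norm u)^2 = (\<Sum>e\<in>G. (x e)^2)"
   "inner g u = (\<Sum>e\<in>G. ev e * (x e)^2)" "(norm g)^2 = (\<Sum>e\<in>G. (ev e)^2 * (x e)^2)" using constrained_combination[where ps=ps, OF EB G fin lin' cd] by (elim exE conjE) (rule that)
 define f where "f = g - s *\<^sub>R V u"
 have K: "(u, f) \<in> K" using ug by (simp add: A_iff f_def)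
 have h: "u - T f \<in> H" using K by (simp add: K_iff)
 have "inner (u - T f) (T f) = 0" by (rule H_Rn(1)[OF h T_in])
 hence "(norm u)^2 = (norm (u - T f))^2 + (norm (T f))^2" by (simp add: power2_norm_eq_inner inner_diff_left inner_diff_right inner_commute)
 moreover have "fi f = 0" if "fi \<in> Ph" for fi using bspec[OF cond InrI[OF that]] by (simp add: ps_def f_def)
 moreover have "inner (u - T f) y = 0" if "y \<in> Y" for y
 proof -
  have "inner (T f) y = 0" using H_Rn(2) T_in that Y by blast
  thus ?thesis using bspec[OF cond InlI[OF that]] by (simp add: ps_def inner_diff_left)
 qed
 ultimately show ?thesis using K h x by (intro exI[of _ x] exI[of _ u] exI[of _ f] exI[of _ "u - T f"]) (simp add: f_def)
qed

lemma weighted_sum_less: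
 fixes p q x :: "'b => real" and G :: "'b set"
 assumes "finite G" "EX e:G. x e ~= 0" "!!e. e \<in> G ==> p e < q e"
 shows "(\<Sum>e\<in>G. p e * (x e)^2) < (\<Sum>e\<in>G. q e * (x e)^2)"
proof (rule sum_strict_mono_ex1[OF assms(1)])
 show "ALL e:G. p e * (x e)^2 <= q e * (x e)^2" using assms(3) by (intro ballI mult_right_mono) (auto intro: less_imp_le)
 show "EX e:G. p e * (x e)^2 < q e * (x e)^2" using assms(2,3) by (meson mult_strict_right_mono zero_less_power2)
qed

text \<open>With more eigenvalues below \<open>- l\<close> than constraints, some
  \<open>u = h + T f\<close> in their span has \<open>h\<close> orthogonal to \<open>Y\<close> and
  \<open>T f\<close> small against the form of \<open>K\<close>. That form absorbs the potential on
  \<open>T f\<close>, and \<open>l\<close> absorbs the potential on \<open>h\<close>, so the form at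
  \<open>u\<close> is at least \<open>- l * (norm u)^2\<close>, which eigenvalues below
  \<open>- l\<close> forbid. The factor 2 is the price of splitting the form of
  \<open>V\<close>.\<close>

lemma upper_count_minus:
 "EX M. ALL B ev. eigenbasis (-1) B ev --> (ALL l Y G. l > 0 --> finite Y --> Y \<subseteq> H -->
  (ALL h:H. (ALL y:Y. inner h y = 0) --> 2 * inner (V h) h <= l * (norm h)^2) -->
  finite G --> G \<subseteq> {e\<in>B. ev e < - l} --> card G <= card Y + M)"
proof -
 \<comment> \<open>With this \<open>ep\<close>, twice the potential on \<open>v = T f\<close>, at
   most \<open>2 * b * (norm v)^2\<close>, is covered by \<open>inner v f\<close>.\<close>
 have "1 / (2 * b) > 0" using b_pos by simp
 note pos = this
 obtain Ph where Ph: "finite Ph" "ALL fi:Ph. bounded_linear (fi :: 'h => real)"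
  "ALL f. (ALL fi:Ph. fi f = 0) --> (norm (T f))^2 <= 1 / (2 * b) * inner (T f) f" using T_small[OF pos] by (elim exE conjE)
 show ?thesis
 proof (intro exI[of _ "card Ph"] allI impI, rule ccontr)
  fix B :: "'h set" and ev l Y G
  assume EB: "eigenbasis (-1) B ev" and l: "l > 0" and Y: "finite Y" "Y \<subseteq> H"
   and small: "ALL h:H. (ALL y:Y. inner h y = 0) --> 2 * inner (V h) h <= l * (norm h)^2"
   and G: "finite G" "G \<subseteq> {e\<in>B. ev e < - l}" and ncd: "~ card G <= card Y + card Ph"
  have GB: "G \<subseteq> B" using G by blast
  obtain x u f h where K: "(u, f) \<in> K" and h: "h \<in> H" and u': "u = h + T f" and nuh: "(norm u)^2 = (norm h)^2 + (norm (T f))^2"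
   and ph: "ALL fi:Ph. fi f = 0" and hY: "ALL y:Y. inner h y = 0"
   and x: "EX e:G. x e ~= 0" and nu: "(norm u)^2 = (\<Sum>e\<in>G. (x e)^2)"
   and form: "inner (f - V u) u = (\<Sum>e\<in>G. ev e * (x e)^2)" using constrained_split[OF EB Y Ph(1,2) G(1) GB ncd] by (elim exE conjE) (rule that, simp_all)
  define v where vT: "v = T f"
  have u: "u = h + v" by (simp add: u' vT)
  have v_small: "2 * b * (norm v)^2 <= inner v f" using Ph(3)[rule_format, of f] ph b_pos by (simp add: vT field_simps)
  have h_small: "2 * inner (V h) h <= l * (norm h)^2" using small h hY by blast
  have hu: "l * (norm h)^2 <= l * (norm u)^2" using l nuh by simp
  have "inner f u = inner v f" using K_form(1)[OF K K] by (simp add: vT)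
  hence "inner (f - V u) u = inner v f - inner (V u) u" by (simp add: inner_diff_left)
  moreover have "inner (V u) u <= 2 * inner (V h) h + 2 * inner (V v) v" unfolding u by (rule V_form_add)
  moreover have "inner (V v) v <= b * (norm v)^2" by (rule V_form_le)
  ultimately have "- l * (norm u)^2 <= inner (f - V u) u" using v_small h_small hu by linarith
  moreover have "inner (f - V u) u < - l * (norm u)^2" using weighted_sum_less[OF G(1) x, of ev "%e. - l"] G(2) unfolding form nu by (auto simp: sum_distrib_left sum_negf)
  ultimately show False by simp
 qed
qed

text \<open>Here \<open>K\<close> and \<open>V\<close> have the same sign, so the form of
  \<open>K\<close> cannot absorb the potential. Instead the upper end \<open>m\<close> of the window
  bounds \<open>norm g\<close> by the form \<open>a\<close>, hence \<open>norm f\<close> by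
  \<open>s\<close>, and \<open>v = T f\<close> becomes negligible. This gives
  \<open>a <= 4 * s\<close> and \<open>s <= 4 * inner (V h) h\<close>, which explains the factor
  16.\<close>

lemma upper_count_plus:
 assumes m: "m > 0"
 shows "EX M. ALL B ev. eigenbasis 1 B ev --> (ALL l Y G. l > 0 --> finite Y --> Y \<subseteq> H -->
  (ALL h:H. (ALL y:Y. inner h y = 0) --> 16 * inner (V h) h <= l * (norm h)^2) -->
  finite G --> G \<subseteq> {e\<in>B. l < ev e & ev e < m} --> card G <= card Y + M)"
proof -
 define X where "X = m + b + 1"
 have X: "X >= 1" "m <= X" "b <= X" using m b_pos by (auto simp: X_def)
 \<comment> \<open>Small enough for the inequalities \<open>em\<close>, \<open>eb\<close> and
   \<open>C1\<close>, through which the contributions of \<open>v\<close> are absorbed into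
   \<open>a / 2\<close>, \<open>s\<close> and \<open>s / 2\<close>.\<close>
 define ep where "ep = 1 / (8 * X^2)"
 have e0: "ep > 0" using X by (simp add: ep_def)
 have eX: "8 * ep * X^2 = 1" using X by (simp add: ep_def)
 have XX: "X <= X^2" using X by (simp add: power2_eq_square)
 have em: "4 * m * ep <= 1"
 proof -
  have "4 * m * ep <= 8 * X^2 * ep" using m X XX e0 by (intro mult_right_mono) auto
  thus ?thesis using eX by (simp add: mult_ac)
 qed
 have eb: "2 * b * ep <= 1"
 proof -
  have "2 * b * ep <= 8 * X^2 * ep" using b_pos X XX e0 by (intro mult_right_mono) auto
  thus ?thesis using eX by (simp add: mult_ac)
 qed
 define C1 where "C1 = 8 * m + 2 * b"
 have C1: "4 * b * ep^2 * C1 <= 1"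
 proof -
  have "4 * b * C1 <= (4 * X) * (10 * X)" unfolding C1_def using X b_pos m by (intro mult_mono) auto
  also have "... <= 64 * X^2" by (simp add: power2_eq_square)
  also have "... <= 64 * (X^2)^2" using mult_left_mono[OF one_le_power[OF X(1), of 2], of "X^2"] by (simp add: power2_eq_square[of "X^2"])
  finally have "(4 * b * C1) * ep^2 <= 64 * (X^2)^2 * ep^2" by (intro mult_right_mono) auto
  also have "... = (8 * ep * X^2)^2" by (simp add: power_mult_distrib)
  finally show ?thesis unfolding eX by (simp add: mult_ac)
 qed
 obtain Ph where Ph: "finite Ph" "ALL fi:Ph. bounded_linear (fi :: 'h => real)"
  "ALL f. (ALL fi:Ph. fi f = 0) --> (norm (T f))^2 <= ep * inner (T f) f" using T_small[OF e0] by (elim exE conjE)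
 show ?thesis
 proof (intro exI[of _ "card Ph"] allI impI, rule ccontr)
  fix B :: "'h set" and ev l Y G
  assume EB: "eigenbasis 1 B ev" and l: "l > 0" and Y: "finite Y" "Y \<subseteq> H"
   and small: "ALL h:H. (ALL y:Y. inner h y = 0) --> 16 * inner (V h) h <= l * (norm h)^2"
   and G: "finite G" "G \<subseteq> {e\<in>B. l < ev e & ev e < m}" and ncd: "~ card G <= card Y + card Ph"
  have GB: "G \<subseteq> B" using G by blast
  obtain x u f h where K: "(u, f) \<in> K" and h: "h \<in> H" and u': "u = h + T f" and nuh: "(norm u)^2 = (norm h)^2 + (norm (T f))^2"
   and ph: "ALL fi:Ph. fi f = 0" and hY: "ALL y:Y. inner h y = 0"
   and x: "EX e:G. x e ~= 0" and nu: "(norm u)^2 = (\<Sum>e\<in>G. (x e)^2)"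
   and form: "inner (f + V u) u = (\<Sum>e\<in>G. ev e * (x e)^2)" and ng: "(norm (f + V u))^2 = (\<Sum>e\<in>G. (ev e)^2 * (x e)^2)"
   using constrained_split[OF EB Y Ph(1,2) G(1) GB ncd] by (elim exE conjE) (rule that, simp_all)
  define v where vT: "v = T f"
  have u: "u = h + v" by (simp add: u' vT)
  define g where "g = f + V u"
  have f_def: "f = g - V u" by (simp add: g_def)
  have v_small: "(norm v)^2 <= ep * inner v f" using Ph(3)[rule_format, of f] ph by (simp add: vT)
  have v_le: "norm v <= ep * norm f"
  proof (cases "v = 0")
   case False
   have "ep * inner v f <= ep * (norm v * norm f)" using e0 by (intro mult_left_mono norm_cauchy_schwarz) auto
   hence "norm v * norm v <= ep * (norm v * norm f)" using v_small unfolding power2_eq_square by linarith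
   hence "norm v * norm v <= norm v * (ep * norm f)" by (simp add: mult_ac)
   thus ?thesis using False by simp
  qed (use e0 in simp)
  have h_small: "16 * inner (V h) h <= l * (norm h)^2" using small h hY by blast
  have hu: "l * (norm h)^2 <= l * (norm u)^2" using l nuh by simp
  define s where "s = inner (V u) u"
  define a where "a = inner g u"
  have s0: "s >= 0" unfolding s_def by (rule V_pos)
  have a_eq: "a = inner v f + s" using K_form(1)[OF K K] by (simp add: a_def s_def g_def vT inner_add_left)
  have vf: "inner v f <= ep * (norm f)^2" using norm_cauchy_schwarz[of v f] mult_right_mono[OF v_le, of "norm f"] by (simp add: power2_eq_square)
  \<comment> \<open>On the window an eigenvalue satisfies
    \<open>(ev e)^2 <= m * ev e\<close>.\<close>
  have ga: "(norm g)^2 <= m * a"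
  proof -
   have "(ev e)^2 * (x e)^2 <= m * (ev e * (x e)^2)" if "e \<in> G" for e
   proof -
    have "ev e * (ev e * (x e)^2) <= m * (ev e * (x e)^2)" using G(2) that l by (intro mult_right_mono) auto
    thus ?thesis by (simp add: power2_eq_square)
   qed
   thus ?thesis unfolding g_def ng a_def form sum_distrib_left by (rule sum_mono)
  qed
  have nf: "(norm f)^2 <= 2 * m * a + 2 * b * s"
  proof -
   have "0 <= (norm (g + V u))^2" by simp
   hence "(norm f)^2 <= 2 * (norm g)^2 + 2 * (norm (V u))^2" unfolding f_def power2_norm_eq_inner by (simp add: inner_diff_left inner_diff_right inner_add_left inner_add_right inner_commute)
   thus ?thesis using ga V_le[of u] unfolding s_def by linarith
  qed
  have a_le: "a <= 4 * s"
  proof -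
   have a0: "a >= 0" using a_eq s0 T_pos[of f] by (simp add: vT)
   have "a <= ep * (2 * m * a + 2 * b * s) + s" using a_eq vf mult_left_mono[OF nf, of ep] e0 by linarith
   also have "... = (4 * m * ep) * (a / 2) + (2 * b * ep) * s + s" by (simp add: algebra_simps)
   also have "... <= 1 * (a / 2) + 1 * s + s" using em eb a0 s0 by (intro add_mono mult_right_mono) auto
   finally show ?thesis by simp
  qed
  have nf': "(norm f)^2 <= C1 * s"
  proof -
   have "2 * m * a <= 2 * m * (4 * s)" using a_le m by (intro mult_left_mono) auto
   thus ?thesis using nf by (simp add: C1_def algebra_simps)
  qed
  have "s <= 4 * inner (V h) h"
  proof -
   have "s <= 2 * inner (V h) h + 2 * inner (V v) v" unfolding s_def u by (rule V_form_add)
   also have "inner (V v) v <= b * (norm v)^2" by (rule V_form_le)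
   also have "(norm v)^2 <= ep^2 * (norm f)^2" using power_mono[OF v_le, of 2] by (simp add: power_mult_distrib)
   also have "ep^2 * (norm f)^2 <= ep^2 * (C1 * s)" using nf' by (intro mult_left_mono) auto
   finally have "s <= 2 * inner (V h) h + (4 * b * ep^2 * C1) * (s / 2)" using b_pos by (simp add: algebra_simps)
   also have "(4 * b * ep^2 * C1) * (s / 2) <= 1 * (s / 2)" using C1 s0 by (intro mult_right_mono) auto
   finally show ?thesis by simp
  qed
  hence "a <= l * (norm u)^2" using a_le h_small hu by linarith
  moreover have "l * (norm u)^2 < a" using weighted_sum_less[OF G(1) x, of "%e. l" ev] G(2) unfolding a_def g_def form nu by (auto simp: sum_distrib_left)
  ultimately show False by simp
 qed
qed

text \<open>A harmonic \<open>h\<close> is in the kernel of \<open>K\<close>, so its image is simply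
  \<open>- V h\<close>. If \<open>h\<close> is orthogonal to every eigenvector below
  \<open>- l\<close>, its form is at least \<open>- l * (norm h)^2\<close>.\<close>

lemma lower_count_minus:
 assumes EB: "eigenbasis (-1) B ev" and Y: "finite Y" "Y \<subseteq> H" "independent Y"
  and large: "!!h. h \<in> span Y ==> h ~= 0 ==> l * (norm h)^2 < inner (V h) h"
  and fin: "finite {e\<in>B. ev e < - l}"
 shows "card Y <= card {e\<in>B. ev e < - l}"
proof (rule ccontr)
 let ?E = "{e\<in>B. ev e < - l}"
 assume "~ ?thesis"
 hence "card ?E < card Y" by simp
 from exists_nontrivial_solution[OF fin Y(1) this, of "%e y. inner y e"] obtain x where
  x: "EX y:Y. x y ~= 0" "ALL e:?E. (\<Sum>y\<in>Y. x y * inner y e) = 0" by blast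
 define h where "h = (\<Sum>y\<in>Y. x y *\<^sub>R y)"
 have hs: "h \<in> span Y" unfolding h_def by (intro span_sum span_scale span_base)
 have h0: "h ~= 0" using Y(1,3) x(1) unfolding h_def independent_explicit_finite_subsets by blast
 have hE: "inner h e = 0" if "e \<in> ?E" for e using x(2) that by (simp add: h_def inner_sum_left)
 have hH: "h \<in> H" using hs Y(2) span_minimal[OF Y(2) H_sub] by blast
 have A: "(h, - V h) \<in> A (-1)" using hH by (simp add: A_iff K_iff subspace_0 Rn_sub T.zero)
 have "- l * (norm h)^2 <= inner (- V h) h"
 proof (rule has_sum_mono)
  show "((%e. - l * (inner h e)^2) has_sum - l * (norm h)^2) B" by (intro has_sum_cmult_right parseval_norm EB_onb[OF EB])
  show "((%e. ev e * (inner h e)^2) has_sum inner (- V h) h) B" by (rule A_form[OF EB A])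
  fix e assume e: "e \<in> B"
  show "- l * (inner h e)^2 <= ev e * (inner h e)^2"
  proof (cases "e \<in> ?E")
   case True
   thus ?thesis using hE by simp
  next
   case False
   thus ?thesis using e by (intro mult_right_mono) auto
  qed
 qed
 thus False using large[OF hs h0] by simp
qed

text \<open>The harmonic \<open>h\<close> is corrected to \<open>u = h - T (V h)\<close>, which
  cancels the component of \<open>V h\<close> in \<open>Rn\<close>, so that \<open>g\<close> is
  small against the form. Eigenvalues in the window are detected by the polynomial
  \<open>(t - l) (t - m)\<close>, negative exactly there: its spectral average at \<open>u\<close>
  is negative although \<open>u\<close> was made orthogonal to the eigenvectors of the
  window.\<close>

lemma lower_count_plus:
 assumes m: "m > 0"
 shows "EX M. ALL B ev. eigenbasis 1 B ev --> (ALL l Y. 0 < l --> l < m --> finite Y --> Y \<subseteq> H --> independent Y -->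
  (ALL h:span Y. h ~= 0 --> 8 * l * (norm h)^2 < inner (V h) h) -->
  finite {e\<in>B. l < ev e & ev e < m} --> card Y <= card {e\<in>B. l < ev e & ev e < m} + M)"
proof -
 \<comment> \<open>The entries give in turn \<open>ep^2 <= ep\<close>, \<open>ep * b <= 1/2\<close>,
   \<open>2 * ep <= m/8\<close> and \<open>2 * b^3 * ep^2 <= m/8\<close>; the last two bound
   \<open>(norm g)^2\<close> by \<open>m/4 * s\<close>.\<close>
 define ep where "ep = Min {1, 1 / (2 * b), m / 16, m / (16 * b^3)}"
 have e: "ep > 0" "ep <= 1" "ep <= 1 / (2 * b)" "ep <= m / 16" "ep <= m / (16 * b^3)" using m b_pos by (auto simp: ep_def)
 have eb: "ep * b <= 1/2" using e(3) b_pos by (simp add: field_simps)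
 have e2: "2 * b^3 * ep^2 <= m / 8"
 proof -
  have "ep^2 <= ep" using e by (simp add: power2_eq_square mult_left_le)
  hence "2 * b^3 * ep^2 <= 2 * b^3 * (m / (16 * b^3))" using e(5) b_pos by (intro mult_left_mono) auto
  thus ?thesis using b_pos by simp
 qed
 obtain Ph where Ph: "finite Ph" "ALL fi:Ph. bounded_linear (fi :: 'h => real)"
  "ALL f. (ALL fi:Ph. fi f = 0) --> (norm (T f))^2 <= ep * inner (T f) f" using T_small[OF e(1)] by (elim exE conjE)
 obtain Ps where Ps: "finite Ps" "ALL fi:Ps. bounded_linear (fi :: 'h => real)"
    "ALL h:H. inner (V h) h <= ep * (norm h)^2 + (\<Sum>fi\<in>Ps. (fi h)^2)" using V_small[OF e(1)] by blast
 show ?thesis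
 proof (intro exI[of _ "card Ph + card Ps"] allI impI, rule ccontr)
  fix B :: "'h set" and ev l Y
  let ?E = "{e\<in>B. l < ev e & ev e < m}"
  assume EB: "eigenbasis 1 B ev" and l: "0 < l" "l < m" and Y: "finite Y" "Y \<subseteq> H" "independent Y"
   and large: "ALL h:span Y. h ~= 0 --> 8 * l * (norm h)^2 < inner (V h) h"
   and fin: "finite ?E" and ncd: "~ card Y <= card ?E + (card Ph + card Ps)"
  \<comment> \<open>The constraints make \<open>u\<close> orthogonal to the window, and make
    \<open>T (V h)\<close> and the harmonic part \<open>P (V h)\<close> small.\<close>
  define a :: "'h + (('h => real) + ('h => real)) => 'h => real" where
   "a j = (case j of Inl e => (%h. inner (h - T (V h)) e)
        | Inr (Inl fi) => (%h. fi (V h)) | Inr (Inr fi) => (%h. fi (P (V h))))" for j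
  let ?J = "?E <+> (Ph <+> Ps)"
  have finJ: "finite ?J" using fin Ph Ps by simp
  have cd: "card ?J < card Y" using fin Ph Ps ncd by (simp add: card_Plus)
  from exists_nontrivial_solution[OF finJ Y(1) cd, of a] obtain x where
   x: "EX y:Y. x y ~= 0" "ALL j:?J. (\<Sum>y\<in>Y. x y * a j y) = 0" by blast
  define h where "h = (\<Sum>y\<in>Y. x y *\<^sub>R y)"
  have hs: "h \<in> span Y" unfolding h_def by (intro span_sum span_scale span_base)
  have h0: "h ~= 0" using Y(1,3) x(1) unfolding h_def independent_explicit_finite_subsets by blast
  have hH: "h \<in> H" using hs Y(2) span_minimal[OF Y(2) H_sub] by blast
  have lin: "linear (a j)" if jJ: "j \<in> ?J" for j
  proof -
   consider (1) e where "j = Inl e" | (2) fi where "j = Inr (Inl fi)" "fi \<in> Ph" | (3) fi where "j = Inr (Inr fi)" "fi \<in> Ps" using jJ by auto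
   thus ?thesis
   proof cases
    case 1
    thus ?thesis by (auto simp: a_def V.add V.scaleR T.add T.scaleR inner_diff_left inner_add_left algebra_simps intro!: linearI)
   next
    case 2
    hence "linear fi" using Ph(2) bounded_linear.linear by blast
    thus ?thesis using 2 by (auto simp: a_def linear_add linear_cmul V.add V.scaleR intro!: linearI)
   next
    case 3
    hence "linear fi" using Ps(2) bounded_linear.linear by blast
    thus ?thesis using 3 by (auto simp: a_def linear_add linear_cmul V.add V.scaleR P.add P.scaleR intro!: linearI)
   qed
  qed
  have ah: "a j h = 0" if "j \<in> ?J" for j using x(2) that unfolding h_def by (simp add: linear_sum[OF lin[OF that]] linear_cmul[OF lin[OF that]])
  define s where "s = inner (V h) h"
  have s0: "s >= 0" unfolding s_def by (rule V_pos)
  have Vh: "(norm (V h))^2 <= b * s" unfolding s_def by (rule V_le)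
  define v where "v = - T (V h)"
  define u where "u = h + v"
  define g where "g = P (V h) + V v"
  have "(u, - Q (V h)) \<in> K" using hH subspace_neg[OF Rn_sub Q_in[of "V h"]] by (simp add: K_iff u_def v_def T.neg T_Q)
  moreover have "g - V u = - Q (V h)" using PQ[of "V h"] by (simp add: g_def u_def V.add algebra_simps)
  ultimately have ug: "(u, g) \<in> A 1" by (simp add: A_iff)
  have vT: "(norm v)^2 <= ep * inner (T (V h)) (V h)"
  proof -
   have "fi (V h) = 0" if "fi \<in> Ph" for fi using ah[OF InrI[OF InlI[OF that]]] by (simp add: a_def)
   thus ?thesis using Ph(3)[rule_format, of "V h"] by (simp add: v_def)
  qed
  have v_le: "norm v <= ep * norm (V h)"
  proof (cases "v = 0")
   case False
   have "inner (T (V h)) (V h) <= norm v * norm (V h)" using norm_cauchy_schwarz[of "T (V h)" "V h"] by (simp add: v_def)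
   hence "ep * inner (T (V h)) (V h) <= ep * (norm v * norm (V h))" using e(1) by (intro mult_left_mono) auto
   hence "norm v * norm v <= ep * (norm v * norm (V h))" using vT unfolding power2_eq_square by linarith
   hence "norm v * norm v <= norm v * (ep * norm (V h))" by (simp add: mult_ac)
   thus ?thesis using False by simp
  qed (use e in simp)
  have v2: "(norm v)^2 <= ep^2 * b * s"
  proof -
   have "(norm v)^2 <= ep^2 * (norm (V h))^2" using power_mono[OF v_le, of 2] by (simp add: power_mult_distrib)
   also have "... <= ep^2 * (b * s)" using Vh by (intro mult_left_mono) auto
   finally show ?thesis by (simp add: mult_ac)
  qed
  have vVh: "- (ep * b * s) <= inner v (V h)"
  proof -
   have "- inner v (V h) <= norm v * norm (V h)" using norm_cauchy_schwarz[of "- v" "V h"] by simp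
   also have "... <= ep * norm (V h) * norm (V h)" by (intro mult_right_mono v_le) auto
   also have "... = ep * (norm (V h))^2" by (simp add: power2_eq_square)
   also have "... <= ep * (b * s)" using Vh e by (intro mult_left_mono) auto
   finally show ?thesis by simp
  qed
  define p where "p = P (V h)"
  have pH: "p \<in> H" unfolding p_def by (rule P_in)
  \<comment> \<open>Nonnegativity of \<open>V\<close> at \<open>ep *\<^sub>R h - p\<close> is a
    Cauchy-Schwarz inequality for its form; together with
    \<open>inner (V p) p <= ep * (norm p)^2\<close> it bounds \<open>p\<close> by
    \<open>s\<close>.\<close>
  have p2: "(norm p)^2 <= ep * s"
  proof -
   have "fi p = 0" if "fi \<in> Ps" for fi using ah[OF InrI[OF InrI[OF that]]] by (simp add: a_def p_def)
   hence "(\<Sum>fi\<in>Ps. (fi p)^2) = 0" by (intro sum.neutral) auto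
   hence Vp: "inner (V p) p <= ep * (norm p)^2" using Ps(3) pH by force
   have "0 <= inner (V (ep *\<^sub>R h - p)) (ep *\<^sub>R h - p)" by (rule V_pos)
   also have "... = ep^2 * s - 2 * ep * inner (V h) p + inner (V p) p" using V_sym[of h p] unfolding s_def by (simp add: V.diff V.scaleR inner_diff_left inner_diff_right inner_commute power2_eq_square algebra_simps)
   also have "inner (V h) p = (norm p)^2" unfolding p_def P_def using inner_proj_self[OF H, of "V h"] by (simp add: inner_commute)
   finally have "2 * ep * (norm p)^2 <= ep^2 * s + ep * (norm p)^2" using Vp by linarith
   hence "ep * (norm p)^2 <= ep * (ep * s)" by (simp add: power2_eq_square algebra_simps)
   thus ?thesis using e(1) by simp
  qed
  have g2: "(norm g)^2 <= (2 * ep + 2 * b^3 * ep^2) * s"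
  proof -
   have "0 <= (norm (p - V v))^2" by simp
   hence "(norm g)^2 <= 2 * (norm p)^2 + 2 * (norm (V v))^2" unfolding g_def p_def power2_norm_eq_inner by (simp add: inner_diff_left inner_diff_right inner_add_left inner_add_right inner_commute)
   also have "(norm (V v))^2 <= b^2 * (norm v)^2" using power_mono[OF norm_V_le[of v], of 2] by (simp add: power_mult_distrib)
   also have "b^2 * (norm v)^2 <= b^2 * (ep^2 * b * s)" using v2 by (intro mult_left_mono) auto
   finally show ?thesis using p2 by (simp add: algebra_simps power2_eq_square power3_eq_cube)
  qed
  have vR: "v \<in> Rn" unfolding v_def by (intro subspace_neg Rn_sub T_in)
  have gu: "s / 2 <= inner g u"
  proof -
   have "inner p h = s" unfolding p_def s_def using P_sym[of "V h" h] P_id[OF hH] by simp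
   moreover have "inner p v = 0" by (rule H_Rn(1)[OF pH vR])
   moreover have "inner (V v) h = inner v (V h)" by (rule V_sym)
   ultimately have "inner g u = s + inner v (V h) + inner (V v) v" by (simp add: g_def u_def p_def[symmetric] inner_add_left inner_add_right)
   moreover have "inner (V v) v >= 0" by (rule V_pos)
   moreover have "ep * b * s <= 1/2 * s" using eb s0 by (intro mult_right_mono) auto
   ultimately show ?thesis using vVh by linarith
  qed
  have u2: "(norm u)^2 <= 2 * (norm h)^2"
  proof -
   have "inner h v = 0" by (rule H_Rn(1)[OF hH vR])
   hence "(norm u)^2 = (norm h)^2 + (norm v)^2" unfolding u_def by (simp add: power2_norm_eq_inner inner_add_left inner_add_right inner_commute)
   moreover have "ep^2 * b * s <= (norm h)^2"
   proof -
    have "ep^2 * b * s <= ep^2 * b * (b * (norm h)^2)" unfolding s_def using b_pos by (intro mult_left_mono V_form_le) auto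
    also have "... = (ep * b)^2 * (norm h)^2" by (simp add: power2_eq_square mult_ac)
    also have "... <= 1 * (norm h)^2" using eb e b_pos by (intro mult_right_mono power_le_one) auto
    finally show ?thesis by simp
   qed
   ultimately show ?thesis using v2 by linarith
  qed
  \<comment> \<open>\<open>8 * l * (norm h)^2 < s\<close> gives
    \<open>l * m * (norm u)^2 < m/4 * s\<close>; with the bound \<open>m/4 * s\<close> for
    \<open>(norm g)^2\<close> this stays below \<open>m/2 * s\<close>, a lower bound of
    \<open>(l + m) * inner g u\<close>.\<close>
  have neg: "(norm g)^2 - (l + m) * inner g u + l * m * (norm u)^2 < 0"
  proof -
   have "(norm g)^2 <= (m / 4) * s" using g2 e e2 s0 mult_right_mono[of "2 * ep + 2 * b^3 * ep^2" "m/4" s] by linarith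
   moreover have "(l + m) * inner g u >= m * (s / 2)" using gu l s0 m by (intro mult_mono) auto
   moreover have "l * m * (norm u)^2 <= l * m * (2 * (norm h)^2)" using u2 l m by (intro mult_left_mono) auto
   moreover have "(m / 4) * (8 * l * (norm h)^2) < (m / 4) * s" using large hs h0 m unfolding s_def by (intro mult_strict_left_mono) auto
   ultimately show ?thesis by (simp add: algebra_simps)
  qed
  have hs: "((%e. (ev e)^2 * (inner u e)^2 + (- (l + m)) * (ev e * (inner u e)^2) + l * m * (inner u e)^2)
   has_sum ((norm g)^2 + (- (l + m)) * inner g u + l * m * (norm u)^2)) B" by (intro has_sum_add has_sum_cmult_right parseval_norm[OF EB_onb[OF EB]]
     A_norm[OF EB ug] A_form[OF EB ug])
  have "0 <= (norm g)^2 + (- (l + m)) * inner g u + l * m * (norm u)^2"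
  proof (rule has_sum_nonneg[OF hs])
   fix e assume eB: "e \<in> B"
   have eq: "(ev e)^2 * (inner u e)^2 + (- (l + m)) * (ev e * (inner u e)^2) + l * m * (inner u e)^2
    = ((ev e - l) * (ev e - m)) * (inner u e)^2" by (simp add: algebra_simps power2_eq_square)
   show "0 <= (ev e)^2 * (inner u e)^2 + (- (l + m)) * (ev e * (inner u e)^2) + l * m * (inner u e)^2"
   proof (cases "e \<in> ?E")
    case True
    hence "inner u e = 0" using ah[OF InlI] by (simp add: a_def u_def v_def)
    thus ?thesis by simp
   next
    case False
    hence "0 <= (ev e - l) * (ev e - m)" using eB l by (cases "ev e <= l") (auto intro: mult_nonneg_nonneg mult_nonpos_nonpos)
    thus ?thesis unfolding eq by simp
   qed
  qed
  thus False using neg by (simp add: algebra_simps)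
 qed
qed

end

section \<open>The Hilbert space of square-integrable functions on the ball\<close>

subsection \<open>Square-integrable functions\<close>

lemma L2I: "u \<in> borel_measurable M ==> integrable M (%x. (cmod (u x))^2) ==> u \<in> L2 M" by (simp add: L2_def)

lemma L2D: assumes "u \<in> L2 M" shows "u \<in> borel_measurable M" "integrable M (%x. (cmod (u x))^2)" using assms by (auto simp: L2_def)

lemma L2_bound:
 assumes "u \<in> borel_measurable M" "integrable M g" "!!x. x \<in> space M ==> (cmod (u x))^2 <= g x"
 shows "u \<in> L2 M"
proof (rule L2I[OF assms(1)])
 have [measurable]: "u \<in> borel_measurable M" by fact
 show "integrable M (%x. (cmod (u x))^2)" by (rule Bochner_Integration.integrable_bound[OF assms(2)]) (use assms(3) in \<open>fastforce+\<close>)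
qed

lemma L2_cmult: assumes "u \<in> L2 M" shows "(%x. c * u x) \<in> L2 M"
proof -
 note [measurable] = L2D(1)[OF assms]
 show ?thesis using L2D(2)[OF assms] by (intro L2I) (auto simp: norm_mult power_mult_distrib)
qed

lemma cmod_add_sq: "(cmod (a + b))^2 <= 2 * (cmod a)^2 + 2 * (cmod b)^2"
proof -
 have "(cmod (a + b))^2 <= (cmod a + cmod b)^2" by (intro power_mono norm_triangle_ineq) simp
 also have "... <= 2 * (cmod a)^2 + 2 * (cmod b)^2" using zero_le_power2[of "cmod a - cmod b"] by (simp add: power2_sum power2_diff)
 finally show ?thesis .
qed

lemma L2_add: assumes "u \<in> L2 M" "v \<in> L2 M" shows "(%x. u x + v x) \<in> L2 M"
proof (rule L2_bound)
 note [measurable] = L2D(1)[OF assms(1)] L2D(1)[OF assms(2)]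
 show "(%x. u x + v x) \<in> borel_measurable M" by measurable
 show "integrable M (%x. 2 * (cmod (u x))^2 + 2 * (cmod (v x))^2)" using L2D(2)[OF assms(1)] L2D(2)[OF assms(2)] by simp
qed (rule cmod_add_sq)

lemma L2_uminus: "u \<in> L2 M ==> (%x. - u x) \<in> L2 M" using L2_cmult[of u M "-1"] by simp

lemma L2_diff: "u \<in> L2 M ==> v \<in> L2 M ==> (%x. u x - v x) \<in> L2 M" using L2_add[OF _ L2_uminus] by simp

lemma L2_zero: "(%x. 0) \<in> L2 M" by (simp add: L2_def)

lemma L2_cnj: assumes "u \<in> L2 M" shows "(%x. cnj (u x)) \<in> L2 M"
proof -
 note [measurable] = L2D(1)[OF assms]
 have "(%x. cnj (u x)) \<in> borel_measurable M" by (rule borel_measurable_continuous_on[OF _ L2D(1)[OF assms]]) (intro continuous_intros)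
 thus ?thesis using L2D(2)[OF assms] by (intro L2I) auto
qed

lemma L2_mult_integrable:
 assumes "u \<in> L2 M" "v \<in> L2 M" shows "integrable M (%x. u x * v x)"
proof (rule Bochner_Integration.integrable_bound)
 note [measurable] = L2D(1)[OF assms(1)] L2D(1)[OF assms(2)]
 show "integrable M (%x. (cmod (u x))^2 + (cmod (v x))^2)" using L2D(2)[OF assms(1)] L2D(2)[OF assms(2)] by simp
 show "(%x. u x * v x) \<in> borel_measurable M" by measurable
 have "cmod a * cmod b <= (cmod a)^2 + (cmod b)^2" for a b using zero_le_power2[of "cmod a - cmod b"] zero_le_power2[of "cmod a"] zero_le_power2[of "cmod b"] unfolding power2_diff by linarith
 thus "AE x in M. norm (u x * v x) <= norm ((cmod (u x))^2 + (cmod (v x))^2)" by (intro AE_I2) (simp add: norm_mult)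
qed

lemma L2_inner_integrable:
 "u \<in> L2 M ==> v \<in> L2 M ==> integrable M (%x. u x * cnj (v x))" using L2_mult_integrable[OF _ L2_cnj] .

lemma L2_inner_cong:
 assumes "u \<in> L2 M" "u' \<in> L2 M" "v \<in> L2 M" "v' \<in> L2 M" "AE x in M. u x = u' x" "AE x in M. v x = v' x"
 shows "L2_inner M u v = L2_inner M u' v'"
proof -
 note [measurable] = assms(1-4)[THEN L2D(1)] assms(3)[THEN L2_cnj, THEN L2D(1)] assms(4)[THEN L2_cnj, THEN L2D(1)]
 show ?thesis unfolding L2_inner_def by (rule integral_cong_AE) (measurable, use assms(5,6) in \<open>eventually_elim, simp\<close>)
qed

lemma L2_inner_add_left:
 "u \<in> L2 M ==> v \<in> L2 M ==> w \<in> L2 M ==> L2_inner M (%x. u x + v x) w = L2_inner M u w + L2_inner M v w"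
 using L2_inner_integrable[of u M w] L2_inner_integrable[of v M w] by (simp add: L2_inner_def distrib_right)

lemma L2_inner_cmult_left: "L2_inner M (%x. c * u x) w = c * L2_inner M u w" by (simp add: L2_inner_def mult.assoc)

lemma L2_inner_cnj: "L2_inner M v u = cnj (L2_inner M u v)"
proof -
 have "(LINT x|M. cnj (u x * cnj (v x))) = cnj (LINT x|M. u x * cnj (v x))" by (rule Bochner_Integration.integral_cnj)
 thus ?thesis by (simp add: L2_inner_def mult.commute)
qed

lemma L2_inner_cmult_right: "L2_inner M w (%x. c * u x) = cnj c * L2_inner M w u"
proof -
 have "L2_inner M w (%x. c * u x) = cnj (L2_inner M (%x. c * u x) w)" by (rule L2_inner_cnj)
 thus ?thesis by (simp add: L2_inner_cmult_left flip: L2_inner_cnj[of M w u])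
qed

lemma L2_inner_self: "L2_inner M u u = cor (LINT x|M. (cmod (u x))^2)" unfolding L2_inner_def integral_complex_of_real[symmetric] by (intro Bochner_Integration.integral_cong refl) (simp only: complex_norm_square)

lemma L2_norm_nonneg: "L2_norm M u >= 0" by (simp add: L2_norm_def)

lemma L2_norm_sq: "(L2_norm M u)^2 = Re (L2_inner M u u)" by (simp add: L2_norm_def L2_inner_self)

lemma L2_AE_zero:
 assumes "u \<in> L2 M" "L2_inner M u u = 0" shows "AE x in M. u x = 0"
proof -
 have "(LINT x|M. (cmod (u x))^2) = 0" using assms(2) by (simp add: L2_inner_self)
 hence "AE x in M. (cmod (u x))^2 = 0" using integral_nonneg_eq_0_iff_AE[OF L2D(2)[OF assms(1)]] by simp
 thus ?thesis by simp
qed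

subsection \<open>The quotient type\<close>

abbreviation MB :: "'a::euclidean_space measure" where "MB == lebesgue_on (ball 0 1)"

definition l2_rel :: "('a::euclidean_space cf) => ('a cf) => bool" where
 "l2_rel f g \<longleftrightarrow> f \<in> L2 MB & g \<in> L2 MB & (AE x in MB. f x = g x)"

\<comment> \<open>The relation is partial because only square-integrable functions represent
  elements. Passing to classes turns almost-everywhere equality into equality, as the abstract
  Hilbert-space part requires.\<close>
quotient_type (overloaded) 'a l2 = "'a::euclidean_space cf" / partial: l2_rel
proof (rule part_equivpI)
 show "EX x. l2_rel x x" by (intro exI[of _ "%_. 0"]) (simp add: l2_rel_def L2_zero)
 show "symp l2_rel" by (auto simp: symp_def l2_rel_def)
 show "transp l2_rel"
 proof (rule transpI)
  fix f g h assume *: "l2_rel f g" "l2_rel g h"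
  hence "AE x in MB. f x = g x" "AE x in MB. g x = h x" by (auto simp: l2_rel_def)
  hence "AE x in MB. f x = h x" by eventually_elim simp
  thus "l2_rel f h" using * by (simp add: l2_rel_def)
 qed
qed

lemma l2_rel_add:
 assumes "l2_rel f f'" "l2_rel g g'" shows "l2_rel (%x. f x + g x) (%x. f' x + g' x)"
proof -
 have "AE x in MB. f x = f' x" "AE x in MB. g x = g' x" using assms by (auto simp: l2_rel_def)
 hence "AE x in MB. f x + g x = f' x + g' x" by eventually_elim simp
 thus ?thesis using assms by (simp add: l2_rel_def L2_add)
qed

lemma l2_rel_uminus: "l2_rel f f' ==> l2_rel (%x. - f x) (%x. - f' x)" by (simp add: l2_rel_def L2_uminus)

instantiation l2 :: (euclidean_space) real_inner
begin

lift_definition zero_l2 :: "'a l2" is "%_. 0" by (simp add: l2_rel_def L2_zero)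
lift_definition plus_l2 :: "'a l2 => 'a l2 => 'a l2" is "%f g x. f x + g x" by (rule l2_rel_add)
lift_definition uminus_l2 :: "'a l2 => 'a l2" is "%f x. - f x" by (simp add: l2_rel_def L2_uminus)
lift_definition minus_l2 :: "'a l2 => 'a l2 => 'a l2" is "%f g x. f x - g x" using l2_rel_add[OF _ l2_rel_uminus] by simp
lift_definition scaleR_l2 :: "real => 'a l2 => 'a l2" is "%r f x. cor r * f x" by (auto simp: l2_rel_def intro: L2_cmult)
lift_definition inner_l2 :: "'a l2 => 'a l2 => real" is "%f g. Re (L2_inner MB f g)" unfolding l2_rel_def using L2_inner_cong by metis

definition norm_l2 :: "'a l2 => real" where "norm_l2 x = sqrt (inner x x)"
definition dist_l2 :: "'a l2 => 'a l2 => real" where "dist_l2 x y = norm (x - y)"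
definition sgn_l2 :: "'a l2 => 'a l2" where "sgn_l2 x = inverse (norm x) *\<^sub>R x"
definition uniformity_l2 :: "('a l2 \<times> 'a l2) filter" where
 "uniformity_l2 = (INF e\<in>{0<..}. principal {(x, y). dist x y < e})"
definition open_l2 :: "'a l2 set => bool" where
 "open_l2 U = (ALL x:U. \<forall>\<^sub>F (x', y) in uniformity. x' = x --> y \<in> U)"

instance
proof
 fix x y z :: "'a l2" and r s :: real
 show "x + y + z = x + (y + z)" by transfer (simp add: l2_rel_def add.assoc L2_add)
 show "x + y = y + x" by transfer (simp add: l2_rel_def add.commute L2_add)
 show "0 + x = x" by transfer (simp add: l2_rel_def)
 show "- x + x = 0" by transfer (simp add: l2_rel_def L2_zero)
 show "x - y = x + - y" by transfer (simp add: l2_rel_def L2_diff)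
 show "r *\<^sub>R (x + y) = r *\<^sub>R x + r *\<^sub>R y" by transfer (simp add: l2_rel_def L2_add L2_cmult distrib_left)
 show "(r + s) *\<^sub>R x = r *\<^sub>R x + s *\<^sub>R x" by transfer (simp add: l2_rel_def L2_add L2_cmult distrib_right)
 show "r *\<^sub>R s *\<^sub>R x = (r * s) *\<^sub>R x" by transfer (simp add: l2_rel_def L2_cmult mult.assoc)
 show "1 *\<^sub>R x = x" by transfer (simp add: l2_rel_def)
 show "inner x y = inner y x"
 proof (transfer)
  fix f g :: "'a cf"
  show "Re (L2_inner MB f g) = Re (L2_inner MB g f)" by (subst L2_inner_cnj) simp
 qed
 show "inner (x + y) z = inner x z + inner y z" by transfer (simp add: l2_rel_def L2_inner_add_left)
 show "inner (r *\<^sub>R x) y = r * inner x y" by transfer (simp add: L2_inner_cmult_left)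
 show "0 <= inner x x" by transfer (simp add: L2_inner_self)
 show "inner x x = 0 \<longleftrightarrow> x = 0"
 proof transfer
  fix f :: "'a cf" assume f: "l2_rel f f"
  show "(Re (L2_inner MB f f) = 0) = l2_rel f (%_. 0)"
  proof
   assume "Re (L2_inner MB f f) = 0"
   hence "L2_inner MB f f = 0" by (simp add: L2_inner_self)
   thus "l2_rel f (%_. 0)" using f L2_AE_zero by (auto simp: l2_rel_def L2_zero)
  next
   assume "l2_rel f (%_. 0)"
   hence *: "f \<in> L2 MB" "(%_::'a. 0) \<in> L2 MB" "AE x in MB. f x = 0" by (auto simp: l2_rel_def)
   have "L2_inner MB f f = L2_inner MB (%_::'a. 0) (%_. 0)" by (rule L2_inner_cong[OF *(1,2,1,2,3,3)])
   thus "Re (L2_inner MB f f) = 0" by (simp add: L2_inner_def)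
  qed
 qed
qed (simp_all only: norm_l2_def dist_l2_def sgn_l2_def uniformity_l2_def open_l2_def)

end

definition mk :: "('a::euclidean_space cf) => 'a l2" where "mk f = abs_l2 f"
definition rp :: "'a::euclidean_space l2 => 'a => complex" where "rp u = rep_l2 u"

lemma l2_rel_refl: "f \<in> L2 MB ==> l2_rel f f" by (simp add: l2_rel_def)

lemma mk_eq_iff: "f \<in> L2 MB ==> g \<in> L2 MB ==> mk f = mk g \<longleftrightarrow> (AE x in MB. f x = g x)" unfolding mk_def using Quotient_rel[OF Quotient_l2, of f g] by (auto simp: l2_rel_def)

lemma rp_L2: "rp u \<in> L2 MB" and mk_rp: "mk (rp u) = u" unfolding mk_def rp_def using Quotient_rep_reflp[OF Quotient_l2, of u] Quotient_abs_rep[OF Quotient_l2, of u] by (auto simp: l2_rel_def)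

lemma mk_cases: obtains f where "f \<in> L2 MB" "u = mk f" using rp_L2 mk_rp by metis

lemma rp_mk: "f \<in> L2 MB ==> AE x in MB. rp (mk f) x = f x" using mk_eq_iff[OF rp_L2] mk_rp by blast

lemma mk_zero: "mk (%_. 0) = 0" unfolding mk_def by (simp add: zero_l2.abs_eq)

lemma mk_add: "f \<in> L2 MB ==> g \<in> L2 MB ==> mk (%x. f x + g x) = mk f + mk g" unfolding mk_def by (simp add: plus_l2.abs_eq l2_rel_refl)

lemma mk_diff: "f \<in> L2 MB ==> g \<in> L2 MB ==> mk (%x. f x - g x) = mk f - mk g" unfolding mk_def by (simp add: minus_l2.abs_eq l2_rel_refl)

lemma mk_uminus: "f \<in> L2 MB ==> mk (%x. - f x) = - mk f" unfolding mk_def by (simp add: uminus_l2.abs_eq l2_rel_refl)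

lemma mk_scaleR: "f \<in> L2 MB ==> mk (%x. cor r * f x) = r *\<^sub>R mk f" unfolding mk_def by (simp add: scaleR_l2.abs_eq l2_rel_refl)

lemma inner_mk: "f \<in> L2 MB ==> g \<in> L2 MB ==> inner (mk f) (mk g) = Re (L2_inner MB f g)" unfolding mk_def by (simp add: inner_l2.abs_eq l2_rel_refl)

lemma norm_mk: "f \<in> L2 MB ==> norm (mk f) = L2_norm MB f" by (simp add: norm_eq_sqrt_inner inner_mk L2_norm_def L2_inner_self)

lemma norm_mk_sq: "f \<in> L2 MB ==> (norm (mk f))^2 = (LINT x|MB. (cmod (f x))^2)" by (simp add: norm_mk L2_norm_def)

section \<open>Complex scalars and the map \<open>J\<close>\<close>

lift_definition cm :: "complex => 'a::euclidean_space l2 => 'a l2" is "%c f x. c * f x" by (auto simp: l2_rel_def intro: L2_cmult)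

lemma cm_mk: "f \<in> L2 MB ==> cm c (mk f) = mk (%x. c * f x)" unfolding mk_def by (simp add: cm.abs_eq l2_rel_refl)

lemma cm_add: "cm c (u + v) = cm c u + cm c v" by transfer (simp add: l2_rel_def L2_add L2_cmult distrib_left)

lemma cm_add_left: "cm (c + d) u = cm c u + cm d u" by transfer (simp add: l2_rel_def L2_add L2_cmult distrib_right)

lemma cm_cm: "cm c (cm d u) = cm (c * d) u" by transfer (simp add: l2_rel_def L2_cmult mult.assoc)

lemma cm_of_real: "cm (cor r) u = r *\<^sub>R u" by transfer (simp add: l2_rel_def L2_cmult)

lemma cm_scaleR: "cm c (r *\<^sub>R u) = r *\<^sub>R cm c u" by (simp add: cm_of_real[symmetric] cm_cm mult.commute)

lemma inner_cm: "inner (cm c u) v = inner u (cm (cnj c) v)" by transfer (simp add: L2_inner_cmult_left L2_inner_cmult_right)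

lemma norm_cm: "norm (cm c u) = cmod c * norm u"
proof -
 have "inner (cm c u) (cm c u) = inner u (cm (cor ((cmod c)^2)) u)" by (subst inner_cm) (simp add: cm_cm mult.commute[of "cnj c"] flip: complex_norm_square)
 also have "... = (cmod c)^2 * inner u u" unfolding cm_of_real by simp
 finally show ?thesis by (simp add: norm_eq_sqrt_inner real_sqrt_mult)
qed

lemma cm_bl: "bounded_linear (cm c)" by (rule bounded_linear_intro[where K="cmod c"]) (auto simp: cm_add cm_scaleR norm_cm mult.commute)

abbreviation J :: "'a::euclidean_space l2 => 'a l2" where "J == cm \<i>"

lemma cm_eq: "cm c u = Re c *\<^sub>R u + Im c *\<^sub>R J u"
proof -
 have "cm c u = cm (cor (Re c) + cor (Im c) * \<i>) u" by (metis complex_eq mult.commute)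
 also have "... = Re c *\<^sub>R u + Im c *\<^sub>R J u" by (simp only: cm_add_left cm_cm[symmetric] cm_of_real)
 finally show ?thesis .
qed

lemma J_J: "J (J u) = - u" using cm_cm[of \<i> \<i> u] cm_of_real[of "-1" u] by simp

lemma inner_J: "inner (J u) v = - inner u (J v)"
proof -
 have "inner (J u) v = inner u (cm (cor (-1)) (J v))" by (subst inner_cm) (simp add: cm_cm)
 thus ?thesis unfolding cm_of_real by simp
qed

lemma norm_J: "norm (J u) = norm u" by (simp add: norm_cm)

text \<open>Inserting \<open>J\<close> into the real inner product reads off the imaginary part of
  the complex one, so a complex identity becomes a pair of real ones.\<close>

lemma L2_inner_mk:
 assumes "f \<in> L2 MB" "g \<in> L2 MB"
 shows "L2_inner MB f g = Complex (inner (mk f) (mk g)) (inner (mk f) (J (mk g)))"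
proof (rule complex_eqI)
 show "Re (L2_inner MB f g) = Re (Complex (inner (mk f) (mk g)) (inner (mk f) (J (mk g))))" using assms by (simp add: inner_mk)
 show "Im (L2_inner MB f g) = Im (Complex (inner (mk f) (mk g)) (inner (mk f) (J (mk g))))" using assms by (simp add: inner_mk cm_mk L2_cmult L2_inner_cmult_right)
qed

lemma finite_measure_MB: "finite_measure MB" by (rule finite_measure_lebesgue_on) auto

lemma L2_imp_integrable:
 assumes "f \<in> L2 MB" shows "integrable MB f"
proof -
 interpret finite_measure MB by (rule finite_measure_MB)
 have "(%_. 1) \<in> L2 MB" by (simp add: L2_def)
 from L2_mult_integrable[OF assms this] show ?thesis by simp
qed

text \<open>The pointwise inequality \<open>2 * r <= e + r^2 / e\<close>, integrated over a set of
  finite measure. The free \<open>e\<close> shows that L^2-Cauchy sequences are L^1-Cauchy.\<close>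

lemma L2_norm_small_L1:
 fixes f :: "'a::euclidean_space cf"
 assumes "f \<in> L2 MB" "e > 0"
 shows "(LINT x|MB. cmod (f x)) <= (e * measure MB (space (MB :: 'a measure)) + (L2_norm MB f)^2 / e) / 2"
proof -
 interpret finite_measure MB by (rule finite_measure_MB)
 have "cmod z <= (e + (cmod z)^2 / e) / 2" for z using zero_le_power2[of "cmod z - e"] assms(2) by (simp add: power2_diff field_simps power2_eq_square)
 hence "(LINT x|MB. cmod (f x)) <= (LINT x|MB. (e + (cmod (f x))^2 / e) / 2)" using L2_imp_integrable[OF assms(1)] L2D(2)[OF assms(1)] by (intro integral_mono) auto
 also have "... = (e * measure MB (space (MB :: 'a measure)) + (LINT x|MB. (cmod (f x))^2) / e) / 2" using L2D(2)[OF assms(1)] by (simp add: mult.commute)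
 finally show ?thesis by (simp add: L2_norm_def)
qed

lemma L2_fatou:
 assumes f: "f \<in> L2 M" and s: "!!i. s i \<in> L2 M" and g: "g \<in> borel_measurable M"
  and lim: "AE x in M. (%i. s i x) ----> g x" and le: "\<forall>\<^sub>F i in sequentially. L2_norm M (%x. f x - s i x) <= e"
 shows "(%x. f x - g x) \<in> L2 M" "L2_norm M (%x. f x - g x) <= e"
proof -
 note [measurable] = L2D(1)[OF f] L2D(1)[OF s] g
 have e: "e >= 0" using le L2_norm_nonneg[of M] by (meson eventually_sequentially order_refl order_trans)
 have "(\<integral>\<^sup>+x. ennreal ((cmod (f x - g x))^2) \<partial>M) <= (\<integral>\<^sup>+x. liminf (%i. ennreal ((cmod (f x - s i x))^2)) \<partial>M)"
 proof (rule nn_integral_mono_AE)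
  show "AE x in M. ennreal ((cmod (f x - g x))^2) <= liminf (%i. ennreal ((cmod (f x - s i x))^2))" using lim
  proof eventually_elim
   case (elim x)
   have "(%i. ennreal ((cmod (f x - s i x))^2)) ----> ennreal ((cmod (f x - g x))^2)" by (intro tendsto_intros elim)
   hence "liminf (%i. ennreal ((cmod (f x - s i x))^2)) = ennreal ((cmod (f x - g x))^2)" by (rule lim_imp_Liminf[OF sequentially_bot])
   thus ?case by simp
  qed
 qed
 also have "... <= liminf (%i. \<integral>\<^sup>+x. ennreal ((cmod (f x - s i x))^2) \<partial>M)" by (rule nn_integral_liminf) measurable
 also have "... <= ennreal (e^2)"
 proof -
  have "(\<integral>\<^sup>+x. ennreal ((cmod (f x - s i x))^2) \<partial>M) <= ennreal (e^2)"
   if "L2_norm M (%x. f x - s i x) <= e" for i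
  proof -
   have "(\<integral>\<^sup>+x. ennreal ((cmod (f x - s i x))^2) \<partial>M) = ennreal ((L2_norm M (%x. f x - s i x))^2)" using L2D(2)[OF L2_diff[OF f s[of i]]] by (simp add: nn_integral_eq_integral L2_norm_def)
   thus ?thesis using that L2_norm_nonneg by (auto intro!: ennreal_leI power_mono)
  qed
  hence "\<forall>\<^sub>F i in sequentially. (\<integral>\<^sup>+x. ennreal ((cmod (f x - s i x))^2) \<partial>M) <= ennreal (e^2)" using le by (auto elim: eventually_mono)
  thus ?thesis by (intro Liminf_le) auto
 qed
 finally have le': "(\<integral>\<^sup>+x. ennreal ((cmod (f x - g x))^2) \<partial>M) <= ennreal (e^2)" .
 hence "integrable M (%x. (cmod (f x - g x))^2)" by (intro integrableI_bounded) (auto simp: less_top[symmetric] top_unique)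
 thus L2: "(%x. f x - g x) \<in> L2 M" by (intro L2I) auto
 have "ennreal ((L2_norm M (%x. f x - g x))^2) <= ennreal (e^2)" using le' L2D(2)[OF L2] by (simp add: nn_integral_eq_integral L2_norm_def)
 hence "(L2_norm M (%x. f x - g x))^2 <= e^2" by (simp add: ennreal_le_iff)
 thus "L2_norm M (%x. f x - g x) <= e" using e by (rule power2_le_imp_le)
qed

text \<open>A subsequence that converges almost everywhere supplies the limit function, and Fatou's
  lemma turns the Cauchy estimate into convergence in norm.\<close>

instance l2 :: (euclidean_space) complete_space
proof
 fix X :: "nat => 'a l2" assume X: "Cauchy X"
 define f where "f n = rp (X n)" for n
 have f: "f n \<in> L2 MB" "X n = mk (f n)" for n by (auto simp: f_def rp_L2 mk_rp)
 have dst: "dist (X i) (X j) = L2_norm MB (%x. f i x - f j x)" for i j unfolding dist_norm f(2) by (simp add: mk_diff[symmetric] f norm_mk L2_diff)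
 define m where "m = measure MB (space (MB :: 'a measure))"
 have m: "m >= 0" by (simp add: m_def)
 have "EX N. ALL i>=N. ALL j>=N. (LINT x|MB. norm (f i x - f j x)) < e" if e: "e > 0" for e
 proof -
  define d where "d = e / (m + 1)"
  have d: "d > 0" "d * m < e" using e m by (auto simp: d_def field_simps)
  have "sqrt (d * e) > 0" using d e by simp
  then obtain N where N: "!!i j. i >= N ==> j >= N ==> dist (X i) (X j) < sqrt (d * e)" using X unfolding Cauchy_def by blast
  have "(LINT x|MB. norm (f i x - f j x)) < e" if "i >= N" "j >= N" for i j
  proof -
   have "(L2_norm MB (%x. f i x - f j x))^2 <= (sqrt (d * e))^2" using N[OF that] unfolding dst by (intro power_mono) (auto simp: L2_norm_nonneg)
   define q where "q = (L2_norm MB (%x. f i x - f j x))^2 / d"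
   have "q <= e" unfolding q_def using \<open>_ <= (sqrt (d * e))^2\<close> d e by (simp add: field_simps)
   moreover have "(LINT x|MB. norm (f i x - f j x)) <= (d * m + q) / 2" unfolding m_def q_def by (rule L2_norm_small_L1[OF L2_diff[OF f(1) f(1)] d(1)])
   ultimately show ?thesis using d(2) by argo
  qed
  thus ?thesis by blast
 qed
 then obtain r where r: "strict_mono r" "AE x in MB. Cauchy (%i. f (r i) x)" by (rule cauchy_L1_AE_cauchy_subseq[OF L2_imp_integrable[OF f(1)]])
 define g where "g x = lim (%i. f (r i) x)" for x
 note [measurable] = L2D(1)[OF f(1)]
 have g: "g \<in> borel_measurable MB" unfolding g_def by measurable
 have lim: "AE x in MB. (%i. f (r i) x) ----> g x" using r(2) unfolding g_def by (auto elim!: eventually_mono simp: Cauchy_convergent_iff convergent_LIMSEQ_iff)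
 have close: "EX N. ALL i>=N. (%x. f i x - g x) \<in> L2 MB & L2_norm MB (%x. f i x - g x) <= e" if e: "e > 0" for e
 proof -
  obtain N where N: "!!i j. i >= N ==> j >= N ==> dist (X i) (X j) < e" using X e unfolding Cauchy_def by blast
  have "(%x. f i x - g x) \<in> L2 MB & L2_norm MB (%x. f i x - g x) <= e" if i: "i >= N" for i
  proof -
   have "\<forall>\<^sub>F j in sequentially. L2_norm MB (%x. f i x - f (r j) x) <= e" using N[OF i] seq_suble[OF r(1)] unfolding dst eventually_sequentially by (meson less_imp_le order_trans)
   from L2_fatou[OF f(1) f(1) g lim this] show ?thesis by blast
  qed
  thus ?thesis by blast
 qed
 obtain N where N: "(%x. f N x - g x) \<in> L2 MB" using close[of 1] by auto
 have gL: "g \<in> L2 MB" using L2_diff[OF f(1)[of N] N] by simp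
 have "X ----> mk g"
 proof (rule metric_LIMSEQ_I)
  fix e :: real assume "e > 0"
  then obtain N where "ALL i>=N. L2_norm MB (%x. f i x - g x) <= e/2" using close[of "e/2"] by auto
  hence "dist (X i) (mk g) < e" if "i >= N" for i using that \<open>e > 0\<close> unfolding dist_norm f(2) by (force simp: mk_diff[symmetric] norm_mk L2_diff f gL)
  thus "EX no. ALL n>=no. dist (X n) (mk g) < e" by blast
 qed
 thus "convergent X" by (auto simp: convergent_def)
qed

section \<open>Calculus of smooth functions\<close>

definition pd :: "'a::euclidean_space => ('a cf) => 'a => complex" where
 "pd h f = (%x. frechet_derivative f (at x) h)"

definition dff :: "('a::euclidean_space cf) => bool" where
 "dff f \<longleftrightarrow> (ALL x. f differentiable (at x))"

lemma partials_Cons: "partials (b # bs) f = pd b (partials bs f)" by (simp add: pd_def)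

lemma partials_append: "partials (bs @ cs) f = partials bs (partials cs f)" by (induction bs) (simp_all del: partials.simps(2) add: partials_Cons)

lemma pdI:
 assumes "!!x. (f has_derivative f' x) (at x)"
 shows "dff f" "pd h f = (%x. f' x h)" using assms frechet_derivative_at[OF assms] by (auto simp: dff_def pd_def differentiable_def)

lemma dff_deriv: assumes "dff f" shows "(f has_derivative (%h. pd h f x)) (at x)"
proof -
 have "(f has_derivative frechet_derivative f (at x)) (at x)" using assms by (simp add: dff_def frechet_derivative_works)
 thus ?thesis by (simp add: pd_def eta_contract_eq)
qed

lemma dff_cont: "dff f ==> continuous_on S f" by (meson dff_deriv has_derivative_continuous continuous_at_imp_continuous_on)

lemma pd_const: "dff (%_. c)" "pd h (%_. c) = (%_. 0)" by (rule pdI[where f'="%_ _. 0"], simp)+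

lemma pd_add:
 assumes "dff f" "dff g"
 shows "dff (%x. f x + g x)" "pd h (%x. f x + g x) = (%x. pd h f x + pd h g x)" by (rule pdI, rule has_derivative_add[OF dff_deriv dff_deriv], fact assms, fact assms)+

lemma pd_mult:
 assumes "dff f" "dff g"
 shows "dff (%x. f x * g x)" "pd h (%x. f x * g x) = (%x. f x * pd h g x + pd h f x * g x)" by (rule pdI, rule has_derivative_mult[OF dff_deriv dff_deriv], fact assms, fact assms)+

lemma pd_bl:
 assumes "dff f" "bounded_linear L"
 shows "dff (%x. L (f x))" "pd h (%x. L (f x)) = (%x. L (pd h f x))" by (rule pdI, rule bounded_linear.has_derivative[OF assms(2) dff_deriv[OF assms(1)]])+

lemmas pd_cmult = pd_bl[OF _ bounded_linear_mult_right]
lemmas pd_cnj = pd_bl[OF _ bounded_linear_cnj]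

lemma pd_diff:
 assumes "dff f" "dff g"
 shows "dff (%x. f x - g x)" "pd h (%x. f x - g x) = (%x. pd h f x - pd h g x)" by (rule pdI, rule has_derivative_diff[OF dff_deriv dff_deriv], fact assms, fact assms)+

lemma pd_coord:
 "dff (%x. cor (inner x a))" "pd h (%x. cor (inner x a)) = (%x. cor (inner h a))" by (rule pdI[where f'="%_ h. cor (inner h a)"],
   rule bounded_linear_imp_has_derivative,
   rule bounded_linear_compose[OF bounded_linear_of_real bounded_linear_inner_left])+

lemma pd_linear_expand:
 fixes f :: "'a::euclidean_space cf"
 assumes "dff f" shows "pd h f x = (\<Sum>b\<in>Basis. inner h b *\<^sub>R pd b f x)"
proof -
 interpret L: bounded_linear "%h. pd h f x" using dff_deriv[OF assms] by (rule has_derivative_bounded_linear)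
 have "pd h f x = pd (\<Sum>b\<in>Basis. inner h b *\<^sub>R b) f x" by (simp add: euclidean_representation)
 thus ?thesis by (simp only: L.sum L.scaleR)
qed

lemma pd_sum:
 assumes "!!i. i \<in> I ==> dff (f i)"
 shows "dff (%x. \<Sum>i\<in>I. f i x)" "pd h (%x. \<Sum>i\<in>I. f i x) = (%x. \<Sum>i\<in>I. pd h (f i) x)" by (rule pdI, rule has_derivative_sum, rule dff_deriv, fact assms)+

lemma smooth_iff: "smooth f \<longleftrightarrow> (ALL bs. set bs \<subseteq> Basis --> dff (partials bs f))" by (simp add: smooth_def dff_def)

lemma smooth_dff: "smooth f ==> dff f" unfolding smooth_iff by (drule spec[of _ "[]"]) simp

lemma smooth_pd: assumes "smooth f" "b \<in> Basis" shows "smooth (pd b f)"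
proof -
 have "dff (partials bs (pd b f))" if "set bs \<subseteq> Basis" for bs
 proof -
  have "partials bs (pd b f) = partials (bs @ [b]) f" by (simp add: partials_append partials_Cons del: partials.simps(2))
  thus ?thesis using assms that unfolding smooth_iff by simp
 qed
 thus ?thesis by (simp add: smooth_iff)
qed

lemma smooth_partials: "smooth f ==> set bs \<subseteq> Basis ==> smooth (partials bs f)"
proof (induction bs)
 case (Cons b bs)
 thus ?case unfolding partials_Cons by (intro smooth_pd) auto
qed simp

lemma smooth_pd_cont: "smooth f ==> b \<in> Basis ==> continuous_on S (pd b f)" using smooth_pd smooth_dff dff_cont by blast

text \<open>Iterated derivatives never leave a class closed under differentiation, so naming such a
  class replaces an induction over derivative lists in each application.\<close>

lemma smooth_coinduct:
 assumes f: "f \<in> D" and D: "!!f. f \<in> D ==> dff f" "!!f b. f \<in> D ==> b \<in> Basis ==> pd b f \<in> D"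
 shows "smooth f"
proof -
 have "partials bs f \<in> D" if "set bs \<subseteq> Basis" for bs using that by (induction bs) (simp_all add: f D(2) partials_Cons del: partials.simps(2) add: partials.simps(1))
 thus ?thesis using D(1) by (simp add: smooth_iff)
qed

lemma smooth_add:
 fixes f g :: "'a::euclidean_space cf"
 assumes "smooth f" "smooth g" shows "smooth (%x. f x + g x)"
proof (rule smooth_coinduct[where D="{%x. f x + g x | f g. smooth f & smooth g}"])
 show "(%x. f x + g x) \<in> {%x. f x + g x | f g. smooth f & smooth g}" using assms by blast
 fix k :: "'a cf" assume "k \<in> {%x. f x + g x | f g. smooth f & smooth g}"
 then obtain f g where k: "k = (%x. f x + g x)" "smooth f" "smooth g" by blast
 note d = smooth_dff[OF k(2)] smooth_dff[OF k(3)]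
 show "dff k" unfolding k(1) by (rule pd_add(1)[OF d])
 fix b :: 'a assume b: "b \<in> Basis"
 have "pd b k = (%x. pd b f x + pd b g x)" unfolding k(1) by (rule pd_add(2)[OF d])
 thus "pd b k \<in> {%x. f x + g x | f g. smooth f & smooth g}" using smooth_pd[OF k(2) b] smooth_pd[OF k(3) b] by blast
qed

lemma smooth_bl:
 fixes f :: "'a::euclidean_space cf"
 assumes "smooth f" "bounded_linear L" shows "smooth (%x. L (f x))"
proof (rule smooth_coinduct[where D="{%x. L (f x) | f. smooth f}"])
 show "(%x. L (f x)) \<in> {%x. L (f x) | f. smooth f}" using assms by blast
 fix k :: "'a cf" assume "k \<in> {%x. L (f x) | f. smooth f}"
 then obtain f where k: "k = (%x. L (f x))" "smooth f" by blast
 note d = smooth_dff[OF k(2)]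
 show "dff k" unfolding k(1) by (rule pd_bl(1)[OF d assms(2)])
 fix b :: 'a assume b: "b \<in> Basis"
 have "pd b k = (%x. L (pd b f x))" unfolding k(1) by (rule pd_bl(2)[OF d assms(2)])
 thus "pd b k \<in> {%x. L (f x) | f. smooth f}" using smooth_pd[OF k(2) b] by blast
qed

lemma partials_add:
 assumes "smooth f" "smooth g" "set bs \<subseteq> Basis"
 shows "partials bs (%x. f x + g x) = (%x. partials bs f x + partials bs g x)" using assms(3)
proof (induction bs)
 case (Cons b bs)
 hence "dff (partials bs f)" "dff (partials bs g)" using assms by (auto intro!: smooth_dff smooth_partials)
 thus ?case using Cons unfolding partials_Cons by (simp add: pd_add)
qed simp

lemma partials_bl:
 assumes "smooth f" "bounded_linear L" "set bs \<subseteq> Basis"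
 shows "partials bs (%x. L (f x)) = (%x. L (partials bs f x))" using assms(3)
proof (induction bs)
 case (Cons b bs)
 hence "dff (partials bs f)" using assms by (auto intro!: smooth_dff smooth_partials)
 thus ?case using Cons unfolding partials_Cons by (simp add: pd_bl[OF _ assms(2)])
qed simp

subsection \<open>A class of explicit smooth functions\<close>

text \<open>The powers \<open>t ^ n\<close> in the denominator make the family closed under
  differentiation. Letting \<open>ep\<close> tend to 0 makes the cutoff tend to 1 where
  \<open>t > 0\<close>.\<close>

definition bmp :: "real => nat => real => real" where
 "bmp ep n t = (if t > 0 then exp (- ep / t) / t ^ n else 0)"

lemma bmp_at_right: assumes "ep > 0" shows "(bmp ep n \<longlongrightarrow> 0) (at_right 0)"
proof -
 have "filterlim (%t. ep * inverse t) at_top (at_right 0)" by (rule filterlim_tendsto_pos_mult_at_top[OF tendsto_const assms filterlim_inverse_at_top_right])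
 from filterlim_compose[OF tendsto_power_div_exp_0[of n] this]
 have "((%t. (1/ep^n) * ((ep * inverse t) ^ n / exp (ep * inverse t))) \<longlongrightarrow> (1/ep^n) * 0) (at_right 0)" by (intro tendsto_intros)
 moreover have "\<forall>\<^sub>F t in at_right 0. (1/ep^n) * ((ep * inverse t) ^ n / exp (ep * inverse t)) = bmp ep n t"
  using assms by (auto simp: eventually_at_right_field bmp_def exp_minus field_simps intro!: exI[of _ 1])
 ultimately show ?thesis by (simp add: tendsto_cong)
qed

lemma bmp_deriv:
 assumes e: "ep > 0"
 shows "(bmp ep n has_real_derivative (ep * bmp ep (n + 2) t - n * bmp ep (n + 1) t)) (at t)"
proof -
 consider "t > 0" | "t < 0" | "t = 0" by linarith
 thus ?thesis
 proof cases
  case 1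
  have "((%t. exp (- ep / t) / t ^ n) has_real_derivative (ep * bmp ep (n + 2) t - n * bmp ep (n + 1) t)) (at t)"
  proof (cases n)
   case 0
   thus ?thesis using 1 by (auto intro!: derivative_eq_intros simp: bmp_def power2_eq_square)
  next
   case (Suc m)
   show ?thesis using 1 by (auto intro!: derivative_eq_intros simp: bmp_def power2_eq_square field_simps Suc) (cases m; simp)
  qed
  thus ?thesis
  proof (rule has_field_derivative_transform_within_open)
   show "open {0::real<..}" by simp
  qed (use 1 in \<open>auto simp: bmp_def\<close>)
 next
  case 2
  have "((%t. 0) has_real_derivative (ep * bmp ep (n + 2) t - n * bmp ep (n + 1) t)) (at t)" using 2 by (simp add: bmp_def)
  thus ?thesis
  proof (rule has_field_derivative_transform_within_open)
   show "open {..<0::real}" by simp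
  qed (use 2 in \<open>auto simp: bmp_def\<close>)
 next
  case 3
  \<comment> \<open>From the right, the difference quotient at 0 is the same function with
    \<open>n\<close> raised by one.\<close>
  have R: "((%h. (bmp ep n (0 + h) - bmp ep n 0) / h) \<longlongrightarrow> 0) (at_right 0)"
  proof (rule Lim_transform_eventually[OF bmp_at_right[OF e, of "Suc n"]])
   show "\<forall>\<^sub>F h in at_right 0. bmp ep (Suc n) h = (bmp ep n (0 + h) - bmp ep n 0) / h" by (auto simp: eventually_at_right_field bmp_def field_simps intro!: exI[of _ 1])
  qed
  have L: "((%h. (bmp ep n (0 + h) - bmp ep n 0) / h) \<longlongrightarrow> 0) (at_left 0)"
  proof (rule Lim_transform_eventually[OF tendsto_const])
   show "\<forall>\<^sub>F h in at_left 0. 0 = (bmp ep n (0 + h) - bmp ep n 0) / h" by (auto simp: eventually_at_left_field bmp_def intro!: exI[of _ "-1"])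
  qed
  have "((%h. (bmp ep n (0 + h) - bmp ep n 0) / h) \<longlongrightarrow> 0) (at 0)" using L R by (simp add: filterlim_split_at)
  thus ?thesis using 3 by (simp add: DERIV_def bmp_def)
 qed
qed

lemma bmp_nonneg: "bmp ep n t >= 0" by (simp add: bmp_def)

definition bumpf :: "real => nat => real => 'a::euclidean_space cf" where
 "bumpf ep n rh x = cor (bmp ep n (rh - inner x x))"

lemma pd_bumpf:
 fixes h :: "'a::euclidean_space"
 assumes "ep > 0"
 shows "dff (bumpf ep n rh :: 'a cf)"
  "pd h (bumpf ep n rh) = (%x. (ep * bumpf ep (n+2) rh x + (- of_nat n) * bumpf ep (n+1) rh x) * (-2 * cor (inner x h)))"
proof -
 have 1: "((%x::'a. bmp ep n (rh - inner x x)) has_derivative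
  (%h. (ep * bmp ep (n + 2) (rh - inner x x) - n * bmp ep (n + 1) (rh - inner x x)) * (- (2 * inner x h)))) (at x)" for x
 proof -
  have s: "((%x::'a. rh - inner x x) has_derivative (%h. - (2 * inner x h))) (at x)" by (auto intro!: derivative_eq_intros simp: inner_commute)
  have b: "(bmp ep n has_derivative (%r. (ep * bmp ep (n + 2) (rh - inner x x) - n * bmp ep (n + 1) (rh - inner x x)) * r)) (at (rh - inner x x))"
   using bmp_deriv[OF assms, of n "rh - inner x x"] by (simp add: has_field_derivative_def)
  show ?thesis using diff_chain_at[OF s b] by (simp add: comp_def)
 qed
 have 2: "((bumpf ep n rh :: 'a cf) has_derivative
  (%h. cor ((ep * bmp ep (n + 2) (rh - inner x x) - n * bmp ep (n + 1) (rh - inner x x)) * (- (2 * inner x h))))) (at x)" for x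
  unfolding bumpf_def[abs_def] by (rule bounded_linear.has_derivative[OF bounded_linear_of_real 1])
 show "dff (bumpf ep n rh :: 'a cf)" by (rule pdI(1)[OF 2])
 show "pd h (bumpf ep n rh) = (%x. (ep * bumpf ep (n+2) rh x + (- of_nat n) * bumpf ep (n+1) rh x) * (-2 * cor (inner x h)))" unfolding pdI(2)[OF 2] by (simp add: bumpf_def)
qed

text \<open>A class of explicit functions closed under differentiation that contains polynomials and
  cutoffs; \<open>smooth_coinduct\<close> then makes its members smooth.\<close>

inductive_set sm :: "('a::euclidean_space cf) set" where
 sm_const: "(%_. c) \<in> sm"
| sm_coord: "(%x. cor (inner x a)) \<in> sm"
| sm_bump: "ep > 0 ==> bumpf ep n rh \<in> sm"
| sm_add: "f \<in> sm ==> g \<in> sm ==> (%x. f x + g x) \<in> sm"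
| sm_mult: "f \<in> sm ==> g \<in> sm ==> (%x. f x * g x) \<in> sm"

lemma sm_pd: "f \<in> sm ==> dff f & pd h f \<in> sm"
proof (induction rule: sm.induct)
 case (sm_const c)
 thus ?case by (simp add: pd_const sm.sm_const)
next
 case (sm_coord a)
 thus ?case by (simp add: pd_coord sm.sm_const)
next
 case (sm_bump ep n rh)
 have "pd h (bumpf ep n rh) \<in> sm" unfolding pd_bumpf(2)[OF sm_bump] by (intro sm.sm_mult sm.sm_add sm.sm_const sm.sm_bump sm.sm_coord sm_bump)
 thus ?case using pd_bumpf(1)[OF sm_bump] by simp
next
 case (sm_add f g)
 thus ?case by (simp add: pd_add sm.sm_add)
next
 case (sm_mult f g)
 thus ?case by (simp add: pd_mult sm.sm_add sm.sm_mult)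
qed

lemma sm_smooth: "f \<in> sm ==> smooth f" by (rule smooth_coinduct[where D=sm]) (auto simp: sm_pd)

subsection \<open>Test functions and integration by parts\<close>

text \<open>The test functions of the unit ball, with the support condition expressed by one radius
  \<open>r < 1\<close>; \<open>tst_iff\<close> gives the equivalence.\<close>

definition tst :: "('a::euclidean_space cf) => bool" where
 "tst f \<longleftrightarrow> smooth f & (EX r<1. ALL x. norm x > r --> f x = 0)"

lemma tst_iff:
 fixes f :: "'a::euclidean_space cf"
 shows "f \<in> test_functions (ball 0 1) \<longleftrightarrow> tst f"
proof
 assume f: "f \<in> test_functions (ball 0 1)"
 let ?K = "closure {x. f x ~= 0}"
 have K: "compact ?K" "?K \<subseteq> ball 0 1" "smooth f" using f by (auto simp: test_functions_def)
 have "EX r<1. ALL x. norm x > r --> f x = 0"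
 proof (cases "?K = {}")
  case True
  hence "f x = 0" for x by auto
  thus ?thesis by (intro exI[of _ 0]) auto
 next
  case False
  obtain x where x: "x \<in> ?K" "!!y. y \<in> ?K ==> norm y <= norm x" using continuous_attains_sup[OF K(1) False, of norm] by (auto intro: continuous_intros)
  show ?thesis
  proof (intro exI[of _ "norm x"] conjI allI impI)
   show "norm x < 1" using x K(2) by auto
   fix y :: 'a assume "norm y > norm x"
   hence "y \<notin> ?K" using x(2) by force
   hence "y \<notin> {x. f x ~= 0}" using closure_subset[of "{x. f x ~= 0}"] by blast
   thus "f y = 0" by simp
  qed
 qed
 thus "tst f" using K(3) by (simp add: tst_def)
next
 assume "tst f"
 then obtain r where r: "r < 1" "!!x. norm x > r ==> f x = 0" "smooth f" by (auto simp: tst_def)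
 have sub: "closure {x. f x ~= 0} \<subseteq> cball 0 r" by (rule closure_minimal) (use r(2) in \<open>force simp: not_less[symmetric]\<close>)+
 have "compact (closure {x. f x ~= 0})" using bounded_subset[OF bounded_cball sub] by (simp add: compact_eq_bounded_closed)
 thus "f \<in> test_functions (ball 0 1)" using sub r by (auto simp: test_functions_def)
qed

lemma tst_smooth: "tst f ==> smooth f" by (simp add: tst_def)

lemma pd_zero_outside:
 fixes f :: "'a::euclidean_space cf"
 assumes "dff f" "!!x. norm x > r ==> f x = 0" "norm x > r" shows "pd h f x = 0"
proof -
 have "open {x::'a. norm x > r}" by (intro open_Collect_less continuous_intros)
 have "((%_. 0 :: complex) has_derivative (%_. 0)) (at x)" by simp
 hence "(f has_derivative (%_. 0)) (at x)" by (rule has_derivative_transform_within_open[OF _ \<open>open {x::'a. norm x > r}\<close>]) (use assms in auto)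
 from has_derivative_unique[OF dff_deriv[OF assms(1)] this] show ?thesis by (simp add: fun_eq_iff)
qed

lemma tst_pd: assumes "tst f" "b \<in> Basis" shows "tst (pd b f)"
proof -
 obtain r where r: "r < 1" "!!x. norm x > r ==> f x = 0" "smooth f" using assms(1) by (auto simp: tst_def)
 have "pd b f x = 0" if "norm x > r" for x by (rule pd_zero_outside[OF smooth_dff[OF r(3)] r(2) that])
 thus ?thesis using r smooth_pd[OF r(3) assms(2)] by (auto simp: tst_def)
qed

lemma tst_partials: "tst f ==> set bs \<subseteq> Basis ==> tst (partials bs f)"
proof (induction bs)
 case (Cons b bs)
 thus ?case unfolding partials_Cons by (intro tst_pd) auto
qed simp

lemma tst_add: assumes "tst f" "tst g" shows "tst (%x. f x + g x)"
proof -
 obtain r s where rs: "r < 1" "s < 1" "!!x. norm x > r ==> f x = 0" "!!x. norm x > s ==> g x = 0" using assms by (auto simp: tst_def)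
 hence "EX r<1. ALL x. norm x > r --> f x + g x = 0" by (intro exI[of _ "max r s"]) auto
 thus ?thesis using assms smooth_add unfolding tst_def by blast
qed

lemma tst_bl: assumes "tst f" "bounded_linear L" shows "tst (%x. L (f x))"
proof -
 have "L 0 = 0" using assms(2) by (simp add: bounded_linear.linear linear_0)
 thus ?thesis using assms smooth_bl[OF _ assms(2)] by (auto simp: tst_def)
qed

lemmas tst_cmult = tst_bl[OF _ bounded_linear_mult_right]
lemmas tst_cnj = tst_bl[OF _ bounded_linear_cnj]

lemma tst_diff: "tst f ==> tst g ==> tst (%x. f x - g x)" using tst_add[OF _ tst_cmult[of g "-1"]] by simp

lemma tst_zero: "tst (%_. 0)" unfolding tst_def using sm_smooth[OF sm_const] by (auto intro: exI[of _ 0])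

lemma tst_sum: "(!!i. i \<in> I ==> tst (f i)) ==> tst (%x. \<Sum>i\<in>I. f i x)" by (induction I rule: infinite_finite_induct) (auto intro: tst_add tst_zero)

lemma integrable_compact_support:
 fixes f :: "'a::euclidean_space cf"
 assumes "continuous_on UNIV f" "!!x. norm x > r ==> f x = 0"
 shows "integrable lborel f"
proof -
 have "integrable lborel (%x. indicator (cball 0 r) x *\<^sub>R f x)" by (rule borel_integrable_compact) (auto intro: continuous_on_subset[OF assms(1)])
 also have "(%x. indicator (cball 0 r) x *\<^sub>R f x) = f" using assms(2) by (auto simp: indicator_def not_le fun_eq_iff)
 finally show ?thesis .
qed

lemma bounded_compact_support:
 fixes f :: "'a::euclidean_space cf"
 assumes "continuous_on UNIV f" "!!x. norm x > r ==> f x = 0"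
 obtains B where "B >= 0" "!!x. norm (f x) <= B"
proof -
 have "compact (f ` cball 0 r)" by (intro compact_continuous_image continuous_on_subset[OF assms(1)]) auto
 then obtain B where B: "B > 0" "!!x. x \<in> cball 0 r ==> norm (f x) <= B" using compact_imp_bounded[of "f ` cball 0 r"] by (auto simp: bounded_pos)
 have "norm (f x) <= B" for x using B assms(2)[of x] by (cases "norm x > r") auto
 thus ?thesis using that[of B] B(1) by simp
qed

lemma lborel_integral_translate:
 fixes f :: "'a::euclidean_space => 'b::{banach,second_countable_topology}"
 assumes "f \<in> borel_measurable borel"
 shows "(LINT x|lborel. f (x + a)) = (LINT x|lborel. f x)"
proof -
 have "(LINT x|lborel. f x) = (LINT x|distr lborel borel ((+) a). f x)" by (simp add: lborel_distr_plus)
 also have "... = (LINT x|lborel. f (a + x))" by (rule integral_distr) (use assms in auto)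
 finally show ?thesis by (simp add: add.commute)
qed

lemma pd_mvt:
 fixes f :: "'a::euclidean_space cf"
 assumes "dff f" "!!x. norm (pd h f x) <= B" "t >= 0"
 shows "norm (f (x + t *\<^sub>R h) - f x) <= B * t"
proof -
 have der: "((%s. f (x + s *\<^sub>R h)) has_derivative (%r. r *\<^sub>R pd h f (x + s *\<^sub>R h))) (at s within {0..t})" for s
 proof -
  have 1: "((%s. x + s *\<^sub>R h) has_derivative (%r. r *\<^sub>R h)) (at s within {0..t})" by (auto intro!: derivative_eq_intros)
  have 2: "(f has_derivative (%k. pd k f (x + s *\<^sub>R h))) (at (x + s *\<^sub>R h) within (%s. x + s *\<^sub>R h) ` {0..t})" by (rule has_derivative_at_withinI[OF dff_deriv[OF assms(1)]])
  have lin: "pd (r *\<^sub>R h) f y = r *\<^sub>R pd h f y" for r y using bounded_linear.linear[OF has_derivative_bounded_linear[OF dff_deriv[OF assms(1), of y]]] linear_cmul by blast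
  show ?thesis using diff_chain_within[OF 1 2] by (simp add: comp_def lin)
 qed
 have "norm (f (x + t *\<^sub>R h) - f (x + 0 *\<^sub>R h)) <= B * norm (t - 0)"
 proof (rule differentiable_bound[OF _ der])
  show "onorm (%r. r *\<^sub>R pd h f (x + s *\<^sub>R h)) <= B" for s by (rule onorm_le) (use assms(2) in \<open>simp add: mult.commute[of B] mult_left_mono\<close>)
 qed (use assms(3) in auto)
 thus ?thesis using assms(3) by simp
qed

text \<open>Translation invariance: the difference quotients of \<open>f\<close> have integral zero.\<close>

lemma integral_pd_zero:
 fixes f :: "'a::euclidean_space cf"
 assumes f: "dff f" "continuous_on UNIV (pd h f)" "!!x. norm x > r ==> f x = 0"
 shows "(LINT x|lborel. pd h f x) = 0"
proof -
 have z: "!!x. norm x > r ==> pd h f x = 0" by (rule pd_zero_outside[OF f(1,3)])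
 obtain B where B: "B >= 0" "!!x. norm (pd h f x) <= B" using bounded_compact_support[OF f(2) z] by blast
 define q where "q n x = of_nat (Suc n) * (f (x + (1 / real (Suc n)) *\<^sub>R h) - f x)" for n x
 have cf: "continuous_on UNIV f" by (rule dff_cont[OF f(1)])
 have [measurable]: "f \<in> borel_measurable borel" using cf by (rule borel_measurable_continuous_onI)
 have [measurable]: "pd h f \<in> borel_measurable borel" using f(2) by (rule borel_measurable_continuous_onI)
 have [measurable]: "q n \<in> borel_measurable borel" for n unfolding q_def by measurable
 have int_f: "integrable lborel f" by (rule integrable_compact_support[OF cf f(3)])
 have "(LINT x|lborel. q n x) = 0" for n
 proof -
  have "(LINT x|lborel. f (x + (1 / real (Suc n)) *\<^sub>R h)) = (LINT x|lborel. f x)" by (rule lborel_integral_translate) simp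
  moreover have "integrable lborel (%x. f (x + (1 / real (Suc n)) *\<^sub>R h))"
  proof (rule integrable_compact_support)
   show "continuous_on UNIV (%x. f (x + (1 / real (Suc n)) *\<^sub>R h))" by (intro continuous_on_compose2[OF cf] continuous_intros) auto
   fix x :: 'a assume "norm x > r + norm h"
   moreover have "norm ((1 / real (Suc n)) *\<^sub>R h) <= norm h" by (simp add: divide_le_eq_1 mult_left_le_one_le field_simps)
   ultimately have "norm (x + (1 / real (Suc n)) *\<^sub>R h) > r" using norm_diff_ineq[of x "(1 / real (Suc n)) *\<^sub>R h"] by linarith
   thus "f (x + (1 / real (Suc n)) *\<^sub>R h) = 0" by (rule f(3))
  qed
  ultimately show ?thesis unfolding q_def by (simp add: int_f)
 qed
 moreover have "(%n. LINT x|lborel. q n x) ----> (LINT x|lborel. pd h f x)"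
 proof (rule integral_dominated_convergence[where w="%x. B * indicator (cball 0 (r + norm h)) x"])
  show "integrable lborel (%x::'a. B * indicator (cball 0 (r + norm h)) x)" using emeasure_bounded_finite[of "cball (0::'a) (r + norm h)"] by (intro integrable_mult_right integrable_real_indicator) simp_all
  show "AE x in lborel. (%n. q n x) ----> pd h f x"
  proof (intro AE_I2)
   fix x
   have 1: "((%s. x + s *\<^sub>R h) has_derivative (%r. r *\<^sub>R h)) (at 0)" by (auto intro!: derivative_eq_intros)
   have 2: "(f has_derivative (%k. pd k f x)) (at (x + 0 *\<^sub>R h))" using dff_deriv[OF f(1)] by simp
   have lin: "pd (r *\<^sub>R h) f x = r *\<^sub>R pd h f x" for r using bounded_linear.linear[OF has_derivative_bounded_linear[OF dff_deriv[OF f(1), of x]]] linear_cmul by blast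
   have "((%s. f (x + s *\<^sub>R h)) has_derivative (%s. s *\<^sub>R pd h f x)) (at 0)" using diff_chain_at[OF 1 2] by (simp add: comp_def lin)
   hence lim: "((%s. norm (f (x + s *\<^sub>R h) - f x - s *\<^sub>R pd h f x) / norm s) \<longlongrightarrow> 0) (at 0)" by (simp add: has_derivative_at)
   have "((%s. norm ((f (x + s *\<^sub>R h) - f x) /\<^sub>R s - pd h f x)) \<longlongrightarrow> 0) (at 0)"
   proof (rule Lim_transform_eventually[OF lim])
    have eq: "norm (a - s *\<^sub>R d) / norm s = norm (a /\<^sub>R s - d)" if "s ~= 0" for a d :: complex and s :: real
    proof -
     have "a /\<^sub>R s - d = (a - s *\<^sub>R d) /\<^sub>R s" using that by (simp add: scaleR_diff_right)
     thus ?thesis by (simp add: divide_inverse mult.commute)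
    qed
    show "\<forall>\<^sub>F s in at 0. norm (f (x + s *\<^sub>R h) - f x - s *\<^sub>R pd h f x) / norm s
      = norm ((f (x + s *\<^sub>R h) - f x) /\<^sub>R s - pd h f x)" by (rule eventually_mono[OF eventually_neq_at_within[of 0 0 UNIV]]) (rule eq)
   qed
   hence "((%s. (f (x + s *\<^sub>R h) - f x) /\<^sub>R s) \<longlongrightarrow> pd h f x) (at 0)" by (rule LIM_zero_cancel[OF tendsto_norm_zero_cancel])
   moreover have "filterlim (%n. 1 / real (Suc n)) (at 0) sequentially" unfolding filterlim_at using LIMSEQ_Suc[OF lim_1_over_n] by auto
   ultimately have "(%n. (f (x + (1 / real (Suc n)) *\<^sub>R h) - f x) /\<^sub>R (1 / real (Suc n))) ----> pd h f x" by (rule filterlim_compose)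
   thus "(%n. q n x) ----> pd h f x" by (simp add: q_def scaleR_conv_of_real)
  qed
  show "AE x in lborel. norm (q n x) <= B * indicator (cball 0 (r + norm h)) x" for n
  proof (intro AE_I2)
   fix x
   have le1: "norm ((1 / real (Suc n)) *\<^sub>R h) <= norm h" by (simp add: divide_le_eq_1 mult_left_le_one_le field_simps)
   show "norm (q n x) <= B * indicator (cball 0 (r + norm h)) x"
   proof (cases "norm x > r + norm h")
    case True
    hence "norm (x + (1 / real (Suc n)) *\<^sub>R h) > r" "norm x > r" using norm_diff_ineq[of x "(1 / real (Suc n)) *\<^sub>R h"] le1 norm_ge_zero[of h] by linarith+
    hence "q n x = 0" unfolding q_def using f(3) by simp
    thus ?thesis using True by simp
   next
    case False
    have "norm (q n x) = real (Suc n) * norm (f (x + (1 / real (Suc n)) *\<^sub>R h) - f x)" unfolding q_def by (simp add: norm_mult del: of_nat_Suc)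
    also have "... <= real (Suc n) * (B * (1 / real (Suc n)))" by (intro mult_left_mono pd_mvt[OF f(1) B(2)]) auto
    also have "... = B" by simp
    finally show ?thesis using False by simp
   qed
  qed
 qed auto
 ultimately show ?thesis by (simp add: LIMSEQ_const_iff)
qed

lemma MB_integral:
 fixes f :: "'a::euclidean_space cf"
 assumes "continuous_on UNIV f" "r < 1" "!!x. norm x > r ==> f x = 0"
 shows "(LINT x|MB. f x) = (LINT x|lborel. f x)"
proof -
 have [measurable]: "f \<in> borel_measurable borel" using assms(1) by (rule borel_measurable_continuous_onI)
 have "(LINT x|MB. f x) = (LINT x|lebesgue. indicat_real (ball 0 1) x *\<^sub>R f x)" by (rule integral_restrict_space) auto
 also have "(%x. indicat_real (ball 0 1) x *\<^sub>R f x) = f" using assms by (force simp: indicator_def fun_eq_iff not_less)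
 also have "(LINT x|lebesgue. f x) = (LINT x|lborel. f x)" by (rule integral_completion) simp
 finally show ?thesis .
qed

text \<open>The product \<open>g * fi\<close> inherits the support of \<open>fi\<close>, so the
  integral of its derivative vanishes. Hence \<open>g\<close> may be a polynomial, which does not
  vanish at the boundary.\<close>

lemma ibp:
 fixes fi g :: "'a::euclidean_space cf"
 assumes t: "tst fi" and g: "dff g" "continuous_on UNIV (pd h g)" and h: "h \<in> Basis"
 shows "(LINT x|MB. g x * pd h fi x) = - (LINT x|MB. pd h g x * fi x)"
proof -
 obtain r where r: "r < 1" "!!x. norm x > r ==> fi x = 0" using t by (auto simp: tst_def)
 have fi: "dff fi" "continuous_on UNIV (pd h fi)" "continuous_on UNIV fi" using smooth_dff smooth_pd_cont[OF _ h] tst_smooth[OF t] dff_cont by blast+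
 have z: "!!x. norm x > r ==> pd h fi x = 0" by (rule pd_zero_outside[OF fi(1) r(2)])
 have cg: "continuous_on UNIV g" by (rule dff_cont[OF g(1)])
 have c1: "continuous_on UNIV (%x. g x * pd h fi x)" and c2: "continuous_on UNIV (%x. pd h g x * fi x)" by (intro continuous_intros cg g fi)+
 have "(LINT x|lborel. pd h (%x. g x * fi x) x) = 0" by (rule integral_pd_zero[where r=r, OF pd_mult(1)[OF g(1) fi(1)]])
   (use r(2) in \<open>auto simp: pd_mult(2)[OF g(1) fi(1)] intro!: continuous_on_add c1 c2\<close>)
 hence "(LINT x|lborel. g x * pd h fi x) + (LINT x|lborel. pd h g x * fi x) = 0" unfolding pd_mult(2)[OF g(1) fi(1)] by (subst (asm) Bochner_Integration.integral_add)
   (use r(2) z in \<open>auto intro!: integrable_compact_support[where r=r] c1 c2\<close>)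
 moreover have "(LINT x|MB. g x * pd h fi x) = (LINT x|lborel. g x * pd h fi x)" by (rule MB_integral[OF c1 r(1)]) (simp add: z)
 moreover have "(LINT x|MB. pd h g x * fi x) = (LINT x|lborel. pd h g x * fi x)" by (rule MB_integral[OF c2 r(1)]) (simp add: r(2))
 ultimately show ?thesis by (simp add: eq_neg_iff_add_eq_0)
qed

section \<open>Polynomials, density and test functions\<close>

subsection \<open>Polynomials\<close>

inductive pol :: "nat => ('a::euclidean_space cf) => bool" where
 pol_const: "pol m (%_. c)"
| pol_add: "pol m f ==> pol m g ==> pol m (%x. f x + g x)"
| pol_coord: "pol m f ==> b \<in> Basis ==> pol (Suc m) (%x. cor (inner x b) * f x)"

lemma pol_Suc: "pol m f ==> pol (Suc m) f" by (induction rule: pol.induct) (auto intro: pol.intros)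

lemma pol_mono: "pol m f ==> m <= n ==> pol n f" by (induction n) (auto simp: le_Suc_eq intro: pol_Suc)

lemma pol_cmult: "pol m f ==> pol m (%x. c * f x)"
proof (induction rule: pol.induct)
 case (pol_add m f g)
 thus ?case by (simp add: distrib_left pol.pol_add)
next
 case (pol_coord m f b)
 thus ?case using pol.pol_coord[OF pol_coord(3,2)] by (simp add: mult.left_commute)
qed (rule pol.pol_const)

lemma pol_mult: "pol m f ==> pol n g ==> pol (m + n) (%x. f x * g x)"
proof (induction rule: pol.induct)
 case (pol_const m c)
 thus ?case by (intro pol_mono[OF pol_cmult]) auto
next
 case (pol_add m f1 f2)
 thus ?case by (simp add: distrib_right pol.pol_add)
next
 case (pol_coord m f b)
 thus ?case using pol.pol_coord[of "m + n" "%x. f x * g x" b] by (simp add: mult.assoc)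
qed

lemma pol_coord1: "b \<in> Basis ==> pol 1 (%x. cor (inner x b))" using pol_coord[OF pol_const[of 0 1]] by simp

lemma pol_sum: "(!!i. i \<in> I ==> pol m (f i)) ==> pol m (%x. \<Sum>i\<in>I. f i x)" by (induction I rule: infinite_finite_induct) (auto intro: pol.intros)

lemma pol_diff: "pol m f ==> pol m g ==> pol m (%x. f x - g x)" using pol_add[OF _ pol_cmult[of m g "-1"]] by simp

lemma pol_norm_sq: "pol 2 (%x::'a::euclidean_space. cor (inner x x))"
proof -
 have "pol 2 (%x::'a. \<Sum>b\<in>Basis. cor (inner x b) * cor (inner x b))" by (rule pol_sum) (use pol_mult[OF pol_coord1 pol_coord1] in \<open>simp add: numeral_2_eq_2\<close>)
 also have "(%x::'a. \<Sum>b\<in>Basis. cor (inner x b) * cor (inner x b))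
   = (%x. cor (inner x x))"
 proof
  fix x :: 'a
  have *: "inner x x = (\<Sum>b\<in>Basis. inner x b * inner x b)" by (rule euclidean_inner)
  show "(\<Sum>b\<in>Basis. cor (inner x b) * cor (inner x b)) = cor (inner x x)" by (subst *) simp
 qed
 finally show ?thesis .
qed

lemma pol_sm: "pol m f ==> f \<in> sm" by (induction rule: pol.induct) (auto intro: sm.intros)

lemma pol_smooth: "pol m f ==> smooth f" by (rule sm_smooth[OF pol_sm])
lemma pol_dff: "pol m f ==> dff f" by (rule smooth_dff[OF pol_smooth])
lemma pol_cont: "pol m f ==> continuous_on S f" by (rule dff_cont[OF pol_dff])

lemma pol_pd: "pol m f ==> pol (m - 1) (pd h f) & (m = 0 --> pd h f = (%_. 0))"
proof (induction rule: pol.induct)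
 case (pol_const m c)
 thus ?case by (simp add: pd_const pol.pol_const)
next
 case (pol_add m f g)
 thus ?case by (simp add: pd_add pol_dff pol.pol_add)
next
 case (pol_coord m f b)
 have eq: "pd h (%x. cor (inner x b) * f x)
   = (%x. cor (inner x b) * pd h f x + cor (inner h b) * f x)" by (simp add: pd_mult pd_coord pol_dff[OF pol_coord(1)])
 have "pol m (%x. cor (inner x b) * pd h f x)"
 proof (cases m)
  case 0
  thus ?thesis using pol_coord by (simp add: pol.pol_const)
 next
  case (Suc k)
  thus ?thesis using pol.pol_coord[of k "pd h f" b] pol_coord by simp
 qed
 thus ?case unfolding eq using pol_coord by (simp add: pol.pol_add pol_cmult)
qed

text \<open>Symmetry of second derivatives is obtained algebraically for polynomials;
  \<open>tst_pd_comm\<close> transfers it to test functions by duality.\<close>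

lemma pol_pd_comm: "pol m f ==> pd b (pd c f) = pd c (pd b f)"
proof (induction rule: pol.induct)
 case (pol_const m k)
 thus ?case by (simp add: pd_const)
next
 case (pol_add m f g)
 thus ?case using pol_pd[OF pol_add(1), THEN conjunct1, THEN pol_dff] pol_pd[OF pol_add(2), THEN conjunct1, THEN pol_dff] by (simp add: pd_add pol_dff)
next
 case (pol_coord m f a)
 note d = pol_dff[OF pol_coord(1)] pol_pd[OF pol_coord(1), THEN conjunct1, THEN pol_dff]
 have eq: "pd h (%x. cor (inner x a) * f x)
   = (%x. cor (inner x a) * pd h f x + cor (inner h a) * f x)" for h by (simp add: pd_mult pd_coord d)
 have "pd k (%x. cor (inner x a) * pd h f x + cor (inner h a) * f x)
  = (%x. cor (inner x a) * pd k (pd h f) x + cor (inner k a) * pd h f x + cor (inner h a) * pd k f x)" for h k by (simp add: pd_add pd_mult pd_coord pd_cmult d)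
 thus ?case unfolding eq using pol_coord(3) by (simp add: algebra_simps)
qed

lemma real_polynomial_pol:
 "real_polynomial_function p ==> EX m. pol m (%x::'a::euclidean_space. cor (p x))"
proof (induction rule: real_polynomial_function.induct)
 case (linear f)
 interpret bounded_linear f by fact
 have "pol 1 (%x::'a. \<Sum>b\<in>Basis. cor (f b) * cor (inner x b))" by (intro pol_sum pol_cmult pol_coord1)
 also have "(%x::'a. \<Sum>b\<in>Basis. cor (f b) * cor (inner x b)) = (%x. cor (f x))"
 proof
  fix x :: 'a
  have "f x = f (\<Sum>b\<in>Basis. inner x b *\<^sub>R b)" by (simp add: euclidean_representation)
  also have "... = (\<Sum>b\<in>Basis. f b * inner x b)" by (simp add: sum scaleR mult.commute)
  finally show "(\<Sum>b\<in>Basis. cor (f b) * cor (inner x b)) = cor (f x)" by simp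
 qed
 finally show ?case by blast
next
 case (const c)
 thus ?case by (intro exI pol_const)
next
 case (add f g)
 then obtain m n where "pol m (%x. cor (f x))" "pol n (%x. cor (g x))" by blast
 hence "pol (max m n) (%x. cor (f x) + cor (g x))" by (intro pol_add) (auto elim: pol_mono)
 thus ?case by auto
next
 case (mult f g)
 then obtain m n where "pol m (%x. cor (f x))" "pol n (%x. cor (g x))" by blast
 from pol_mult[OF this] show ?case by auto
qed

subsection \<open>Density\<close>

lemma cont_L2:
 fixes f :: "'a::euclidean_space cf"
 assumes "continuous_on UNIV f" shows "f \<in> L2 MB"
proof -
 interpret finite_measure "MB :: 'a measure" by (rule finite_measure_MB)
 have [measurable]: "f \<in> borel_measurable borel" using assms by (rule borel_measurable_continuous_onI)
 have "compact (f ` cball 0 1)" by (intro compact_continuous_image continuous_on_subset[OF assms]) auto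
 then obtain B where B: "B > 0" "!!x. x \<in> cball 0 1 ==> norm (f x) <= B" using compact_imp_bounded[of "f ` cball 0 1"] by (auto simp: bounded_pos)
 show ?thesis
 proof (rule L2_bound)
  show "f \<in> borel_measurable MB" by (rule measurable_restrict_space1) (auto intro: measurable_completion)
  show "integrable MB (%_::'a. B^2)" by simp
  show "(cmod (f x))^2 <= B^2" if "x \<in> space MB" for x using that B(2)[of x] by (intro power_mono) auto
 qed
qed

lemma smooth_L2: "smooth f ==> f \<in> L2 MB" by (rule cont_L2[OF dff_cont[OF smooth_dff]])

lemma tst_L2: "tst f ==> f \<in> L2 MB" by (rule smooth_L2[OF tst_smooth])
lemma pol_L2: "pol m f ==> f \<in> L2 MB" by (rule smooth_L2[OF pol_smooth])

lemma L2_bounded_mult: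
 assumes f: "f \<in> L2 M" and g: "g \<in> borel_measurable M" "!!x. x \<in> space M ==> norm (g x) <= B"
 shows "(%x. g x * f x) \<in> L2 M"
proof (rule L2_bound)
 note [measurable] = L2D(1)[OF f] g(1)
 show "(%x. g x * f x) \<in> borel_measurable M" by measurable
 show "integrable M (%x. B^2 * (cmod (f x))^2)" using L2D(2)[OF f] by simp
 show "(cmod (g x * f x))^2 <= B^2 * (cmod (f x))^2" if "x \<in> space M" for x unfolding norm_mult power_mult_distrib by (intro mult_right_mono power_mono g that) auto
qed

lemma orth_pol_continuous:
 fixes f :: "'a::euclidean_space cf" and g :: "'a => real"
 assumes f: "f \<in> L2 MB" and z: "!!m p. pol m p ==> (LINT x|MB. f x * p x) = 0"
  and g: "continuous_on UNIV g"
 shows "(LINT x|MB. f x * cor (g x)) = 0"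
proof -
 let ?I = "LINT x|MB. norm (f x)"
 have int: "integrable MB (%x. f x * cor (h x))" if "continuous_on UNIV h" for h :: "'a => real" by (rule L2_mult_integrable[OF f cont_L2]) (intro continuous_intros that)
 have If: "integrable MB (%x. norm (f x))" using L2_imp_integrable[OF f] by simp
 have "norm (LINT x|MB. f x * cor (g x)) <= e * ?I" if e: "e > 0" for e
 proof -
  obtain p where p: "real_polynomial_function p" "!!x. x \<in> cball 0 1 ==> \<bar>g x - p x\<bar> < e" using Stone_Weierstrass_real_polynomial_function[OF compact_cball continuous_on_subset[OF g subset_UNIV] e] by blast
  have cp: "continuous_on UNIV p" by (simp add: continuous_on_eq_continuous_at continuous_real_polymonial_function p(1))
  obtain m where m: "pol m (%x. cor (p x))" using real_polynomial_pol[OF p(1)] by blast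
  have "(LINT x|MB. f x * cor (g x))
    = (LINT x|MB. f x * cor (g x)) - (LINT x|MB. f x * cor (p x))" using z[OF m] by simp
  also have "... = (LINT x|MB. f x * cor (g x) - f x * cor (p x))" by (rule Bochner_Integration.integral_diff[symmetric]) (intro int g cp)+
  also have "norm ... <= (LINT x|MB. e * norm (f x))"
  proof (rule Bochner_Integration.integral_norm_bound_integral)
   show "integrable MB (%x. f x * cor (g x) - f x * cor (p x))" by (intro Bochner_Integration.integrable_diff int g cp)
   show "integrable MB (%x. e * norm (f x))" using If by simp
   fix x :: 'a assume "x \<in> space MB"
   hence "\<bar>g x - p x\<bar> <= e" using p(2)[of x] by force
   hence "norm (f x) * \<bar>g x - p x\<bar> <= norm (f x) * e" by (intro mult_left_mono) auto
   thus "norm (f x * cor (g x) - f x * cor (p x)) <= e * norm (f x)" by (simp add: norm_mult mult.commute flip: right_diff_distrib of_real_diff)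
  qed
  also have "... = e * ?I" by simp
  finally show ?thesis .
 qed
 hence le: "norm (LINT x|MB. f x * cor (g x)) <= e * ?I" if "e > 0" for e using that by blast
 have I0: "?I >= 0" by (intro integral_nonneg_AE) auto
 have "norm (LINT x|MB. f x * cor (g x)) <= 0 + e" if "e > 0" for e
 proof -
  have "?I / (?I + 1) <= 1" by (rule divide_le_eq_1_pos[THEN iffD2]) (use I0 in linarith)+
  hence "e * (?I / (?I + 1)) <= e * 1" using that by (intro mult_left_mono) auto
  hence "e / (?I + 1) * ?I <= e" by simp
  thus ?thesis using le[of "e / (?I + 1)"] that I0 by (simp add: add_nonneg_pos)
 qed
 hence "norm (LINT x|MB. f x * cor (g x)) <= 0" by (rule field_le_epsilon)
 thus ?thesis by simp
qed

text \<open>The conjugate of \<open>f\<close> is an almost everywhere limit of continuous functions,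
  which are scaled to modulus at most 1 so that \<open>norm (f x)\<close> dominates. In the limit
  the integral of \<open>(norm (f x))^2 / max 1 (norm (f x))\<close> vanishes, which forces
  \<open>f\<close> to vanish.\<close>

lemma orth_pol_zero:
 fixes f :: "'a::euclidean_space cf"
 assumes f: "f \<in> L2 MB" and z: "!!m p. pol m p ==> (LINT x|MB. f x * p x) = 0"
 shows "AE x in MB. f x = 0"
proof -
 note [measurable] = L2D(1)[OF f]
 define h where "h x = cnj (f x)" for x
 have hL: "h \<in> L2 MB" unfolding h_def by (rule L2_cnj[OF f])
 have "h measurable_on (ball 0 1)" using L2D(1)[OF hL] by (simp add: measurable_on_iff_borel_measurable)
 then obtain N g where N: "negligible N" and g: "!!n. continuous_on UNIV (g n)"
  and lim: "!!x. x \<notin> N ==> (%n::nat. g n x) ----> (if x \<in> ball 0 1 then h x else 0)" unfolding measurable_on_def by metis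
 define k :: "nat => 'a => complex" where "k n x = g n x / of_real (max 1 (norm (g n x)))" for n x
 have k1: "norm (k n x) <= 1" for n x by (simp add: k_def norm_divide divide_le_eq)
 have kc: "continuous_on UNIV (k n)" for n unfolding k_def by (intro continuous_intros g) (metis max.cobounded1 not_one_le_zero of_real_eq_0_iff)
 have kL: "k n \<in> L2 MB" for n by (rule cont_L2[OF kc])
 note [measurable] = L2D(1)[OF kL]
 have zero: "(LINT x|MB. f x * k n x) = 0" for n
 proof -
  have c: "continuous_on UNIV (%x. Re (k n x))" "continuous_on UNIV (%x. Im (k n x))" by (intro continuous_intros kc)+
  have i: "integrable MB (%x. f x * cor (Re (k n x)))" "integrable MB (%x. \<i> * (f x * cor (Im (k n x))))" by (intro L2_mult_integrable[OF f cont_L2] integrable_mult_right continuous_intros c)+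
  have "(LINT x|MB. f x * k n x) = (LINT x|MB. f x * cor (Re (k n x)) + \<i> * (f x * cor (Im (k n x))))"
  proof (rule Bochner_Integration.integral_cong[OF refl])
   fix x
   have "f x * k n x = f x * (cor (Re (k n x)) + \<i> * cor (Im (k n x)))" by (simp flip: complex_eq)
   thus "f x * k n x = f x * cor (Re (k n x)) + \<i> * (f x * cor (Im (k n x)))" by (simp add: algebra_simps)
  qed
  also have "... = 0" using i orth_pol_continuous[OF f z c(1)] orth_pol_continuous[OF f z c(2)] by simp
  finally show ?thesis .
 qed
 define K where "K x = h x / of_real (max 1 (norm (h x)))" for x
 have AEN: "AE x in MB. x \<notin> N"
 proof -
  have "AE x in lebesgue. x \<notin> N" using N by (simp add: negligible_iff_null_sets AE_not_in)
  thus ?thesis by (auto simp: AE_restrict_space_iff elim: eventually_mono)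
 qed
 have "(%n. LINT x|MB. f x * k n x) ----> (LINT x|MB. f x * K x)"
 proof (rule integral_dominated_convergence[where w="%x. norm (f x)"])
  show "(%x. f x * K x) \<in> borel_measurable MB" unfolding K_def h_def using L2D(1)[OF L2_cnj[OF f]] by measurable
  show "(%x. f x * k n x) \<in> borel_measurable MB" for n by measurable
  show "integrable MB (%x. norm (f x))" using L2_imp_integrable[OF f] by simp
  show "AE x in MB. (%n. f x * k n x) ----> f x * K x" using AEN AE_space
  proof eventually_elim
   case (elim x)
   hence "(%n. g n x) ----> h x" using lim[of x] by simp
   moreover have "cor (max 1 (cmod (h x))) ~= 0" by (metis max.cobounded1 not_one_le_zero of_real_eq_0_iff)
   ultimately show ?case unfolding k_def K_def by (intro tendsto_intros)
  qed
  show "AE x in MB. norm (f x * k n x) <= norm (f x)" for n by (rule AE_I2) (simp add: norm_mult k1 mult_left_le)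
 qed
 hence "(LINT x|MB. f x * K x) = 0" using zero by (simp add: LIMSEQ_const_iff)
 moreover have fK: "f x * K x = cor ((norm (f x))^2 / max 1 (norm (f x)))" for x unfolding K_def h_def by (simp only: times_divide_eq_right complex_norm_square[symmetric] of_real_divide complex_mod_cnj)
 ultimately have I0: "(LINT x|MB. (norm (f x))^2 / max 1 (norm (f x))) = 0" by (simp only: fK integral_complex_of_real of_real_eq_0_iff)
 have nn: "0 <= (norm (f x))^2 / max 1 (norm (f x))" for x by (simp add: max_def)
 have "(norm (f x))^2 / max 1 (norm (f x)) <= (norm (f x))^2 / 1" for x by (intro divide_left_mono) auto
 hence "integrable MB (%x. (norm (f x))^2 / max 1 (norm (f x)))" using nn by (intro Bochner_Integration.integrable_bound[OF L2D(2)[OF f]]) (auto intro!: AE_I2)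
 from integral_nonneg_eq_0_iff_AE[OF this] nn I0
 have "AE x in MB. (norm (f x))^2 / max 1 (norm (f x)) = 0" by auto
 thus ?thesis by (rule AE_mp) (auto simp: max_def split: if_splits)
qed

lemma bumpf_tst:
 assumes e: "ep > 0" and r: "rh < 1" and p: "p \<in> sm"
 shows "tst (%x. bumpf ep n rh x * p x)"
proof -
 have "smooth (%x. bumpf ep n rh x * p x)" by (intro sm_smooth sm.intros e p)
 moreover have "EX r<1. ALL x. norm x > r --> bumpf ep n rh x * p x = 0"
 proof (intro exI[of _ "sqrt (max 0 rh)"] conjI allI impI)
  show "sqrt (max 0 rh) < 1" using r by simp
  fix x :: 'a assume "sqrt (max 0 rh) < norm x"
  hence "(sqrt (max 0 rh))^2 < (norm x)^2" by (intro power_strict_mono) auto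
  hence "rh - inner x x < 0" by (simp add: power2_norm_eq_inner)
  thus "bumpf ep n rh x * p x = 0" by (simp add: bumpf_def bmp_def)
 qed
 ultimately show ?thesis by (simp add: tst_def)
qed

lemma bmp0_le_1: "ep > 0 ==> bmp ep 0 t <= 1" by (simp add: bmp_def)

text \<open>A cutoff times a polynomial is a test function, so a cutoff times \<open>f\<close>
  annihilates all polynomials and vanishes; the cutoffs are positive on balls that exhaust the unit
  ball.\<close>

lemma orth_tst_zero:
 fixes f :: "'a::euclidean_space cf"
 assumes f: "f \<in> L2 MB" and z: "!!fi. tst fi ==> (LINT x|MB. f x * fi x) = 0"
 shows "AE x in MB. f x = 0"
proof -
 define rh where "rh n = 1 - 1 / real (Suc n)" for n
 have bm: "bumpf 1 0 (rh n) \<in> borel_measurable MB" for n by (rule L2D(1)[OF smooth_L2[OF sm_smooth[OF sm_bump]]]) simp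
 have "AE x in MB. bumpf 1 0 (rh n) x * f x = 0" for n
 proof (rule orth_pol_zero)
  show "(%x. bumpf 1 0 (rh n) x * f x) \<in> L2 MB" by (rule L2_bounded_mult[OF f bm, of _ 1]) (simp add: bumpf_def bmp_nonneg bmp0_le_1)
  fix m and p :: "'a cf" assume p: "pol m p"
  have "tst (%x. bumpf 1 0 (rh n) x * p x)" by (rule bumpf_tst) (auto simp: rh_def pol_sm[OF p])
  from z[OF this] show "(LINT x|MB. bumpf 1 0 (rh n) x * f x * p x) = 0" by (simp add: mult_ac)
 qed
 hence "AE x in MB. ALL n. bumpf 1 0 (rh n) x * f x = 0" by (intro AE_all_countable[THEN iffD2] allI)
 thus ?thesis using AE_space
 proof eventually_elim
  case (elim x)
  hence "inner x x < 1" by (simp add: power_less_one_iff flip: power2_norm_eq_inner)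
  moreover have "rh ----> 1" using tendsto_diff[OF tendsto_const LIMSEQ_Suc[OF lim_1_over_n], of 1] by (simp add: rh_def[abs_def])
  ultimately have "\<forall>\<^sub>F n in sequentially. inner x x < rh n" by (rule order_tendstoD(1)[rotated])
  then obtain n where "inner x x < rh n" by (auto simp: eventually_sequentially)
  hence "bumpf 1 0 (rh n) x ~= 0" by (simp add: bumpf_def bmp_def)
  thus ?case using elim by auto
 qed
qed

lemma continuous_AE_zero:
 fixes F :: "'a::euclidean_space cf"
 assumes "continuous_on UNIV F" "AE x in MB. F x = 0" "x \<in> ball 0 1" shows "F x = 0"
proof -
 have "x \<in> {x. F x = 0}"
 proof (rule mem_closed_if_AE_lebesgue_open[OF open_ball _ _ assms(3)])
  show "closed {x. F x = 0}" by (intro closed_Collect_eq continuous_intros assms)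
  show "AE x\<in>ball 0 1 in lebesgue. x \<in> {x. F x = 0}" using assms(2) by (simp add: AE_restrict_space_iff)
 qed
 thus ?thesis by simp
qed

subsection \<open>Derivatives of test functions in the Hilbert space\<close>

text \<open>Two integrations by parts against a polynomial move both derivatives onto it, where they
  commute. The difference of the mixed derivatives therefore annihilates all polynomials, and it is
  continuous.\<close>

lemma tst_pd_comm:
 fixes fi :: "'a::euclidean_space cf"
 assumes t: "tst fi" and b: "b \<in> Basis" and c: "c \<in> Basis"
 shows "pd b (pd c fi) = pd c (pd b fi)"
proof -
 define F where "F x = pd b (pd c fi) x - pd c (pd b fi) x" for x
 have tF: "tst F" unfolding F_def by (intro tst_diff tst_pd t b c)
 have two: "(LINT x|MB. p x * pd b (pd c fi) x) = (LINT x|MB. pd c (pd b p) x * fi x)"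
  if p: "pol m p" and b: "b \<in> Basis" and c: "c \<in> Basis" for m p b c
 proof -
  note p1 = pol_pd[OF p, THEN conjunct1]
  have "(LINT x|MB. p x * pd b (pd c fi) x) = - (LINT x|MB. pd b p x * pd c fi x)" by (rule ibp[OF tst_pd[OF t c] pol_dff[OF p] pol_cont[OF p1] b])
  also have "(LINT x|MB. pd b p x * pd c fi x) = - (LINT x|MB. pd c (pd b p) x * fi x)" by (rule ibp[OF t pol_dff[OF p1] pol_cont[OF pol_pd[OF p1, THEN conjunct1]] c])
  finally show ?thesis by simp
 qed
 have "AE x in MB. F x = 0"
 proof (rule orth_pol_zero[OF tst_L2[OF tF]])
  fix m and p :: "'a cf" assume p: "pol m p"
  have i: "integrable MB (%x. p x * pd b (pd c fi) x)" "integrable MB (%x. p x * pd c (pd b fi) x)" by (intro L2_mult_integrable pol_L2[OF p] tst_L2 tst_pd t b c)+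
  have "(LINT x|MB. F x * p x) = (LINT x|MB. p x * pd b (pd c fi) x - p x * pd c (pd b fi) x)" by (intro Bochner_Integration.integral_cong refl) (simp add: F_def algebra_simps)
  also have "... = (LINT x|MB. pd c (pd b p) x * fi x) - (LINT x|MB. pd b (pd c p) x * fi x)" using two[OF p b c] two[OF p c b] i by simp
  also have "... = 0" by (simp add: pol_pd_comm[OF p, of b c])
  finally show "(LINT x|MB. F x * p x) = 0" .
 qed
 hence in0: "F x = 0" if "x \<in> ball 0 1" for x using continuous_AE_zero[OF dff_cont[OF smooth_dff[OF tst_smooth[OF tF]]] _ that] by blast
 moreover have "F x = 0" if "x \<notin> ball 0 1" for x using tF that by (force simp: tst_def)
 ultimately show ?thesis by (auto simp: F_def fun_eq_iff)
qed

lemma L2_inner_ibp: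
 assumes ps: "tst ps" and g: "dff g" "continuous_on UNIV (pd b g)" and b: "b \<in> Basis"
 shows "L2_inner MB g (pd b ps) = - L2_inner MB (pd b g) ps" using ibp[OF tst_cnj[OF ps] g b] pd_cnj(2)[OF smooth_dff[OF tst_smooth[OF ps]], of b] by (simp add: L2_inner_def)

lemma inner_ibp:
 assumes "tst fi" "tst ps" "b \<in> Basis"
 shows "inner (mk fi) (mk (pd b ps)) = - inner (mk (pd b fi)) (mk ps)" using L2_inner_ibp[OF assms(2) smooth_dff[OF tst_smooth] smooth_pd_cont[OF tst_smooth] assms(3), of fi] assms by (simp add: inner_mk tst_L2 tst_pd)

definition lap :: "('a::euclidean_space cf) => 'a => complex" where
 "lap f x = (\<Sum>b\<in>Basis. pd b (pd b f) x)"

lemma lap_partials: "(\<Sum>b\<in>Basis. partials [b, b] f x) = lap f x" by (simp add: lap_def pd_def)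

lemma tst_lap: "tst f ==> tst (lap f)" unfolding lap_def[abs_def] by (intro tst_sum tst_pd)

lemma mk_sum:
 assumes "!!i. i \<in> I ==> f i \<in> L2 MB"
 shows "mk (%x. \<Sum>i\<in>I. f i x) = (\<Sum>i\<in>I. mk (f i)) & (%x. \<Sum>i\<in>I. f i x) \<in> L2 MB" using assms by (induction I rule: infinite_finite_induct) (auto simp: mk_zero mk_add L2_zero L2_add)

lemma mk_lap: "tst f ==> mk (lap f) = (\<Sum>b\<in>Basis. mk (pd b (pd b f)))" unfolding lap_def[abs_def] by (intro mk_sum[THEN conjunct1] tst_L2 tst_pd)

lemma tst_grad: "tst f ==> b \<in> Basis ==> (norm (mk (pd b f)))^2 = - inner (mk f) (mk (pd b (pd b f)))" using inner_ibp[OF _ tst_pd, of f f b] by (simp add: power2_norm_eq_inner)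

lemma tst_grad_sum: "tst f ==> (\<Sum>b\<in>Basis. (norm (mk (pd b f)))^2) = - inner (mk f) (mk (lap f))" by (simp add: tst_grad mk_lap inner_sum_right sum_negf)

lemma tst_hess:
 assumes f: "tst f" and b: "b \<in> Basis" and c: "c \<in> Basis"
 shows "(norm (mk (pd c (pd b f))))^2 = inner (mk (pd b (pd b f))) (mk (pd c (pd c f)))"
proof -
 have "pd c (pd c (pd b f)) = pd b (pd c (pd c f))" using tst_pd_comm[OF f c b] tst_pd_comm[OF tst_pd[OF f c] c b] by simp
 thus ?thesis using tst_grad[OF tst_pd[OF f b] c] inner_ibp[OF tst_pd[OF f b] tst_pd[OF tst_pd[OF f c] c] b] by simp
qed

text \<open>Integration by parts turns the square of a mixed derivative into a product of two pure
  ones. The Laplacian alone thus controls all second derivatives of a test function, which is why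
  the graph norm is as strong as the H^2 norm.\<close>

lemma tst_hess_sum: "tst f ==> (\<Sum>b\<in>Basis. \<Sum>c\<in>Basis. (norm (mk (pd c (pd b f))))^2) = (norm (mk (lap f)))^2"
proof -
 assume f: "tst f"
 have "(norm (mk (lap f)))^2 = (\<Sum>b\<in>Basis. \<Sum>c\<in>Basis. inner (mk (pd b (pd b f))) (mk (pd c (pd c f))))" unfolding mk_lap[OF f] power2_norm_eq_inner inner_sum_left inner_sum_right by (rule sum.swap)
 thus ?thesis using f by (simp add: tst_hess)
qed

lemma tst_hess_le:
 assumes f: "tst f" and b: "b \<in> Basis" and c: "c \<in> Basis"
 shows "norm (mk (pd c (pd b f))) <= norm (mk (lap f))"
proof (rule power2_le_imp_le)
 have "(norm (mk (pd c (pd b f))))^2 <= (\<Sum>c\<in>Basis. (norm (mk (pd c (pd b f))))^2)" by (rule member_le_sum) (use c in auto)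
 also have "... <= (\<Sum>b\<in>Basis. \<Sum>c\<in>Basis. (norm (mk (pd c (pd b f))))^2)"
  by (rule member_le_sum[where f="%b. \<Sum>c\<in>Basis. (norm (mk (pd c (pd b f))))^2"]) (use b in \<open>auto intro: sum_nonneg\<close>)
 finally show "(norm (mk (pd c (pd b f))))^2 <= (norm (mk (lap f)))^2" unfolding tst_hess_sum[OF f] .
qed simp

text \<open>The derivative 1 of the coordinate \<open>inner x b\<close> is integrated by parts
  against the square of the modulus of \<open>f\<close>; the coordinate is at most 1 in modulus on
  the ball, and the 2 counts the two terms of the product rule.\<close>

lemma poincare:
 assumes f: "tst f" and b: "b \<in> Basis"
 shows "norm (mk f) <= 2 * norm (mk (pd b f))"
proof -
 let ?g = "%x. cor (inner x b) * f x"
 have xs: "(%x. cor (inner x b)) \<in> sm" by (rule sm_coord)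
 have xd: "dff (%x. cor (inner x b))" by (rule pd_coord)
 have fd: "dff f" by (rule smooth_dff[OF tst_smooth[OF f]])
 have cx: "continuous_on UNIV (%x. cor (inner x b))" by (intro continuous_intros)
 have pg: "pd b ?g = (%x. cor (inner x b) * pd b f x + f x)" using b by (simp add: pd_mult pd_coord xd fd)
 have cpf: "continuous_on UNIV (pd b f)" by (rule smooth_pd_cont[OF tst_smooth[OF f] b])
 have gL: "?g \<in> L2 MB" "(%x. cor (inner x b) * pd b f x) \<in> L2 MB" by (intro cont_L2 continuous_intros dff_cont[OF fd] cpf)+
 have "L2_inner MB ?g (pd b f) = - L2_inner MB (pd b ?g) f" by (rule L2_inner_ibp[OF f _ _ b])
   (auto simp: pg pd_mult xd fd intro!: continuous_intros cpf dff_cont[OF fd])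
 also have "L2_inner MB (pd b ?g) f = L2_inner MB (%x. cor (inner x b) * pd b f x) f + L2_inner MB f f" unfolding pg by (intro L2_inner_add_left gL tst_L2 f)
 finally have "Re (L2_inner MB f f) = - Re (L2_inner MB ?g (pd b f)) - Re (L2_inner MB (%x. cor (inner x b) * pd b f x) f)" by simp
 hence eq: "(norm (mk f))^2 = - inner (mk ?g) (mk (pd b f)) - inner (mk (%x. cor (inner x b) * pd b f x)) (mk f)" using f b gL by (simp add: power2_norm_eq_inner inner_mk tst_L2 tst_pd)
 have le: "norm (mk (%x. cor (inner x b) * u x)) <= norm (mk u)" if u: "u \<in> L2 MB" for u
 proof (rule power2_le_imp_le)
  have xb: "(cmod (cor (inner x b)))^2 <= 1" if "x \<in> space MB" for x
  proof -
   have "\<bar>inner x b\<bar> <= norm x * norm b" by (rule Cauchy_Schwarz_ineq2)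
   also have "... <= 1" using that b by simp
   finally show ?thesis by (simp add: abs_square_le_1)
  qed
  have uL: "(%x. cor (inner x b) * u x) \<in> L2 MB" by (rule L2_bounded_mult[OF u L2D(1)[OF cont_L2[OF cx]], of 1]) (use xb in \<open>force simp: abs_square_le_1\<close>)
  show "(norm (mk (%x. cor (inner x b) * u x)))^2 <= (norm (mk u))^2" unfolding norm_mk_sq[OF uL] norm_mk_sq[OF u]
  proof (rule integral_mono[OF L2D(2)[OF uL] L2D(2)[OF u]])
   fix x :: 'a assume "x \<in> space MB"
   thus "(cmod (cor (inner x b) * u x))^2 <= (cmod (u x))^2" unfolding norm_mult power_mult_distrib using xb by (intro mult_left_le_one_le) auto
  qed
 qed simp
 have "(norm (mk f))^2 <= norm (mk ?g) * norm (mk (pd b f)) + norm (mk (%x. cor (inner x b) * pd b f x)) * norm (mk f)" unfolding eq using norm_cauchy_schwarz[of "- mk ?g" "mk (pd b f)"]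
   norm_cauchy_schwarz[of "- mk (%x. cor (inner x b) * pd b f x)" "mk f"] by simp
 also have "... <= norm (mk f) * norm (mk (pd b f)) + norm (mk (pd b f)) * norm (mk f)" by (intro add_mono mult_right_mono le tst_L2 tst_pd f b) auto
 finally have "norm (mk f) * norm (mk f) <= norm (mk f) * (2 * norm (mk (pd b f)))" by (simp add: power2_eq_square mult.commute)
 thus ?thesis by (cases "mk f = 0") auto
qed

lemma tst_pd_le:
 assumes f: "tst f" and b: "b \<in> Basis" shows "norm (mk (pd b f)) <= 2 * norm (mk (lap f))" using poincare[OF tst_pd[OF f b] b] tst_hess_le[OF f b b] by linarith

lemma tst_le:
 assumes f: "tst f" shows "norm (mk f) <= 4 * norm (mk (lap f))"
proof -
 obtain b where "b \<in> (Basis :: 'a set)" using nonempty_Basis by blast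
 thus ?thesis using poincare[OF f] tst_pd_le[OF f] by force
qed

subsection \<open>Compactness of the embedding\<close>

lemma nn_integral_translate:
 fixes f :: "'a::euclidean_space => ennreal"
 assumes "f \<in> borel_measurable borel"
 shows "(\<integral>\<^sup>+x. f (x + a) \<partial>lborel) = (\<integral>\<^sup>+x. f x \<partial>lborel)"
proof -
 have "(\<integral>\<^sup>+x. f x \<partial>lborel) = (\<integral>\<^sup>+x. f x \<partial>distr lborel borel ((+) a))" by (simp add: lborel_distr_plus)
 also have "... = (\<integral>\<^sup>+x. f (a + x) \<partial>lborel)" by (rule nn_integral_distr) (use assms in auto)
 finally show ?thesis by (simp add: add.commute)
qed

text \<open>Jensen's inequality on the unit interval, read off from the nonnegative integral of
  \<open>(norm (g t) - m)^2\<close>.\<close>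

lemma norm_integral_sq_le:
 fixes g :: "real => complex"
 assumes g: "continuous_on {0..1} g" and I: "(g has_integral I) {0..1}"
 shows "(norm I)^2 <= integral {0..1} (%t. (norm (g t))^2)"
proof -
 define m where "m = integral {0..1} (%t. norm (g t))"
 have i1: "(%t. norm (g t)) integrable_on {0..1}" and i2: "(%t. (norm (g t))^2) integrable_on {0..1}" by (intro integrable_continuous_real continuous_intros g)+
 have "norm I <= m" unfolding m_def using has_integral_norm_bound_integral_component I i1 integral_norm_bound_integral[of g "{0..1}" "%t. norm (g t)"] by (auto simp: has_integral_iff)
 hence "(norm I)^2 <= m^2" by (intro power_mono) auto
 also have "m^2 <= integral {0..1} (%t. (norm (g t))^2)"
 proof -
  have "0 <= integral {0..1} (%t. (norm (g t) - m)^2)" by (rule Henstock_Kurzweil_Integration.integral_nonneg) (auto intro!: integrable_continuous_real continuous_intros g)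
  also have "(%t. (norm (g t) - m)^2) = (%t. (norm (g t))^2 - 2 * m * norm (g t) + m^2)" by (simp add: power2_diff fun_eq_iff)
  also have "integral {0..1} ... = integral {0..1} (%t. (norm (g t))^2) - 2 * m * m + m^2" by (rule integral_unique)
    (use has_integral_add[OF has_integral_diff[OF integrable_integral[OF i2]
      has_integral_mult_right[OF integrable_integral[OF i1], of "2 * m"]] has_integral_const_real[of "m^2" 0 1]]
     in \<open>simp add: m_def\<close>)
  finally show ?thesis by (simp add: power2_eq_square)
 qed
 finally show ?thesis .
qed

lemma pd_sq_le:
 fixes f :: "'a::euclidean_space cf"
 assumes "dff f"
 shows "(norm (pd z f x))^2 <= (norm z)^2 * (\<Sum>b\<in>Basis. (norm (pd b f x))^2)"
proof -
 have "norm (pd z f x) <= (\<Sum>b\<in>Basis. \<bar>inner z b\<bar> * norm (pd b f x))" unfolding pd_linear_expand[OF assms, of z] by (rule order_trans[OF norm_sum]) simp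
 hence "(norm (pd z f x))^2 <= (\<Sum>b\<in>Basis. \<bar>inner z b\<bar> * norm (pd b f x))^2" by (intro power_mono) auto
 also have "... <= (\<Sum>b\<in>Basis. \<bar>inner z b\<bar>^2) * (\<Sum>b\<in>Basis. (norm (pd b f x))^2)" by (rule Cauchy_Schwarz_ineq_sum)
 also have "(\<Sum>b\<in>Basis. \<bar>inner z b\<bar>^2) = (norm z)^2" unfolding power2_norm_eq_inner by (subst euclidean_inner) (simp add: power2_eq_square)
 finally show ?thesis .
qed

lemma tst_nn_norm:
 assumes "tst f" shows "(\<integral>\<^sup>+x. ennreal ((norm (f x))^2) \<partial>lborel) = ennreal ((norm (mk f))^2)"
proof -
 obtain r where r: "r < 1" "!!x. norm x > r ==> f x = 0" using assms by (auto simp: tst_def)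
 have c: "continuous_on UNIV f" by (rule dff_cont[OF smooth_dff[OF tst_smooth[OF assms]]])
 have cc: "continuous_on UNIV (%x. cor ((norm (f x))^2))" by (intro continuous_intros c)
 have int: "integrable lborel (%x. cor ((norm (f x))^2))" by (rule integrable_compact_support[OF cc, of r]) (simp add: r(2))
 have "(LINT x|MB. cor ((norm (f x))^2)) = (LINT x|lborel. cor ((norm (f x))^2))" by (rule MB_integral[OF cc r(1)]) (simp add: r(2))
 hence "(LINT x|MB. (norm (f x))^2) = (LINT x|lborel. (norm (f x))^2)" by (simp only: integral_complex_of_real of_real_eq_iff)
 hence "(norm (mk f))^2 = (LINT x|lborel. (norm (f x))^2)" by (simp add: norm_mk_sq tst_L2[OF assms])
 moreover have "integrable lborel (%x. (norm (f x))^2)" using int by (simp only: complex_of_real_integrable_eq)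
 ultimately show ?thesis by (simp add: nn_integral_eq_integral)
qed

text \<open>The increment is the integral of the directional derivative \<open>pd z f\<close> along
  a segment; Jensen's inequality, Fubini and translation invariance give the bound.\<close>

lemma translate_difference_le:
 fixes f :: "'a::euclidean_space cf"
 assumes f: "tst f"
 shows "(\<integral>\<^sup>+x. ennreal ((norm (f (x + z) - f x))^2) \<partial>lborel)
  <= ennreal ((norm z)^2 * (\<Sum>b\<in>Basis. (norm (mk (pd b f)))^2))"
proof -
 have fd: "dff f" by (rule smooth_dff[OF tst_smooth[OF f]])
 have cb: "continuous_on S (pd b f)" if "b \<in> Basis" for b S by (rule smooth_pd_cont[OF tst_smooth[OF f] that])
 define g where "g = pd z f"
 have gc: "continuous_on S g" for S unfolding g_def using pd_linear_expand[OF fd, of z] by (simp add: fun_eq_iff[symmetric] cong: continuous_on_cong)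
   (intro continuous_intros cb)
 have gm [measurable]: "g \<in> borel_measurable borel" using gc by (rule borel_measurable_continuous_onI)
 have 1: "ennreal ((norm (f (x + z) - f x))^2) <= (\<integral>\<^sup>+t. ennreal (indicator {0..1} t * (norm (g (x + t *\<^sub>R z)))^2) \<partial>lborel)" for x
 proof -
  have gx: "continuous_on S (%t. g (x + t *\<^sub>R z))" for S by (rule continuous_on_compose2[OF gc[of UNIV]]) (auto intro!: continuous_intros)
  have "((%t. g (x + t *\<^sub>R z)) has_integral (f (x + 1 *\<^sub>R z) - f (x + 0 *\<^sub>R z))) {0..1}"
  proof (rule fundamental_theorem_of_calculus)
   fix t :: real assume "t \<in> {0..1}"
   have a: "((%t. x + t *\<^sub>R z) has_derivative (%r. r *\<^sub>R z)) (at t within {0..1})" by (auto intro!: derivative_eq_intros)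
   have b: "(f has_derivative (%k. pd k f (x + t *\<^sub>R z))) (at (x + t *\<^sub>R z) within (%t. x + t *\<^sub>R z) ` {0..1})" by (rule has_derivative_at_withinI[OF dff_deriv[OF fd]])
   have lin: "pd (r *\<^sub>R z) f y = r *\<^sub>R pd z f y" for r y using bounded_linear.linear[OF has_derivative_bounded_linear[OF dff_deriv[OF fd, of y]]] linear_cmul by blast
   show "((%t. f (x + t *\<^sub>R z)) has_vector_derivative g (x + t *\<^sub>R z)) (at t within {0..1})" using diff_chain_within[OF a b] by (simp add: comp_def lin has_vector_derivative_def g_def)
  qed simp
  from norm_integral_sq_le[OF gx this]
  have le: "(norm (f (x + z) - f x))^2 <= integral {0..1} (%t. (norm (g (x + t *\<^sub>R z)))^2)" by simp
  have hi: "((%t. (norm (g (x + t *\<^sub>R z)))^2) has_integral integral {0..1} (%t. (norm (g (x + t *\<^sub>R z)))^2)) {0..1}" by (intro integrable_integral integrable_continuous_real continuous_intros gx)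
  have "(\<integral>\<^sup>+t. ennreal (indicator {0..1} t * (norm (g (x + t *\<^sub>R z)))^2) \<partial>lborel)
   = ennreal (integral {0..1} (%t. (norm (g (x + t *\<^sub>R z)))^2))"
  proof (rule nn_integral_has_integral_lborel)
   show "(%t. indicator {0..1} t * (norm (g (x + t *\<^sub>R z)))^2) \<in> borel_measurable borel" by measurable
   have eq: "(%t. indicator {0..1} t * (norm (g (x + t *\<^sub>R z)))^2) = (%t. if t \<in> {0..1} then (norm (g (x + t *\<^sub>R z)))^2 else 0)" by (auto simp: indicator_def fun_eq_iff)
   show "((%t. indicator {0..1} t * (norm (g (x + t *\<^sub>R z)))^2) has_integral integral {0..1} (%t. (norm (g (x + t *\<^sub>R z)))^2)) UNIV" unfolding eq has_integral_restrict_UNIV by (rule hi)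
  qed auto
  thus ?thesis using le by (simp add: ennreal_leI)
 qed
 have "(\<integral>\<^sup>+x. ennreal ((norm (f (x + z) - f x))^2) \<partial>lborel)
  <= (\<integral>\<^sup>+x. \<integral>\<^sup>+t. ennreal (indicator {0..1} t * (norm (g (x + t *\<^sub>R z)))^2) \<partial>lborel \<partial>lborel)" by (intro nn_integral_mono 1)
 also have "... = (\<integral>\<^sup>+t. \<integral>\<^sup>+x. ennreal (indicator {0..1} t * (norm (g (x + t *\<^sub>R z)))^2) \<partial>lborel \<partial>lborel)" by (rule lborel_pair.Fubini') measurable
 also have "... <= (\<integral>\<^sup>+t. ennreal ((norm z)^2 * (\<Sum>b\<in>Basis. (norm (mk (pd b f)))^2)) * indicator {0..1} (t::real) \<partial>lborel)"
 proof (rule nn_integral_mono)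
  fix t :: real
  have "(\<integral>\<^sup>+x. ennreal ((norm (g (x + t *\<^sub>R z)))^2) \<partial>lborel) = (\<integral>\<^sup>+x. ennreal ((norm (g x))^2) \<partial>lborel)"
   by (rule nn_integral_translate[of "%x. ennreal ((norm (g x))^2)"]) measurable
  also have "... <= (\<integral>\<^sup>+x. ennreal ((norm z)^2) * (\<Sum>b\<in>Basis. ennreal ((norm (pd b f x))^2)) \<partial>lborel)" using pd_sq_le[OF fd, of z] unfolding g_def
   by (intro nn_integral_mono) (simp add: sum_ennreal ennreal_mult[symmetric] sum_nonneg ennreal_leI)
  also have "... = ennreal ((norm z)^2) * (\<Sum>b\<in>Basis. (\<integral>\<^sup>+x. ennreal ((norm (pd b f x))^2) \<partial>lborel))"
  proof -
   have m: "(%x. ennreal ((norm (pd b f x))^2)) \<in> borel_measurable borel" if "b \<in> Basis" for b using borel_measurable_continuous_onI[OF cb[OF that]] by measurable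
   hence m': "(%x. ennreal ((norm (pd b f x))^2)) \<in> borel_measurable lborel" if "b \<in> Basis" for b using that by simp
   have "(\<integral>\<^sup>+x. (\<Sum>b\<in>Basis. ennreal ((norm (pd b f x))^2)) \<partial>lborel)
     = (\<Sum>b\<in>Basis. (\<integral>\<^sup>+x. ennreal ((norm (pd b f x))^2) \<partial>lborel))" by (rule nn_integral_sum[OF m'])
   moreover have "(\<integral>\<^sup>+x. ennreal ((norm z)^2) * (\<Sum>b\<in>Basis. ennreal ((norm (pd b f x))^2)) \<partial>lborel)
     = ennreal ((norm z)^2) * (\<integral>\<^sup>+x. (\<Sum>b\<in>Basis. ennreal ((norm (pd b f x))^2)) \<partial>lborel)" by (rule nn_integral_cmult) (rule borel_measurable_sum[OF m'])
   ultimately show ?thesis by simp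
  qed
  also have "... = ennreal ((norm z)^2 * (\<Sum>b\<in>Basis. (norm (mk (pd b f)))^2))" by (simp add: tst_nn_norm tst_pd[OF f] sum_ennreal ennreal_mult sum_nonneg)
  finally have le: "(\<integral>\<^sup>+x. ennreal ((norm (g (x + t *\<^sub>R z)))^2) \<partial>lborel)
   <= ennreal ((norm z)^2 * (\<Sum>b\<in>Basis. (norm (mk (pd b f)))^2))" .
  show "(\<integral>\<^sup>+x. ennreal (indicator {0..1} t * (norm (g (x + t *\<^sub>R z)))^2) \<partial>lborel)
   <= ennreal ((norm z)^2 * (\<Sum>b\<in>Basis. (norm (mk (pd b f)))^2)) * indicator {0..1} t" using le by (auto simp: indicator_def)
 qed
 also have "... = ennreal ((norm z)^2 * (\<Sum>b\<in>Basis. (norm (mk (pd b f)))^2))" by (subst nn_integral_cmult_indicator) auto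
 finally show ?thesis .
qed

text \<open>The variance identity: after expanding the square, the cross term factors into the
  squared modulus of the integral of \<open>f\<close> over \<open>Q\<close>.\<close>

lemma double_difference_integral:
 fixes f :: "'a::euclidean_space cf"
 assumes f: "continuous_on UNIV f" "!!x. norm x > r ==> f x = 0"
  and Q: "Q \<in> sets borel" "emeasure lborel Q = ennreal m" "m >= 0"
 shows "(\<integral>\<^sup>+x. \<integral>\<^sup>+y. ennreal (indicator Q x * (indicator Q y * (norm (f x - f y))^2)) \<partial>lborel \<partial>lborel)
  = ennreal (2 * m * (LINT x|lborel. indicator Q x * (norm (f x))^2) - 2 * (norm (LINT x|lborel. indicat_real Q x *\<^sub>R f x))^2)"
proof -
 have [measurable]: "Q \<in> sets borel" by fact
 have [measurable]: "f \<in> borel_measurable borel" using f(1) by (rule borel_measurable_continuous_onI)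
 have fin: "emeasure lborel Q < \<infinity>" using Q by simp
 define a where "a = (LINT x|lborel. indicat_real Q x *\<^sub>R f x)"
 define A where "A = (LINT x|lborel. indicat_real Q x * (norm (f x))^2)"
 have if1: "integrable lborel f" by (rule integrable_compact_support[OF f])
 have i1: "integrable lborel (%x. indicat_real Q x *\<^sub>R f x)" using integrable_mult_indicator[OF _ if1, of Q] by simp
 have "integrable lborel (%x. cor ((norm (f x))^2))" by (rule integrable_compact_support[of _ r]) (auto intro!: continuous_intros f)
 hence "integrable lborel (%x. (norm (f x))^2)" by (simp only: complex_of_real_integrable_eq)
 hence i2: "integrable lborel (%x. indicat_real Q x * (norm (f x))^2)" using integrable_mult_indicator[of Q lborel "%x. (norm (f x))^2"] by simp
 have i0: "integrable lborel (indicat_real Q)" using fin by simp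
 have m: "measure lborel Q = m" using Q by (simp add: measure_def)
 have ex: "indicat_real Q y * (norm (f x - f y))^2
  = indicat_real Q y * (norm (f x))^2 - 2 * inner (f x) (indicat_real Q y *\<^sub>R f y) + indicat_real Q y * (norm (f y))^2" for x y
  by (simp add: power2_norm_eq_inner inner_diff_left inner_diff_right inner_commute algebra_simps)
 have inn: "(\<integral>\<^sup>+y. ennreal (indicat_real Q y * (norm (f x - f y))^2) \<partial>lborel)
  = ennreal (m * (norm (f x))^2 - 2 * inner (f x) a + A)" for x
 proof -
  have i3: "integrable lborel (%y. inner (f x) (indicat_real Q y *\<^sub>R f y))" by (rule integrable_inner_right[OF i1])
  have i: "integrable lborel (%y. indicat_real Q y * (norm (f x - f y))^2)" unfolding ex using i0 i2 i3 by simp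
  have "(LINT y|lborel. indicat_real Q y * (norm (f x - f y))^2) = m * (norm (f x))^2 - 2 * inner (f x) a + A" unfolding ex using i0 i2 i3 i1 by (simp add: m a_def A_def del: inner_scaleR_right)
  thus ?thesis using i by (simp add: nn_integral_eq_integral)
 qed
 have nn: "m * (norm (f x))^2 - 2 * inner (f x) a + A >= 0" for x
 proof -
  have i3: "integrable lborel (%y. inner (f x) (indicat_real Q y *\<^sub>R f y))" by (rule integrable_inner_right[OF i1])
  have "(LINT y|lborel. indicat_real Q y * (norm (f x - f y))^2) = m * (norm (f x))^2 - 2 * inner (f x) a + A" unfolding ex using i0 i2 i3 i1 by (simp add: m a_def A_def del: inner_scaleR_right)
  moreover have "0 <= (LINT y|lborel. indicat_real Q y * (norm (f x - f y))^2)" by (intro integral_nonneg_AE) auto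
  ultimately show ?thesis by simp
 qed
 have "(\<integral>\<^sup>+x. \<integral>\<^sup>+y. ennreal (indicator Q x * (indicator Q y * (norm (f x - f y))^2)) \<partial>lborel \<partial>lborel)
  = (\<integral>\<^sup>+x. ennreal (indicat_real Q x * (m * (norm (f x))^2 - 2 * inner (f x) a + A)) \<partial>lborel)"
 proof (rule nn_integral_cong)
  fix x
  show "(\<integral>\<^sup>+y. ennreal (indicator Q x * (indicator Q y * (norm (f x - f y))^2)) \<partial>lborel)
   = ennreal (indicat_real Q x * (m * (norm (f x))^2 - 2 * inner (f x) a + A))" by (cases "x \<in> Q") (simp_all add: inn)
 qed
 also have "... = ennreal (LINT x|lborel. indicat_real Q x * (m * (norm (f x))^2 - 2 * inner (f x) a + A))"
 proof (rule nn_integral_eq_integral)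
  have eq: "(%x. indicat_real Q x * (m * (norm (f x))^2 - 2 * inner (f x) a + A))
   = (%x. m * (indicat_real Q x * (norm (f x))^2) - 2 * inner (indicat_real Q x *\<^sub>R f x) a + A * indicat_real Q x)" by (simp add: fun_eq_iff algebra_simps)
  show "integrable lborel (%x. indicat_real Q x * (m * (norm (f x))^2 - 2 * inner (f x) a + A))" unfolding eq by (intro Bochner_Integration.integrable_add Bochner_Integration.integrable_diff integrable_mult_right
     integrable_inner_left i0 i1 i2)
 qed (use nn in auto)
 also have "(LINT x|lborel. indicat_real Q x * (m * (norm (f x))^2 - 2 * inner (f x) a + A))
  = (LINT x|lborel. m * (indicat_real Q x * (norm (f x))^2) - 2 * inner (indicat_real Q x *\<^sub>R f x) a + A * indicat_real Q x)" by (intro Bochner_Integration.integral_cong refl) (simp add: algebra_simps)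
 also have "... = m * A - 2 * inner a a + A * m"
 proof -
  have i3: "integrable lborel (%x. inner (indicat_real Q x *\<^sub>R f x) a)" by (rule integrable_inner_left[OF i1])
  have "(LINT x|lborel. inner (indicat_real Q x *\<^sub>R f x) a) = inner (LINT x|lborel. indicat_real Q x *\<^sub>R f x) a" by (rule integral_inner_left) (use i1 in simp)
  hence "(LINT x|lborel. inner (indicat_real Q x *\<^sub>R f x) a) = inner a a" by (simp only: a_def)
  moreover have "(LINT x|lborel. m * (indicat_real Q x * (norm (f x))^2) - 2 * inner (indicat_real Q x *\<^sub>R f x) a + A * indicat_real Q x)
   = m * A - 2 * (LINT x|lborel. inner (indicat_real Q x *\<^sub>R f x) a) + A * m" using i0 i2 i3 by (simp add: m A_def del: inner_scaleR_left)
  ultimately show ?thesis by simp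
 qed
 finally show ?thesis by (simp add: a_def A_def power2_norm_eq_inner mult_ac)
qed

lemma MB_integral_borel:
 fixes f :: "'a::euclidean_space cf"
 assumes [measurable]: "f \<in> borel_measurable borel" and r: "r < 1" "!!x. norm x > r ==> f x = 0"
 shows "(LINT x|MB. f x) = (LINT x|lborel. f x)"
proof -
 have "(LINT x|MB. f x) = (LINT x|lebesgue. indicat_real (ball 0 1) x *\<^sub>R f x)" by (rule integral_restrict_space) auto
 also have "(%x. indicat_real (ball 0 1) x *\<^sub>R f x) = f" using r by (force simp: indicator_def fun_eq_iff not_less)
 also have "(LINT x|lebesgue. f x) = (LINT x|lborel. f x)" by (rule integral_completion) simp
 finally show ?thesis .
qed

lemma emeasure_cball_le:
 assumes "r >= 0" shows "emeasure lborel (cball (0::'a::euclidean_space) r) <= ennreal ((2 * r) ^ DIM('a))"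
proof -
 define l u :: 'a where "l = (\<Sum>b\<in>Basis. (- r) *\<^sub>R b)" and "u = (\<Sum>b\<in>Basis. r *\<^sub>R b)"
 have l: "inner l b = - r" and u: "inner u b = r" if "b \<in> Basis" for b unfolding l_def u_def by (rule inner_sum_left_Basis[OF that])+
 have "cball 0 r \<subseteq> cbox l u"
 proof
  fix x :: 'a assume "x \<in> cball 0 r"
  hence "\<bar>inner x b\<bar> <= r" if "b \<in> Basis" for b using Basis_le_norm[OF that, of x] by simp
  thus "x \<in> cbox l u" using l u by (force simp: mem_box abs_le_iff)
 qed
 hence "emeasure lborel (cball (0::'a) r) <= emeasure lborel (cbox l u)" by (rule emeasure_mono) simp
 also have "... = ennreal (\<Prod>b\<in>Basis. inner (u - l) b)" by (rule emeasure_lborel_cbox) (use assms l u in auto)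
 also have "(\<Prod>b\<in>Basis. inner (u - l) b) = (\<Prod>b\<in>(Basis::'a set). 2 * r)" by (intro prod.cong refl) (simp add: inner_diff_left l u)
 finally show ?thesis by simp
qed

text \<open>\<open>ennreal\<close> sends negative numbers to 0, so for mixed signs additivity is
  only an inequality.\<close>

lemma ennreal_add_le: "ennreal (a + b) <= ennreal a + ennreal b"
proof -
 have "ennreal (a + b) <= ennreal (max 0 a + max 0 b)" by (rule ennreal_leI) simp
 also have "... = ennreal (max 0 a) + ennreal (max 0 b)" by (rule ennreal_plus) auto
 also have "... = ennreal a + ennreal b" by (auto simp: max_def ennreal_neg)
 finally show ?thesis .
qed

text \<open>The ball is covered by half-open cubes of side \<open>et\<close>. On a cube the mean
  square of \<open>f\<close> exceeds the square of its mean by a double integral of differences; the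
  pairs involved differ by vectors of norm at most \<open>D * et\<close>, so translation differences
  bound the total by the gradient. The cube averages are the finitely many functionals.\<close>

lemma rellich:
 assumes e: "ep > 0"
 shows "EX (I :: (('a::euclidean_space => int) \<times> bool) set) x. finite I & (ALL f. tst f -->
  (norm (mk f))^2 <= ep * (\<Sum>b\<in>Basis. (norm (mk (pd b f)))^2) + (\<Sum>i\<in>I. (inner (mk f) (x i :: 'a l2))^2))"
proof -
 define D where "D = real DIM('a)"
 have D: "D >= 1" using DIM_positive[where 'a='a] by (simp add: D_def)
 \<comment> \<open>Collects \<open>(D * et)^2\<close> from the translation bound and
   \<open>(2 * (D * et)) ^ DIM('a)\<close> from the volume of the ball of differences, relative to
   the cube volume \<open>et ^ DIM('a)\<close> and the factor \<open>et^2\<close>.\<close>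
 define c where "c = (2 * D) ^ DIM('a) * D^2"
 have c: "c > 0" using D by (simp add: c_def)
 define et where "et = sqrt (2 * ep / c)"
 have et: "et > 0" "c * et^2 = 2 * ep" using e c by (auto simp: et_def)
 define Q where "Q k = {x::'a. ALL b:Basis. \<lfloor>inner x b / et\<rfloor> = k b}" for k :: "'a => int"
 define key where "key x = (\<lambda>b\<in>Basis. \<lfloor>inner x b / et\<rfloor>)" for x :: 'a
 define N where "N = \<lceil>1 / et\<rceil> + 1"
 define Kf where "Kf = (\<Pi>\<^sub>E b\<in>(Basis::'a set). {- N..N})"
 have finK: "finite Kf" unfolding Kf_def by (intro finite_PiE) auto
 have key_iff: "x \<in> Q k \<longleftrightarrow> k = key x" if "k \<in> Kf" for k x using that unfolding Q_def key_def Kf_def by (auto simp: PiE_def extensional_def fun_eq_iff restrict_def)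
 have keyK: "key x \<in> Kf" if "norm x < 1" for x
 proof -
  have "\<lfloor>inner x b / et\<rfloor> \<in> {- N..N}" if b: "b \<in> Basis" for b
  proof -
   have "\<bar>inner x b\<bar> <= 1" using Basis_le_norm[OF b, of x] \<open>norm x < 1\<close> by linarith
   hence "- (1/et) <= inner x b / et" "inner x b / et <= 1 / et" using et(1) by (auto simp: field_simps)
   thus ?thesis unfolding N_def by (simp add: floor_le_iff le_floor_iff; linarith)
  qed
  thus ?thesis by (auto simp: key_def Kf_def)
 qed
 define m where "m = et ^ DIM('a)"
 have m: "m > 0" using et by (simp add: m_def)
 have Q_eq: "Q k = {x. ALL b:Basis. of_int (k b) <= inner x b / et & inner x b / et < of_int (k b) + 1}" for k unfolding Q_def by (simp add: floor_eq_iff)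
 have Qb [measurable]: "Q k \<in> sets borel" for k
 proof -
  have "Q k = (\<Inter>b\<in>Basis. {x. of_int (k b) <= inner x b / et & inner x b / et < of_int (k b) + 1})" unfolding Q_eq by auto
  moreover have "{x::'a. of_int (k b) <= inner x b / et & inner x b / et < of_int (k b) + 1} \<in> sets borel" for b by measurable
  ultimately show ?thesis by (auto intro!: sets.finite_INT)
 qed
 have Qm: "emeasure lborel (Q k) = ennreal m" for k
 proof -
  define l where "l = (\<Sum>b\<in>Basis. (et * of_int (k b)) *\<^sub>R b)"
  define u where "u = (\<Sum>b\<in>Basis. (et * (of_int (k b) + 1)) *\<^sub>R b)"
  have lb: "inner l b = et * of_int (k b)" "inner u b = et * (of_int (k b) + 1)" if "b \<in> Basis" for b using that by (simp_all add: l_def u_def inner_sum_left_Basis)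
  have le: "inner l b <= inner u b" if "b \<in> Basis" for b using lb[OF that] et(1) by simp
  have "(\<Prod>b\<in>Basis. inner (u - l) b) = (\<Prod>b\<in>(Basis::'a set). et)" by (intro prod.cong refl) (simp add: inner_diff_left lb algebra_simps)
  hence pr: "(\<Prod>b\<in>Basis. inner (u - l) b) = m" by (simp add: m_def)
  have "box l u \<subseteq> Q k" unfolding Q_eq mem_box subset_iff using lb et(1) by (auto simp: mem_box field_simps intro: less_imp_le)
  hence "emeasure lborel (box l u) <= emeasure lborel (Q k)" by (rule emeasure_mono) simp
  moreover have "Q k \<subseteq> cbox l u" unfolding Q_eq subset_iff using lb et(1) by (auto simp: mem_box field_simps intro: less_imp_le)
  hence "emeasure lborel (Q k) <= emeasure lborel (cbox l u)" by (rule emeasure_mono) simp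
  ultimately show ?thesis using le pr by (simp add: antisym)
 qed
 define ch where "ch k x = cor (indicator (Q k) x)" for k x
 have chL: "ch k \<in> L2 MB" for k
 proof -
  interpret finite_measure "MB :: 'a measure" by (rule finite_measure_MB)
  show ?thesis
  proof (rule L2_bound)
   have "ch k \<in> borel_measurable borel" unfolding ch_def[abs_def] by measurable
   thus "ch k \<in> borel_measurable MB" by (intro measurable_restrict_space1) (auto intro: measurable_completion)
   show "integrable MB (%_::'a. 1::real)" by simp
  qed (simp add: ch_def indicator_def)
 qed
 define I where "I = Kf \<times> (UNIV :: bool set)"
 \<comment> \<open>Real and imaginary part of a cube average are two real functionals, normalised by
   the cube volume.\<close>
 define x where "x i = sqrt (1 / m) *\<^sub>R (if snd i then J (mk (ch (fst i))) else mk (ch (fst i)))" for i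
 have main: "(norm (mk f))^2 <= ep * (\<Sum>b\<in>Basis. (norm (mk (pd b f)))^2) + (\<Sum>i\<in>I. (inner (mk f) (x i))^2)"
  if f: "tst f" for f
 proof -
  obtain r where r: "r < 1" "!!x. norm x > r ==> f x = 0" using f by (auto simp: tst_def)
  have fc: "continuous_on UNIV f" by (rule dff_cont[OF smooth_dff[OF tst_smooth[OF f]]])
  have [measurable]: "f \<in> borel_measurable borel" using fc by (rule borel_measurable_continuous_onI)
  define E where "E = (\<Sum>b\<in>Basis. (norm (mk (pd b f)))^2)"
  have E: "E >= 0" by (simp add: E_def sum_nonneg)
  define Ak where "Ak k = (LINT x|lborel. indicator (Q k) x * (norm (f x))^2)" for k
  define a where "a k = (LINT x|lborel. indicat_real (Q k) x *\<^sub>R f x)" for k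
  have dd: "(\<integral>\<^sup>+x. \<integral>\<^sup>+y. ennreal (indicator (Q k) x * (indicator (Q k) y * (norm (f x - f y))^2)) \<partial>lborel \<partial>lborel)
   = ennreal (2 * m * Ak k - 2 * (norm (a k))^2)" for k unfolding Ak_def a_def by (rule double_difference_integral[OF fc r(2) Qb Qm]) (use m in auto)
  let ?C = "cball 0 (D * et) :: 'a set"
  have "(\<Sum>k\<in>Kf. ennreal (2 * m * Ak k - 2 * (norm (a k))^2))
   = (\<integral>\<^sup>+x. \<integral>\<^sup>+y. (\<Sum>k\<in>Kf. ennreal (indicator (Q k) x * (indicator (Q k) y * (norm (f x - f y))^2))) \<partial>lborel \<partial>lborel)"
  proof -
   have 1: "(\<integral>\<^sup>+y. (\<Sum>k\<in>Kf. ennreal (indicator (Q k) x * (indicator (Q k) y * (norm (f x - f y))^2))) \<partial>lborel)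
    = (\<Sum>k\<in>Kf. (\<integral>\<^sup>+y. ennreal (indicator (Q k) x * (indicator (Q k) y * (norm (f x - f y))^2)) \<partial>lborel))" for x by (rule nn_integral_sum) measurable
   show ?thesis unfolding 1 dd[symmetric] by (rule nn_integral_sum[symmetric]) measurable
  qed
  \<comment> \<open>At most one cube contains both points, and then their difference lies in
    \<open>?C\<close>. Admitting all pairs with difference in \<open>?C\<close> makes the double
    integral one over translations.\<close>
  also have "... <= (\<integral>\<^sup>+x. \<integral>\<^sup>+y. ennreal (indicator ?C (y - x) * (norm (f y - f x))^2) \<partial>lborel \<partial>lborel)"
  proof (intro nn_integral_mono)
   fix x y :: 'a
   have "(\<Sum>k\<in>Kf. indicator (Q k) x * (indicator (Q k) y * (norm (f x - f y))^2))
    <= indicator ?C (y - x) * (norm (f y - f x))^2"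
   proof (cases "EX k:Kf. x \<in> Q k & y \<in> Q k")
    case True
    then obtain k where k: "k \<in> Kf" "x \<in> Q k" "y \<in> Q k" by blast
    have "norm (y - x) <= (\<Sum>b\<in>Basis. \<bar>inner (y - x) b\<bar>)" by (rule norm_le_l1)
    also have "... <= (\<Sum>b\<in>(Basis::'a set). et)"
    proof (rule sum_mono)
     fix b :: 'a assume "b \<in> Basis"
     hence "\<lfloor>inner x b / et\<rfloor> = \<lfloor>inner y b / et\<rfloor>" using k by (simp add: Q_def)
     hence "\<bar>inner y b / et - inner x b / et\<bar> <= 1" by linarith
     thus "\<bar>inner (y - x) b\<bar> <= et" using et(1) by (simp add: inner_diff_left field_simps flip: diff_divide_distrib)
    qed
    finally have inC: "y - x \<in> ?C" by (simp add: D_def)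
    have "(\<Sum>k\<in>Kf. indicator (Q k) x * (indicator (Q k) y * (norm (f x - f y))^2))
     <= (\<Sum>k'\<in>Kf. if k' = k then (norm (f x - f y))^2 else 0)" by (rule sum_mono) (use k key_iff in \<open>auto simp: indicator_def\<close>)
    also have "... = (norm (f x - f y))^2" using finK k(1) by simp
    finally show ?thesis using inC by (simp add: norm_minus_commute)
   next
    case False
    hence "(\<Sum>k\<in>Kf. indicator (Q k) x * (indicator (Q k) y * (norm (f x - f y))^2)) = 0" by (intro sum.neutral) (auto simp: indicator_def)
    thus ?thesis by simp
   qed
   thus "(\<Sum>k\<in>Kf. ennreal (indicator (Q k) x * (indicator (Q k) y * (norm (f x - f y))^2)))
    <= ennreal (indicator ?C (y - x) * (norm (f y - f x))^2)" by (subst sum_ennreal) (auto intro: ennreal_leI)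
  qed
  also have "... = (\<integral>\<^sup>+x. \<integral>\<^sup>+z. ennreal (indicator ?C z * (norm (f (z + x) - f x))^2) \<partial>lborel \<partial>lborel)"
  proof (rule nn_integral_cong)
   fix x :: 'a
   have [measurable]: "(%y. indicat_real ?C (y - x)) \<in> borel_measurable borel" by (rule measurable_compose[of "%y. y - x" borel borel]) (auto intro: borel_measurable_indicator)
   have m: "(%y. ennreal (indicator ?C (y - x) * (norm (f y - f x))^2)) \<in> borel_measurable borel" by measurable
   show "(\<integral>\<^sup>+y. ennreal (indicator ?C (y - x) * (norm (f y - f x))^2) \<partial>lborel)
     = (\<integral>\<^sup>+z. ennreal (indicator ?C z * (norm (f (z + x) - f x))^2) \<partial>lborel)" using nn_integral_translate[OF m, of x] by simp
  qed
  also have "... = (\<integral>\<^sup>+z. \<integral>\<^sup>+x. ennreal (indicator ?C z * (norm (f (z + x) - f x))^2) \<partial>lborel \<partial>lborel)"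
  proof (rule lborel_pair.Fubini')
   have f2: "continuous_on UNIV (%p::'a \<times> 'a. f (fst p + snd p))" "continuous_on UNIV (%p::'a \<times> 'a. f (snd p))" by (auto intro!: continuous_on_compose2[OF fc] continuous_intros)
   have c2: "continuous_on UNIV (%p::'a \<times> 'a. (norm (f (fst p + snd p) - f (snd p)))^2)" by (intro continuous_intros f2)
   have "(%p::'a \<times> 'a. indicat_real (?C \<times> UNIV) p * (norm (f (fst p + snd p) - f (snd p)))^2) \<in> borel_measurable borel"
    by (intro borel_measurable_times borel_measurable_indicator borel_closed closed_Times borel_measurable_continuous_onI[OF c2]) auto
   also have "(%p::'a \<times> 'a. indicat_real (?C \<times> UNIV) p * (norm (f (fst p + snd p) - f (snd p)))^2)
    = (%(z, x). indicator ?C z * (norm (f (z + x) - f x))^2)" by (auto simp: fun_eq_iff indicator_def)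
   finally have "(%(z, x). indicator ?C z * (norm (f (z + x) - f x))^2) \<in> borel_measurable (lborel \<Otimes>\<^sub>M lborel)" by (simp add: lborel_prod)
   hence "(%p. ennreal ((%(z, x). indicator ?C z * (norm (f (z + x) - f x))^2) p)) \<in> borel_measurable (lborel \<Otimes>\<^sub>M lborel)" by (rule measurable_compose[OF _ measurable_ennreal])
   thus "(%(z, x). ennreal (indicator ?C z * (norm (f (z + x) - f x))^2)) \<in> borel_measurable (lborel \<Otimes>\<^sub>M lborel)" by (simp add: case_prod_beta)
  qed
  also have "... <= (\<integral>\<^sup>+z. ennreal ((D * et)^2 * E) * indicator ?C z \<partial>lborel)"
  proof (rule nn_integral_mono)
   fix z :: 'a
   have "(\<integral>\<^sup>+x. ennreal ((norm (f (x + z) - f x))^2) \<partial>lborel) <= ennreal ((D * et)^2 * E)" if "z \<in> ?C"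
   proof -
    have "(norm z)^2 * E <= (D * et)^2 * E" using that E by (intro mult_right_mono power_mono) auto
    thus ?thesis using translate_difference_le[OF f, of z] unfolding E_def[symmetric] by (meson ennreal_leI order_trans)
   qed
   thus "(\<integral>\<^sup>+x. ennreal (indicator ?C z * (norm (f (z + x) - f x))^2) \<partial>lborel)
    <= ennreal ((D * et)^2 * E) * indicator ?C z" by (cases "z \<in> ?C") (simp_all add: add.commute)
  qed
  also have "... = ennreal ((D * et)^2 * E) * emeasure lborel ?C" by (rule nn_integral_cmult_indicator) simp
  also have "... <= ennreal ((D * et)^2 * E) * ennreal ((2 * (D * et)) ^ DIM('a))" by (intro mult_left_mono emeasure_cball_le) (use D et in auto)
  also have "... = ennreal ((D * et)^2 * E * (2 * (D * et)) ^ DIM('a))" by (rule ennreal_mult[symmetric]) (use D et E in auto)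
  also have "(D * et)^2 * E * (2 * (D * et)) ^ DIM('a) = m * (c * et^2) * E" by (simp add: c_def m_def power_mult_distrib mult_ac)
  also have "... = 2 * m * ep * E" unfolding et(2) by simp
  finally have le: "(\<Sum>k\<in>Kf. ennreal (2 * m * Ak k - 2 * (norm (a k))^2)) <= ennreal (2 * m * ep * E)" .
  have "ennreal (\<Sum>k\<in>Kf. 2 * m * Ak k - 2 * (norm (a k))^2) <= (\<Sum>k\<in>Kf. ennreal (2 * m * Ak k - 2 * (norm (a k))^2))"
  proof -
   have "ennreal (\<Sum>k\<in>Kf. g k) <= (\<Sum>k\<in>Kf. ennreal (g k))" for g :: "('a => int) => real" using finK by (induction rule: finite_induct)
     (auto intro: order_trans[OF ennreal_add_le] add_left_mono)
   thus ?thesis .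
  qed
  with le have "(\<Sum>k\<in>Kf. 2 * m * Ak k - 2 * (norm (a k))^2) <= 2 * m * ep * E" using m e E by (simp add: ennreal_le_iff[symmetric] del: ennreal_le_iff)
  hence "2 * m * (\<Sum>k\<in>Kf. Ak k) - 2 * (\<Sum>k\<in>Kf. (norm (a k))^2) <= 2 * m * ep * E" by (simp add: sum_subtractf sum_distrib_left)
  hence le2: "(\<Sum>k\<in>Kf. Ak k) <= ep * E + (1 / m) * (\<Sum>k\<in>Kf. (norm (a k))^2)" using m by (simp add: field_simps)
  have fsq: "integrable lborel (%x. (norm (f x))^2)"
  proof -
   have "integrable lborel (%x. cor ((norm (f x))^2))" by (rule integrable_compact_support[of _ r]) (auto intro!: continuous_intros fc r(2))
   thus ?thesis by (simp only: complex_of_real_integrable_eq)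
  qed
  have "(\<Sum>k\<in>Kf. Ak k) = (LINT x|lborel. (\<Sum>k\<in>Kf. indicator (Q k) x * (norm (f x))^2))" unfolding Ak_def by (rule Bochner_Integration.integral_sum[symmetric])
    (use integrable_mult_indicator[OF _ fsq] in simp)
  also have "... = (LINT x|lborel. (norm (f x))^2)"
  proof (rule Bochner_Integration.integral_cong[OF refl])
   fix x :: 'a
   show "(\<Sum>k\<in>Kf. indicator (Q k) x * (norm (f x))^2) = (norm (f x))^2"
   proof (cases "norm x < 1")
    case True
    have "(\<Sum>k\<in>Kf. indicator (Q k) x * (norm (f x))^2) = (\<Sum>k\<in>Kf. if k = key x then (norm (f x))^2 else 0)" by (rule sum.cong) (use key_iff in \<open>auto simp: indicator_def\<close>)
    thus ?thesis using finK keyK[OF True] by simp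
   next
    case False
    hence "f x = 0" using r by force
    thus ?thesis by simp
   qed
  qed
  also have "... = (norm (mk f))^2" using tst_nn_norm[OF f] fsq by (simp add: nn_integral_eq_integral)
  finally have sumA: "(\<Sum>k\<in>Kf. Ak k) = (norm (mk f))^2" .
  have ak: "(norm (a k))^2 = (inner (mk f) (mk (ch k)))^2 + (inner (mk f) (J (mk (ch k))))^2" for k
  proof -
   have "L2_inner MB f (ch k) = (LINT x|MB. indicat_real (Q k) x *\<^sub>R f x)" unfolding L2_inner_def by (intro Bochner_Integration.integral_cong refl) (simp add: ch_def scaleR_conv_of_real)
   also have "... = a k" unfolding a_def by (rule MB_integral_borel[OF _ r(1)]) (use r(2) in auto)
   finally have "a k = Complex (inner (mk f) (mk (ch k))) (inner (mk f) (J (mk (ch k))))" using L2_inner_mk[OF tst_L2[OF f] chL] by simp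
   thus ?thesis by (simp add: cmod_power2)
  qed
  have "(\<Sum>i\<in>I. (inner (mk f) (x i))^2) = (\<Sum>k\<in>Kf. \<Sum>t\<in>UNIV. (inner (mk f) (x (k, t)))^2)" unfolding I_def by (simp add: sum.cartesian_product case_prod_beta)
  also have "... = (\<Sum>k\<in>Kf. (1 / m) * (norm (a k))^2)"
  proof (rule sum.cong[OF refl])
   fix k
   show "(\<Sum>t\<in>UNIV. (inner (mk f) (x (k, t)))^2) = (1 / m) * (norm (a k))^2" unfolding UNIV_bool ak using m by (simp add: x_def power_mult_distrib real_sqrt_divide field_simps)
  qed
  finally show ?thesis using le2 sumA unfolding E_def by (simp add: sum_distrib_left)
 qed
 moreover have "finite I" by (simp add: I_def finK)
 ultimately show ?thesis by blast
qed

subsection \<open>The concrete Krein Laplacian\<close>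

text \<open>As in \<open>compact_opI\<close>, a weight, here \<open>sqrt n\<close>, compensates for
  equal functionals collapsing in the image.\<close>

lemma functionals_of_family:
 assumes "finite I"
 shows "EX Ph. finite Ph & (ALL fi:Ph. bounded_linear (fi :: 'h::real_inner => real)) &
  (ALL w. (\<Sum>i\<in>I. (inner w (x i))^2) <= (\<Sum>fi\<in>Ph. (fi w)^2))"
proof -
 define n where "n = real (card I)"
 define Ph where "Ph = (%i w. inner w (sqrt n *\<^sub>R x i)) ` I"
 have bl: "ALL fi:Ph. bounded_linear (fi :: 'h => real)" by (auto simp: Ph_def intro!: bounded_linear_inner_left simp del: inner_scaleR_right)
 have le: "n * (inner w (x i))^2 <= (\<Sum>fi\<in>Ph. (fi w)^2)" if "i \<in> I" for i w
 proof -
  have "n * (inner w (x i))^2 = (%fi. (fi w)^2) (%w. inner w (sqrt n *\<^sub>R x i))" by (simp add: power_mult_distrib n_def)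
  also have "... <= (\<Sum>fi\<in>Ph. (fi w)^2)" by (rule member_le_sum) (use that assms in \<open>auto simp: Ph_def\<close>)
  finally show ?thesis .
 qed
 have "(\<Sum>i\<in>I. (inner w (x i))^2) <= (\<Sum>fi\<in>Ph. (fi w)^2)" for w
 proof (cases "I = {}")
  case True thus ?thesis by (simp add: sum_nonneg)
 next
  case False
  hence n: "n > 0" using assms by (simp add: n_def card_gt_0_iff)
  have "n * (\<Sum>i\<in>I. (inner w (x i))^2) <= (\<Sum>i\<in>I. (\<Sum>fi\<in>Ph. (fi w)^2))" unfolding sum_distrib_left by (rule sum_mono) (rule le)
  also have "... = n * (\<Sum>fi\<in>Ph. (fi w)^2)" by (simp add: n_def)
  finally show ?thesis using n by simp
 qed
 thus ?thesis using bl assms by (intro exI[of _ Ph]) (auto simp: Ph_def)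
qed

text \<open>The minimal operator; \<open>H2_0_iff\<close> shows that its domain is H^2_0.\<close>

definition KS :: "('a::euclidean_space l2 \<times> 'a l2) set" where
 "KS = closure {(mk fi, - mk (lap fi)) | fi. tst fi}"

lemma lap_add: "smooth f ==> smooth g ==> lap (%x. f x + g x) = (%x. lap f x + lap g x)" using partials_add[of f g "[_, _]"] by (simp add: fun_eq_iff sum.distrib del: partials.simps flip: lap_partials)

lemma lap_bl: "smooth f ==> bounded_linear L ==> lap (%x. L (f x)) = (%x. L (lap f x))" using partials_bl[of f L "[_, _]"]
 by (simp add: fun_eq_iff linear_sum[OF bounded_linear.linear] del: partials.simps flip: lap_partials)

lemma tst_lap_L2: "tst fi ==> lap fi \<in> L2 MB" by (rule tst_L2[OF tst_lap])

lemma KS_mem: "tst fi ==> (mk fi, - mk (lap fi)) \<in> KS" unfolding KS_def by (rule subsetD[OF closure_subset]) blast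

lemma KS_seq:
 assumes "(w, f) \<in> KS"
 shows "EX fi. (ALL n::nat. tst (fi n)) & (%n. mk (fi n)) ----> w & (%n. mk (lap (fi n))) ----> - f"
proof -
 obtain x where x: "!!n. x n \<in> {(mk fi, - mk (lap fi)) | fi. tst (fi :: 'a cf)}" "x ----> (w, f)" using assms unfolding KS_def closure_sequential by blast
 hence "ALL n. EX fi. tst fi & x n = (mk fi, - mk (lap fi))" by blast
 from choice[OF this] obtain fi where fi: "!!n. tst (fi n)" "!!n. x n = (mk (fi n), - mk (lap (fi n)))" by blast
 have "(%n. mk (fi n)) ----> w" "(%n. - mk (lap (fi n))) ----> f" using tendsto_fst[OF x(2)] tendsto_snd[OF x(2)] by (simp_all add: fi(2))
 moreover from tendsto_minus[OF this(2)] have "(%n. mk (lap (fi n))) ----> - f" by simp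
 ultimately show ?thesis using fi(1) by blast
qed

lemma KS_closedI:
 assumes "!!n::nat. tst (fi n)" "(%n. mk (fi n)) ----> w" "(%n. mk (lap (fi n))) ----> - f"
 shows "(w, f) \<in> KS"
proof -
 have "(%n. (mk (fi n), - mk (lap (fi n)))) ----> (w, f)" using tendsto_Pair[OF assms(2) tendsto_minus[OF assms(3)]] by simp
 thus ?thesis by (rule closed_sequentially[of KS, rotated 2, simplified])
   (auto simp: KS_def intro!: KS_mem[unfolded KS_def] assms(1))
qed

lemma l2_dense_tst:
 fixes g :: "'a::euclidean_space l2"
 assumes "!!fi. tst fi ==> inner (mk fi) g = 0" shows "g = 0"
proof -
 have "(LINT x|MB. rp g x * fi x) = 0" if fi: "tst fi" for fi
 proof -
  have c: "tst (%x. cnj (fi x))" and ic: "tst (%x. \<i> * cnj (fi x))" by (rule tst_cnj[OF fi]) (rule tst_cmult[OF tst_cnj[OF fi]])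
  have "L2_inner MB (rp g) (%x. cnj (fi x)) = 0" using assms[OF c] assms[OF ic] unfolding L2_inner_mk[OF rp_L2 tst_L2[OF c]] by (simp add: mk_rp cm_mk tst_L2[OF c] inner_commute complex_eq_iff)
  thus ?thesis by (simp add: L2_inner_def)
 qed
 hence "AE x in MB. rp g x = 0" by (intro orth_tst_zero rp_L2)
 hence "mk (rp g) = mk (%_. 0)" by (simp add: mk_eq_iff rp_L2 L2_zero)
 thus ?thesis by (simp add: mk_rp mk_zero)
qed

lemma KS_lap: "(w, f) \<in> KS ==> tst fi ==> inner w (mk (lap fi)) = - inner f (mk fi)"
proof -
 assume S: "(w, f) \<in> KS" and fi: "tst fi"
 obtain ps where ps: "!!n::nat. tst (ps n)" "(%n. mk (ps n)) ----> w" "(%n. mk (lap (ps n))) ----> - f" using KS_seq[OF S] by blast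
 have eq: "inner (mk (ps n)) (mk (lap fi)) = inner (mk (lap (ps n))) (mk fi)" for n by (simp add: mk_lap fi ps(1) inner_sum_left inner_sum_right inner_ibp tst_pd)
 have a: "(%n. inner (mk (ps n)) (mk (lap fi))) ----> inner w (mk (lap fi))" by (intro tendsto_intros ps)
 have b: "(%n. inner (mk (lap (ps n))) (mk fi)) ----> inner (- f) (mk fi)" by (intro tendsto_intros ps)
 show ?thesis using LIMSEQ_unique[OF a b[folded eq]] by simp
qed

text \<open>Symmetry and the estimates hold for test functions by integration by parts, the Poincare
  inequality and \<open>rellich\<close>, and survive limits in the graph. The constant 4 is that of
  \<open>tst_le\<close>.\<close>

lemma KS_graph: "krein_graph (KS :: ('a::euclidean_space l2 \<times> 'a l2) set) 4"
proof
 show "subspace (KS :: ('a l2 \<times> 'a l2) set)" unfolding KS_def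
 proof (intro subspace_closure subspaceI)
  show "0 \<in> {(mk fi, - mk (lap fi)) | fi. tst (fi :: 'a cf)}" by (intro CollectI exI[of _ "%_. 0"])
    (simp add: tst_zero lap_def[abs_def] pd_const mk_zero zero_prod_def)
 next
  fix x y :: "'a l2 \<times> 'a l2" and r :: real
  assume x: "x \<in> {(mk fi, - mk (lap fi)) | fi. tst (fi :: 'a cf)}"
  then obtain f where f: "x = (mk f, - mk (lap f))" "tst f" by blast
  note f' = tst_L2[OF f(2)] tst_lap_L2[OF f(2)]
  show "r *\<^sub>R x \<in> {(mk fi, - mk (lap fi)) | fi. tst fi}" by (intro CollectI exI[of _ "%x. cor r * f x"])
    (simp add: f tst_cmult lap_bl[OF tst_smooth[OF f(2)] bounded_linear_mult_right] mk_scaleR f')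
  assume "y \<in> {(mk fi, - mk (lap fi)) | fi. tst (fi :: 'a cf)}"
  then obtain g where g: "y = (mk g, - mk (lap g))" "tst g" by blast
  note g' = tst_L2[OF g(2)] tst_lap_L2[OF g(2)]
  show "x + y \<in> {(mk fi, - mk (lap fi)) | fi. tst fi}" by (intro CollectI exI[of _ "%x. f x + g x"])
    (simp add: f g tst_add lap_add tst_smooth mk_add f' g')
 qed
next
 show "closed (KS :: ('a l2 \<times> 'a l2) set)" by (simp add: KS_def)
next
 fix w f w' f' :: "'a l2" assume 1: "(w, f) \<in> KS" and 2: "(w', f') \<in> KS"
 obtain ps where ps: "!!n::nat. tst (ps n)" "(%n. mk (ps n)) ----> w'" "(%n. mk (lap (ps n))) ----> - f'" using KS_seq[OF 2] by blast
 have a: "(%n. inner w (mk (lap (ps n)))) ----> inner w (- f')" by (intro tendsto_intros ps)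
 have b: "(%n. - inner f (mk (ps n))) ----> - inner f w'" by (intro tendsto_intros ps)
 show "inner w f' = inner f w'" using LIMSEQ_unique[OF a b[folded KS_lap[OF 1 ps(1)]]] by simp
next
 fix g :: "'a l2" assume z: "!!w f. (w, f) \<in> KS ==> inner w g = 0"
 show "g = 0" by (rule l2_dense_tst) (rule z[OF KS_mem])
next
 fix w f :: "'a l2" assume S: "(w, f) \<in> KS"
 obtain ps where ps: "!!n::nat. tst (ps n)" "(%n. mk (ps n)) ----> w" "(%n. mk (lap (ps n))) ----> - f" using KS_seq[OF S] by blast
 have "norm w <= 4 * norm (- f)" by (rule LIMSEQ_le[OF tendsto_norm[OF ps(2)] tendsto_mult_left[OF tendsto_norm[OF ps(3)]]])
   (use tst_le[OF ps(1)] in auto)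
 thus "norm w <= 4 * norm f" by simp
 have "- inner w (- f) >= 0"
 proof (rule LIMSEQ_le_const)
  show "(%n. - inner (mk (ps n)) (mk (lap (ps n)))) ----> - inner w (- f)" by (intro tendsto_intros ps)
  show "EX N. ALL n>=N. 0 <= - inner (mk (ps n)) (mk (lap (ps n)))" using tst_grad_sum[OF ps(1), symmetric] by (simp add: sum_nonneg)
 qed
 thus "0 <= inner w f" by simp
next
 fix ep :: real assume "ep > 0"
 then obtain I :: "(('a => int) \<times> bool) set" and x where I: "finite I" "!!f. tst f ==>
  (norm (mk f))^2 <= ep * (\<Sum>b\<in>Basis. (norm (mk (pd b f)))^2) + (\<Sum>i\<in>I. (inner (mk f) (x i :: 'a l2))^2)" using rellich[of ep] by blast
 obtain Ph where Ph: "finite Ph" "ALL fi:Ph. bounded_linear (fi :: 'a l2 => real)"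
  "!!w. (\<Sum>i\<in>I. (inner w (x i))^2) <= (\<Sum>fi\<in>Ph. (fi w)^2)" using functionals_of_family[OF I(1), of x] by blast
 have "(norm w)^2 <= ep * inner w f + (\<Sum>fi\<in>Ph. (fi w)^2)" if S: "(w, f) \<in> KS" for w f
 proof -
  obtain ps where ps: "!!n::nat. tst (ps n)" "(%n. mk (ps n)) ----> w" "(%n. mk (lap (ps n))) ----> - f" using KS_seq[OF S] by blast
  have "(norm w)^2 <= ep * - inner w (- f) + (\<Sum>i\<in>I. (inner w (x i))^2)"
  proof (rule LIMSEQ_le)
   show "(%n. (norm (mk (ps n)))^2) ----> (norm w)^2" by (intro tendsto_intros ps)
   show "(%n. ep * - inner (mk (ps n)) (mk (lap (ps n))) + (\<Sum>i\<in>I. (inner (mk (ps n)) (x i))^2))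
    ----> ep * - inner w (- f) + (\<Sum>i\<in>I. (inner w (x i))^2)" by (intro tendsto_intros ps)
   show "EX N. ALL n>=N. (norm (mk (ps n)))^2 <= ep * - inner (mk (ps n)) (mk (lap (ps n))) + (\<Sum>i\<in>I. (inner (mk (ps n)) (x i))^2)" using I(2)[OF ps(1)] tst_grad_sum[OF ps(1)] by auto
  qed
  thus ?thesis using Ph(3)[of w] by simp
 qed
 thus "EX Ph. finite Ph & (ALL fi:Ph. bounded_linear (fi :: 'a l2 => real)) &
    (ALL w f. (w, f) \<in> KS --> (norm w)^2 <= ep * inner w f + (\<Sum>fi\<in>Ph. (fi w)^2))" using Ph by blast
qed

interpretation KR: krein_graph KS 4 by (rule KS_graph)

lemma H_lap_iff: "h \<in> KR.H \<longleftrightarrow> (ALL fi. tst fi --> inner h (mk (lap fi)) = 0)"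
proof
 assume h: "h \<in> KR.H"
 show "ALL fi. tst fi --> inner h (mk (lap fi)) = 0"
 proof (intro allI impI)
  fix fi :: "'a cf" assume "tst fi"
  from bspec[OF h[unfolded KR.H_def, simplified] KS_mem[OF this]] show "inner h (mk (lap fi)) = 0" by simp
 qed
next
 assume z: "ALL fi. tst fi --> inner h (mk (lap fi)) = 0"
 have "inner h f = 0" if S: "(w, f) \<in> KS" for w f
 proof -
  obtain ps where ps: "!!n::nat. tst (ps n)" "(%n. mk (lap (ps n))) ----> - f" using KS_seq[OF S] by blast
  have "(%n. inner h (mk (lap (ps n)))) ----> inner h (- f)" by (intro tendsto_intros ps)
  thus ?thesis using z ps(1) by (simp add: LIMSEQ_const_iff)
 qed
 thus "h \<in> KR.H" by (auto simp: KR.H_def)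
qed

lemma H_cm: "(h :: 'a::euclidean_space l2) \<in> KR.H ==> cm c h \<in> KR.H" unfolding H_lap_iff
proof (intro allI impI)
 fix fi :: "'a cf" assume h: "ALL fi. tst fi --> inner h (mk (lap fi)) = 0" and fi: "tst fi"
 have "cm (cnj c) (mk (lap fi)) = mk (lap (%x. cnj c * fi x))" by (simp add: cm_mk tst_lap_L2 fi lap_bl[OF tst_smooth[OF fi] bounded_linear_mult_right])
 thus "inner (cm c h) (mk (lap fi)) = 0" using h tst_cmult[OF fi, of "cnj c"] by (simp add: inner_cm)
qed

text \<open>Conjugating the test function turns the bilinear pairing into the inner product, and a
  further test function multiplied by \<open>\<i>\<close> supplies the imaginary part. It is applied
  to the Laplacian and to iterated partial derivatives, with \<open>s\<close> as the sign from
  integration by parts.\<close>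

lemma weak_pairing:
 fixes u g :: "'a::euclidean_space cf" and L :: "('a cf) => 'a => complex" and s :: real
 assumes u: "u \<in> L2 MB" and g: "g \<in> L2 MB" and L: "!!fi. tst fi ==> tst (L fi)"
  and Lb: "!!fi B. tst fi ==> bounded_linear B ==> L (%x. B (fi x)) = (%x. B (L fi x))"
 shows "(ALL fi. tst fi --> (LINT x|MB. u x * L fi x) = cor s * (LINT x|MB. g x * fi x))
  \<longleftrightarrow> (ALL fi. tst fi --> inner (mk u) (mk (L fi)) = s * inner (mk g) (mk fi))"
proof -
 have 1: "(LINT x|MB. u x * L (%x. cnj (fi x)) x) = Complex (inner (mk u) (mk (L fi))) (inner (mk u) (mk (L (%x. \<i> * fi x))))"
  and 2: "(LINT x|MB. g x * cnj (fi x)) = Complex (inner (mk g) (mk fi)) (inner (mk g) (mk (%x. \<i> * fi x)))"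
  if fi: "tst fi" for fi using L2_inner_mk[OF u tst_L2[OF L[OF fi]]] L2_inner_mk[OF g tst_L2[OF fi]] unfolding L2_inner_def
  by (simp_all add: Lb[OF fi bounded_linear_cnj] Lb[OF fi bounded_linear_mult_right] cm_mk tst_L2 L fi)
 show ?thesis (is "?l = ?r")
 proof
  assume l: ?l
  show ?r
  proof (intro allI impI)
   fix fi :: "'a cf" assume fi: "tst fi"
   from l tst_cnj[OF fi] have "(LINT x|MB. u x * L (%x. cnj (fi x)) x) = cor s * (LINT x|MB. g x * cnj (fi x))" by blast
   thus "inner (mk u) (mk (L fi)) = s * inner (mk g) (mk fi)" unfolding 1[OF fi] 2[OF fi] by (simp add: complex_eq_iff)
  qed
 next
  assume r: ?r
  show ?l
  proof (intro allI impI)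
   fix fi :: "'a cf" assume fi: "tst fi"
   note c = tst_cnj[OF fi]
   show "(LINT x|MB. u x * L fi x) = cor s * (LINT x|MB. g x * fi x)" using 1[OF c] 2[OF c] r[rule_format, OF c] r[rule_format, OF tst_cmult[OF c, of \<i>]] by (simp add: complex_eq_iff)
  qed
 qed
qed

lemma is_laplacian_iff:
 assumes u: "u \<in> L2 MB" and f: "f \<in> L2 MB"
 shows "is_laplacian (ball 0 1) u f \<longleftrightarrow> (ALL fi. tst fi --> inner (mk u) (mk (lap fi)) = inner (mk f) (mk fi))" unfolding is_laplacian_def Ball_def tst_iff lap_partials
 using weak_pairing[OF u f, of lap 1] by (simp add: tst_lap lap_bl tst_smooth)

lemma harmonic_iff: "u \<in> harmonic_L2 (ball 0 1) \<longleftrightarrow> u \<in> L2 MB & mk u \<in> KR.H" unfolding harmonic_L2_def H_lap_iff by (auto simp: is_laplacian_iff L2_zero mk_zero)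

section \<open>Weak derivatives and the identification of H^2_0\<close>

definition wk :: "'a list => 'a::euclidean_space l2 => 'a l2 => bool" where
 "wk bs u g \<longleftrightarrow> (ALL fi. tst fi --> inner u (mk (partials bs fi)) = (-1) ^ length bs * inner g (mk fi))"

lemma is_weak_deriv_iff:
 assumes u: "u \<in> L2 MB" and g: "g \<in> L2 MB" and bs: "set bs \<subseteq> Basis"
 shows "is_weak_deriv (ball 0 1) bs u g \<longleftrightarrow> wk bs (mk u) (mk g)" unfolding is_weak_deriv_def Ball_def tst_iff wk_def using weak_pairing[OF u g, of "partials bs" "(-1) ^ length bs"] bs
 by (simp add: tst_partials partials_bl tst_smooth)

lemma wk_unique: assumes "wk bs u g" "wk bs u g'" shows "g = g'"
proof -
 have "inner (mk fi) (g - g') = 0" if "tst fi" for fi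
 proof -
  have "(-1) ^ length bs * inner g (mk fi) = (-1) ^ length bs * inner g' (mk fi)" using assms that unfolding wk_def by metis
  thus ?thesis by (simp add: inner_diff_right inner_commute)
 qed
 hence "g - g' = 0" by (rule l2_dense_tst)
 thus ?thesis by simp
qed

lemma wk_diff: "wk bs u g ==> wk bs u' g' ==> wk bs (u - u') (g - g')" by (simp add: wk_def inner_diff_left right_diff_distrib)

lemma wk_limit:
 assumes "!!n::nat. wk bs (u n) (g n)" "u ----> u'" "g ----> g'" shows "wk bs u' g'" unfolding wk_def
proof (intro allI impI)
 fix fi :: "'a cf" assume fi: "tst fi"
 have a: "(%n. inner (u n) (mk (partials bs fi))) ----> inner u' (mk (partials bs fi))" by (intro tendsto_intros assms)
 have b: "(%n. (-1) ^ length bs * inner (g n) (mk fi)) ----> (-1) ^ length bs * inner g' (mk fi)" by (intro tendsto_intros assms)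
 have eq: "inner (u n) (mk (partials bs fi)) = (-1) ^ length bs * inner (g n) (mk fi)" for n using assms(1) fi by (simp add: wk_def)
 from LIMSEQ_unique[OF a[unfolded eq] b] show "inner u' (mk (partials bs fi)) = (-1) ^ length bs * inner g' (mk fi)" .
qed

text \<open>Each integration by parts moves the outermost derivative first, hence the reversed
  list.\<close>

lemma inner_partials:
 "tst fi ==> tst ps ==> set bs \<subseteq> Basis ==>
  inner (mk fi) (mk (partials bs ps)) = (-1) ^ length bs * inner (mk (partials (rev bs) fi)) (mk ps)"
proof (induction bs arbitrary: fi)
 case (Cons b bs)
 have "inner (mk fi) (mk (partials (b # bs) ps)) = - inner (mk (pd b fi)) (mk (partials bs ps))" unfolding partials_Cons using Cons.prems by (intro inner_ibp tst_partials) auto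
 also have "... = - ((-1) ^ length bs * inner (mk (partials (rev bs) (pd b fi))) (mk ps))" using Cons.prems by (subst Cons.IH) (auto intro: tst_pd)
 finally show ?case by (simp add: partials_append partials_Cons del: partials.simps(2))
qed simp

lemma multi_indices2_cases:
 assumes "bs \<in> multi_indices2"
 obtains "bs = []" | b where "bs = [b]" "b \<in> Basis" | b c where "bs = [b, c]" "b \<in> Basis" "c \<in> Basis"
proof (cases bs)
 case (Cons b l)
 thus thesis using assms that by (cases l) (auto simp: multi_indices2_def)
qed (use that in blast)

lemma partials_rev:
 assumes "tst fi" "bs \<in> multi_indices2" shows "partials (rev bs) fi = partials bs fi" using assms(2) by (cases rule: multi_indices2_cases) (simp_all add: partials_Cons tst_pd_comm[OF assms(1)] del: partials.simps(2))

lemma wk_tst: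
 assumes "tst fi" "bs \<in> multi_indices2" shows "wk bs (mk fi) (mk (partials bs fi))" using assms inner_partials[OF assms(1)] partials_rev[OF assms] by (simp add: wk_def multi_indices2_def)

lemma partials_le:
 assumes "tst fi" "bs \<in> multi_indices2" shows "norm (mk (partials bs fi)) <= 4 * norm (mk (lap fi))" using assms(2)
proof (cases rule: multi_indices2_cases)
 case 1 thus ?thesis using tst_le[OF assms(1)] by simp
next
 case (2 b) thus ?thesis using order_trans[OF tst_pd_le[OF assms(1), of b], of "4 * norm (mk (lap fi))"] by (simp add: partials_Cons del: partials.simps(2))
next
 case (3 b c) thus ?thesis using order_trans[OF tst_hess_le[OF assms(1), of c b], of "4 * norm (mk (lap fi))"] by (simp add: partials_Cons del: partials.simps(2))
qed

lemma finite_multi_indices2: "finite (multi_indices2 :: 'a::euclidean_space list set)" unfolding multi_indices2_def by (rule finite_lists_length_le) simp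

lemma weak_deriv_mk:
 assumes "u \<in> L2 MB" "bs \<in> multi_indices2" "wk bs (mk u) g"
 shows "mk (weak_deriv (ball 0 1) bs u) = g" "weak_deriv (ball 0 1) bs u \<in> L2 MB"
proof -
 have bs: "set bs \<subseteq> Basis" using assms(2) by (simp add: multi_indices2_def)
 have "rp g \<in> L2 MB & is_weak_deriv (ball 0 1) bs u (rp g)" using assms by (simp add: is_weak_deriv_iff rp_L2 bs mk_rp)
 from someI[where P="%g. g \<in> L2 MB & is_weak_deriv (ball 0 1) bs u g", OF this]
 have d: "weak_deriv (ball 0 1) bs u \<in> L2 MB" "is_weak_deriv (ball 0 1) bs u (weak_deriv (ball 0 1) bs u)" unfolding weak_deriv_def by blast+
 show "weak_deriv (ball 0 1) bs u \<in> L2 MB" by (rule d)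
 show "mk (weak_deriv (ball 0 1) bs u) = g" using d assms by (intro wk_unique[of bs "mk u"]) (simp_all add: is_weak_deriv_iff bs)
qed

lemma H2_norm_eq:
 assumes "u \<in> L2 MB" "!!bs. bs \<in> multi_indices2 ==> wk bs (mk u) (g bs)"
 shows "H2_norm (ball 0 1) u = sqrt (\<Sum>bs\<in>multi_indices2. (norm (g bs))^2)" unfolding H2_norm_def using weak_deriv_mk[OF assms(1) _ assms(2)] by (simp add: norm_mk[symmetric])

lemma H2_iff: "u \<in> H2 (ball 0 1) \<longleftrightarrow> u \<in> L2 MB & (EX g. ALL bs:multi_indices2. wk bs (mk u) (g bs))"
proof -
 have "(EX g:L2 MB. is_weak_deriv (ball 0 1) bs u g) \<longleftrightarrow> (EX g. wk bs (mk u) g)" if "u \<in> L2 MB" "bs \<in> multi_indices2" for bs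
  using that is_weak_deriv_iff[OF that(1), of _ bs] by (auto simp: multi_indices2_def intro: bexI[of _ "rp _"] simp: rp_L2 mk_rp)
 thus ?thesis unfolding H2_def using bchoice[of multi_indices2 "%bs. wk bs (mk u)"] by (auto, blast)
qed

text \<open>Convergence in the H^2 norm contains convergence of the Laplacians; conversely
  \<open>partials_le\<close> makes all derivatives up to second order Cauchy once the Laplacians
  converge. So the H^2 closure and the graph closure of the test functions agree.\<close>

lemma H2_0_iff: "u \<in> H2_0 (ball 0 1) \<longleftrightarrow> u \<in> L2 MB & (EX f. (mk u, f) \<in> KS)"
proof
 assume "u \<in> H2_0 (ball 0 1)"
 hence u: "u \<in> H2 (ball 0 1)" and app: "!!ep. ep > 0 ==> EX fi. tst fi & H2_norm (ball 0 1) (%x. u x - fi x) < ep" by (auto simp: H2_0_def tst_iff[symmetric])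
 then obtain g where uL: "u \<in> L2 MB" and g: "!!bs. bs \<in> multi_indices2 ==> wk bs (mk u) (g bs)" unfolding H2_iff by blast
 have "ALL n::nat. EX fi. tst fi & H2_norm (ball 0 1) (%x. u x - fi x) < 1 / real (Suc n)" using app by simp
 from choice[OF this] obtain fi where fi: "!!n. tst (fi n)" "!!n. H2_norm (ball 0 1) (%x. u x - fi n x) < 1 / real (Suc n)" by blast
 have lim: "(%n. mk (partials bs (fi n))) ----> g bs" if bs: "bs \<in> multi_indices2" for bs
 proof -
  have "norm (mk (partials bs (fi n)) - g bs) <= 1 / real (Suc n)" for n
  proof -
   have "wk bs (mk (%x. u x - fi n x)) (g bs - mk (partials bs (fi n)))" if "bs \<in> multi_indices2" for bs using wk_diff[OF g[OF that] wk_tst[OF fi(1) that]] by (simp add: mk_diff uL tst_L2 fi(1))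
   from H2_norm_eq[OF L2_diff[OF uL tst_L2[OF fi(1)]] this]
   have "H2_norm (ball 0 1) (%x. u x - fi n x) = sqrt (\<Sum>bs\<in>multi_indices2. (norm (g bs - mk (partials bs (fi n))))^2)" .
   also have "... >= sqrt ((norm (g bs - mk (partials bs (fi n))))^2)" by (intro real_sqrt_le_mono member_le_sum[of bs _ "%bs. (norm (g bs - mk (partials bs (fi n))))^2"] bs finite_multi_indices2) auto
   finally show ?thesis using fi(2)[of n] by (simp add: norm_minus_commute)
  qed
  hence "\<forall>\<^sub>F n in sequentially. norm (mk (partials bs (fi n)) - g bs) <= inverse (real (Suc n))" by (simp add: inverse_eq_divide)
  from Lim_null_comparison[OF this LIMSEQ_inverse_real_of_nat] show ?thesis by (rule LIM_zero_cancel)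
 qed
 have "g [] = mk u" using wk_unique[OF g[of "[]"], of "mk u"] by (simp add: multi_indices2_def wk_def)
 hence l0: "(%n. mk (fi n)) ----> mk u" using lim[of "[]"] by (simp add: multi_indices2_def)
 have "(%n. mk (lap (fi n))) ----> (\<Sum>b\<in>Basis. g [b, b])" unfolding mk_lap[OF fi(1)]
  by (rule tendsto_sum) (use lim[of "[_, _]"] in \<open>simp add: multi_indices2_def partials_Cons del: partials.simps(2)\<close>)
 hence "(mk u, - (\<Sum>b\<in>Basis. g [b, b])) \<in> KS" by (intro KS_closedI[OF fi(1) l0]) simp
 thus "u \<in> L2 MB & (EX f. (mk u, f) \<in> KS)" using uL by blast
next
 assume "u \<in> L2 MB & (EX f. (mk u, f) \<in> KS)"
 then obtain f where uL: "u \<in> L2 MB" and S: "(mk u, f) \<in> KS" by blast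
 obtain fi where fi: "!!n::nat. tst (fi n)" "(%n. mk (fi n)) ----> mk u" "(%n. mk (lap (fi n))) ----> - f" using KS_seq[OF S] by blast
 have "ALL bs:multi_indices2. EX g. (%n. mk (partials bs (fi n))) ----> g"
 proof
  fix bs :: "'a list" assume bs: "bs \<in> multi_indices2"
  have "Cauchy (%n. mk (partials bs (fi n)))"
  proof (rule CauchyI)
   fix e :: real assume "e > 0"
   hence "EX M. ALL m>=M. ALL n>=M. norm (mk (lap (fi m)) - mk (lap (fi n))) < e / 4" using LIMSEQ_imp_Cauchy[OF fi(3)] by (intro CauchyD) auto
   then obtain M where M: "!!m n. m >= M ==> n >= M ==> norm (mk (lap (fi m)) - mk (lap (fi n))) < e / 4" by blast
   have le: "norm (mk (partials bs (fi m)) - mk (partials bs (fi n))) <= 4 * norm (mk (lap (fi m)) - mk (lap (fi n)))" for m n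
   proof -
    have t: "tst (%x. - fi n x)" using tst_cmult[OF fi(1), of "-1"] by simp
    have s: "smooth (fi m)" "smooth (fi n)" "smooth (%x. - fi n x)" using fi(1) t by (auto intro: tst_smooth)
    have bl: "bounded_linear (uminus :: complex => complex)" by (rule bounded_linear_minus[OF bounded_linear_ident])
    have bs': "set bs \<subseteq> Basis" using bs by (simp add: multi_indices2_def)
    have p: "partials bs (%x. fi m x + - fi n x) = (%x. partials bs (fi m) x - partials bs (fi n) x)" by (subst partials_add[OF s(1,3) bs']) (simp add: partials_bl[OF s(2) bl bs'])
    have l: "lap (%x. fi m x + - fi n x) = (%x. lap (fi m) x - lap (fi n) x)" by (subst lap_add[OF s(1,3)]) (simp add: lap_bl[OF s(2) bl])
    have L: "partials bs (fi k) \<in> L2 MB" "lap (fi k) \<in> L2 MB" for k by (rule tst_L2[OF tst_partials[OF fi(1) bs']]) (rule tst_lap_L2[OF fi(1)])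
    show ?thesis using partials_le[OF tst_add[OF fi(1) t] bs, of m] unfolding p l by (simp add: mk_diff L)
   qed
   show "EX M. ALL m>=M. ALL n>=M. norm (mk (partials bs (fi m)) - mk (partials bs (fi n))) < e"
   proof (intro exI[of _ M] allI impI)
    fix m n assume "m >= M" "n >= M"
    from M[OF this] le[of m n] show "norm (mk (partials bs (fi m)) - mk (partials bs (fi n))) < e" by linarith
   qed
  qed
  thus "EX g. (%n. mk (partials bs (fi n))) ----> g" by (simp add: Cauchy_convergent_iff convergent_def)
 qed
 from bchoice[OF this] obtain g where g: "!!bs. bs \<in> multi_indices2 ==> (%n. mk (partials bs (fi n))) ----> g bs" by blast
 have wg: "wk bs (mk u) (g bs)" if "bs \<in> multi_indices2" for bs by (rule wk_limit[OF wk_tst[OF fi(1) that] fi(2) g[OF that]])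
 have norm: "H2_norm (ball 0 1) (%x. u x - fi n x) = sqrt (\<Sum>bs\<in>multi_indices2. (norm (g bs - mk (partials bs (fi n))))^2)" for n
 proof (rule H2_norm_eq[OF L2_diff[OF uL tst_L2[OF fi(1)]]])
  fix bs :: "'a list" assume bs: "bs \<in> multi_indices2"
  show "wk bs (mk (%x. u x - fi n x)) (g bs - mk (partials bs (fi n)))" using wk_diff[OF wg[OF bs] wk_tst[OF fi(1) bs]] by (simp add: mk_diff uL tst_L2 fi(1))
 qed
 have "(%n. H2_norm (ball 0 1) (%x. u x - fi n x)) ----> sqrt (\<Sum>bs\<in>(multi_indices2 :: 'a list set). (norm (g bs - g bs))^2)"
  unfolding norm by (intro tendsto_real_sqrt tendsto_sum tendsto_power tendsto_norm tendsto_diff tendsto_const g)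
 hence l0: "(%n. H2_norm (ball 0 1) (%x. u x - fi n x)) ----> 0" by simp
 hence "EX fi. tst fi & H2_norm (ball 0 1) (%x. u x - fi x) < ep" if "ep > 0" for ep
 proof -
  have "\<forall>\<^sub>F n in sequentially. H2_norm (ball 0 1) (%x. u x - fi n x) < ep" using order_tendstoD(2)[OF l0 that] .
  from eventually_happens[OF this] show ?thesis using fi(1) by auto
 qed
 moreover have "u \<in> H2 (ball 0 1)" unfolding H2_iff using uL wg by blast
 ultimately show "u \<in> H2_0 (ball 0 1)" by (simp add: H2_0_def Bex_def tst_iff)
qed

text \<open>The distributional Laplacian of \<open>h + w\<close> is that of \<open>w\<close>, and
  density of the test functions identifies it with the second component in the minimal
  graph.\<close>

lemma krein_laplacian_iff:
 "(u, f) \<in> krein_laplacian (ball 0 1) \<longleftrightarrow> u \<in> L2 MB & f \<in> L2 MB & (mk u, mk f) \<in> KR.K"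
proof
 assume "(u, f) \<in> krein_laplacian (ball 0 1)"
 then obtain h w where u: "u = (%x. h x + w x)" "h \<in> harmonic_L2 (ball 0 1)" "w \<in> H2_0 (ball 0 1)"
  and f: "f \<in> L2 MB" "is_laplacian (ball 0 1) u (%x. - f x)" by (auto simp: krein_laplacian_def krein_dom_def)
 from u obtain g where h: "h \<in> L2 MB" "mk h \<in> KR.H" and w: "w \<in> L2 MB" "(mk w, g) \<in> KS" by (auto simp: harmonic_iff H2_0_iff)
 have uL: "u \<in> L2 MB" "mk u = mk h + mk w" unfolding u(1) by (auto intro: L2_add h w simp: mk_add h w)
 have "inner (mk fi) (g - mk f) = 0" if fi: "tst fi" for fi
 proof -
  have "inner (mk u) (mk (lap fi)) = - inner (mk f) (mk fi)" using f(2) fi unfolding is_laplacian_iff[OF uL(1) L2_uminus[OF f(1)]] by (simp add: mk_uminus f(1))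
  moreover have "inner (mk u) (mk (lap fi)) = - inner g (mk fi)" using h(2) KS_lap[OF w(2) fi] fi by (simp add: uL inner_add_left H_lap_iff)
  ultimately show ?thesis by (simp add: inner_diff_right inner_commute)
 qed
 hence "g - mk f = 0" by (rule l2_dense_tst)
 thus "u \<in> L2 MB & f \<in> L2 MB & (mk u, mk f) \<in> KR.K" using uL f(1) h w by (auto simp: KR.K_def)
next
 assume a: "u \<in> L2 MB & f \<in> L2 MB & (mk u, mk f) \<in> KR.K"
 then obtain h w where h: "mk u = h + w" "h \<in> KR.H" "(w, mk f) \<in> KS" by (auto simp: KR.K_def)
 have "(%x. u x - rp w x) \<in> harmonic_L2 (ball 0 1)" using a h by (simp add: harmonic_iff L2_diff rp_L2 mk_diff mk_rp)
 moreover have "rp w \<in> H2_0 (ball 0 1)" using h by (auto simp: H2_0_iff rp_L2 mk_rp)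
 ultimately have "u \<in> krein_dom (ball 0 1)" unfolding krein_dom_def by (intro CollectI exI[of _ "%x. u x - rp w x"] exI[of _ "rp w"]) auto
 moreover have "is_laplacian (ball 0 1) u (%x. - f x)" using a h KS_lap[OF h(3)] by (simp add: is_laplacian_iff L2_uminus mk_uminus inner_add_left H_lap_iff)
 ultimately show "(u, f) \<in> krein_laplacian (ball 0 1)" using a by (simp add: krein_laplacian_def)
qed

lemma orth_compl_harmonic_iff:
 "u \<in> orth_compl MB (harmonic_L2 (ball 0 1)) \<longleftrightarrow> u \<in> L2 MB & mk u \<in> KR.Rn"
proof -
 have "(ALL v:harmonic_L2 (ball 0 1). L2_inner MB u v = 0) \<longleftrightarrow> mk u \<in> KR.Rn" if u: "u \<in> L2 MB"
 proof
  assume z: "ALL v:harmonic_L2 (ball 0 1). L2_inner MB u v = 0"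
  have "inner (mk u) h = 0" if "h \<in> KR.H" for h
  proof -
   have "L2_inner MB u (rp h) = 0" using z that by (simp add: harmonic_iff rp_L2 mk_rp)
   thus ?thesis unfolding L2_inner_mk[OF u rp_L2] by (simp add: mk_rp complex_eq_iff)
  qed
  from this[OF KR.P_in[of "mk u"]] have "inner (KR.P (mk u)) (KR.P (mk u)) = 0" using KR.H_Rn(1)[OF KR.P_in KR.Q_in, of "mk u" "mk u"] KR.PQ[of "mk u"] by (metis add.right_neutral inner_add_right inner_commute)
  thus "mk u \<in> KR.Rn" using KR.PQ[of "mk u"] KR.Q_in[of "mk u"] by simp
 next
  assume r: "mk u \<in> KR.Rn"
  show "ALL v:harmonic_L2 (ball 0 1). L2_inner MB u v = 0" using KR.H_Rn(2)[OF _ r] KR.H_Rn(2)[OF H_cm r] by (auto simp: harmonic_iff L2_inner_mk u complex_eq_iff)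
 qed
 thus ?thesis by (auto simp: orth_compl_def)
qed

text \<open>Orthogonality to the harmonic functions removes the freedom of \<open>h\<close> in
  \<open>u = h + T f\<close>, so \<open>L\<close> is the inverse of \<open>T\<close> on
  \<open>Rn\<close>.\<close>

lemma krein_reduced_iff:
 "(u, f) \<in> krein_reduced (ball 0 1) \<longleftrightarrow> u \<in> L2 MB & f \<in> L2 MB & mk f \<in> KR.Rn & mk u = KR.T (mk f)"
proof -
 have "(mk u, mk f) \<in> KR.K & mk u \<in> KR.Rn \<longleftrightarrow> mk f \<in> KR.Rn & mk u = KR.T (mk f)"
 proof
  assume a: "(mk u, mk f) \<in> KR.K & mk u \<in> KR.Rn"
  have "mk u - KR.T (mk f) \<in> KR.Rn" using a by (intro subspace_diff KR.Rn_sub KR.T_in) auto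
  hence "inner (mk u - KR.T (mk f)) (mk u - KR.T (mk f)) = 0" using a by (intro KR.H_Rn) (auto simp: KR.K_iff)
  thus "mk f \<in> KR.Rn & mk u = KR.T (mk f)" using a by (auto simp: KR.K_iff)
 next
  assume "mk f \<in> KR.Rn & mk u = KR.T (mk f)"
  thus "(mk u, mk f) \<in> KR.K & mk u \<in> KR.Rn" using subspace_0[OF KR.H_sub] by (auto simp: KR.K_iff KR.T_in)
 qed
 thus ?thesis by (auto simp: krein_reduced_def krein_laplacian_iff orth_compl_harmonic_iff)
qed

section \<open>Positivity of lambda_0\<close>

lemma l2_nontrivial: "EX x::'a::euclidean_space l2. x ~= 0"
proof -
 have "mk (%_. 1) ~= (0 :: 'a l2)"
 proof
  assume "mk (%_. 1) = (0 :: 'a l2)"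
  hence "AE x in (MB :: 'a measure). (1::complex) = 0" using mk_eq_iff[OF pol_L2[OF pol_const] L2_zero, of "1::complex", where 'a='a] by (simp only: mk_zero simp_thms)
  from continuous_AE_zero[OF _ this, of 0] show False by simp
 qed
 thus ?thesis by blast
qed

text \<open>\<open>reduced_resolvent\<close> keeps the spectrum above a positive \<open>mm\<close>,
  and the eigenvalue \<open>1 / s\<close> shows that it is nonempty, so the infimum inherits the
  bound.\<close>

lemma lambda0_pos: "lambda0 (ball (0::'a::euclidean_space) 1) > 0"
proof -
 define X where "X = orth_compl MB (harmonic_L2 (ball (0::'a) 1))"
 define Sp where "Sp = {t. cor t \<in> op_spectrum MB X (krein_reduced (ball (0::'a) 1))}"
 obtain mm where mm: "mm > 0" "!!t g. t < mm ==> g \<in> KR.Rn ==> EX f:KR.Rn. f - t *\<^sub>R KR.T f = (g :: 'a l2)"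
  "!!t. t < mm ==> EX D. ALL f:KR.Rn. norm (KR.T (f :: 'a l2)) <= D * norm (f - t *\<^sub>R KR.T f)" using KR.reduced_resolvent by blast
 have mk': "mk (%x. f x - cor t * u x) = mk f - t *\<^sub>R mk u"
  "(%x. f x - cor t * u x) \<in> L2 MB"
  if "f \<in> L2 MB" "u \<in> L2 MB" for f u :: "'a cf" and t using that by (simp_all add: mk_diff L2_cmult mk_scaleR L2_diff)
 have ge: "t >= mm" if "t \<in> Sp" for t
 proof (rule ccontr)
  assume "~ t >= mm"
  hence t: "t < mm" by simp
  have "EX (u, f):krein_reduced (ball 0 1). AE x in MB. f x - cor t * u x = g x" if g: "g \<in> X" for g
  proof -
   have g': "g \<in> L2 MB" "mk g \<in> KR.Rn" using g by (simp_all add: X_def orth_compl_harmonic_iff)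
   obtain f where f: "f \<in> KR.Rn" "f - t *\<^sub>R KR.T f = mk g" using mm(2)[OF t g'(2)] by blast
   have "(rp (KR.T f), rp f) \<in> krein_reduced (ball 0 1)" using f by (simp add: krein_reduced_iff rp_L2 mk_rp)
   moreover have "AE x in MB. rp f x - cor t * rp (KR.T f) x = g x" using mk_eq_iff[OF mk'(2)[OF rp_L2 rp_L2] g'(1)] f by (simp add: mk' rp_L2 mk_rp)
   ultimately show ?thesis by blast
  qed
  moreover have "EX C. ALL (u, f):krein_reduced (ball (0::'a) 1). L2_norm MB u <= C * L2_norm MB (%x. f x - cor t * u x)"
  proof -
   obtain D where D: "ALL f:KR.Rn. norm (KR.T (f :: 'a l2)) <= D * norm (f - t *\<^sub>R KR.T f)" using mm(3)[OF t] by blast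
   show ?thesis
   proof (intro exI[of _ D] ballI, clarify)
    fix u f :: "'a cf" assume "(u, f) \<in> krein_reduced (ball 0 1)"
    hence uf: "u \<in> L2 MB" "f \<in> L2 MB" "mk f \<in> KR.Rn" "mk u = KR.T (mk f)" by (auto simp: krein_reduced_iff)
    have "norm (mk u) <= D * norm (mk f - t *\<^sub>R mk u)" using D uf by simp
    thus "L2_norm MB u <= D * L2_norm MB (%x. f x - cor t * u x)" by (simp add: norm_mk[symmetric] mk' uf)
   qed
  qed
  ultimately have "cor t \<in> resolvent_set MB X (krein_reduced (ball 0 1))" unfolding resolvent_set_def by blast
  thus False using that by (simp add: Sp_def op_spectrum_def)
 qed
 obtain s x where sx: "s > 0" "x \<in> KR.Rn" "x ~= (0::'a l2)" "KR.T x = s *\<^sub>R x" using KR.T_eigenvector[OF l2_nontrivial] by blast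
 have "1 / s \<in> Sp"
 proof (rule ccontr)
  assume "1 / s \<notin> Sp"
  hence "cor (1 / s) \<in> resolvent_set MB X (krein_reduced (ball 0 1))" by (simp add: Sp_def op_spectrum_def)
  then obtain C where C: "ALL (u, f):krein_reduced (ball (0::'a) 1). L2_norm MB u <= C * L2_norm MB (%x. f x - cor (1 / s) * u x)" unfolding resolvent_set_def by blast
  have "(rp (KR.T x), rp x) \<in> krein_reduced (ball 0 1)" using sx by (simp add: krein_reduced_iff rp_L2 mk_rp)
  with C have "L2_norm MB (rp (KR.T x)) <= C * L2_norm MB (%y. rp x y - cor (1 / s) * rp (KR.T x) y)" by blast
  hence "norm (KR.T x) <= C * norm (x - (1 / s) *\<^sub>R KR.T x)" unfolding norm_mk[OF rp_L2, symmetric] norm_mk[OF mk'(2)[OF rp_L2 rp_L2], symmetric] by (simp only: mk' rp_L2 mk_rp)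
  hence "s * norm x <= 0" using sx by simp
  thus False using mult_pos_pos[OF sx(1), of "norm x"] sx(3) by simp
 qed
 hence "mm <= Inf Sp" using ge by (intro cInf_greatest) auto
 thus ?thesis using mm(1) by (simp add: lambda0_def Sp_def X_def)
qed

subsection \<open>The functions \<open>(1 - |x|^2)^2 p\<close> belong to \<open>H^2\<^sub>0\<close>\<close>

text \<open>Bounded pointwise convergence on the ball: stable under sums and products, and by
  dominated convergence strong enough for L^2 (\<open>good_mk\<close>).\<close>

definition good :: "(nat => 'a::euclidean_space cf) => ('a cf) => bool" where
 "good F G \<longleftrightarrow> (EX B. ALL n. ALL x:ball 0 1. norm (F n x) <= B) & (ALL x:ball 0 1. (%n. F n x) ----> G x)"

lemma good_add: assumes "good F G" "good F' G'" shows "good (%n x. F n x + F' n x) (%x. G x + G' x)"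
proof -
 obtain B B' where B: "!!n x. x \<in> ball 0 1 ==> norm (F n x) <= B" "!!n x. x \<in> ball 0 1 ==> norm (F' n x) <= B'" using assms unfolding good_def by blast
 have "norm (F n x + F' n x) <= B + B'" if "x \<in> ball 0 1" for n x by (rule norm_triangle_mono) (rule B[OF that])+
 moreover have "(%n. F n x + F' n x) ----> G x + G' x" if "x \<in> ball 0 1" for x using assms that unfolding good_def by (intro tendsto_add) blast+
 ultimately show ?thesis unfolding good_def by blast
qed

lemma good_mult: assumes "good F G" "good F' G'" shows "good (%n x. F n x * F' n x) (%x. G x * G' x)"
proof -
 obtain B B' where B: "!!n x. x \<in> ball 0 1 ==> norm (F n x) <= B" "!!n x. x \<in> ball 0 1 ==> norm (F' n x) <= B'" using assms unfolding good_def by blast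
 have "norm (F n x * F' n x) <= B * B'" if "x \<in> ball 0 1" for n x unfolding norm_mult by (intro mult_mono B that norm_ge_zero order_trans[OF norm_ge_zero B(1)[OF that]])
 moreover have "(%n. F n x * F' n x) ----> G x * G' x" if "x \<in> ball 0 1" for x using assms that unfolding good_def by (intro tendsto_mult) blast+
 ultimately show ?thesis unfolding good_def by blast
qed

lemma good_sum:
 assumes "finite I" "!!i. i \<in> I ==> good (F i) (G i)" shows "good (%n x. \<Sum>i\<in>I. F i n x) (%x. \<Sum>i\<in>I. G i x)" using assms
proof (induction I)
 case empty show ?case by (auto simp: good_def)
qed (simp add: good_add)

lemma good_cont: assumes "continuous_on UNIV f" shows "good (%n. f) f"
proof -
 have "compact (f ` cball 0 1)" by (intro compact_continuous_image continuous_on_subset[OF assms]) auto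
 then obtain B where "!!x. x \<in> cball 0 1 ==> norm (f x) <= B" using compact_imp_bounded bounded_iff by (metis image_eqI)
 hence "ALL n::nat. ALL x:ball 0 1. norm (f x) <= B" by auto
 thus ?thesis unfolding good_def by blast
qed

lemma good_seq: assumes "a ----> l" shows "good (%n x. a n) (%x. l)" using convergent_imp_bounded[OF assms] assms by (auto simp: good_def bounded_iff)

lemma good_mk:
 fixes F :: "nat => 'a::euclidean_space cf"
 assumes F: "!!n. F n \<in> L2 MB" and G: "G \<in> L2 MB" and g: "good F G"
 shows "(%n. mk (F n)) ----> mk G"
proof -
 obtain B where B: "!!n x. x \<in> ball 0 1 ==> norm (F n x) <= B" and lim: "!!x. x \<in> ball 0 1 ==> (%n. F n x) ----> G x" using g unfolding good_def by blast
 have GB: "norm (G x) <= B" if "x \<in> ball 0 1" for x by (rule Lim_bounded[OF tendsto_norm[OF lim[OF that]], of 0]) (use B[OF that] in auto)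
 interpret finite_measure "MB :: 'a measure" by (rule finite_measure_MB)
 note [measurable] = L2D(1)[OF F] L2D(1)[OF G]
 have "(%n. LINT x|MB. (norm (F n x - G x))^2) ----> (LINT x|(MB :: 'a measure). 0)"
 proof (rule integral_dominated_convergence)
  show "integrable MB (%x::'a. (2 * B)^2)" by simp
  show "AE x in MB. (%n. (norm (F n x - G x))^2) ----> 0"
  proof (rule AE_I2)
   fix x :: 'a assume "x \<in> space MB"
   hence "x \<in> ball 0 1" by (simp add: space_restrict_space)
   from tendsto_power[OF tendsto_norm[OF tendsto_diff[OF lim[OF this] tendsto_const[of "G x"]]], of 2]
   show "(%n. (norm (F n x - G x))^2) ----> 0" by simp
  qed
  show "AE x in MB. norm ((norm (F n x - G x))^2) <= (2 * B)^2" for n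
  proof (rule AE_I2)
   fix x :: 'a assume "x \<in> space MB"
   hence x: "x \<in> ball 0 1" by (simp add: space_restrict_space)
   have "norm (F n x - G x) <= 2 * B" using norm_triangle_ineq4[of "F n x" "G x"] B[OF x, of n] GB[OF x] by linarith
   hence "(norm (F n x - G x))^2 <= (2 * B)^2" by (rule power_mono) simp
   thus "norm ((norm (F n x - G x))^2) <= (2 * B)^2" by simp
  qed
 qed measurable
 hence "(%n. (norm (mk (F n) - mk G))^2) ----> 0" by (simp add: mk_diff[symmetric] F G norm_mk_sq L2_diff)
 from tendsto_real_sqrt[OF this] have "(%n. norm (mk (F n) - mk G)) ----> 0" by simp
 thus ?thesis by (simp add: tendsto_norm_zero_iff LIM_zero_iff)
qed

definition eps :: "nat => real" where "eps n = 1 / real (Suc n)"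
abbreviation rho :: "nat => real" where "rho n == 1 - eps n"

lemma eps_pos: "eps n > 0" by (simp add: eps_def)
lemma eps_lim: "eps ----> 0" using LIMSEQ_inverse_real_of_nat by (simp add: eps_def[abs_def] inverse_eq_divide)

lemma power_exp_le:
 assumes "(y::real) >= 0" "j <= (2::nat)" shows "y ^ j * exp (- y) <= 2"
proof -
 have "j = 0 | j = 1 | j = 2" using assms(2) by auto
 hence "y ^ j <= 2 * (1 + y + y^2 / 2)" using assms(1) by (elim disjE) (simp_all add: power2_eq_square)
 also have "... <= 2 * exp y" using exp_lower_Taylor_quadratic[OF assms(1)] by simp
 finally show ?thesis by (simp add: exp_minus field_simps)
qed

text \<open>With \<open>y = ep / t\<close> the product \<open>ep ^ j * bmp ep j t\<close> is
  \<open>y ^ j * exp (- y)\<close>, which is bounded uniformly in \<open>t > 0\<close> and tends to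
  its value at \<open>y = 0\<close> when \<open>t\<close> stays away from 0. Derivatives of the
  cutoff are thus harmless if they come with as many factors \<open>ep\<close>.\<close>

lemma good_bump:
 assumes j: "j <= 2"
 shows "good (%n x::'a::euclidean_space. cor (eps n) ^ j * bumpf (eps n) j (rho n) x) (%x. if j = 0 then 1 else 0)"
proof -
 have eq: "eps n ^ j * bmp (eps n) j t = (if t > 0 then (eps n / t) ^ j * exp (- (eps n / t)) else 0)" for n t by (simp add: bmp_def power_divide)
 have nn: "0 <= eps n ^ j * bmp (eps n) j t" for n t using eps_pos[of n] by (simp add: bmp_nonneg)
 have le: "eps n ^ j * bmp (eps n) j t <= 2" for n t unfolding eq using power_exp_le[OF _ j, of "eps n / t"] eps_pos[of n] by (auto simp: less_imp_le)
 have lim: "(%n. eps n ^ j * bmp (eps n) j (rho n - inner x x)) ----> (if j = 0 then 1 else 0)" if x: "x \<in> ball 0 1" for x :: 'a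
 proof -
  have "inner x x < 1" using x by (simp add: power_less_one_iff flip: power2_norm_eq_inner)
  hence t: "1 - 0 - inner x x > 0" by simp
  have lt: "(%n. rho n - inner x x) ----> 1 - 0 - inner x x" by (intro tendsto_intros eps_lim)
  have "(%n. (eps n / (rho n - inner x x)) ^ j * exp (- (eps n / (rho n - inner x x)))) ----> (0 / (1 - 0 - inner x x)) ^ j * exp (- (0 / (1 - 0 - inner x x)))"
   by (intro tendsto_intros lt eps_lim) (use t in auto)
  moreover have "\<forall>\<^sub>F n in sequentially. (eps n / (rho n - inner x x)) ^ j * exp (- (eps n / (rho n - inner x x))) = eps n ^ j * bmp (eps n) j (rho n - inner x x)"
   using order_tendstoD(1)[OF lt t] by eventually_elim (simp add: eq)
  ultimately have "(%n. eps n ^ j * bmp (eps n) j (rho n - inner x x)) ----> (0 / (1 - 0 - inner x x)) ^ j * exp (- (0 / (1 - 0 - inner x x)))" by (rule Lim_transform_eventually)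
  thus ?thesis by (simp add: power_0_left)
 qed
 have c: "cor (eps n) ^ j * bumpf (eps n) j (rho n) x = cor (eps n ^ j * bmp (eps n) j (rho n - inner x x))" for n and x :: 'a by (simp add: bumpf_def)
 have "(%n. cor (eps n ^ j * bmp (eps n) j (rho n - inner x x))) ----> (if j = 0 then 1 else 0)" if "x \<in> ball 0 1" for x :: 'a using tendsto_of_real[OF lim[OF that]] by (simp split: if_splits)
 moreover have "norm (cor (eps n ^ j * bmp (eps n) j t)) <= 2" for n t using nn[of n t] le[of n t] by (simp only: norm_of_real abs_of_nonneg)
 ultimately show ?thesis unfolding good_def c by blast
qed

text \<open>The weight has a double zero at the unit sphere, so the product with a polynomial
  belongs to H^2_0 without being compactly supported.\<close>

definition s2 :: "('a::euclidean_space cf) => 'a => complex" where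
 "s2 p x = (1 - cor (inner x x))^2 * p x"

lemma pol_one_minus: "pol 2 (%x::'a::euclidean_space. r - cor (inner x x))" by (intro pol_diff pol_const pol_norm_sq)

lemma pol_sq_mult:
 "pol m p ==> pol (m + 4) (%x::'a::euclidean_space. (r - cor (inner x x))^2 * p x)" using pol_mult[OF pol_mult[OF pol_one_minus pol_one_minus], of m p r r] by (simp add: power2_eq_square add.commute)

lemma pol_s2: "pol m p ==> pol (m + 4) (s2 p)" unfolding s2_def[abs_def] by (rule pol_sq_mult)

lemma pol_pd1: "pol m f ==> pol (m - 1) (pd h f)" using pol_pd by blast

lemma pol_pd2: assumes "pol m f" shows "pol (m - 2) (pd h (pd k f))" using pol_pd1[OF pol_pd1[OF assms]] by (simp add: numeral_2_eq_2)

lemma pol_lap: "pol m f ==> pol (m - 2) (lap f)" unfolding lap_def[abs_def] by (intro pol_sum pol_pd2)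

lemma pd_norm_sq:
 fixes h :: "'a::euclidean_space"
 shows "dff (%x::'a. cor (inner x x))" "pd h (%x::'a. cor (inner x x)) = (%x. 2 * cor (inner x h))" by (rule pdI[where f'="%x h. 2 * cor (inner x h)"]; auto intro!: derivative_eq_intros simp: inner_commute)+

text \<open>Differentiating the cutoff of index 0 costs two powers of \<open>rh - inner x x\<close>,
  which the squared factor restores. The result is arranged so that every term is
  \<open>ep ^ j\<close> times the cutoff of index \<open>j\<close>, as \<open>good_bump\<close>
  wants it, times continuous functions; the corrections to the second derivative of
  \<open>s2 p\<close> carry a factor \<open>ep\<close> or \<open>1 - rh\<close>.\<close>

lemma pd_pd_cutoff:
 fixes p :: "'a::euclidean_space cf" and b :: 'a
 assumes p: "pol m p" and e: "ep > 0" and b: "b \<in> Basis"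
 defines "s == %x::'a. 1 - cor (inner x x)" and "xb == %x::'a. cor (inner x b)"
 shows "pd b (pd b (%x. bumpf ep 0 rh x * ((cor rh - cor (inner x x))^2 * p x)))
  = (%x. (cor ep ^ 2 * bumpf ep 2 rh x) * (4 * xb x * xb x * p x)
   + (cor ep ^ 1 * bumpf ep 1 rh x) * (8 * xb x * xb x * p x)
   + (cor ep ^ 0 * bumpf ep 0 rh x) *
    (pd b (pd b (s2 p)) x + cor ep * (-2 * xb x * pd b p x + -2 * pd b (%x. xb x * p x) x)
     + cor (1 - rh) * (-2 * pd b (pd b (%x. s x * p x)) x)
     + cor (1 - rh) * (cor (1 - rh) * pd b (pd b p) x)))"
proof -
 let ?r = "cor rh" let ?e = "cor ep"
 define t where "t x = ?r - cor (inner x x)" for x :: 'a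
 have sp: "pol (m + 2) (%x. s x * p x)" using pol_mult[OF pol_one_minus p, of 1] by (simp add: s_def add.commute)
 have xp: "pol (Suc m) (%x. xb x * p x)" using pol_mult[OF pol_coord1[OF b] p] by (simp add: xb_def)
 have dp: "dff p" and d1: "dff (pd b p)" using p pol_pd[OF p, of b] by (blast intro: pol_dff)+
 have tp: "pol (m + 4) (%x. (t x)^2 * p x)" unfolding t_def by (rule pol_sq_mult[OF p])
 have pt: "pd b (%x. (t x)^2 * p x) x = - 4 * xb x * t x * p x + (t x)^2 * pd b p x" for x
 proof -
  have dt: "dff t" "pd b t = (%x. - 2 * xb x)" unfolding t_def[abs_def] using pd_diff[OF pd_const(1)[of ?r] pd_norm_sq(1)] by (simp_all add: pd_const pd_norm_sq xb_def)
  show ?thesis unfolding power2_eq_square by (simp add: pd_mult pd_mult(1)[OF dt(1) dt(1)] pd_mult(2)[OF dt(1) dt(1)] dt dp algebra_simps)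
 qed
 \<comment> \<open>Expanding about \<open>rh = 1\<close> isolates \<open>s2 p\<close>, with
   corrections that carry powers of \<open>1 - rh\<close>.\<close>
 have teq: "(%x. (t x)^2 * p x) = (%x. s2 p x + (-2 * cor (1 - rh)) * (s x * p x) + (cor (1 - rh))^2 * p x)" by (simp add: fun_eq_iff t_def s_def s2_def power2_eq_square algebra_simps)
 have dd: "dff f & dff (pd b f)" if "pol n f" for n f using that pol_pd[OF that, of b] by (blast intro: pol_dff)
 have ptt: "pd b (pd b (%x. (t x)^2 * p x)) x = pd b (pd b (s2 p)) x + (-2 * cor (1 - rh)) * pd b (pd b (%x. s x * p x)) x
   + (cor (1 - rh))^2 * pd b (pd b p) x" for x unfolding teq using dd[OF pol_s2[OF p]] dd[OF sp] dd[OF p] by (simp add: pd_add pd_cmult)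
 define g where "g x = (-2 * ?e) * (xb x * p x) + pd b (%x. (t x)^2 * p x) x" for x
 have dg: "dff g" "pd b g = (%x. (-2 * ?e) * pd b (%x. xb x * p x) x + pd b (pd b (%x. (t x)^2 * p x)) x)" unfolding g_def[abs_def] using dd[OF xp] dd[OF tp] by (simp_all only: pd_add[OF pd_cmult(1)] pd_cmult(2))
 have B: "bumpf ep (Suc k) rh x * t x = bumpf ep k rh x" for k and x :: 'a by (simp add: bumpf_def bmp_def t_def flip: of_real_diff of_real_mult)
 have B2: "bumpf ep 2 rh x * t x = bumpf ep 1 rh x" "bumpf ep 1 rh x * t x = bumpf ep 0 rh x" for x :: 'a using B[of 1 x] B[of 0 x] by (simp_all add: numeral_2_eq_2)
 have B3: "bumpf ep 2 rh x * (t x)^2 = bumpf ep 0 rh x" for x :: 'a unfolding power2_eq_square mult.assoc[symmetric] B2 by simp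
 have db: "dff (bumpf ep 0 rh :: 'a cf)" "pd b (bumpf ep 0 rh) = (%x. ?e * bumpf ep 2 rh x * (-2 * xb x))"
  using pd_bumpf(1)[OF e, where n=0] pd_bumpf(2)[OF e, where n=0 and h=b] by (simp_all add: xb_def numeral_2_eq_2)
 have 1: "pd b (%x. bumpf ep 0 rh x * ((t x)^2 * p x)) = (%x. bumpf ep 0 rh x * g x)"
 proof
  fix x
  have "pd b (%x. bumpf ep 0 rh x * ((t x)^2 * p x)) x
   = bumpf ep 0 rh x * pd b (%x. (t x)^2 * p x) x + ?e * (bumpf ep 2 rh x * (t x)^2) * (-2 * xb x) * p x" using pd_mult(2)[OF db(1), of "%x. (t x)^2 * p x" b] dd[OF tp] by (simp add: db)
  thus "pd b (%x. bumpf ep 0 rh x * ((t x)^2 * p x)) x = bumpf ep 0 rh x * g x" unfolding B3 by (simp add: g_def algebra_simps)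
 qed
 have 2: "bumpf ep 2 rh x * g x = -2 * ?e * (xb x * p x) * bumpf ep 2 rh x - 4 * xb x * p x * bumpf ep 1 rh x + pd b p x * bumpf ep 0 rh x" for x
 proof -
  have "bumpf ep 2 rh x * g x = -2 * ?e * (xb x * p x) * bumpf ep 2 rh x - 4 * xb x * p x * (bumpf ep 2 rh x * t x) + pd b p x * (bumpf ep 2 rh x * (t x)^2)" unfolding g_def pt by (simp add: algebra_simps)
  thus ?thesis by (simp only: B2 B3)
 qed
 have 3: "pd b (pd b (%x. bumpf ep 0 rh x * ((t x)^2 * p x))) x = bumpf ep 0 rh x * pd b g x + ?e * (-2 * xb x) * (bumpf ep 2 rh x * g x)" for x
  unfolding 1 using pd_mult(2)[OF db(1) dg(1), where h=b] by (simp add: db mult_ac)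
 show ?thesis
 proof
  fix x
  define P1 P2 where "P1 = pd b (%x. xb x * p x) x" and "P2 = pd b (pd b (%x. s x * p x)) x"
  have "bumpf ep 0 rh x * pd b g x + ?e * (-2 * xb x) * (bumpf ep 2 rh x * g x)
   = (?e ^ 2 * bumpf ep 2 rh x) * (4 * xb x * xb x * p x) + (?e ^ 1 * bumpf ep 1 rh x) * (8 * xb x * xb x * p x)
   + (?e ^ 0 * bumpf ep 0 rh x) *
    (pd b (pd b (s2 p)) x + ?e * (-2 * xb x * pd b p x + -2 * P1)
     + cor (1 - rh) * (-2 * P2)
     + cor (1 - rh) * (cor (1 - rh) * pd b (pd b p) x))" unfolding 2 dg(2) ptt P1_def[symmetric] P2_def[symmetric] by (simp add: algebra_simps power2_eq_square)
  with 3[of x] show "pd b (pd b (%x. bumpf ep 0 rh x * ((?r - cor (inner x x))^2 * p x))) x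
   = (?e ^ 2 * bumpf ep 2 rh x) * (4 * xb x * xb x * p x) + (?e ^ 1 * bumpf ep 1 rh x) * (8 * xb x * xb x * p x)
   + (?e ^ 0 * bumpf ep 0 rh x) *
    (pd b (pd b (s2 p)) x + ?e * (-2 * xb x * pd b p x + -2 * pd b (%x. xb x * p x) x)
     + cor (1 - rh) * (-2 * pd b (pd b (%x. s x * p x)) x)
     + cor (1 - rh) * (cor (1 - rh) * pd b (pd b p) x))" unfolding t_def P1_def P2_def by (rule trans)
 qed
qed

lemma s2_KS_seq:
 fixes p :: "'a::euclidean_space cf"
 assumes p: "pol m p"
 shows "EX fi. (ALL n::nat. tst (fi n)) & (%n. mk (fi n)) ----> mk (s2 p) & (%n. mk (lap (fi n))) ----> mk (lap (s2 p))"
proof -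
 define fi where "fi n x = bumpf (eps n) 0 (rho n) x * ((cor (rho n) - cor (inner x x))^2 * p x)" for n x
 have t: "tst (fi n)" for n unfolding fi_def[abs_def] by (rule bumpf_tst[OF eps_pos _ pol_sm[OF pol_sq_mult[OF p]]]) (use eps_pos in simp)
 have E: "good (%n x::'a. cor (eps n) ^ 2 * bumpf (eps n) 2 (rho n) x) (%x. 0)"
  "good (%n x::'a. cor (eps n) ^ 1 * bumpf (eps n) 1 (rho n) x) (%x. 0)"
  "good (%n x::'a. cor (eps n) ^ 0 * bumpf (eps n) 0 (rho n) x) (%x. 1)" using good_bump[of 2] good_bump[of 1] good_bump[of 0] by simp_all
 have el: "(%n. cor (eps n)) ----> 0" using tendsto_of_real[OF eps_lim, where 'a=complex] by simp
 have el1: "(%n. cor (1 - rho n)) ----> 0" using el by simp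
 have pc: "continuous_on UNIV f" if "pol n f" for n and f :: "'a cf" using that by (rule pol_cont)
 have "good (%n x. fi n x) (%x. 1 * ((cor (1 - 0) - cor (inner x x))^2 * p x))"
 proof -
  have "good (%n x. cor (rho n) - cor (inner x x)) (%x::'a. cor (1 - 0) - cor (inner x x))"
  proof -
   have "(%n. cor (rho n)) ----> cor (1 - 0)" by (intro tendsto_intros eps_lim)
   from good_add[OF good_seq[OF this] good_cont[OF pc[OF pol_cmult[OF pol_norm_sq, of "-1"]]]] show ?thesis by simp
  qed
  from good_mult[OF E(3) good_mult[OF good_mult[OF this this] good_cont[OF pc[OF p]]]]
  show ?thesis by (simp add: fi_def power2_eq_square)
 qed
 hence "good fi (s2 p)" by (simp add: s2_def[abs_def])
 hence l1: "(%n. mk (fi n)) ----> mk (s2 p)" by (intro good_mk tst_L2[OF t] pol_L2[OF pol_s2[OF p]])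
 have "good (%n x. lap (fi n) x) (%x. \<Sum>b\<in>Basis. pd b (pd b (s2 p)) x)" unfolding lap_def
 proof (rule good_sum)
  fix b :: 'a assume b: "b \<in> Basis"
  let ?s = "%x::'a. 1 - cor (inner x x)" and ?xb = "%x::'a. cor (inner x b)"
  have pb: "pol 1 ?xb" by (rule pol_coord1[OF b])
  have sp: "pol (2 + m) (%x. ?s x * p x)" by (rule pol_mult[OF pol_one_minus p])
  have c: "continuous_on UNIV (%x. 4 * ?xb x * ?xb x * p x)" "continuous_on UNIV (%x. 8 * ?xb x * ?xb x * p x)"
   "continuous_on UNIV (%x. -2 * ?xb x * pd b p x + -2 * pd b (%x. ?xb x * p x) x)"
   "continuous_on UNIV (%x. -2 * pd b (pd b (%x. ?s x * p x)) x)"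
   "continuous_on UNIV (pd b (pd b p))" "continuous_on UNIV (pd b (pd b (s2 p)))" by (intro continuous_intros pol_cont[OF p] pol_cont[OF pb] pol_cont[OF pol_pd1[OF p]] pol_cont[OF pol_pd1[OF pol_mult[OF pb p]]]
     pol_cont[OF pol_pd2[OF sp]] pol_cont[OF pol_pd2[OF p]] pol_cont[OF pol_pd2[OF pol_s2[OF p]]])+
  have "good (%n x. (cor (eps n) ^ 2 * bumpf (eps n) 2 (rho n) x) * (4 * ?xb x * ?xb x * p x)
   + (cor (eps n) ^ 1 * bumpf (eps n) 1 (rho n) x) * (8 * ?xb x * ?xb x * p x)
   + (cor (eps n) ^ 0 * bumpf (eps n) 0 (rho n) x) *
    (pd b (pd b (s2 p)) x + cor (eps n) * (-2 * ?xb x * pd b p x + -2 * pd b (%x. ?xb x * p x) x)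
     + cor (1 - rho n) * (-2 * pd b (pd b (%x. ?s x * p x)) x)
     + cor (1 - rho n) * (cor (1 - rho n) * pd b (pd b p) x)))
   (%x. 0 * (4 * ?xb x * ?xb x * p x) + 0 * (8 * ?xb x * ?xb x * p x)
   + 1 * (pd b (pd b (s2 p)) x + 0 * (-2 * ?xb x * pd b p x + -2 * pd b (%x. ?xb x * p x) x)
     + 0 * (-2 * pd b (pd b (%x. ?s x * p x)) x) + 0 * (0 * pd b (pd b p) x)))" by (intro good_add good_mult E good_cont[OF c(1)] good_cont[OF c(2)] good_cont[OF c(3)] good_cont[OF c(4)]
     good_cont[OF c(5)] good_cont[OF c(6)] good_seq[OF el] good_seq[OF el1])
  thus "good (%n x. pd b (pd b (fi n)) x) (pd b (pd b (s2 p)))" unfolding fi_def[abs_def] pd_pd_cutoff[OF p eps_pos b] by simp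
 qed simp
 hence "good (%n. lap (fi n)) (lap (s2 p))" by (simp add: lap_def[abs_def])
 hence l2: "(%n. mk (lap (fi n))) ----> mk (lap (s2 p))" by (intro good_mk tst_lap_L2[OF t] pol_L2[OF pol_lap[OF pol_s2[OF p]]])
 show ?thesis using t l1 l2 by blast
qed

lemma s2_KS: "pol m p ==> (mk (s2 p), - mk (lap (s2 p))) \<in> KS" using s2_KS_seq[of m p] KS_closedI[of _ "mk (s2 p)" "- mk (lap (s2 p))"] by auto

section \<open>Green's formula and pairings with Laplacians of \<open>s2 p\<close>\<close>

lemma green_tst:
 assumes g: "pol m g" and fi: "tst fi"
 shows "inner (mk g) (mk (lap fi)) = inner (mk (lap g)) (mk fi)"
proof -
 have p1: "pol (m - 1) (pd b g)" and p2: "pol (m - 1 - 1) (pd b (pd b g))" for b using pol_pd[OF g, of b] pol_pd[of "m - 1" "pd b g" b] by blast+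
 have "inner (mk g) (mk (pd b (pd b fi))) = inner (mk (pd b (pd b g))) (mk fi)" if b: "b \<in> Basis" for b
 proof -
  note t = tst_pd[OF fi b]
  have "L2_inner MB g (pd b (pd b fi)) = L2_inner MB (pd b (pd b g)) fi" using L2_inner_ibp[OF t pol_dff[OF g] pol_cont[OF p1] b] L2_inner_ibp[OF fi pol_dff[OF p1] pol_cont[OF p2] b] by simp
  thus ?thesis by (simp add: inner_mk pol_L2[OF g] pol_L2[OF p2] tst_L2 t tst_pd b fi)
 qed
 moreover have "mk (lap g) = (\<Sum>b\<in>Basis. mk (pd b (pd b g)))" using mk_sum[of Basis "%b. pd b (pd b g)", OF pol_L2[OF p2]] by (simp add: lap_def[abs_def])
 ultimately show ?thesis by (simp add: mk_lap fi inner_sum_left inner_sum_right)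
qed

lemma green_s2:
 assumes g: "pol m g" and p: "pol n p"
 shows "inner (mk g) (mk (lap (s2 p))) = inner (mk (lap g)) (mk (s2 p))"
proof -
 obtain fi where fi: "!!n::nat. tst (fi n)" "(%n. mk (fi n)) ----> mk (s2 p)" "(%n. mk (lap (fi n))) ----> mk (lap (s2 p))" using s2_KS_seq[OF p] by blast
 have a: "(%n. inner (mk g) (mk (lap (fi n)))) ----> inner (mk g) (mk (lap (s2 p)))" by (intro tendsto_intros fi)
 have b: "(%n. inner (mk (lap g)) (mk (fi n))) ----> inner (mk (lap g)) (mk (s2 p))" by (intro tendsto_intros fi)
 show ?thesis by (rule LIMSEQ_unique[OF a b[folded green_tst[OF g fi(1)]]])
qed

lemma harmonic_pol_H: "pol m q ==> lap q = (%_. 0) ==> mk q \<in> KR.H" by (simp add: H_lap_iff green_tst mk_zero)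

text \<open>\<open>lap (s2 p)\<close> is in the range of the minimal operator, to which
  \<open>H\<close> is orthogonal. This drives the orthogonality of different degrees and the density
  of harmonic polynomials.\<close>

lemma H_s2: "h \<in> KR.H ==> pol m p ==> inner h (mk (lap (s2 p))) = 0" using bspec[of KS _ "(mk (s2 p), - mk (lap (s2 p)))"] s2_KS[of m p] by (auto simp: KR.H_def)

lemma s2_inj: "pol m p ==> mk (lap (s2 p)) = 0 ==> mk (s2 p) = 0" using KR.S_bound[OF s2_KS, of m p] by simp

subsection \<open>Homogeneous polynomials\<close>

inductive hpol :: "nat => ('a::euclidean_space cf) => bool" where
 hpol_const: "hpol 0 (%_. c)"
| hpol_add: "hpol k f ==> hpol k g ==> hpol k (%x. f x + g x)"
| hpol_coord: "hpol k f ==> b \<in> Basis ==> hpol (Suc k) (%x. cor (inner x b) * f x)"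

lemma hpol_pol: "hpol k f ==> pol k f" by (induction rule: hpol.induct) (auto intro: pol.intros)

lemma hpol_scale: "hpol k f ==> f (t *\<^sub>R x) = cor t ^ k * f x" by (induction rule: hpol.induct) (simp_all add: distrib_left)

lemma hpol_zero: "hpol k (%_::'a::euclidean_space. 0)"
proof (induction k)
 case (Suc k)
 from hpol_coord[OF this SOME_Basis] show ?case by simp
qed (rule hpol_const)

lemma hpol_cmult: "hpol k f ==> hpol k (%x. c * f x)"
proof (induction rule: hpol.induct)
 case (hpol_add k f g)
 thus ?case by (simp add: distrib_left hpol.hpol_add)
next
 case (hpol_coord k f b)
 from hpol.hpol_coord[OF hpol_coord.IH hpol_coord.hyps(2)] show ?case by (simp add: mult_ac)
qed (rule hpol_const)

lemma hpol_sum: "(!!i. i \<in> I ==> hpol k (f i)) ==> hpol k (%x. \<Sum>i\<in>I. f i x)" by (induction I rule: infinite_finite_induct) (auto intro: hpol_zero hpol_add)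

lemma pd_coord_mult:
 assumes "dff f"
 shows "pd h (%x. cor (inner x b) * f x) = (%x. cor (inner x b) * pd h f x + cor (inner h b) * f x)" by (simp add: pd_mult(2)[OF pd_coord(1) assms] pd_coord)

lemma hpol_pd: "hpol k f ==> hpol (k - 1) (pd h f) & (k = 0 --> pd h f = (%_. 0))"
proof (induction rule: hpol.induct)
 case (hpol_const c)
 thus ?case by (simp add: pd_const hpol_zero)
next
 case (hpol_add k f g)
 note d = pol_dff[OF hpol_pol[OF hpol_add.hyps(1)]] pol_dff[OF hpol_pol[OF hpol_add.hyps(2)]]
 from hpol_add show ?case by (simp add: pd_add(2)[OF d] hpol.hpol_add)
next
 case (hpol_coord k f b)
 have "hpol k (%x. cor (inner x b) * pd h f x)"
 proof (cases k)
  case 0 thus ?thesis using hpol_coord.IH by (simp add: hpol_zero)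
 next
  case (Suc j) thus ?thesis using hpol.hpol_coord[of "k - 1" "pd h f" b] hpol_coord by simp
 qed
 thus ?case using hpol_coord by (simp add: pd_coord_mult[OF pol_dff[OF hpol_pol[OF hpol_coord.hyps(1)]]] hpol.hpol_add hpol_cmult)
qed

lemma euler_identity: "hpol k f ==> pd x f x = of_nat k * f x"
proof (induction rule: hpol.induct)
 case (hpol_add k f g)
 thus ?case by (simp add: pd_add pol_dff[OF hpol_pol] distrib_left)
next
 case (hpol_coord k f b)
 thus ?case unfolding pd_coord_mult[OF pol_dff[OF hpol_pol[OF hpol_coord.hyps(1)]]] by (simp add: algebra_simps)
qed (simp add: pd_const)

lemma hpol_lap: assumes "hpol k f" shows "hpol (k - 2) (lap f)" "k < 2 ==> lap f = (%_. 0)"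
proof -
 have h: "hpol (k - 1) (pd b f)" "hpol (k - 1 - 1) (pd b (pd b f))" for b using hpol_pd[OF assms, of b] hpol_pd[of "k - 1" "pd b f" b] by blast+
 show "hpol (k - 2) (lap f)" unfolding lap_def[abs_def] by (rule hpol_sum) (use h(2) in \<open>simp add: numeral_2_eq_2\<close>)
 show "k < 2 ==> lap f = (%_. 0)" using hpol_pd[OF h(1)] by (simp add: lap_def[abs_def])
qed

lemma pol_decomp: "pol m f ==> EX g. (ALL k. hpol k (g k)) & f = (%x. \<Sum>k\<le>m. g k x)"
proof (induction rule: pol.induct)
 case (pol_const m c)
 have "(%_. c) = (%x::'a. \<Sum>k\<le>m. (if k = 0 then (%_. c) else (%_. 0)) x)" by (simp add: if_distrib[of "%f. f _"] cong: if_cong)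
 thus ?case by (intro exI[of _ "%k. if k = 0 then (%_. c) else (%_. 0)"]) (auto intro: hpol_const hpol_zero)
next
 case (pol_add m f f')
 then obtain g g' where "ALL k. hpol k (g k)" "f = (%x. \<Sum>k\<le>m. g k x)" "ALL k. hpol k (g' k)" "f' = (%x. \<Sum>k\<le>m. g' k x)" by blast
 thus ?case by (intro exI[of _ "%k x. g k x + g' k x"]) (simp add: hpol_add sum.distrib)
next
 case (pol_coord m f b)
 then obtain g where g: "ALL k. hpol k (g k)" "f = (%x. \<Sum>k\<le>m. g k x)" by blast
 define g' where "g' k = (case k of 0 => (%_. 0) | Suc j => (%x. cor (inner x b) * g j x))" for k
 have "hpol k (g' k)" for k using g pol_coord.hyps by (auto simp: g'_def split: nat.split intro: hpol_zero hpol_coord)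
 moreover have "(%x. cor (inner x b) * f x) = (%x. \<Sum>k\<le>Suc m. g' k x)" unfolding sum.atMost_Suc_shift by (simp add: g'_def g sum_distrib_left)
 ultimately show ?case by blast
qed

lemma infinite_real_roots:
 fixes c :: "nat => complex"
 assumes e: "ep > 0" and z: "!!t::real. 0 < t ==> t < ep ==> (\<Sum>k\<le>m. c k * cor t ^ k) = 0" and "k <= m"
 shows "c k = 0"
proof (rule ccontr)
 assume "c k ~= 0"
 hence "finite {z. (\<Sum>i\<le>m. c i * z ^ i) = 0}" using \<open>k <= m\<close> polyfun_finite_roots[of c m] by blast
 hence "finite (cor ` {0<..<ep})" by (rule finite_subset[rotated]) (use z in auto)
 hence "finite {0<..<ep}" by (rule finite_imageD) (simp add: inj_on_def)
 thus False using infinite_Ioo[OF e] by simp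
qed

lemma hpol_sum_zero:
 assumes g: "!!k. hpol k (g k)" and e: "ep > 0"
  and z: "!!t::real. 0 < t ==> t < ep ==> (\<Sum>k\<le>m. g k (t *\<^sub>R x)) = 0" and "k <= m"
 shows "g k x = 0" by (rule infinite_real_roots[OF e _ \<open>k <= m\<close>, of "%k. g k x"])
  (use z in \<open>simp add: hpol_scale[OF g] mult.commute\<close>)

text \<open>Along a ray the polynomial is one in the scale \<open>t\<close>, with the values of its
  homogeneous parts as coefficients, and it has infinitely many zeros there.\<close>

lemma pol_ball_zero:
 fixes f :: "'a::euclidean_space cf"
 assumes f: "pol m f" and z: "!!x. x \<in> ball 0 1 ==> f x = 0"
 shows "f = (%_. 0)"
proof
 fix x :: 'a
 obtain g where g: "!!k. hpol k (g k)" "f = (%x. \<Sum>k\<le>m. g k x)" using pol_decomp[OF f] by blast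
 have "g k x = 0" if "k <= m" for k
 proof (rule hpol_sum_zero[OF g(1) _ _ that])
  show "1 / (norm x + 1) > 0" by (simp add: add_nonneg_pos)
  fix t :: real assume t: "0 < t" "t < 1 / (norm x + 1)"
  hence "t * (norm x + 1) < 1" by (subst (asm) pos_less_divide_eq) (auto simp: add_nonneg_pos)
  hence "t *\<^sub>R x \<in> ball 0 1" using t by (simp add: algebra_simps)
  from z[OF this] show "(\<Sum>k\<le>m. g k (t *\<^sub>R x)) = 0" by (simp add: g(2))
 qed
 thus "f x = 0" by (simp add: g(2))
qed

lemma pol_mk_zero: assumes "pol m f" "mk f = 0" shows "f = (%_. 0)"
proof (rule pol_ball_zero[OF assms(1)])
 have "AE x in MB. f x = 0" using assms mk_eq_iff[OF pol_L2[OF assms(1)] L2_zero] by (simp add: mk_zero)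
 thus "f x = 0" if "x \<in> ball 0 1" for x by (rule continuous_AE_zero[OF pol_cont[OF assms(1)] _ that])
qed

text \<open>The Laplacian of the part of degree \<open>k\<close> is homogeneous of degree
  \<open>k - 2\<close>, so the vanishing of the sum along each ray separates the parts; a factor
  \<open>t^2\<close> realigns the powers with \<open>k\<close>. Truncated subtraction does no harm,
  because the Laplacian vanishes for \<open>k < 2\<close>.\<close>

lemma harmonic_decomp:
 fixes q :: "'a::euclidean_space cf"
 assumes q: "pol m q" "lap q = (%_. 0)"
 shows "EX g. (ALL k. hpol k (g k) & lap (g k) = (%_. 0)) & q = (%x. \<Sum>k\<le>m. g k x)"
proof -
 obtain g where g: "!!k. hpol k (g k)" "q = (%x. \<Sum>k\<le>m. g k x)" using pol_decomp[OF q(1)] by blast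
 have lapq: "(\<Sum>k\<le>m. lap (g k) x) = 0" for x
 proof -
  have "dff (g k)" "dff (pd b (g k))" for k b using hpol_pol[OF g(1)[of k]] pol_pd1[OF hpol_pol[OF g(1)[of k]]] by (blast intro: pol_dff)+
  hence "lap q x = (\<Sum>b\<in>Basis. \<Sum>k\<le>m. pd b (pd b (g k)) x)" unfolding g(2) lap_def by (simp add: pd_sum)
  also have "... = (\<Sum>k\<le>m. lap (g k) x)" unfolding lap_def by (rule sum.swap)
  finally show ?thesis using q(2) by simp
 qed
 have "lap (g k) x = 0" if "k <= m" for k x
 proof (rule infinite_real_roots[of 1 "%k. lap (g k) x" m, OF _ _ that])
  fix t :: real
  have "(\<Sum>k\<le>m. lap (g k) x * cor t ^ k) = cor t ^ 2 * (\<Sum>k\<le>m. lap (g k) (t *\<^sub>R x))" unfolding sum_distrib_left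
  proof (rule sum.cong[OF refl])
   fix k
   show "lap (g k) x * cor t ^ k = cor t ^ 2 * lap (g k) (t *\<^sub>R x)"
   proof (cases "k < 2")
    case False
    hence "k = 2 + (k - 2)" by simp
    hence "cor t ^ k = cor t ^ 2 * cor t ^ (k - 2)" by (metis power_add)
    thus ?thesis using hpol_scale[OF hpol_lap(1)[OF g(1)]] by (simp add: mult_ac)
   qed (simp add: hpol_lap(2)[OF g(1)])
  qed
  thus "(\<Sum>k\<le>m. lap (g k) x * cor t ^ k) = 0" by (simp add: lapq)
 qed simp
 thus ?thesis using g by (intro exI[of _ "%k. if k <= m then g k else (%_. 0)"])
   (auto simp: hpol_zero lap_def[abs_def] pd_const fun_eq_iff)
qed

text \<open>With \<open>s = 1 - inner x x\<close> and dimension \<open>d\<close>, the Laplacian of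
  \<open>s^2\<close> is \<open>8 * inner x x - 4 * d * s\<close>, the mixed term contributes
  \<open>- 8 * k * s * v\<close> by Euler's identity, and \<open>inner x x = 1 - s\<close> produces
  the constants.\<close>

lemma lap_s2_homogeneous:
 fixes v :: "'a::euclidean_space cf"
 assumes v: "hpol k v" "lap v = (%_. 0)"
 shows "lap (s2 v) x = 8 * v x - of_nat (4 * DIM('a) + 8 * k + 8) * ((1 - cor (inner x x)) * v x)"
proof -
 define s where "s x = 1 - cor (inner x x)" for x :: 'a
 have dv: "dff v" "dff (pd b v)" for b using hpol_pol[OF v(1)] pol_pd1[OF hpol_pol[OF v(1)]] by (blast intro: pol_dff)+
 have ds: "dff s" "pd b s = (%x. - 2 * cor (inner x b))" for b unfolding s_def[abs_def] using pd_diff[OF pd_const(1)[of 1] pd_norm_sq(1)] by (simp_all add: pd_const pd_norm_sq)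
 have 1: "pd b (s2 v) = (%x. s x * (- 4 * (cor (inner x b) * v x) + s x * pd b v x))" for b
 proof -
  have eq: "s2 v = (%x. s x * (s x * v x))" by (simp add: s2_def s_def power2_eq_square fun_eq_iff)
  show ?thesis unfolding eq by (simp add: pd_mult(2)[OF ds(1) pd_mult(1)[OF ds(1) dv(1)]] pd_mult(2)[OF ds(1) dv(1)] ds fun_eq_iff algebra_simps)
 qed
 have 2: "pd b (pd b (s2 v)) x = - 4 * (s x * v x) + 8 * ((cor (inner x b))^2 * v x)
  - 8 * (s x * (cor (inner x b) * pd b v x)) + (s x)^2 * pd b (pd b v) x" if b: "b \<in> Basis" for b
 proof -
  have dx: "dff (%x. cor (inner x b) * v x)" by (rule pd_mult(1)[OF pd_coord(1) dv(1)])
  have dsv: "dff (%x. s x * pd b v x)" by (rule pd_mult(1)[OF ds(1) dv(2)])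
  have "pd b (pd b (s2 v)) x = s x * (- 4 * (cor (inner x b) * pd b v x + cor (inner b b) * v x) +
    (s x * pd b (pd b v) x + - 2 * cor (inner x b) * pd b v x))
   + (- 2 * cor (inner x b)) * (- 4 * (cor (inner x b) * v x) + s x * pd b v x)" unfolding 1 pd_mult(2)[OF ds(1) pd_add(1)[OF pd_cmult(1)[OF dx] dsv]] pd_add(2)[OF pd_cmult(1)[OF dx] dsv]
    pd_cmult(2)[OF dx] pd_coord_mult[OF dv(1)] pd_mult(2)[OF ds(1) dv(2)] ds(2) ..
  also have "inner b b = 1" using b by (simp add: inner_same_Basis)
  finally show ?thesis by (simp add: algebra_simps power2_eq_square)
 qed
 have e: "(\<Sum>b\<in>Basis. cor (inner x b) * pd b v x) = of_nat k * v x" using euler_identity[OF v(1), of x] pd_linear_expand[OF dv(1), of x x] by (simp add: scaleR_conv_of_real)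
 have r: "(\<Sum>b\<in>Basis. (cor (inner x b))^2) = cor (inner x x)" by (subst euclidean_inner) (simp add: power2_eq_square)
 have "lap (s2 v) x = (\<Sum>b\<in>(Basis::'a set). - 4 * (s x * v x)) + 8 * ((\<Sum>b\<in>Basis. (cor (inner x b))^2) * v x)
  - 8 * (s x * (\<Sum>b\<in>Basis. cor (inner x b) * pd b v x)) + (s x)^2 * lap v x" unfolding lap_def sum_distrib_left sum_distrib_right sum.distrib[symmetric] sum_subtractf[symmetric]
  by (rule sum.cong[OF refl]) (simp add: 2)
 also have "... = 8 * v x - of_nat (4 * DIM('a) + 8 * k + 8) * (s x * v x)" unfolding e r v(2) by (simp add: s_def algebra_simps)
 finally show ?thesis by (simp add: s_def)
qed

text \<open>Pairing \<open>u\<close> with \<open>lap (s2 v)\<close> gives 0, which relates the inner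
  product of \<open>u\<close> and \<open>v\<close> to the one weighted by
  \<open>1 - inner x x\<close>, with a constant that depends on \<open>k\<close>. Exchanging the
  roles gives the same relation with \<open>j\<close>, and two different constants force both to
  vanish.\<close>

lemma homogeneous_orthogonal:
 fixes u v :: "'a::euclidean_space cf"
 assumes u: "hpol j u" "lap u = (%_. 0)" and v: "hpol k v" "lap v = (%_. 0)" and "j ~= k"
 shows "inner (mk u) (mk v) = 0"
proof -
 let ?s = "%f x. (1 - cor (inner x x)) * f x"
 have L: "u \<in> L2 MB" "v \<in> L2 MB" "?s u \<in> L2 MB" "?s v \<in> L2 MB" using pol_L2[OF hpol_pol[OF u(1)]] pol_L2[OF hpol_pol[OF v(1)]]
   pol_L2[OF pol_mult[OF pol_one_minus hpol_pol[OF u(1)], of 1]] pol_L2[OF pol_mult[OF pol_one_minus hpol_pol[OF v(1)], of 1]] by auto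
 have a: "8 * inner (mk f) (mk g) = (4 * DIM('a) + 8 * k + 8) * inner (mk f) (mk (?s g))"
  if f: "hpol j f" "lap f = (%_. 0)" and g: "hpol k g" "lap g = (%_. 0)" for f g :: "'a cf" and j k
 proof -
  have Lg: "g \<in> L2 MB" "?s g \<in> L2 MB" using pol_L2[OF hpol_pol[OF g(1)]] pol_L2[OF pol_mult[OF pol_one_minus hpol_pol[OF g(1)], of 1]] by auto
  have eq: "lap (s2 g) = (%x. cor 8 * g x - cor (4 * DIM('a) + 8 * k + 8) * ?s g x)" by (rule ext) (simp add: lap_s2_homogeneous[OF g])
  have "mk (lap (s2 g)) = 8 *\<^sub>R mk g - (4 * DIM('a) + 8 * k + 8) *\<^sub>R mk (?s g)" unfolding eq using Lg by (simp add: mk_diff L2_cmult mk_scaleR del: of_real_numeral of_real_add of_real_mult of_real_of_nat_eq)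
  thus ?thesis using H_s2[OF harmonic_pol_H[OF hpol_pol[OF f(1)] f(2)] hpol_pol[OF g(1)]] by (simp add: inner_diff_right)
 qed
 have sym: "inner (mk v) (mk (?s u)) = inner (mk u) (mk (?s v))" by (subst inner_commute, unfold inner_mk[OF L(3) L(2)] inner_mk[OF L(1) L(4)])
   (simp add: L2_inner_def mult_ac)
 have "8 * inner (mk u) (mk v) = (4 * DIM('a) + 8 * k + 8) * inner (mk u) (mk (?s v))" by (rule a[OF u v])
 moreover have "8 * inner (mk u) (mk v) = (4 * DIM('a) + 8 * j + 8) * inner (mk u) (mk (?s v))" using a[OF v u] by (simp only: sym inner_commute)
 ultimately have "(8 * real j - 8 * real k) * inner (mk u) (mk (?s v)) = 0"
  and e: "8 * inner (mk u) (mk v) = (4 * DIM('a) + 8 * k + 8) * inner (mk u) (mk (?s v))" by (auto simp add: algebra_simps)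
 hence "inner (mk u) (mk (?s v)) = 0" using \<open>j ~= k\<close> by auto
 thus ?thesis using e by simp
qed

subsection \<open>Monomials and dimensions\<close>

definition IX :: "'i set => nat => ('i => nat) set" where
 "IX B m = {al. (ALL b. b \<notin> B --> al b = 0) & sum al B <= m}"

lemma IX_insert:
 fixes B :: "'i set"
 assumes "finite B" "b \<notin> B"
 shows "bij_betw (%al. (al b, al(b := 0))) (IX (insert b B) m) (SIGMA j:{..m}. IX B (m - j))"
proof -
 have e: "(\<Sum>x\<in>B. if x = b then j else al x) = sum al B" for j and al :: "'i => nat" by (rule sum.cong[OF refl]) (use assms(2) in auto)
 show ?thesis by (rule bij_betw_byWitness[where f'="%(j, al). al(b := j)"])
   (use assms in \<open>auto simp: IX_def fun_eq_iff e split: if_splits\<close>)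
qed

text \<open>Splitting off the exponent of one variable reduces the count to the hockey-stick sum of
  binomial coefficients.\<close>

lemma card_IX: "finite (B :: 'i set) ==> finite (IX B m) & card (IX B m) = (m + card B) choose (card B)"
proof (induction B arbitrary: m rule: finite_induct)
 case empty
 have "IX ({} :: 'i set) m = {%_. 0}" by (auto simp: IX_def)
 thus ?case by simp
next
 case (insert b B)
 have "finite (SIGMA j:{..m}. IX B (m - j))" using insert.IH by (intro finite_SigmaI) auto
 hence f: "finite (IX (insert b B) m)" using bij_betw_finite[OF IX_insert[OF insert(1,2)]] by blast
 have "card (IX (insert b B) m) = (\<Sum>j\<le>m. (m - j + card B) choose (card B))" using bij_betw_same_card[OF IX_insert[OF insert(1,2)]] insert.IH by simp
 also have "... = (\<Sum>j\<le>m. (card B + j) choose (card B))" by (subst sum.nat_diff_reindex[of _ "Suc m", simplified lessThan_Suc_atMost, symmetric]) (simp add: add.commute)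
 also have "... = (m + card (insert b B)) choose card (insert b B)" unfolding choose_rising_sum(1) using insert(1,2) by (simp add: add.commute)
 finally show ?case using f by simp
qed

text \<open>One variable at a time: fixing the others leaves a polynomial in \<open>t\<close> with
  infinitely many zeros, whose coefficients are sums in fewer variables.\<close>

lemma monomials_independent:
 fixes c :: "('i => nat) => complex"
 assumes "finite B"
  and "!!y::'i => real. (\<Sum>al\<in>IX B m. c al * (\<Prod>b\<in>B. cor (y b) ^ al b)) = 0" and "al \<in> IX B m"
 shows "c al = 0" using assms
proof (induction B arbitrary: m c al rule: finite_induct)
 case empty
 have "IX ({} :: 'i set) m = {%_. 0}" by (auto simp: IX_def)
 thus ?case using empty by simp
next
 case (insert b B)
 define g where "g = (%al::'i => nat. (al b, al(b := 0)))"
 have bij: "bij_betw g (IX (insert b B) m) (SIGMA j:{..m}. IX B (m - j))" unfolding g_def by (rule IX_insert[OF insert(1,2)])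
 have z: "(\<Sum>bt\<in>IX B (m - j). c (bt(b := j)) * (\<Prod>i\<in>B. cor (y i) ^ bt i)) = 0" if "j <= m" for j and y :: "'i => real"
 proof (rule infinite_real_roots[of 1 "%j. \<Sum>bt\<in>IX B (m - j). c (bt(b := j)) * (\<Prod>i\<in>B. cor (y i) ^ bt i)" m, OF _ _ that])
  fix t :: real
  have "0 = (\<Sum>al\<in>IX (insert b B) m. c al * (\<Prod>i\<in>insert b B. cor ((y(b := t)) i) ^ al i))" by (simp only: insert.prems)
  also have "... = (\<Sum>al\<in>IX (insert b B) m. (%(j, bt). c (bt(b := j)) * (\<Prod>i\<in>B. cor (y i) ^ bt i) * cor t ^ j) (g al))"
  proof (rule sum.cong[OF refl])
   fix al :: "'i => nat"
   have "(\<Prod>i\<in>B. cor ((y(b := t)) i) ^ al i) = (\<Prod>i\<in>B. cor (y i) ^ (al(b := 0)) i)" using insert(2) by (intro prod.cong) auto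
   thus "c al * (\<Prod>i\<in>insert b B. cor ((y(b := t)) i) ^ al i)
    = (%(j, bt). c (bt(b := j)) * (\<Prod>i\<in>B. cor (y i) ^ bt i) * cor t ^ j) (g al)" using insert(1,2) by (simp add: g_def)
  qed
  also have "... = (\<Sum>(j, bt)\<in>(SIGMA j:{..m}. IX B (m - j)). c (bt(b := j)) * (\<Prod>i\<in>B. cor (y i) ^ bt i) * cor t ^ j)" by (rule sum.reindex_bij_betw[OF bij])
  also have "... = (\<Sum>j\<le>m. \<Sum>bt\<in>IX B (m - j). c (bt(b := j)) * (\<Prod>i\<in>B. cor (y i) ^ bt i) * cor t ^ j)" by (rule sum.Sigma[symmetric]) (use card_IX[OF insert(1)] in auto)
  finally show "(\<Sum>j\<le>m. (\<Sum>bt\<in>IX B (m - j). c (bt(b := j)) * (\<Prod>i\<in>B. cor (y i) ^ bt i)) * cor t ^ j) = 0" by (simp add: sum_distrib_right)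
 qed simp
 have "g al \<in> (SIGMA j:{..m}. IX B (m - j))" using bij_betwE[OF bij] insert.prems(2) by blast
 hence ab: "al b <= m" "al(b := 0) \<in> IX B (m - al b)" by (simp_all add: g_def)
 have "c ((al(b := 0))(b := al b)) = 0" by (rule insert.IH[of "%bt. c (bt(b := al b))", OF z ab(2)]) (rule ab(1))
 thus ?case by (simp only: fun_upd_upd fun_upd_triv)
qed

definition mono :: "('a => nat) => 'a::euclidean_space cf" where
 "mono al x = (\<Prod>b\<in>Basis. cor (inner x b) ^ al b)"

lemma pol_mono_index: "al \<in> IX Basis m ==> pol m (mono al :: 'a::euclidean_space cf)"
proof -
 assume a: "al \<in> IX Basis m"
 have pw: "pol n (%x. cor (inner x b) ^ n)" if "b \<in> Basis" for b :: 'a and n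
 proof (induction n)
  case 0 show ?case using pol_const[of 0 1] by simp
 qed (use that in \<open>simp add: pol_coord\<close>)
 have "pol (sum al B) (%x. \<Prod>b\<in>B. cor (inner x b) ^ al b)" if "finite B" "B \<subseteq> Basis" for B :: "'a set" using that
 proof (induction B rule: finite_induct)
  case empty show ?case using pol_const[of 0 1] by simp
 qed (simp add: pol_mult pw)
 from this[of Basis] show ?thesis using a by (auto simp: IX_def mono_def[abs_def] intro: pol_mono)
qed

lemma finite_IX_Basis: "finite (IX (Basis :: 'a::euclidean_space set) m)" using card_IX[OF finite_Basis] by blast

lemma pol_expand: "pol m f ==> EX c. f = (%x. \<Sum>al\<in>IX Basis m. c al * mono al (x :: 'a::euclidean_space))"
proof (induction rule: pol.induct)
 case (pol_const m k)
 have e: "k = (\<Sum>al\<in>IX Basis m. (if al = (%_. 0) then k else 0) * mono al x)" for x :: 'a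
 proof -
  have "(\<Sum>al\<in>IX Basis m. (if al = (%_. 0) then k else 0) * mono al x) = (\<Sum>al\<in>IX (Basis :: 'a set) m. if al = (%_. 0) then k * mono (%_. 0) x else 0)" by (rule sum.cong[OF refl]) auto
  also have "... = k * mono (%_. 0) x"
  proof -
   have "(%_. 0) \<in> IX (Basis :: 'a set) m" by (simp add: IX_def)
   thus ?thesis using finite_IX_Basis[of m, where 'a='a] by simp
  qed
  finally show ?thesis by (simp add: mono_def)
 qed
 show ?case by (rule exI, rule ext, rule e)
next
 case (pol_add m f g)
 then obtain c d where "f = (%x. \<Sum>al\<in>IX Basis m. c al * mono al x)" "g = (%x. \<Sum>al\<in>IX Basis m. d al * mono al x)" by blast
 thus ?case by (intro exI[of _ "%al. c al + d al"]) (simp add: distrib_right sum.distrib)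
next
 case (pol_coord m f b)
 then obtain c where c: "f = (%x. \<Sum>al\<in>IX Basis m. c al * mono al x)" by blast
 define sh where "sh al = al(b := Suc (al b))" for al :: "'a => nat"
 define un where "un al = al(b := al b - 1)" for al :: "'a => nat"
 have us: "un (sh al) = al" for al by (simp add: un_def sh_def)
 have inj: "inj_on sh X" for X by (rule inj_on_inverseI[of _ un]) (rule us)
 have sub: "sh ` IX Basis m \<subseteq> IX Basis (Suc m)"
 proof clarify
  fix al :: "'a => nat" assume a: "al \<in> IX Basis m"
  have "sum (sh al) Basis = Suc (al b) + sum al (Basis - {b})" using pol_coord.hyps(2) by (simp add: sum.remove[of Basis b] sh_def)
  also have "... = Suc (sum al Basis)" using pol_coord.hyps(2) by (simp add: sum.remove[of Basis b])
  finally show "sh al \<in> IX Basis (Suc m)" using a pol_coord.hyps(2) by (auto simp: IX_def sh_def)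
 qed
 have m: "cor (inner x b) * mono al x = mono (sh al) x" for al x unfolding mono_def prod.remove[OF finite_Basis pol_coord.hyps(2)] by (simp add: sh_def mult.assoc)
 have e: "cor (inner x b) * f x = (\<Sum>al\<in>IX Basis (Suc m). (if al \<in> sh ` IX Basis m then c (un al) else 0) * mono al x)" for x
 proof -
  have "cor (inner x b) * f x = (\<Sum>al\<in>IX Basis m. c (un (sh al)) * mono (sh al) x)" unfolding c sum_distrib_left us by (rule sum.cong[OF refl]) (simp add: m[symmetric] mult_ac)
  also have "... = (\<Sum>al\<in>sh ` IX Basis m. c (un al) * mono al x)" by (simp add: sum.reindex[OF inj])
  also have "... = (\<Sum>al\<in>IX Basis (Suc m). (if al \<in> sh ` IX Basis m then c (un al) else 0) * mono al x)" by (rule sum.mono_neutral_cong_left[OF finite_IX_Basis sub]) auto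
  finally show ?thesis .
 qed
 show ?case by (rule exI, rule ext, rule e)
qed

text \<open>The hypothesis is independence over the complex numbers; over the reals the vectors
  \<open>v al\<close> and \<open>J (v al)\<close> together are independent, hence the factor
  2.\<close>

lemma complex_family_basis:
 fixes v :: "'i => 'a::euclidean_space l2"
 assumes S: "finite S" and inj: "!!c al. (\<Sum>al\<in>S. cm (c al) (v al)) = 0 ==> al \<in> S ==> c al = 0"
 shows "EX B. finite B & independent B & card B = 2 * card S & span B = range (%c. \<Sum>al\<in>S. cm (c al) (v al))"
proof -
 define w where "w i = (if snd i then J (v (fst i)) else v (fst i))" for i
 let ?I = "S \<times> (UNIV :: bool set)"
 have comb: "(\<Sum>i\<in>?I. r i *\<^sub>R w i) = (\<Sum>al\<in>S. cm (Complex (r (al, False)) (r (al, True))) (v al))" for r :: "'i \<times> bool => real"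
 proof -
  have "(\<Sum>i\<in>?I. r i *\<^sub>R w i) = (\<Sum>al\<in>S. \<Sum>t\<in>UNIV. r (al, t) *\<^sub>R w (al, t))" by (simp add: sum.cartesian_product case_prod_beta)
  also have "... = (\<Sum>al\<in>S. cm (Complex (r (al, False)) (r (al, True))) (v al))"
  proof (rule sum.cong[OF refl])
   fix al
   show "(\<Sum>t\<in>UNIV. r (al, t) *\<^sub>R w (al, t)) = cm (Complex (r (al, False)) (r (al, True))) (v al)" by (subst cm_eq) (simp add: UNIV_bool w_def add.commute)
  qed
  finally show ?thesis .
 qed
 have ind: "r i = 0" if "(\<Sum>i\<in>?I. r i *\<^sub>R w i) = 0" "i \<in> ?I" for r :: "'i \<times> bool => real" and i
  using inj[OF that(1)[unfolded comb], of "fst i"] that(2) by (cases i; cases "snd i") (auto simp: complex_eq_iff)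
 have w_inj: "inj_on w ?I"
 proof (rule inj_onI, rule ccontr)
  fix i j assume ij: "i \<in> ?I" "j \<in> ?I" "w i = w j" "i ~= j"
  have "(\<Sum>k\<in>?I. ((if k = i then 1 else 0) - (if k = j then 1 else 0)) *\<^sub>R w k) = w i - w j" using ij(1,2) S by (simp add: scaleR_diff_left sum_subtractf if_distrib[of "%r. r *\<^sub>R _"] cong: if_cong)
  from ind[OF this[unfolded ij(3), simplified], of i] ij show False by simp
 qed
 have fin: "finite (w ` ?I)" using S by simp
 have "independent (w ` ?I)"
 proof (rule independent_if_scalars_zero[OF fin])
  fix f x assume f: "(\<Sum>x\<in>w ` ?I. f x *\<^sub>R x) = 0" and x: "x \<in> w ` ?I"
  then obtain i where i: "i \<in> ?I" "x = w i" by blast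
  show "f x = 0" using ind[of "f \<circ> w" i] f i by (simp add: sum.reindex[OF w_inj])
 qed
 moreover have "card (w ` ?I) = 2 * card S" using S by (simp add: card_image[OF w_inj] card_cartesian_product)
 moreover have "span (w ` ?I) = range (%c. \<Sum>al\<in>S. cm (c al) (v al))"
 proof
  show "span (w ` ?I) \<subseteq> range (%c. \<Sum>al\<in>S. cm (c al) (v al))"
  proof
   fix x assume "x \<in> span (w ` ?I)"
   then obtain f where "x = (\<Sum>y\<in>w ` ?I. f y *\<^sub>R y)" unfolding span_finite[OF fin] by blast
   hence "x = (\<Sum>i\<in>?I. f (w i) *\<^sub>R w i)" by (simp add: sum.reindex[OF w_inj])
   thus "x \<in> range (%c. \<Sum>al\<in>S. cm (c al) (v al))" using comb[of "%i. f (w i)"] by auto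
  qed
  show "range (%c. \<Sum>al\<in>S. cm (c al) (v al)) \<subseteq> span (w ` ?I)"
  proof clarify
   fix c :: "'i => complex"
   have "v al \<in> span (w ` ?I)" "J (v al) \<in> span (w ` ?I)" if "al \<in> S" for al
   proof -
    have "w (al, t) \<in> span (w ` ?I)" for t by (rule span_base) (use that in blast)
    from this[of False] this[of True] show "v al \<in> span (w ` ?I)" "J (v al) \<in> span (w ` ?I)" by (simp_all only: w_def fst_conv snd_conv if_True if_False)
   qed
   thus "(\<Sum>al\<in>S. cm (c al) (v al)) \<in> span (w ` ?I)" by (intro span_sum, subst cm_eq) (simp add: span_add span_scale)
  qed
 qed
 ultimately show ?thesis using fin by blast
qed

text \<open>Stated for an injective complex-linear \<open>L\<close> because it is applied to the
  identity and to \<open>lap\<close> after \<open>s2\<close>, the two dimensions whose difference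
  enters \<open>harmonic_basis\<close>.\<close>

lemma pol_image_basis:
 fixes L :: "('a::euclidean_space cf) => 'a => complex"
 assumes Lp: "!!m f. pol m f ==> L f \<in> L2 MB"
  and La: "!!m f g. pol m f ==> pol m g ==> L (%x. f x + g x) = (%x. L f x + L g x)"
  and Lc: "!!m f c. pol m f ==> L (%x. c * f x) = (%x. c * L f x)"
  and inj: "!!m f. pol m f ==> mk (L f) = 0 ==> f = (%_. 0)"
 shows "EX B. finite B & independent B & card B = 2 * ((m + DIM('a)) choose DIM('a)) & span B = {mk (L f) | f. pol m f}"
proof -
 let ?S = "IX (Basis :: 'a set) m"
 have p: "pol m (%x. \<Sum>al\<in>I. c al * mono al x)" if "I \<subseteq> ?S" for I c by (intro pol_sum pol_cmult pol_mono_index) (use that in auto)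
 have eq: "mk (L (%x. \<Sum>al\<in>I. c al * mono al x)) = (\<Sum>al\<in>I. cm (c al) (mk (L (mono al))))" if "finite I" "I \<subseteq> ?S" for c I using that
 proof (induction I rule: finite_induct)
  case empty
  show ?case using Lc[OF pol_const[of 0 0], of 0] by (simp add: mk_zero)
 next
  case (insert i I)
  have i: "pol m (mono i :: 'a cf)" using insert by (intro pol_mono_index) auto
  show ?case using insert La[OF pol_cmult[OF i] p] Lp[OF i] Lp[OF p] by (simp add: Lc[OF i] mk_add L2_cmult cm_mk)
 qed
 have "EX B. finite B & independent B & card B = 2 * card ?S & span B = range (%c. \<Sum>al\<in>?S. cm (c al) (mk (L (mono al))))"
 proof (rule complex_family_basis[OF finite_IX_Basis])
  fix c al assume z: "(\<Sum>al\<in>?S. cm (c al) (mk (L (mono al)))) = 0" and a: "al \<in> ?S"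
  have f0: "(%x. \<Sum>al\<in>?S. c al * mono al x) = (%_. 0)" by (rule inj[OF p[OF subset_refl]]) (simp add: eq finite_IX_Basis z)
  show "c al = 0"
  proof (rule monomials_independent[OF finite_Basis _ a])
   fix y :: "'a => real"
   have "(\<Prod>b\<in>Basis. cor (y b) ^ al b) = mono al (\<Sum>b\<in>Basis. y b *\<^sub>R b)" for al unfolding mono_def by (intro prod.cong) auto
   thus "(\<Sum>al\<in>?S. c al * (\<Prod>b\<in>Basis. cor (y b) ^ al b)) = 0" using fun_cong[OF f0] by simp
  qed
 qed
 moreover have "range (%c. \<Sum>al\<in>?S. cm (c al) (mk (L (mono al)))) = {mk (L f) | f. pol m f}" unfolding eq[OF finite_IX_Basis subset_refl, symmetric] using p[OF subset_refl] pol_expand[of m] by fast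
 ultimately show ?thesis using card_IX[of "Basis :: 'a set" m] by simp
qed

text \<open>\<open>pr\<close> projects along the span of \<open>BU\<close>. Orthogonal generators of
  its image, without 0 and normalised, complete those of the span of \<open>BU\<close>, and
  comparing dimensions gives the cardinality.\<close>

lemma orthogonal_complement_basis:
 fixes BE BU :: "'h::real_inner set"
 assumes BE: "finite BE" "independent BE" and BU: "finite BU" "independent BU" "BU \<subseteq> span BE"
 shows "EX Y. finite Y & (ALL x:Y. norm x = 1) & pairwise orthogonal Y & card Y + card BU = card BE
  & (ALL y:Y. y \<in> span BE & (ALL u:span BU. inner y u = 0)) & (ALL x:span BE. EX y:span Y. x - y \<in> span BU)"
proof -
 obtain C where C: "finite C" "span C = span BU" "pairwise orthogonal C" using basis_orthogonal[OF BU(1)] by blast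
 define pr where "pr x = x - (\<Sum>c\<in>C. (inner x c / inner c c) *\<^sub>R c)" for x :: 'h
 have lin: "linear pr" unfolding pr_def by (rule linearI) (simp_all add: inner_add_left add_divide_distrib scaleR_add_left sum.distrib scaleR_sum_right algebra_simps)
 have pr_span: "x - pr x \<in> span BU" for x unfolding pr_def C(2)[symmetric] by (simp add: span_sum span_scale span_base)
 have oc: "inner (pr x) c = 0" if c: "c \<in> C" for x c
 proof -
  have "(\<Sum>c'\<in>C. (inner x c' / inner c' c') * inner c' c) = (\<Sum>c'\<in>C. if c' = c then inner x c else 0)" by (rule sum.cong[OF refl]) (use C(3) c in \<open>auto simp: pairwise_def orthogonal_def\<close>)
  thus ?thesis using c C(1) by (simp add: pr_def inner_diff_left inner_sum_left)
 qed
 have orth: "inner (pr x) u = 0" if "u \<in> span BU" for x u using that[folded C(2)] by (induction rule: span_induct_alt) (auto simp: inner_add_right oc)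
 have BUE: "span BU \<subseteq> span BE" using BU(3) by (simp add: span_minimal)
 have prE: "pr x \<in> span BE" if "x \<in> span BE" for x using span_diff[OF that subsetD[OF BUE pr_span[of x]]] by simp
 obtain D where D: "finite D" "span D = span (pr ` BE)" "pairwise orthogonal D" using basis_orthogonal[of "pr ` BE"] BE(1) by blast
 have sD: "span D = pr ` span BE" unfolding D(2) by (rule span_linear_image[OF lin])
 define C' D' where "C' = C - {0}" and "D' = D - {0}"
 define Y where "Y = (%x. x /\<^sub>R norm x) ` D'"
 have D'in: "x \<in> span BE" "u \<in> span BU ==> inner x u = 0" if d: "x \<in> D" for x u
 proof -
  obtain z where z: "z \<in> span BE" "x = pr z" using span_base[OF d] unfolding sD by blast
  show "x \<in> span BE" using prE z by simp
  show "u \<in> span BU ==> inner x u = 0" using orth z by simp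
 qed
 have CD: "inner c x = 0 & inner x c = 0" if "c \<in> C" "x \<in> D" for c x using D'in(2)[OF that(2), of c] span_base[OF that(1)] by (simp add: C(2) inner_commute)
 have disj: "C' \<inter> D' = {}" using D'in(2) span_base[of _ C] by (fastforce simp: C'_def D'_def C(2))
 have "pairwise orthogonal (C' \<union> D')" using C(3) D(3) CD unfolding pairwise_def orthogonal_def C'_def D'_def by blast
 hence indCD: "independent (C' \<union> D')" by (rule pairwise_orthogonal_independent) (simp add: C'_def D'_def)
 have spCD: "span (C' \<union> D') = span BE"
 proof
  show "span (C' \<union> D') \<subseteq> span BE" by (rule span_minimal) (use BUE D'in(1) span_base[of _ C] in \<open>auto simp: C'_def D'_def C(2)\<close>)
  show "span BE \<subseteq> span (C' \<union> D')"
  proof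
   fix x assume x: "x \<in> span BE"
   have "x - pr x \<in> span C" "pr x \<in> span D" using pr_span x by (auto simp: C(2) sD)
   hence "x - pr x \<in> span C'" "pr x \<in> span D'" by (simp_all add: C'_def D'_def)
   hence "x - pr x \<in> span (C' \<union> D')" "pr x \<in> span (C' \<union> D')" using span_mono[of C' "C' \<union> D'"] span_mono[of D' "C' \<union> D'"] by auto
   from span_add[OF this] show "x \<in> span (C' \<union> D')" by simp
  qed
 qed
 have "card (C' \<union> D') = card BE" using dim_eq_card_independent[OF indCD] dim_eq_card_independent[OF BE(2)] spCD by (metis dim_span)
 moreover have "card C' = card BU"
 proof -
  have "independent C'" using independent_mono[OF indCD] by blast
  moreover have "span C' = span BU" unfolding C(2)[symmetric] C'_def by simp
  ultimately show ?thesis using dim_eq_card_independent[of C'] dim_eq_card_independent[OF BU(2)] by (metis dim_span)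
 qed
 moreover have "card (C' \<union> D') = card C' + card D'" by (rule card_Un_disjoint) (use C(1) D(1) disj in \<open>auto simp: C'_def D'_def\<close>)
 moreover have "inj_on (%x. x /\<^sub>R norm x) D'"
 proof (rule inj_onI, rule ccontr)
  fix x y assume xy: "x \<in> D'" "y \<in> D'" "x /\<^sub>R norm x = y /\<^sub>R norm y" "x ~= y"
  hence "inner x y = 0" using D(3) by (auto simp: pairwise_def orthogonal_def D'_def)
  hence "inner (x /\<^sub>R norm x) (y /\<^sub>R norm y) = 0" by simp
  hence "inner (x /\<^sub>R norm x) (x /\<^sub>R norm x) = 0" using xy(3) by simp
  thus False using xy(1) by (simp add: D'_def)
 qed
 hence "card Y = card D'" by (simp add: Y_def card_image)
 moreover have "ALL x:Y. norm x = 1" by (auto simp: Y_def D'_def)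
 moreover have "pairwise orthogonal Y" using D(3) unfolding pairwise_def orthogonal_def Y_def D'_def by fastforce
 moreover have "ALL y:Y. y \<in> span BE & (ALL u:span BU. inner y u = 0)" using D'in by (auto simp: Y_def D'_def span_scale)
 moreover have "ALL x:span BE. EX y:span Y. x - y \<in> span BU"
 proof
  fix x assume x: "x \<in> span BE"
  have "D \<subseteq> span Y"
  proof
   fix d assume d: "d \<in> D"
   show "d \<in> span Y"
   proof (cases "d = 0")
    case False
    hence "d /\<^sub>R norm d \<in> span Y" using d by (intro span_base) (auto simp: Y_def D'_def)
    from span_scale[OF this, of "norm d"] show ?thesis using False by simp
   qed (simp add: span_zero)
  qed
  hence "span D \<subseteq> span Y" by (simp add: span_minimal)
  hence "pr x \<in> span Y" using x sD by blast
  thus "EX y:span Y. x - y \<in> span BU" using pr_span by blast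
 qed
 moreover have "finite Y" using D(1) by (simp add: Y_def D'_def)
 ultimately show ?thesis by (intro exI[of _ Y]) simp
qed

definition Nd :: "nat => nat => nat" where "Nd d m = (m + d) choose d"

lemma one_minus_neq_0: assumes "x \<in> ball 0 1" shows "1 - cor (inner x x) ~= 0"
proof -
 have "inner x x < 1" using assms by (simp add: power_less_one_iff flip: power2_norm_eq_inner)
 hence "cor (inner x x) ~= cor 1" by (simp only: of_real_eq_iff)
 thus ?thesis by simp
qed

text \<open>Among polynomials of degree at most \<open>m + 2\<close>, those orthogonal to all
  \<open>lap (s2 p)\<close> with \<open>p\<close> of degree at most \<open>m\<close> are the
  harmonic ones, by \<open>green_s2\<close> with \<open>p = lap q\<close>. Since \<open>s2\<close>
  raises the degree by 4, \<open>lap\<close> lowers it by 2, and \<open>lap\<close> after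
  \<open>s2\<close> is injective, the dimension is a difference of binomial coefficients.\<close>

lemma harmonic_basis:
 fixes m :: nat
 shows "EX Y :: 'a::euclidean_space l2 set. finite Y & (ALL x:Y. norm x = 1) & pairwise orthogonal Y
  & card Y + 2 * Nd DIM('a) m = 2 * Nd DIM('a) (m + 2)
  & span Y = {mk q | q. pol (m + 2) q & lap q = (%_. 0)}
  & (ALL f. pol (m + 2) f --> (EX p. pol m p & mk f - mk (lap (s2 p)) \<in> span Y))"
proof -
 obtain BE :: "'a l2 set" where BE: "finite BE" "independent BE" "card BE = 2 * Nd DIM('a) (m + 2)" "span BE = {mk f | f. pol (m + 2) f}"
  using pol_image_basis[of "%f. f" "m + 2"] pol_L2 pol_mk_zero by (auto simp: Nd_def)
 have s2a: "lap (s2 (%x. f x + g x)) = (%x. lap (s2 f) x + lap (s2 g) x)" if "pol n f" "pol n g" for n and f g :: "'a cf"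
 proof -
  have "s2 (%x. f x + g x) = (%x. s2 f x + s2 g x)" by (simp add: s2_def[abs_def] distrib_left)
  thus ?thesis using that by (simp add: lap_add pol_smooth[OF pol_s2])
 qed
 have s2c: "lap (s2 (%x. c * f x)) = (%x. c * lap (s2 f) x)" if "pol n f" for n c and f :: "'a cf"
 proof -
  have "s2 (%x. c * f x) = (%x. c * s2 f x)" by (simp add: s2_def[abs_def] mult_ac)
  thus ?thesis using lap_bl[OF pol_smooth[OF pol_s2[OF that]] bounded_linear_mult_right] by simp
 qed
 have s2i: "f = (%_. 0)" if "pol n f" "mk (lap (s2 f)) = 0" for n and f :: "'a cf"
 proof (rule pol_ball_zero[OF that(1)])
  fix x :: 'a assume "x \<in> ball 0 1"
  from one_minus_neq_0[OF this] have "1 - cor (inner x x) ~= 0" .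
  thus "f x = 0" using fun_cong[OF pol_mk_zero[OF pol_s2[OF that(1)] s2_inj[OF that]], of x] by (simp add: s2_def)
 qed
 obtain BU :: "'a l2 set" where BU: "finite BU" "independent BU" "card BU = 2 * Nd DIM('a) m" "span BU = {mk (lap (s2 f)) | f. pol m f}"
  using pol_image_basis[of "%f. lap (s2 f)" m] pol_L2[OF pol_lap[OF pol_s2]] s2a s2c s2i by (auto simp: Nd_def)
 have "BU \<subseteq> span BE"
 proof
  fix x assume "x \<in> BU"
  hence "x \<in> span BU" by (rule span_base)
  then obtain f where f: "x = mk (lap (s2 f))" "pol m f" unfolding BU(4) by blast
  have "pol (m + 2) (lap (s2 f))" using pol_lap[OF pol_s2[OF f(2)]] by simp
  thus "x \<in> span BE" unfolding BE(4) f by blast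
 qed
 from orthogonal_complement_basis[OF BE(1,2) BU(1,2) this]
 obtain Y where Y: "finite Y" "ALL x:Y. norm x = 1" "pairwise orthogonal Y" "card Y + card BU = card BE"
  "!!y. y \<in> Y ==> y \<in> span BE" "!!y u. y \<in> Y ==> u \<in> span BU ==> inner y u = 0"
  "!!x. x \<in> span BE ==> EX y:span Y. x - y \<in> span BU" by blast
 have YE: "span Y \<subseteq> span BE" by (rule span_minimal) (use Y(5) in auto)
 have YU: "inner y u = 0" if "y \<in> span Y" "u \<in> span BU" for y u using that(1) by (induction rule: span_induct_alt) (auto simp: inner_add_left Y(6)[OF _ that(2)])
 have "span Y = {mk q | q. pol (m + 2) q & lap q = (%_. 0)}"
 proof
  show "span Y \<subseteq> {mk q | q. pol (m + 2) q & lap q = (%_. 0)}"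
  proof
   fix y assume y: "y \<in> span Y"
   then obtain q where q: "y = mk q" "pol (m + 2) q" using YE BE(4) by auto
   have pl: "pol m (lap q)" using pol_lap[OF q(2)] by simp
   have "mk (lap (s2 (lap q))) \<in> span BU" unfolding BU(4) using pl by blast
   from YU[OF y this] have "inner (mk (lap q)) (mk (s2 (lap q))) = 0" unfolding q(1) green_s2[OF q(2) pl] .
   \<comment> \<open>The weight in \<open>s2\<close> is a square, so this pairing is a squared
     norm.\<close>
   moreover have "inner (mk (lap q)) (mk (s2 (lap q))) = (norm (mk (%x. (1 - cor (inner x x)) * lap q x)))^2"
   proof -
    have L: "(%x. (1 - cor (inner x x)) * lap q x) \<in> L2 MB" using pol_L2[OF pol_mult[OF pol_one_minus pl, of 1]] by simp
    show ?thesis unfolding power2_norm_eq_inner inner_mk[OF pol_L2[OF pl] pol_L2[OF pol_s2[OF pl]]] inner_mk[OF L L] by (simp add: L2_inner_def s2_def power2_eq_square mult_ac)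
   qed
   ultimately have "mk (%x. (1 - cor (inner x x)) * lap q x) = 0" by simp
   from pol_mk_zero[OF pol_mult[OF pol_one_minus pl, of 1], simplified, OF this]
   have z: "(1 - cor (inner x x)) * lap q x = 0" for x by (simp add: fun_eq_iff)
   have "lap q = (%_. 0)"
   proof (rule pol_ball_zero[OF pl])
    fix x :: 'a assume "x \<in> ball 0 1"
    from one_minus_neq_0[OF this] have "1 - cor (inner x x) ~= 0" .
    thus "lap q x = 0" using z[of x] by simp
   qed
   thus "y \<in> {mk q | q. pol (m + 2) q & lap q = (%_. 0)}" using q by blast
  qed
  show "{mk q | q. pol (m + 2) q & lap q = (%_. 0)} \<subseteq> span Y"
  proof clarify
   fix q :: "'a cf" assume q: "pol (m + 2) q" "lap q = (%_. 0)"
   have "mk q \<in> span BE" unfolding BE(4) using q by blast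
   then obtain y where y: "y \<in> span Y" "mk q - y \<in> span BU" using Y(7) by blast
   then obtain p where p: "pol m p" "mk q - y = mk (lap (s2 p))" unfolding BU(4) by blast
   have "inner (mk q) (mk q - y) = 0" unfolding p(2) using green_s2[OF q(1) p(1)] q(2) by (simp add: mk_zero)
   hence "inner (mk q - y) (mk q - y) = 0" using YU[OF y] by (simp add: inner_diff_left)
   thus "mk q \<in> span Y" using y(1) by simp
  qed
 qed
 moreover have "EX p. pol m p & mk f - mk (lap (s2 p)) \<in> span Y" if f: "pol (m + 2) f" for f
 proof -
  have "mk f \<in> span BE" unfolding BE(4) using f by blast
  then obtain y where y: "y \<in> span Y" "mk f - y \<in> span BU" using Y(7) by blast
  then obtain p where p: "pol m p" "mk f - y = mk (lap (s2 p))" unfolding BU(4) by blast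
  from p(2) have "mk f - mk (lap (s2 p)) = y" by (simp add: algebra_simps)
  thus ?thesis using p(1) y(1) by auto
 qed
 ultimately show ?thesis using Y(1-4) BE(3) BU(3) by (intro exI[of _ Y]) simp
qed

subsection \<open>Multiplication operators\<close>

definition bm :: "('a::euclidean_space => real) => real => bool" where
 "bm W M \<longleftrightarrow> W \<in> borel_measurable MB & (ALL x:ball 0 1. 0 <= W x & W x <= M)"

definition mo :: "('a::euclidean_space => real) => 'a l2 => 'a l2" where
 "mo W u = mk (%x. cor (W x) * rp u x)"

lemma bm_mult_L2: assumes "bm W M" "f \<in> L2 MB" shows "(%x. cor (W x) * f x) \<in> L2 MB"
proof (rule L2_bounded_mult[OF assms(2)])
 have [measurable]: "W \<in> borel_measurable MB" using assms(1) by (simp add: bm_def)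
 show "(%x. cor (W x)) \<in> borel_measurable MB" by measurable
 show "norm (cor (W x)) <= M" if "x \<in> space MB" for x using assms(1) that by (simp add: bm_def space_restrict_space)
qed

lemma mo_mk: assumes "bm W M" "f \<in> L2 MB" shows "mo W (mk f) = mk (%x. cor (W x) * f x)" unfolding mo_def using rp_mk[OF assms(2)] by (subst mk_eq_iff) (auto intro!: bm_mult_L2[OF assms(1)] rp_L2 assms(2))

lemma bm_integrable:
 assumes "bm W M" "f \<in> L2 MB" shows "integrable MB (%x. W x * (cmod (f x))^2)"
proof -
 have "integrable MB (%x. cor (W x) * f x * cnj (f x))" by (rule L2_inner_integrable[OF bm_mult_L2[OF assms] assms(2)])
 also have "(%x. cor (W x) * f x * cnj (f x)) = (%x. cor (W x * (cmod (f x))^2))" by (simp add: complex_norm_square mult.assoc fun_eq_iff del: of_real_power)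
 finally show ?thesis by (simp only: complex_of_real_integrable_eq)
qed

lemma mo_form: assumes "bm W M" "f \<in> L2 MB" shows "inner (mo W (mk f)) (mk f) = (LINT x|MB. W x * (cmod (f x))^2)"
proof -
 have "L2_inner MB (%x. cor (W x) * f x) f = (LINT x|MB. cor (W x * (cmod (f x))^2))" unfolding L2_inner_def by (intro Bochner_Integration.integral_cong refl) (simp add: complex_norm_square mult.assoc del: of_real_power)
 also have "... = cor (LINT x|MB. W x * (cmod (f x))^2)" by (rule integral_complex_of_real)
 finally show ?thesis by (simp add: mo_mk[OF assms] inner_mk[OF bm_mult_L2[OF assms] assms(2)])
qed

lemma mo_mono:
 assumes W: "bm W M" and W': "bm W' M'" and le: "!!x. x \<in> ball 0 1 ==> W x <= k * W' x"
 shows "inner (mo W u) u <= k * inner (mo W' u) u"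
proof -
 note L = rp_L2[of u]
 have "(LINT x|MB. W x * (cmod (rp u x))^2) <= (LINT x|MB. k * (W' x * (cmod (rp u x))^2))"
 proof (rule integral_mono)
  fix x :: 'a assume "x \<in> space MB"
  hence "W x <= k * W' x" by (intro le) (simp add: space_restrict_space)
  thus "W x * (cmod (rp u x))^2 <= k * (W' x * (cmod (rp u x))^2)" unfolding mult.assoc[symmetric] by (rule mult_right_mono) simp
 qed (use bm_integrable[OF W L] bm_integrable[OF W' L] in auto)
 thus ?thesis using mo_form[OF W L] mo_form[OF W' L] by (simp add: mk_rp)
qed

lemma bm_one: "bm (%_. 1) 1" by (simp add: bm_def)

lemma mo_one: "mo (%_. 1) u = u" by (simp add: mo_def mk_rp)

lemma mo_le: "bm W M ==> inner (mo W u) u <= M * (norm u)^2" using mo_mono[OF _ bm_one, of W M M u] by (simp add: mo_one bm_def power2_norm_eq_inner)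

lemma mo_nonneg: "bm W M ==> 0 <= inner (mo W u) u" using mo_mono[OF bm_one, of W M 0 u] mo_form[of W M "rp u"] rp_L2[of u] by (auto simp: mk_rp bm_def space_restrict_space intro!: integral_nonneg_AE AE_I2)

lemma mo_sym: assumes "bm W M" shows "inner (mo W u) v = inner u (mo W v)"
proof -
 obtain f g where "f \<in> L2 MB" "u = mk f" "g \<in> L2 MB" "v = mk g" using mk_cases by metis
 thus ?thesis by (simp add: mo_mk[OF assms] inner_mk bm_mult_L2[OF assms] L2_inner_def mult.left_commute mult.assoc)
qed

text \<open>Pointwise \<open>(W x)^2 <= M * W x\<close>. The bound is by the form rather than by the
  norm of \<open>u\<close>, as \<open>V_le\<close> requires.\<close>

lemma mo_norm: assumes "bm W M" shows "(norm (mo W u))^2 <= M * inner (mo W u) u"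
proof -
 have W2: "bm (%x. (W x)^2) (M^2)" using assms by (auto simp: bm_def power_mono)
 have "(norm (mo W u))^2 = inner (mo (%x. (W x)^2) u) u"
 proof -
  have "(norm (mo W u))^2 = inner (mo W (mo W u)) u" by (simp add: power2_norm_eq_inner mo_sym[OF assms])
  also have "mo W (mo W u) = mo (%x. (W x)^2) u" unfolding mo_def[of W u] mo_mk[OF assms bm_mult_L2[OF assms rp_L2]] by (simp add: mo_def power2_eq_square mult.assoc)
  finally show ?thesis .
 qed
 also have "... <= M * inner (mo W u) u"
 proof (rule mo_mono[OF W2 assms])
  fix x :: 'a assume "x \<in> ball 0 1"
  hence "0 <= W x" "W x <= M" using assms by (auto simp: bm_def)
  thus "(W x)^2 <= M * W x" by (simp add: power2_eq_square mult_right_mono)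
 qed
 finally show ?thesis .
qed

lemma mo_bl: assumes "bm W M" shows "bounded_linear (mo W)"
proof -
 have M: "M >= 0" using assms unfolding bm_def by (metis centre_in_ball order_trans zero_less_one)
 show ?thesis
 proof (rule bounded_linear_intro[where K=M])
  fix u v :: "'a l2" and r :: real
  show "mo W (u + v) = mo W u + mo W v"
  proof -
   have "mo W (mk (%x. rp u x + rp v x)) = mo W (mk (rp u)) + mo W (mk (rp v))" unfolding mo_mk[OF assms rp_L2] mo_mk[OF assms L2_add[OF rp_L2 rp_L2]]
    by (subst mk_add[symmetric]) (auto simp: distrib_left bm_mult_L2[OF assms] rp_L2)
   thus ?thesis by (simp add: mk_add rp_L2 mk_rp)
  qed
  show "mo W (r *\<^sub>R u) = r *\<^sub>R mo W u"
  proof -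
   have "mo W (mk (%x. cor r * rp u x)) = r *\<^sub>R mo W (mk (rp u))" unfolding mo_mk[OF assms rp_L2] mo_mk[OF assms L2_cmult[OF rp_L2]]
    unfolding mult.left_commute[of "cor (W _)"] by (rule mk_scaleR[OF bm_mult_L2[OF assms rp_L2]])
   thus ?thesis by (simp add: mk_scaleR rp_L2 mk_rp)
  qed
  have "(norm (mo W u))^2 <= M * (M * (norm u)^2)" using mo_norm[OF assms, of u] mult_left_mono[OF mo_le[OF assms, of u] M] by linarith
  hence "(norm (mo W u))^2 <= (norm u * M)^2" by (simp add: power2_eq_square mult_ac)
  thus "norm (mo W u) <= norm u * M" by (rule power2_le_imp_le) (use M in simp)
 qed
qed

lemma mo_cm: assumes "bm W M" shows "mo W (cm z u) = cm z (mo W u)"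
proof -
 have "mo W (mk (%x. z * rp u x)) = cm z (mo W (mk (rp u)))" unfolding mo_mk[OF assms rp_L2] mo_mk[OF assms L2_cmult[OF rp_L2]]
  unfolding mult.left_commute[of "cor (W _)"] by (rule cm_mk[OF bm_mult_L2[OF assms rp_L2], symmetric])
 thus ?thesis by (simp add: cm_mk[symmetric] rp_L2 mk_rp)
qed

subsection \<open>Harmonic functions on smaller balls\<close>

text \<open>The squared L^2 norm of \<open>u\<close> over the ball of radius
  \<open>de\<close>.\<close>

definition nb :: "real => 'a::euclidean_space l2 => real" where
 "nb de u = inner (mo (indicator (ball 0 de)) u) u"

lemma bm_ind: "bm (indicator (ball (0::'a::euclidean_space) de)) 1"
proof -
 have "ball (0::'a) de \<inter> space MB \<in> sets MB" by (simp add: sets_restrict_space_iff space_restrict_space sets.Int)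
 hence "(indicator (ball (0::'a) de) :: 'a => real) \<in> borel_measurable MB" by (subst borel_measurable_indicator_iff) simp
 thus ?thesis by (simp add: bm_def indicator_def)
qed

lemma lborel_integral_scale:
 fixes f :: "'a::euclidean_space cf"
 assumes "f \<in> borel_measurable borel" "de > 0"
 shows "(LINT x|lborel. f x) = de ^ DIM('a) *\<^sub>R (LINT x|lborel. f (de *\<^sub>R x))"
proof -
 have "(LINT x|lborel. f x) = (LINT x|density (distr lborel borel (%x::'a. 0 + de *\<^sub>R x)) (%_. ennreal (de ^ DIM('a))). f x)" using assms(2) by (subst lborel_affine[of de 0]) auto
 also have "... = (LINT x|distr lborel borel (%x::'a. 0 + de *\<^sub>R x). de ^ DIM('a) *\<^sub>R f x)" by (rule integral_density) (use assms in auto)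
 also have "... = (LINT x|lborel. de ^ DIM('a) *\<^sub>R f (0 + de *\<^sub>R x))" by (rule integral_distr) (use assms in auto)
 finally show ?thesis by simp
qed

lemma nb_scale:
 fixes q :: "'a::euclidean_space cf"
 assumes d: "0 < de" "de < 1" and q: "continuous_on UNIV q"
 shows "nb de (mk q) = de ^ DIM('a) * (norm (mk (%x. q (de *\<^sub>R x))))^2"
proof -
 define F where "F x = cor (indicator (ball 0 de) x * (cmod (q x))^2)" for x
 have Fe: "F = (%x. indicat_real (ball 0 de) x *\<^sub>R cor ((cmod (q x))^2))" by (auto simp: F_def fun_eq_iff indicator_def)
 have Fm: "F \<in> borel_measurable borel" unfolding Fe by (intro borel_measurable_scaleR borel_measurable_indicator borel_measurable_continuous_onI continuous_intros q) simp
 have qd: "continuous_on UNIV (%x. q (de *\<^sub>R x))" by (rule continuous_on_compose2[OF q]) (auto intro!: continuous_intros)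
 have "cor (nb de (mk q)) = (LINT x|MB. F x)" unfolding nb_def mo_form[OF bm_ind cont_L2[OF q]] F_def by (rule integral_complex_of_real[symmetric])
 also have "... = (LINT x|lborel. F x)" by (rule MB_integral_borel[OF Fm d(2)]) (simp add: F_def)
 also have "... = de ^ DIM('a) *\<^sub>R (LINT x|lborel. F (de *\<^sub>R x))" by (rule lborel_integral_scale[OF Fm d(1)])
 also have "(LINT x|lborel. F (de *\<^sub>R x)) = (LINT x|lebesgue. F (de *\<^sub>R x))" by (rule integral_completion[symmetric]) (use Fm in simp)
 also have "(%x. F (de *\<^sub>R x)) = (%x. indicat_real (ball 0 1) x *\<^sub>R cor ((cmod (q (de *\<^sub>R x)))^2))" using d by (auto simp: F_def fun_eq_iff indicator_def)
 also have "(LINT x|lebesgue. indicat_real (ball 0 1) x *\<^sub>R cor ((cmod (q (de *\<^sub>R x)))^2))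
   = (LINT x|MB. cor ((cmod (q (de *\<^sub>R x)))^2))" by (rule integral_restrict_space[symmetric]) auto
 also have "... = cor ((norm (mk (%x. q (de *\<^sub>R x))))^2)" by (simp only: integral_complex_of_real norm_mk_sq[OF cont_L2[OF qd]])
 finally have "cor (nb de (mk q)) = cor (de ^ DIM('a) * (norm (mk (%x. q (de *\<^sub>R x))))^2)" by (simp add: scaleR_conv_of_real)
 thus ?thesis by (simp only: of_real_eq_iff)
qed

definition HP :: "nat => 'a::euclidean_space l2 set" where
 "HP m = {mk q | q. pol m q & lap q = (%_. 0)}"

lemma HP_H: "HP m \<subseteq> KR.H" by (auto simp: HP_def harmonic_pol_H)

lemma HP_mono: "m <= n ==> HP m \<subseteq> HP n" by (auto simp: HP_def intro: pol_mono)

text \<open>\<open>a k\<close> is the squared norm of the homogeneous part of degree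
  \<open>k\<close>; the dilation in \<open>nb_scale\<close> multiplies that part by
  \<open>de ^ k\<close> and keeps the parts orthogonal. The last clause holds because parts of
  degree at most \<open>n\<close> are themselves in \<open>HP n\<close>.\<close>

lemma nb_harmonic:
 fixes u :: "'a::euclidean_space l2"
 assumes u: "u \<in> HP m" and d: "0 < de" "de < 1"
 shows "EX a. (ALL k. 0 <= a k) & (norm u)^2 = (\<Sum>k\<le>m. a k) & nb de u = (\<Sum>k\<le>m. de ^ (2 * k + DIM('a)) * a k)
  & (ALL n. (ALL y:HP n. inner u y = 0) --> (ALL k<=n. k <= m --> a k = 0))"
proof -
 obtain q where q: "u = mk q" "pol m q" "lap q = (%_. 0)" using u by (auto simp: HP_def)
 obtain g where g: "!!k. hpol k (g k)" "!!k. lap (g k) = (%_. 0)" "q = (%x. \<Sum>k\<le>m. g k x)" using harmonic_decomp[OF q(2,3)] by blast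
 have gL: "g k \<in> L2 MB" for k by (rule pol_L2[OF hpol_pol[OF g(1)]])
 have orth: "inner (mk (g j)) (mk (g k)) = 0" if "j ~= k" for j k by (rule homogeneous_orthogonal[OF g(1,2) g(1,2) that])
 have u_eq: "u = (\<Sum>k\<le>m. mk (g k))" unfolding q(1) g(3) using mk_sum[of "{..m}" g, OF gL] by simp
 have n: "(norm u)^2 = (\<Sum>k\<le>m. (norm (mk (g k)))^2)" unfolding u_eq by (rule norm_sum_Pythagorean) (use orth in \<open>auto simp: pairwise_def orthogonal_def\<close>)
 have "mk (%x. q (de *\<^sub>R x)) = (\<Sum>k\<le>m. mk (%x. cor (de ^ k) * g k x))" using mk_sum[of "{..m}" "%k x. cor (de ^ k) * g k x", OF L2_cmult[OF gL]] by (simp add: g(3) hpol_scale[OF g(1)])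
 also have "... = (\<Sum>k\<le>m. de ^ k *\<^sub>R mk (g k))" by (intro sum.cong refl mk_scaleR gL)
 finally have "(norm (mk (%x. q (de *\<^sub>R x))))^2 = (\<Sum>k\<le>m. (norm (de ^ k *\<^sub>R mk (g k)))^2)"
  by (simp only:) (rule norm_sum_Pythagorean, use orth in \<open>auto simp: pairwise_def orthogonal_def\<close>)
 hence "nb de u = (\<Sum>k\<le>m. de ^ (2 * k + DIM('a)) * (norm (mk (g k)))^2)" unfolding q(1) nb_scale[OF d pol_cont[OF q(2)]] by (simp add: sum_distrib_left power_mult_distrib power_add power_mult[symmetric] mult_ac)
 moreover have "(norm (mk (g k)))^2 = 0" if "ALL y:HP n. inner u y = 0" "k <= n" "k <= m" for n k
 proof -
  have "mk (g k) \<in> HP n" using pol_mono[OF hpol_pol[OF g(1)] that(2)] g(2) by (auto simp: HP_def)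
  hence "0 = (\<Sum>j\<le>m. inner (mk (g j)) (mk (g k)))" using that(1) by (simp add: u_eq inner_sum_left)
  also have "... = (\<Sum>j\<le>m. if j = k then inner (mk (g k)) (mk (g k)) else 0)" by (rule sum.cong[OF refl]) (simp add: orth)
  finally show ?thesis using that(3) by (simp add: power2_norm_eq_inner)
 qed
 ultimately show ?thesis using n by (intro exI[of _ "%k. (norm (mk (g k)))^2"]) simp
qed

lemma nb_lower:
 fixes u :: "'a::euclidean_space l2"
 assumes u: "u \<in> HP m" and d: "0 < de" "de < 1"
 shows "de ^ (2 * m + DIM('a)) * (norm u)^2 <= nb de u"
proof -
 obtain a where a: "!!k. 0 <= a k" "(norm u)^2 = (\<Sum>k\<le>m. a k)" "nb de u = (\<Sum>k\<le>m. de ^ (2 * k + DIM('a)) * a k)" using nb_harmonic[OF u d] by blast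
 show ?thesis unfolding a(2,3) sum_distrib_left by (intro sum_mono mult_right_mono power_decreasing a(1)) (use d in auto)
qed

lemma nb_upper:
 fixes u :: "'a::euclidean_space l2"
 assumes u: "u \<in> HP n" and d: "0 < de" "de < 1" and o: "!!y. y \<in> HP m ==> inner u y = 0"
 shows "nb de u <= de ^ (2 * m + DIM('a)) * (norm u)^2"
proof -
 obtain a where a: "!!k. 0 <= a k" "(norm u)^2 = (\<Sum>k\<le>n. a k)" "nb de u = (\<Sum>k\<le>n. de ^ (2 * k + DIM('a)) * a k)"
  "!!k. k <= m ==> k <= n ==> a k = 0" using nb_harmonic[OF u d] o by blast
 show ?thesis unfolding a(2,3) sum_distrib_left
 proof (rule sum_mono)
  fix k assume "k \<in> {..n}"
  thus "de ^ (2 * k + DIM('a)) * a k <= de ^ (2 * m + DIM('a)) * a k" using a(4)[of k] by (cases "k <= m") (auto intro!: mult_right_mono power_decreasing a(1) simp: d less_imp_le)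
 qed
qed

lemma pol_cnj: "pol m p ==> pol m (%x. cnj (p x))" by (induction rule: pol.induct) (auto intro: pol.intros)

lemma l2_dense_pol:
 fixes g :: "'a::euclidean_space l2"
 assumes "!!m p. pol m p ==> inner g (mk p) = 0" shows "g = 0"
proof -
 have "(LINT x|MB. rp g x * p x) = 0" if p: "pol m p" for m p
 proof -
  note c = pol_cnj[OF p]
  have "L2_inner MB (rp g) (%x. cnj (p x)) = 0" using assms[OF c] assms[OF pol_cmult[OF c, of \<i>]] unfolding L2_inner_mk[OF rp_L2 pol_L2[OF c]] by (simp add: mk_rp cm_mk pol_L2[OF c] complex_eq_iff)
  thus ?thesis by (simp add: L2_inner_def)
 qed
 hence "AE x in MB. rp g x = 0" by (intro orth_pol_zero rp_L2)
 hence "mk (rp g) = mk (%_. 0)" by (simp add: mk_eq_iff rp_L2 L2_zero)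
 thus ?thesis by (simp add: mk_rp mk_zero)
qed

text \<open>Every polynomial is some \<open>lap (s2 p)\<close> plus a harmonic polynomial, and
  \<open>h\<close> is orthogonal to the former by \<open>H_s2\<close>. Orthogonality to harmonic
  polynomials thus extends to all polynomials.\<close>

lemma harmonic_dense:
 assumes h: "h \<in> KR.H" and z: "!!m y. y \<in> HP m ==> inner h y = 0" shows "(h :: 'a::euclidean_space l2) = 0"
proof (rule l2_dense_pol)
 fix m and f :: "'a cf" assume "pol m f"
 hence f: "pol (m + 2) f" by (rule pol_mono) simp
 obtain p where p: "pol m p" "mk f - mk (lap (s2 p)) \<in> HP (m + 2)" using harmonic_basis[of m, where 'a='a] f unfolding HP_def[symmetric] by metis
 have "inner h (mk f) = inner h (mk f - mk (lap (s2 p)))" by (simp add: inner_diff_right H_s2[OF h p(1)])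
 thus "inner h (mk f) = 0" using z[OF p(2)] by simp
qed

lemma subspace_HP: "subspace (HP m :: 'a::euclidean_space l2 set)"
proof (rule subspaceI)
 have "mk (%_::'a. 0) \<in> HP m" unfolding HP_def using pol_const[of m 0] by (force simp: lap_def[abs_def] pd_const)
 thus "0 \<in> (HP m :: 'a l2 set)" by (simp add: mk_zero)
next
 fix x y :: "'a l2" and r assume "x \<in> HP m"
 then obtain f where f: "x = mk f" "pol m f" "lap f = (%_. 0)" by (auto simp: HP_def)
 have "lap (%x. cor r * f x) = (%_. 0)" using lap_bl[OF pol_smooth[OF f(2)] bounded_linear_mult_right] f(3) by simp
 thus "r *\<^sub>R x \<in> HP m" unfolding HP_def f(1) mk_scaleR[OF pol_L2[OF f(2)], symmetric] using pol_cmult[OF f(2)] by blast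
 assume "y \<in> HP m"
 then obtain g where g: "y = mk g" "pol m g" "lap g = (%_. 0)" by (auto simp: HP_def)
 have "lap (%x. f x + g x) = (%_. 0)" using lap_add[OF pol_smooth[OF f(2)] pol_smooth[OF g(2)]] f(3) g(3) by simp
 thus "x + y \<in> HP m" unfolding HP_def f(1) g(1) mk_add[OF pol_L2[OF f(2)] pol_L2[OF g(2)], symmetric] using pol_add[OF f(2) g(2)] by blast
qed

lemma harmonic_approx:
 fixes h :: "'a::euclidean_space l2"
 assumes h: "h \<in> KR.H" and e: "ep > 0" shows "EX n. EX y:HP n. norm (y - h) < ep"
proof -
 define W where "W = (\<Union>n. HP n :: 'a l2 set)"
 have "subspace W"
 proof (rule subspaceI)
  show "0 \<in> W" using subspace_0[OF subspace_HP] by (auto simp: W_def)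
  fix x y :: "'a l2" and r assume "x \<in> W"
  then obtain n where n: "x \<in> HP n" by (auto simp: W_def)
  show "r *\<^sub>R x \<in> W" using subspace_scale[OF subspace_HP n] by (auto simp: W_def)
  assume "y \<in> W"
  then obtain k where k: "y \<in> HP k" by (auto simp: W_def)
  have "x \<in> HP (max n k)" "y \<in> HP (max n k)" using n k HP_mono[of n "max n k"] HP_mono[of k "max n k"] by auto
  from subspace_add[OF subspace_HP this] show "x + y \<in> W" by (auto simp: W_def)
 qed
 hence Z: "subspace (closure W)" "closed (closure W)" by (auto intro: subspace_closure)
 have ZH: "closure W \<subseteq> KR.H" by (rule closure_minimal[OF _ KR.H_closed]) (use HP_H in \<open>auto simp: W_def\<close>)
 define z where "z = h - proj (closure W) h"
 have "z = 0"
 proof (rule harmonic_dense)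
  show "z \<in> KR.H" unfolding z_def using ZH proj_in[OF Z] by (intro subspace_diff[OF KR.H_sub] h) auto
  show "inner z y = 0" if "y \<in> HP m" for m y unfolding z_def by (rule proj_orth[OF Z]) (use that closure_subset[of W] in \<open>auto simp: W_def\<close>)
 qed
 hence "h \<in> closure W" using proj_in[OF Z, of h] by (simp add: z_def)
 thus ?thesis using e by (force simp: closure_approachable W_def dist_norm)
qed

lemma nb_upper_H:
 fixes h :: "'a::euclidean_space l2"
 assumes h: "h \<in> KR.H" and d: "0 < de" "de < 1"
  and Y: "finite Y" "ALL x:Y. norm x = 1" "pairwise orthogonal Y" "span Y = HP m"
  and o: "!!y. y \<in> Y ==> inner h y = 0"
 shows "nb de h <= de ^ (2 * m + DIM('a)) * (norm h)^2"
proof -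
 have "ALL i::nat. EX y. (EX n. y \<in> HP n) & norm (y - h) < inverse (real (Suc i))" using harmonic_approx[OF h] by (metis inverse_Suc)
 from choice[OF this] obtain q where q: "!!i. EX n. q i \<in> HP n" "!!i::nat. norm (q i - h) < inverse (real (Suc i))" by blast
 have "\<forall>\<^sub>F i in sequentially. norm (q i - h) <= inverse (real (Suc i))" using q(2) by (simp add: less_imp_le)
 from Lim_null_comparison[OF this LIMSEQ_inverse_real_of_nat] have lim: "q ----> h" by (rule LIM_zero_cancel)
 \<comment> \<open>Removing the components along \<open>Y\<close> gives the approximants the
   orthogonality that \<open>nb_upper\<close> demands; they still tend to \<open>h\<close>, which is
   orthogonal to \<open>Y\<close>.\<close>
 define p where "p i = q i - (\<Sum>y\<in>Y. inner (q i) y *\<^sub>R y)" for i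
 have "p ----> h - (\<Sum>y\<in>Y. inner h y *\<^sub>R y)" unfolding p_def by (intro tendsto_intros lim)
 hence plim: "p ----> h" using o by simp
 have le: "nb de (p i) <= de ^ (2 * m + DIM('a)) * (norm (p i))^2" for i
 proof -
  obtain n where n: "q i \<in> HP n" using q(1) by blast
  have qn: "q i \<in> HP (max n m)" using n HP_mono[of n "max n m"] by auto
  have "(\<Sum>y\<in>Y. inner (q i) y *\<^sub>R y) \<in> HP m" unfolding Y(4)[symmetric] by (intro span_sum span_scale span_base)
  hence "(\<Sum>y\<in>Y. inner (q i) y *\<^sub>R y) \<in> HP (max n m)" using HP_mono[of m "max n m"] by auto
  hence pn: "p i \<in> HP (max n m)" unfolding p_def by (intro subspace_diff subspace_HP qn)
  have pY: "inner (p i) y = 0" if y: "y \<in> Y" for y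
  proof -
   have "(\<Sum>y'\<in>Y. inner (q i) y' * inner y' y) = (\<Sum>y'\<in>Y. if y' = y then inner (q i) y else 0)"
    by (rule sum.cong[OF refl]) (use Y(2,3) y in \<open>auto simp: pairwise_def orthogonal_def norm_eq_1\<close>)
   thus ?thesis using y Y(1) by (simp add: p_def inner_diff_left inner_sum_left)
  qed
  have "inner (p i) y = 0" if "y \<in> HP m" for y using that unfolding Y(4)[symmetric] by (induction rule: span_induct_alt) (auto simp: inner_add_right pY)
  from nb_upper[OF pn d this] show ?thesis .
 qed
 have nbl: "(%i. nb de (p i)) ----> nb de h" unfolding nb_def by (intro tendsto_intros plim bounded_linear.tendsto[OF mo_bl[OF bm_ind]])
 show ?thesis by (rule LIMSEQ_le[OF nbl tendsto_mult_left[OF tendsto_power[OF tendsto_norm[OF plim]]]]) (use le in auto)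
qed

section \<open>The potential on the ball as a perturbation of the Krein Laplacian\<close>

locale ball_potential =
 fixes V :: "'a::euclidean_space => real" and c M :: real
 assumes bmV: "bm V M" and M: "M > 0" and c: "0 < c" "c < 1"
  and V_out: "!!x. x \<in> ball 0 1 ==> x \<notin> ball 0 c ==> V x = 0"
  and V_in: "!!de. 0 < de ==> de < c ==> EX v>0. ALL x:ball 0 de. v <= V x"
begin

lemma form_le_nb: "inner (mo V u) u <= M * nb c u" unfolding nb_def by (rule mo_mono[OF bmV bm_ind]) (use bmV V_out in \<open>auto simp: bm_def indicator_def\<close>)

lemma form_ge_nb:
 assumes "0 < de" "de < c" shows "EX v>0. ALL u. v * nb de u <= inner (mo V u) u"
proof -
 obtain v where v: "v > 0" "ALL x:ball 0 de. v <= V x" using V_in[OF assms] by blast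
 have "nb de u <= (1 / v) * inner (mo V u) u" for u unfolding nb_def by (rule mo_mono[OF bm_ind bmV]) (use bmV v in \<open>auto simp: bm_def indicator_def field_simps\<close>)
 thus ?thesis using v(1) by (intro exI[of _ v]) (simp add: field_simps)
qed

lemma form_upper:
 fixes h :: "'a l2"
 assumes "h \<in> KR.H" "finite Y" "ALL x:Y. norm x = 1" "pairwise orthogonal Y" "span Y = HP m" "!!y. y \<in> Y ==> inner h y = 0"
 shows "inner (mo V h) h <= M * c ^ (2 * m + DIM('a)) * (norm h)^2" using order_trans[OF form_le_nb mult_left_mono[OF nb_upper_H[OF assms(1) c assms(2-6)]]] M by (simp add: mult.assoc)

text \<open>On harmonic vectors orthogonal to \<open>HP m\<close> the form is at most
  \<open>M * c ^ (2 * m + DIM('a))\<close> times the squared norm, which is small for large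
  \<open>m\<close> as \<open>c < 1\<close>. The components along a basis of \<open>HP m\<close> are
  the finitely many functionals; their weight \<open>sqrt (2 * M)\<close> covers twice the form on
  the span.\<close>

lemma V_ehrling:
 assumes e: "ep > 0"
 shows "EX Ph. finite Ph & (ALL fi:Ph. bounded_linear (fi :: 'a l2 => real)) &
    (ALL h:KR.H. inner (mo V h) h <= ep * (norm h)^2 + (\<Sum>fi\<in>Ph. (fi h)^2))"
proof -
 interpret V: bounded_linear "mo V" by (rule mo_bl[OF bmV])
 obtain n where n: "c ^ n < ep / (2 * M)" using real_arch_pow_inv[of "ep / (2 * M)" c] e M c by auto
 define m where "m = n + 2"
 have cm: "2 * (M * c ^ (2 * m + DIM('a))) <= ep"
 proof -
  have "c ^ (2 * m + DIM('a)) <= c ^ n" by (rule power_decreasing) (use c in \<open>auto simp: m_def\<close>)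
  hence "c ^ (2 * m + DIM('a)) <= ep / (2 * M)" using n by simp
  thus ?thesis using M by (simp add: field_simps)
 qed
 obtain Y :: "'a l2 set" where Y: "finite Y" "ALL x:Y. norm x = 1" "pairwise orthogonal Y" "span Y = HP m" using harmonic_basis[of n, where 'a='a] unfolding HP_def m_def by blast
 have YH: "y \<in> KR.H" if "y \<in> Y" for y using span_base[OF that] Y(4) HP_H by auto
 obtain Ph where Ph: "finite Ph" "ALL fi:Ph. bounded_linear (fi :: 'a l2 => real)"
  "!!w. (\<Sum>y\<in>Y. (inner w (sqrt (2 * M) *\<^sub>R y))^2) <= (\<Sum>fi\<in>Ph. (fi w)^2)" using functionals_of_family[OF Y(1), of "%y. sqrt (2 * M) *\<^sub>R y"] by blast
 have "inner (mo V h) h <= ep * (norm h)^2 + (\<Sum>fi\<in>Ph. (fi h)^2)" if h: "h \<in> KR.H" for h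
 proof -
  define y where "y = (\<Sum>e\<in>Y. inner h e *\<^sub>R e)"
  define z where "z = h - y"
  have yH: "y \<in> KR.H" unfolding y_def by (intro subspace_sum[OF KR.H_sub] subspace_scale[OF KR.H_sub] YH)
  have zH: "z \<in> KR.H" unfolding z_def by (rule subspace_diff[OF KR.H_sub h yH])
  have zo: "inner z e = 0" if e: "e \<in> Y" for e
  proof -
   have "(\<Sum>e'\<in>Y. inner h e' * inner e' e) = (\<Sum>e'\<in>Y. if e' = e then inner h e else 0)" by (rule sum.cong[OF refl]) (use Y(2,3) e in \<open>auto simp: pairwise_def orthogonal_def norm_eq_1\<close>)
   thus ?thesis using e Y(1) by (simp add: z_def y_def inner_diff_left inner_sum_left)
  qed
  have zy: "inner z y = 0" unfolding y_def by (simp add: inner_sum_right zo)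
  have hz: "h = z + y" by (simp add: z_def)
  have "(norm h)^2 = (norm z)^2 + (norm y)^2" unfolding hz power2_norm_eq_inner using zy by (simp add: inner_add_left inner_add_right inner_commute)
  hence zn: "(norm z)^2 <= (norm h)^2" by simp
  have yn: "(norm y)^2 = (\<Sum>e\<in>Y. (inner h e)^2)"
  proof -
   have "(norm y)^2 = (\<Sum>e\<in>Y. (norm (inner h e *\<^sub>R e))^2)" unfolding y_def by (rule norm_sum_Pythagorean[OF Y(1)]) (use Y(3) in \<open>auto simp: pairwise_def orthogonal_def\<close>)
   thus ?thesis using Y(2) by simp
  qed
  have "0 <= inner (mo V (z - y)) (z - y)" by (rule mo_nonneg[OF bmV])
  hence "inner (mo V h) h <= 2 * inner (mo V z) z + 2 * inner (mo V y) y" by (simp add: hz V.add V.diff inner_add_left inner_add_right inner_diff_left inner_diff_right)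
  also have "... <= 2 * (M * c ^ (2 * m + DIM('a)) * (norm z)^2) + 2 * (M * (norm y)^2)" using form_upper[OF zH Y zo] mo_le[OF bmV, of y] by simp
  also have "2 * (M * c ^ (2 * m + DIM('a)) * (norm z)^2) <= ep * (norm h)^2" using mult_mono[OF cm zn] e by (simp add: mult.assoc)
  also have "2 * (M * (norm y)^2) = (\<Sum>y\<in>Y. (inner h (sqrt (2 * M) *\<^sub>R y))^2)" unfolding yn sum_distrib_left by (rule sum.cong[OF refl]) (use M in \<open>simp add: power_mult_distrib\<close>)
  also have "... <= (\<Sum>fi\<in>Ph. (fi h)^2)" by (rule Ph(3))
  finally show ?thesis by simp
 qed
 thus ?thesis using Ph(1,2) by blast
qed

sublocale krein_perturbation KS 4 "mo V" M
proof (intro krein_perturbation.intro KS_graph krein_perturbation_axioms.intro)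
 show "bounded_linear (mo V)" by (rule mo_bl[OF bmV])
 show "inner (mo V u) v = inner u (mo V v)" for u v by (rule mo_sym[OF bmV])
 show "0 <= inner (mo V u) u" for u by (rule mo_nonneg[OF bmV])
 show "M > 0" by (rule M)
 show "(norm (mo V u))^2 <= M * inner (mo V u) u" for u by (rule mo_norm[OF bmV])
qed (rule V_ehrling)

lemma form_lower:
 assumes "0 < de" "de < c"
 shows "EX v>0. ALL m. ALL h:HP m. v * de ^ (2 * m + DIM('a)) * (norm h)^2 <= inner (mo V h) h"
proof -
 obtain v where v: "v > 0" "ALL u. v * nb de u <= inner (mo V u) u" using form_ge_nb[OF assms] by blast
 have "v * de ^ (2 * m + DIM('a)) * (norm h)^2 <= inner (mo V h) h" if "h \<in> HP m" for m h
 proof -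
  have "v * (de ^ (2 * m + DIM('a)) * (norm h)^2) <= v * nb de h" by (rule mult_left_mono[OF nb_lower[OF that assms(1)]]) (use assms c v in auto)
  thus ?thesis using v(2)[rule_format, of h] by (simp add: mult.assoc)
 qed
 thus ?thesis using v(1) by blast
qed

end

subsection \<open>Spectral resolutions of graphs with an eigenbasis\<close>

lemma summable_count_space:
 fixes f :: "'i => real"
 shows "f summable_on B \<longleftrightarrow> integrable (count_space B) f" by (rule trans[OF summable_on_iff_abs_summable_on_real trans[OF abs_summable_equivalent Infinite_Set_Sum.abs_summable_on_def]])

lemma has_sum_count_space:
 fixes f :: "'i => real"
 assumes "(f has_sum s) B" shows "integrable (count_space B) f" "(LINT e|count_space B. f e) = s"
proof -
 have "f summable_on B" using assms by (auto simp: summable_on_def)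
 thus i: "integrable (count_space B) f" by (simp add: summable_count_space)
 hence "infsetsum f B = infsum f B" by (intro infsetsum_infsum) (simp add: Infinite_Set_Sum.abs_summable_on_def)
 thus "(LINT e|count_space B. f e) = s" using infsumI[OF assms] by (simp add: infsetsum_def)
qed

lemma nn_integral_count_space_finite:
 fixes f :: "'i => real"
 assumes "!!e. f e >= 0"
 shows "(\<integral>\<^sup>+e. ennreal (f e) \<partial>count_space B) < \<infinity> \<longleftrightarrow> f summable_on B" unfolding summable_count_space using assms by (simp add: integrable_iff_bounded)

lemma has_sum_ennreal:
 fixes f :: "'i => real"
 assumes "(f has_sum s) B" "!!i. f i >= 0" shows "((%i. ennreal (f i)) has_sum ennreal s) B"
proof -
 have "((%F. ennreal (sum f F)) \<longlongrightarrow> ennreal s) (finite_subsets_at_top B)" using assms(1) by (intro tendsto_ennrealI) (simp add: has_sum_def)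
 moreover have "ennreal (sum f F) = (\<Sum>i\<in>F. ennreal (f i))" for F using assms(2) by (simp add: sum_ennreal)
 ultimately show ?thesis by (simp add: has_sum_def)
qed

lemma has_sum_finite_sum:
 fixes f :: "'j => 'i => real"
 assumes "finite G" "!!b. b \<in> G ==> (f b has_sum s b) B" shows "((%i. \<Sum>b\<in>G. f b i) has_sum (\<Sum>b\<in>G. s b)) B" using assms
proof (induction G)
 case empty show ?case by (simp add: has_sum_0)
qed (simp add: has_sum_add)

lemma L2_orthonormal_basis_exists: "EX Bc :: ('a::euclidean_space cf) set. L2_orthonormal_basis MB Bc"
proof -
 define D where "D = {u::'a cf. u \<in> L2 MB & L2_inner MB u u = 1}"
 have s: "L2_inner MB u v = 0 ==> L2_inner MB v u = 0" for u v :: "'a cf" using L2_inner_cnj[of MB v u] by simp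
 obtain Bc where Bc: "Bc \<subseteq> D" "ALL x:Bc. ALL y:Bc. x ~= y --> L2_inner MB x y = 0"
  "ALL x:D. (ALL y:Bc. L2_inner MB x y = 0) --> x \<in> Bc"
 proof -
  have "EX B. B \<subseteq> D & (ALL x:B. ALL y:B. x ~= y --> L2_inner MB x y = 0) & (ALL x:D. (ALL y:B. L2_inner MB x y = 0) --> x \<in> B)" by (rule maximal_pairwise) (rule s)
  thus thesis using that by blast
 qed
 have "AE x in MB. u x = 0" if u: "u \<in> L2 MB" and o: "ALL e:Bc. L2_inner MB u e = 0" for u
 proof (rule ccontr)
  assume n: "~ (AE x in MB. u x = 0)"
  define r where "r = L2_norm MB u"
  have iu: "L2_inner MB u u = cor (r^2)" by (simp add: r_def L2_norm_sq) (simp add: L2_inner_self)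
  have "r ~= 0" using L2_AE_zero[OF u] n iu by auto
  define v where "v x = cor (1 / r) * u x" for x
  have "L2_inner MB v v = 1" unfolding v_def[abs_def] L2_inner_cmult_left L2_inner_cmult_right iu using \<open>r ~= 0\<close> by (simp add: power2_eq_square)
  hence "v \<in> D" unfolding D_def v_def[abs_def] using L2_cmult[OF u] by blast
  moreover have vo: "ALL e:Bc. L2_inner MB v e = 0" unfolding v_def[abs_def] L2_inner_cmult_left using o by simp
  ultimately have "v \<in> Bc" using Bc(3) by blast
  thus False using vo \<open>L2_inner MB v v = 1\<close> by auto
 qed
 hence "L2_orthonormal_basis MB Bc" unfolding L2_orthonormal_basis_def using Bc(1,2) by (auto simp: D_def)
 thus ?thesis by blast
qed

text \<open>\<open>B\<close> is orthonormal for the real inner product; \<open>A_J\<close> carries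
  the complex structure of the graph, by which the real eigenspaces are complex subspaces.\<close>

locale diag_graph =
 fixes A :: "('a::euclidean_space l2 \<times> 'a l2) set" and B :: "'a l2 set" and ev :: "'a l2 => real"
 assumes B: "onb B" and eig: "!!e. e \<in> B ==> (e, ev e *\<^sub>R e) \<in> A"
  and sym: "!!u g u' g'. (u, g) \<in> A ==> (u', g') \<in> A ==> inner g u' = inner u g'"
  and dom: "!!u. (EX g. (u, g) \<in> A) \<longleftrightarrow> (%e. (ev e)^2 * (inner u e)^2) summable_on B"
  and A_J: "!!u g. (u, g) \<in> A ==> (J u, J g) \<in> A"
  and A_add: "!!u g u' g'. (u, g) \<in> A ==> (u', g') \<in> A ==> (u + u', g + g') \<in> A"
begin

lemma B_eqI: "(!!e. e \<in> B ==> inner x e = inner y e) ==> x = y" using onbD(2)[OF B, of "x - y"] by (simp add: inner_diff_left)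

lemma ES_ex: "EX y. ALL e:B. inner y e = (if ev e \<in> S then inner x e else 0)"
proof (rule riesz_fischer_onb[OF B])
 have "(%e. (inner x e)^2) summable_on B" using parseval_norm[OF B, of x] by (auto simp: summable_on_def)
 hence "(%e. (inner x e)^2) summable_on {e \<in> B. ev e \<in> S}" by (rule summable_on_subset_banach) auto
 moreover have "(%e. (if ev e \<in> S then inner x e else 0)^2) summable_on B
   \<longleftrightarrow> (%e. (inner x e)^2) summable_on {e \<in> B. ev e \<in> S}" by (rule summable_on_cong_neutral) auto
 ultimately show "(%e. (if ev e \<in> S then inner x e else 0)^2) summable_on B" by simp
qed

text \<open>The spectral projection of the set \<open>S\<close>, given by its coefficients in the
  eigenbasis.\<close>

definition "ES S x = (SOME y. ALL e:B. inner y e = (if ev e \<in> S then inner x e else 0))"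

lemma ES_coeff: "e \<in> B ==> inner (ES S x) e = (if ev e \<in> S then inner x e else 0)" using someI_ex[OF ES_ex, of S x] unfolding ES_def by blast

lemma ES_add: "ES S (x + y) = ES S x + ES S y" by (rule B_eqI) (simp add: ES_coeff inner_add_left)

lemma ES_scaleR: "ES S (r *\<^sub>R x) = r *\<^sub>R ES S x" by (rule B_eqI) (simp add: ES_coeff)

lemma ES_idem: "ES S (ES S x) = ES S x" by (rule B_eqI) (simp add: ES_coeff)

lemma ES_UNIV: "ES UNIV x = x" by (rule B_eqI) (simp add: ES_coeff)

lemma ES_has_sum: "((%e. if ev e \<in> S then inner x e * inner y e else 0) has_sum inner (ES S x) y) B" using parseval_inner[OF B, of "ES S x" y] by (rule has_sum_cong[THEN iffD1, rotated]) (simp add: ES_coeff)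

lemma ES_sym: "inner (ES S x) y = inner x (ES S y)" using has_sum_unique[OF ES_has_sum[of S x y] ES_has_sum[of S y x, THEN has_sum_cong[THEN iffD1, rotated]]] by (simp add: mult.commute inner_commute)

lemma inner_J_eigen: assumes "e \<in> B" "f \<in> B" "ev e ~= ev f" shows "inner (J e) f = 0"
proof -
 have "inner (J (ev e *\<^sub>R e)) f = inner (J e) (ev f *\<^sub>R f)" by (rule sym[OF A_J[OF eig[OF assms(1)]] eig[OF assms(2)]])
 thus ?thesis using assms(3) by (simp add: cm_scaleR)
qed

text \<open>\<open>J\<close> preserves eigenvalues, so \<open>J e\<close> has coefficients only
  along eigenvectors with the eigenvalue of \<open>e\<close> (\<open>inner_J_eigen\<close>). This
  makes the real-linear projections complex linear.\<close>

lemma ES_J: "ES S (J x) = J (ES S x)"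
proof (rule B_eqI)
 fix e assume e: "e \<in> B"
 have 1: "((%f. inner (ES S x) f * inner (J e) f) has_sum inner (ES S x) (J e)) B" by (rule parseval_inner[OF B])
 have "inner (ES S x) (J e) = (if ev e \<in> S then inner x (J e) else 0)"
 proof (cases "ev e \<in> S")
  case True
  have z: "inner (J e) f = 0" if "f \<in> B" "ev f \<notin> S" for f by (rule inner_J_eigen[OF e that(1)]) (use True that(2) in auto)
  have "((%f. inner (ES S x) f * inner (J e) f) has_sum inner x (J e)) B" by (rule has_sum_cong[THEN iffD1, OF _ parseval_inner[OF B]]) (auto simp: ES_coeff z)
  from has_sum_unique[OF 1 this] show ?thesis using True by simp
 next
  case False
  have "((%f. inner (ES S x) f * inner (J e) f) has_sum 0) B"
  proof (rule has_sum_0)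
   fix f assume f: "f \<in> B"
   show "inner (ES S x) f * inner (J e) f = 0" using False inner_J_eigen[OF e f] f by (cases "ev e = ev f") (simp_all add: ES_coeff)
  qed
  from has_sum_unique[OF 1 this] show ?thesis using False by simp
 qed
 thus "inner (ES S (J x)) e = inner (J (ES S x)) e" using e by (simp add: ES_coeff inner_J)
qed

lemma ES_cm: "ES S (cm z x) = cm z (ES S x)"
proof -
 have "ES S (Re z *\<^sub>R x + Im z *\<^sub>R J x) = Re z *\<^sub>R ES S x + Im z *\<^sub>R J (ES S x)" by (simp add: ES_add ES_scaleR ES_J)
 thus ?thesis by (simp only: cm_eq[symmetric])
qed

lemma ES_tail:
 fixes D :: "nat => real set"
 assumes "disjoint_family D"
 shows "ES (\<Union>k. D k) x - (\<Sum>k<n. ES (D k) x) = ES (\<Union>k\<in>{n..}. D k) x"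
proof (rule B_eqI)
 fix e assume e: "e \<in> B"
 have "(\<Sum>k<n. if ev e \<in> D k then inner x e else 0) = (if ev e \<in> (\<Union>k. D k) & ev e \<notin> (\<Union>k\<in>{n..}. D k) then inner x e else 0)"
 proof (cases "ev e \<in> (\<Union>k. D k)")
  case True
  then obtain j where j: "ev e \<in> D j" by blast
  have uj: "ev e \<in> D k \<longleftrightarrow> k = j" for k using j assms by (auto simp: disjoint_family_on_def)
  have "(\<Sum>k<n. if ev e \<in> D k then inner x e else 0) = (if j < n then inner x e else 0)" unfolding uj by simp
  thus ?thesis using j by (auto simp: uj)
 next
  case False
  hence "ev e \<notin> D k" for k by blast
  thus ?thesis by simp
 qed
 thus "inner (ES (\<Union>k. D k) x - (\<Sum>k<n. ES (D k) x)) e = inner (ES (\<Union>k\<in>{n..}. D k) x) e" using e by (auto simp: inner_diff_left inner_sum_left ES_coeff)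
qed

lemma ES_form: "inner (ES S x) x = (norm (ES S x))^2"
proof -
 have "inner (ES S (ES S x)) x = inner (ES S x) (ES S x)" by (rule ES_sym)
 thus ?thesis by (simp add: ES_idem power2_norm_eq_inner)
qed

text \<open>The scalar spectral measure of \<open>x\<close>. As an image measure it turns integrals
  over the spectrum into sums over the eigenbasis.\<close>

definition "nu x = distr (density (count_space B) (%e. ennreal ((inner x e)^2))) borel ev"

lemma ev_meas: "ev \<in> measurable (count_space B) borel" "ev \<in> measurable (density (count_space B) w) borel" by simp_all

lemma sets_nu: "sets (nu x) = sets borel" "space (nu x) = UNIV" by (simp_all add: nu_def)

lemma emeasure_nu: assumes "S \<in> sets borel" shows "emeasure (nu x) S = ennreal (inner (ES S x) x)"
proof -
 let ?f = "%e. if ev e \<in> S then inner x e * inner x e else 0"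
 have "emeasure (nu x) S = (\<integral>\<^sup>+e. ennreal ((inner x e)^2) * indicator (ev -` S \<inter> B) e \<partial>count_space B)"
  unfolding nu_def by (subst emeasure_distr[OF ev_meas(2) assms], subst emeasure_density) simp_all
 also have "... = (\<integral>\<^sup>+e. ennreal (?f e) \<partial>count_space B)" by (rule nn_integral_cong) (auto simp: indicator_def power2_eq_square)
 also have "... = ennreal (LINT e|count_space B. ?f e)" by (rule nn_integral_eq_integral[OF has_sum_count_space(1)[OF ES_has_sum]]) auto
 finally show ?thesis by (simp add: has_sum_count_space(2)[OF ES_has_sum])
qed

lemma nn_integral_nu: "(\<integral>\<^sup>+t. ennreal (t^2) \<partial>nu x) < \<infinity> \<longleftrightarrow> (EX g. (x, g) \<in> A)"
proof -
 have "(\<integral>\<^sup>+t. ennreal (t^2) \<partial>nu x) = (\<integral>\<^sup>+e. ennreal ((inner x e)^2) * ennreal ((ev e)^2) \<partial>count_space B)"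
  unfolding nu_def by (subst nn_integral_distr[OF ev_meas(2)], simp, subst nn_integral_density) simp_all
 also have "... = (\<integral>\<^sup>+e. ennreal ((ev e)^2 * (inner x e)^2) \<partial>count_space B)" by (simp add: ennreal_mult[symmetric] mult.commute)
 finally show ?thesis unfolding dom using nn_integral_count_space_finite[of "%e. (ev e)^2 * (inner x e)^2" B] by simp
qed

lemma form_nu: assumes "(x, g) \<in> A" shows "(LINT t|nu x. t) = inner g x"
proof -
 have "(LINT t|nu x. t) = (LINT e|count_space B. (inner x e)^2 * ev e)" unfolding nu_def by (subst integral_distr[OF ev_meas(2)], simp, subst integral_density) simp_all
 also have "... = inner g x"
 proof (rule has_sum_count_space(2))
  have "inner g e = ev e * inner x e" if "e \<in> B" for e using sym[OF assms eig[OF that]] by simp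
  hence eq: "inner g e * inner x e = (inner x e)^2 * ev e" if "e \<in> B" for e using that by (simp add: power2_eq_square)
  show "((%e. (inner x e)^2 * ev e) has_sum inner g x) B" by (rule has_sum_cong[THEN iffD1, OF eq parseval_inner[OF B]])
 qed
 finally show ?thesis .
qed

definition "TG = {(u, f). u \<in> L2 MB & f \<in> L2 MB & (mk u, mk f) \<in> A}"

lemma Domain_TG: "Domain TG = {u \<in> L2 MB. EX g. (mk u, g) \<in> A}"
proof -
 have "EX f. f \<in> L2 MB & (mk u, mk f) \<in> A" if "(mk u, g) \<in> A" for u g by (rule exI[of _ "rp g"]) (simp add: rp_L2 mk_rp that)
 thus ?thesis by (auto simp: TG_def Domain_iff)
qed

lemma form_imag: assumes "(x, g) \<in> A" shows "inner g (J x) = 0"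
proof -
 have "inner g (J x) = inner x (J g)" by (rule sym[OF assms A_J[OF assms]])
 thus ?thesis using inner_J[of x g] by (simp add: inner_commute)
qed

text \<open>Strong countable additivity follows from continuity from above of the finite measure
  \<open>nu\<close> along the tails \<open>Dn\<close>, since its value on a set is the squared norm
  of the projected vector.\<close>

lemma spectral_resolution_exists: "EX E. spectral_resolution MB TG E"
proof -
 define E where "E S u = rp (ES S (mk u))" for S u
 have EL: "E S u \<in> L2 MB" for S u by (simp add: E_def rp_L2)
 have mkE: "mk (E S u) = ES S (mk u)" for S u by (simp add: E_def mk_rp)
 have tail: "(%n. L2_norm MB (%x. E (\<Union>k. D k) u x - (\<Sum>k<n. E (D k) u x))) ----> 0"
  if D: "range D \<subseteq> sets borel" "disjoint_family D" for D :: "nat => real set" and u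
 proof -
  define Dn where "Dn n = (\<Union>k\<in>{n..}. D k)" for n
  have Dn: "Dn n \<in> sets borel" for n unfolding Dn_def using D(1) by (intro sets.countable_UN') auto
  have dec: "decseq Dn" unfolding decseq_def Dn_def by (intro allI impI UN_mono) auto
  have nrm: "L2_norm MB (%x. E (\<Union>k. D k) u x - (\<Sum>k<n. E (D k) u x)) = norm (ES (Dn n) (mk u))" for n
  proof -
   have "(%x. \<Sum>k<n. E (D k) u x) \<in> L2 MB" "mk (%x. \<Sum>k<n. E (D k) u x) = (\<Sum>k<n. ES (D k) (mk u))" using mk_sum[of "{..<n}" "%k. E (D k) u"] by (simp_all add: EL mkE)
   thus ?thesis using ES_tail[OF D(2), of "mk u" n] by (simp add: norm_mk[symmetric] L2_diff EL mk_diff mkE Dn_def)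
  qed
  have "(\<Inter>n. Dn n) = {}"
  proof -
   have "EX n. x \<notin> Dn n" for x
   proof (cases "EX j. x \<in> D j")
    case True
    then obtain j where j: "x \<in> D j" by blast
    have "x \<notin> D k" if "k >= Suc j" for k using disjoint_family_onD[OF D(2), of j k] j that by auto
    hence "x \<notin> Dn (Suc j)" by (auto simp: Dn_def)
    thus ?thesis by blast
   qed (auto simp: Dn_def)
   thus ?thesis by blast
  qed
  moreover have "(%n. emeasure (nu (mk u)) (Dn n)) ----> emeasure (nu (mk u)) (\<Inter>n. Dn n)" by (rule Lim_emeasure_decseq) (use Dn dec in \<open>auto simp: sets_nu emeasure_nu\<close>)
  ultimately have "(%n. ennreal ((norm (ES (Dn n) (mk u)))^2)) ----> ennreal 0" by (simp add: emeasure_nu Dn ES_form)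
  hence "(%n. (norm (ES (Dn n) (mk u)))^2) ----> 0" by (subst (asm) tendsto_ennreal_iff) auto
  from tendsto_real_sqrt[OF this] show ?thesis unfolding nrm by simp
 qed
 have L2i: "L2_inner MB (E S u) v = Complex (inner (ES S (mk u)) (mk v)) (inner (ES S (mk u)) (J (mk v)))" if "v \<in> L2 MB" for S u v by (simp add: L2_inner_mk EL mkE that)
 have pvm: "projection_valued_measure MB E" unfolding projection_valued_measure_def
 proof (intro conjI ballI allI impI)
  fix S :: "real set"
  show "orth_projection MB (E S)" unfolding orth_projection_def
  proof (intro conjI ballI allI)
   fix u v :: "'a cf" and a b assume u: "u \<in> L2 MB" and v: "v \<in> L2 MB"
   have "mk (E S (%y. a * u y + b * v y)) = mk (%x. a * E S u x + b * E S v x)" using u v EL by (simp add: mkE mk_add L2_cmult cm_mk[symmetric] ES_add ES_cm)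
   thus "AE x in MB. E S (%y. a * u y + b * v y) x = a * E S u x + b * E S v x" by (subst (asm) mk_eq_iff) (auto intro!: EL L2_add L2_cmult)
   have "L2_inner MB u (E S v) = Complex (inner (mk u) (ES S (mk v))) (inner (mk u) (J (ES S (mk v))))" by (simp add: L2_inner_mk EL mkE u)
   thus "L2_inner MB (E S u) v = L2_inner MB u (E S v)" unfolding L2i[OF v] by (simp add: ES_sym ES_J)
  next
   fix u :: "'a cf" assume u: "u \<in> L2 MB"
   have "mk (E S (E S u)) = mk (E S u)" by (simp add: mkE ES_idem)
   thus "AE x in MB. E S (E S u) x = E S u x" by (simp add: mk_eq_iff EL)
  qed (rule EL)
 next
  fix u :: "'a cf" assume u: "u \<in> L2 MB"
  have "mk (E UNIV u) = mk u" by (simp add: mkE ES_UNIV)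
  thus "AE x in MB. E UNIV u x = u x" by (simp add: mk_eq_iff EL u)
 qed (rule tail)
 have ssm: "scalar_spectral_measure MB E u = nu (mk u)" if u: "u \<in> L2 MB" for u
 proof -
  have "scalar_spectral_measure MB E u = measure_of (space (nu (mk u))) (sets (nu (mk u))) (emeasure (nu (mk u)))" unfolding scalar_spectral_measure_def sets_nu
  proof (rule measure_of_eq)
   show "sets borel \<subseteq> Pow (UNIV :: real set)" by simp
   fix S assume "S \<in> sigma_sets UNIV (sets borel :: real set set)"
   hence "S \<in> sets borel" by (metis sets.sigma_sets_eq space_borel)
   thus "ennreal (Re (L2_inner MB (E S u) u)) = emeasure (nu (mk u)) S" by (simp add: emeasure_nu L2i u)
  qed
  thus ?thesis by (simp only: measure_of_of_measure)
 qed
 have "spectral_resolution MB TG E" unfolding spectral_resolution_def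
 proof (intro conjI pvm)
  show "Domain TG = {u \<in> L2 MB. (\<integral>\<^sup>+ t. ennreal (t^2) \<partial>scalar_spectral_measure MB E u) < \<infinity>}" unfolding Domain_TG using ssm nn_integral_nu by (metis (no_types, lifting))
  show "ALL (u, f):TG. L2_inner MB f u = cor (LINT t|scalar_spectral_measure MB E u. t)"
  proof clarify
   fix u f assume "(u, f) \<in> TG"
   hence uf: "u \<in> L2 MB" "f \<in> L2 MB" "(mk u, mk f) \<in> A" by (auto simp: TG_def)
   show "L2_inner MB f u = cor (LINT t|scalar_spectral_measure MB E u. t)" using form_nu[OF uf(3)] form_imag[OF uf(3)] by (simp add: ssm uf L2_inner_mk complex_eq_iff)
  qed
 qed
 thus ?thesis by blast
qed

text \<open>It suffices to know the projections on eigenvectors. \<open>F\<close> is the given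
  resolution on classes; it is additive and multiplicative in the set, and \<open>key\<close> shows
  that \<open>F U\<close> kills an eigenvector whose eigenvalue lies strictly to one side of
  \<open>U\<close>. So the choice made by \<open>SOME\<close> does not matter.\<close>

lemma spectral_resolution_unique:
 assumes E: "spectral_resolution MB TG E" and S: "S \<in> sets borel" and u: "u \<in> L2 MB"
 shows "mk (E S u) = ES S (mk u)"
proof -
 have op: "orth_projection MB (E S)" if "S \<in> sets borel" for S using E that by (simp add: spectral_resolution_def projection_valued_measure_def)
 define F where "F S x = mk (E S (rp x))" for S x
 have EL: "E S u \<in> L2 MB" if "S \<in> sets borel" "u \<in> L2 MB" for S u using op[OF that(1)] that(2) by (simp add: orth_projection_def)
 have Ei: "L2_inner MB (E S u) v = L2_inner MB u (E S v)" if "S \<in> sets borel" "u \<in> L2 MB" "v \<in> L2 MB" for S u v using op[OF that(1)] that(2,3) by (simp add: orth_projection_def)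
 have E_sym: "inner (mk (E S u)) (mk v) = inner (mk u) (mk (E S v))" if "S \<in> sets borel" "u \<in> L2 MB" "v \<in> L2 MB" for S u v using Ei[OF that] by (simp add: inner_mk EL that)
 have mkE: "mk (E S u) = F S (mk u)" if S: "S \<in> sets borel" and u: "u \<in> L2 MB" for S u
 proof -
  have "inner (mk (E S u)) (mk v) = inner (F S (mk u)) (mk v)" if v: "v \<in> L2 MB" for v using E_sym[OF S u v] E_sym[OF S rp_L2 v, of "mk u"] by (simp add: F_def mk_rp)
  from this[OF rp_L2] have "inner (mk (E S u)) w = inner (F S (mk u)) w" for w by (simp add: mk_rp)
  thus ?thesis by (intro B_eqI)
 qed
 have F_sym: "inner (F S x) y = inner x (F S y)" if "S \<in> sets borel" for S x y using E_sym[OF that rp_L2 rp_L2, of x y] by (simp add: F_def mk_rp)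
 have F_add: "F S (x + y) = F S x + F S y" if "S \<in> sets borel" for S x y by (rule B_eqI) (simp add: F_sym that inner_add_left)
 have F_idem: "F S (F S x) = F S x" if "S \<in> sets borel" for S x
 proof -
  have "AE z in MB. E S (E S (rp x)) z = E S (rp x) z" using op[OF that] rp_L2[of x] unfolding orth_projection_def by blast
  hence "mk (E S (E S (rp x))) = mk (E S (rp x))" by (simp add: mk_eq_iff EL that rp_L2)
  thus ?thesis by (simp add: mkE that EL rp_L2 mk_rp)
 qed
 have F_UNIV: "F UNIV x = x" for x
 proof -
  have "AE z in MB. E UNIV (rp x) z = rp x z" using E rp_L2[of x] unfolding spectral_resolution_def projection_valued_measure_def by blast
  hence "mk (E UNIV (rp x)) = mk (rp x)" by (simp add: mk_eq_iff EL rp_L2)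
  thus ?thesis by (simp add: F_def mk_rp)
 qed
 have F_sums: "(%k. F (D k) x) sums F (\<Union>k. D k) x" if D: "range D \<subseteq> sets borel" "disjoint_family D" for D :: "nat => real set" and x
 proof -
  have Dk: "D k \<in> sets borel" "(\<Union>k. D k) \<in> sets borel" for k using D(1) by auto
  have "(%n. L2_norm MB (%z. E (\<Union>k. D k) (rp x) z - (\<Sum>k<n. E (D k) (rp x) z))) ----> 0" using E D rp_L2[of x] unfolding spectral_resolution_def projection_valued_measure_def by blast
  moreover have "L2_norm MB (%z. E (\<Union>k. D k) (rp x) z - (\<Sum>k<n. E (D k) (rp x) z)) = norm (F (\<Union>k. D k) x - (\<Sum>k<n. F (D k) x))" for n
  proof -
   have L: "(%z. \<Sum>k<n. E (D k) (rp x) z) \<in> L2 MB" "mk (%z. \<Sum>k<n. E (D k) (rp x) z) = (\<Sum>k<n. F (D k) x)" using mk_sum[of "{..<n}" "%k. E (D k) (rp x)"] by (simp_all add: EL rp_L2 Dk F_def)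
   show ?thesis unfolding norm_mk[OF L2_diff[OF EL[OF Dk(2) rp_L2] L(1)], symmetric] by (simp add: mk_diff[OF EL[OF Dk(2) rp_L2] L(1)] L(2) F_def)
  qed
  ultimately have "(%n. norm (F (\<Union>k. D k) x - (\<Sum>k<n. F (D k) x))) ----> 0" by simp
  hence "(%n. F (\<Union>k. D k) x - (\<Sum>k<n. F (D k) x)) ----> 0" by (rule tendsto_norm_zero_cancel)
  from tendsto_diff[OF tendsto_const this, of "F (\<Union>k. D k) x"] show ?thesis by (simp add: sums_def)
 qed
 have F_empty: "F {} x = 0" for x
 proof -
  have "(%k::nat. F {} x) sums F {} x" using F_sums[of "%_. {}" x] by (simp add: disjoint_family_on_def)
  from summable_LIMSEQ_zero[OF sums_summable[OF this]] show ?thesis by (simp add: LIMSEQ_const_iff)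
 qed
 have F_Un: "F (S \<union> S') x = F S x + F S' x" if "S \<in> sets borel" "S' \<in> sets borel" "S \<inter> S' = {}" for S S' x
 proof -
  define D where "D k = (if k = 0 then S else if k = 1 then S' else {})" for k :: nat
  have "(\<Union>k. D k) = S \<union> S'"
  proof
   have "D 0 = S" "D 1 = S'" by (simp_all add: D_def)
   thus "S \<union> S' \<subseteq> (\<Union>k. D k)" by blast
  qed (auto simp: D_def split: if_splits)
  moreover have "disjoint_family D" using that(3) by (auto simp: disjoint_family_on_def D_def)
  ultimately have s: "(%k. F (D k) x) sums F (S \<union> S') x" using F_sums[of D x] that by (auto simp: D_def)
  have "(%k. F (D k) x) sums (\<Sum>k\<in>{0, 1}. F (D k) x)" by (rule sums_finite) (auto simp: D_def F_empty)
  from sums_unique2[OF s this] show ?thesis by (simp add: D_def)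
 qed
 have F_form: "inner (F S x) x = (norm (F S x))^2" if "S \<in> sets borel" for S x
 proof -
  have "inner (F S x) x = inner (F S (F S x)) x" by (simp add: F_idem that)
  also have "... = (norm (F S x))^2" by (simp add: F_sym[OF that, of "F S x" x] power2_norm_eq_inner)
  finally show ?thesis .
 qed
 have F_pyth: "(norm (F (S \<union> S') x))^2 = (norm (F S x))^2 + (norm (F S' x))^2"
  if "S \<in> sets borel" "S' \<in> sets borel" "S \<inter> S' = {}" for S S' x using F_form[of "S \<union> S'" x] F_form[OF that(1), of x] F_form[OF that(2), of x] that by (simp add: F_Un inner_add_left)
 have F_compl: "(norm x)^2 = (norm (F S x))^2 + (norm (F (- S) x))^2" "x = F S x + F (- S) x" if "S \<in> sets borel" for S x using F_pyth[of S "- S" x] F_Un[of S "- S" x] that F_UNIV by simp_all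
 have F_orth: "F S' (F S x) = 0" if "S \<in> sets borel" "S' \<in> sets borel" "S \<inter> S' = {}" for S S' x
 proof -
  have "(norm (F S' (F S x)))^2 + (norm (F S (F S x)))^2 <= (norm (F S x))^2" using F_pyth[of S' S "F S x"] F_compl(1)[of "S' \<union> S" "F S x"] that by (auto simp: Int_commute)
  thus ?thesis by (simp add: F_idem that)
 qed
 have F_Int: "F S (F U x) = F (S \<inter> U) x" if "S \<in> sets borel" "U \<in> sets borel" for S U x
 proof -
  have "F S (F U x) = F (S \<inter> U) (F U x) + F (S - U) (F U x)" using F_Un[of "S \<inter> U" "S - U" "F U x"] that by (simp add: Int_Diff_Un Int_Diff_disjoint)
  also have "F (S - U) (F U x) = 0" using F_orth[of U "S - U"] that by auto
  finally have 1: "F S (F U x) = F (S \<inter> U) (F U x)" by simp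
  have "F (S \<inter> U) x = F (S \<inter> U) (F U x) + F (S \<inter> U) (F (- U) x)" using F_add[of "S \<inter> U" "F U x" "F (- U) x"] F_compl(2)[of U x] that by simp
  also have "F (S \<inter> U) (F (- U) x) = 0" using F_orth[of "- U" "S \<inter> U"] that by auto
  finally show ?thesis using 1 by simp
 qed
 define mu where "mu x = scalar_spectral_measure MB E (rp x)" for x
 have smu: "sets (mu x) = sets borel" "space (mu x) = UNIV" for x unfolding mu_def scalar_spectral_measure_def by (simp_all add: sets.sigma_sets_eq[of borel, simplified])
 have emu: "emeasure (mu x) S = ennreal (inner (F S x) x)" if S: "S \<in> sets borel" for x S
 proof -
  have eq: "Re (L2_inner MB (E S (rp x)) (rp x)) = inner (F S x) x" if "S \<in> sets borel" for S by (simp add: L2_inner_mk EL that rp_L2 F_def mk_rp)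
  show ?thesis unfolding eq[OF S, symmetric]
  proof (rule emeasure_measure_of[OF mu_def[unfolded scalar_spectral_measure_def]])
   show "positive (sets (mu x)) (%A. ennreal (Re (L2_inner MB (E A (rp x)) (rp x))))" by (simp add: positive_def smu eq F_empty)
   show "countably_additive (sets (mu x)) (%A. ennreal (Re (L2_inner MB (E A (rp x)) (rp x))))" unfolding countably_additive_def smu
   proof (intro allI impI)
    fix D :: "nat => real set" assume D: "range D \<subseteq> sets borel" "disjoint_family D" "(\<Union>k. D k) \<in> sets borel"
    have Dk: "D k \<in> sets borel" for k using D(1) by auto
    have "(%k. inner (F (D k) x) x) sums inner (F (\<Union>k. D k) x) x" by (rule bounded_linear.sums[OF bounded_linear_inner_left F_sums[OF D(1,2)]])
    hence "(%k. ennreal (inner (F (D k) x) x)) sums ennreal (inner (F (\<Union>k. D k) x) x)" by (subst sums_ennreal) (auto simp: F_form Dk D(3))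
    thus "(\<Sum>k. ennreal (Re (L2_inner MB (E (D k) (rp x)) (rp x)))) = ennreal (Re (L2_inner MB (E (\<Union>k. D k) (rp x)) (rp x)))" unfolding eq[OF Dk] eq[OF D(3)] by (rule sums_unique[symmetric])
   qed
  qed (auto simp: smu S)
 qed
 have dommu: "(EX g. (x, g) \<in> A) \<longleftrightarrow> (\<integral>\<^sup>+t. ennreal (t^2) \<partial>mu x) < \<infinity>" for x
 proof -
  have "rp x \<in> Domain TG \<longleftrightarrow> (\<integral>\<^sup>+t. ennreal (t^2) \<partial>mu x) < \<infinity>" using E rp_L2[of x] unfolding spectral_resolution_def mu_def by blast
  thus ?thesis by (simp add: Domain_TG rp_L2 mk_rp)
 qed
 have formmu: "inner g x = (LINT t|mu x. t)" if "(x, g) \<in> A" for x g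
 proof -
  have "(rp x, rp g) \<in> TG" using that by (simp add: TG_def rp_L2 mk_rp)
  hence "L2_inner MB (rp g) (rp x) = cor (LINT t|mu x. t)" using E unfolding spectral_resolution_def mu_def by blast
  thus ?thesis by (simp add: L2_inner_mk rp_L2 mk_rp complex_eq_iff)
 qed
 \<comment> \<open>A resolution gives the domain and the quadratic form of the graph, so
   \<open>F U x\<close> is first shown to be in the domain. Symmetry then makes the integral of
   \<open>k * (s - t)\<close> over \<open>U\<close> vanish; the integrand is positive there, so
   \<open>U\<close> is null for \<open>mu x\<close>.\<close>
 have key: "F U x = 0"
  if xA: "(x, t *\<^sub>R x) \<in> A" and U: "U \<in> sets borel" and k: "!!s. s \<in> U ==> k * (s - t) > 0" for x t U and k :: real
 proof -
  have mud: "mu (F U' x) = density (mu x) (indicator U')" if U': "U' \<in> sets borel" for U'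
  proof (rule measure_eqI)
   fix S assume "S \<in> sets (mu (F U' x))"
   hence S: "S \<in> sets borel" by (simp add: smu)
   have "inner (F S (F U' x)) (F U' x) = inner (F U' (F S (F U' x))) x" by (simp add: F_sym U')
   also have "... = inner (F (U' \<inter> S \<inter> U') x) x" by (simp add: F_Int S U' sets.Int Int_ac)
   also have "U' \<inter> S \<inter> U' = U' \<inter> S" by blast
   finally show "emeasure (mu (F U' x)) S = emeasure (density (mu x) (indicator U')) S" by (simp add: emu[OF S] emu[OF sets.Int[OF U' S]] S U' smu emeasure_restricted)
  qed (simp add: smu)
  have m2: "(%t. ennreal (t^2)) \<in> borel_measurable (mu x)" by (simp add: measurable_cong_sets[OF smu(1) refl])
  have fin2: "(\<integral>\<^sup>+t. ennreal (t^2) \<partial>mu x) < \<infinity>" using dommu xA by blast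
  have ind: "(indicator U' :: real => real) \<in> borel_measurable (mu x)" "(indicator U' :: real => ennreal) \<in> borel_measurable (mu x)"
   if "U' \<in> sets borel" for U' using that by (simp_all add: borel_measurable_indicator smu)
  have yA: "EX g. (F U' x, g) \<in> A" if U': "U' \<in> sets borel" for U'
  proof -
   have "(\<integral>\<^sup>+t. ennreal (t^2) \<partial>mu (F U' x)) = (\<integral>\<^sup>+t. indicator U' t * ennreal (t^2) \<partial>mu x)" unfolding mud[OF U'] by (rule nn_integral_density[OF ind(2)[OF U'] m2])
   also have "... <= (\<integral>\<^sup>+t. ennreal (t^2) \<partial>mu x)" by (rule nn_integral_mono) (auto simp: indicator_def)
   finally show ?thesis using fin2 dommu by auto
  qed
  interpret finite_measure "mu x" by (rule finite_measureI) (simp add: smu emu)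
  have m1: "(%s. s) \<in> borel_measurable (mu x)" by (simp add: measurable_cong_sets[OF smu(1) refl])
  have int1: "integrable (mu x) (%s. s)"
  proof (rule Bochner_Integration.integrable_bound)
   have "integrable (mu x) (%s. s^2)" using fin2 m1 by (intro integrableI_bounded) auto
   thus "integrable (mu x) (%s. 1 + s^2)" by simp
   have "\<bar>s\<bar> <= 1 + s^2" for s :: real
   proof -
    have "0 <= (\<bar>s\<bar> - 1)^2" by simp
    hence "2 * \<bar>s\<bar> <= 1 + s^2" by (simp add: power2_diff)
    thus ?thesis by linarith
   qed
   thus "AE s in mu x. norm s <= norm (1 + s^2)" by auto
  qed (rule m1)
  have form_ind: "inner g (F U' x) = (LINT s|mu x. indicator U' s * s)" "integrable (mu x) (%s. indicator U' s * s)"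
   if "(F U' x, g) \<in> A" "U' \<in> sets borel" for U' g
  proof -
   have "inner g (F U' x) = (LINT s|density (mu x) (%s. ennreal (indicator U' s)). s)" using formmu[OF that(1)] unfolding mud[OF that(2)] by (simp add: ennreal_indicator)
   thus "inner g (F U' x) = (LINT s|mu x. indicator U' s * s)" using ind(1)[OF that(2)] m1 by (simp add: integral_density)
   show "integrable (mu x) (%s. indicator U' s * s)" using integrable_mult_indicator[OF _ int1, of U'] that(2) by (simp add: smu)
  qed
  have U2: "- U \<in> sets borel" using U by simp
  obtain g where g: "(F U x, g) \<in> A" using yA[OF U] by blast
  obtain g' where g': "(F (- U) x, g') \<in> A" using yA[OF U2] by blast
  have xs: "F U x + F (- U) x = x" using F_compl(2)[OF U, of x] by simp
  \<comment> \<open>The form at \<open>x\<close> splits into the integrals over \<open>U\<close> and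
    its complement, so the two cross terms sum to 0; by symmetry they are equal, hence both
    vanish.\<close>
  have "(x, g + g') \<in> A" using A_add[OF g g'] by (simp add: xs)
  from formmu[OF this] have "inner (g + g') x = (LINT s|mu x. indicator U s * s + indicator (- U) s * s)" by (simp add: indicator_compl algebra_simps)
  also have "... = inner g (F U x) + inner g' (F (- U) x)" using form_ind[OF g U] form_ind[OF g' U2] by simp
  finally have "inner (g + g') (F U x + F (- U) x) = inner g (F U x) + inner g' (F (- U) x)" by (simp add: xs)
  moreover have "inner g (F (- U) x) = inner g' (F U x)" using sym[OF g g'] by (simp add: inner_commute)
  ultimately have "inner g (F (- U) x) = 0" by (simp add: inner_add_left inner_add_right)
  hence gx: "inner g (F U x) = inner g x" using arg_cong[OF xs, of "inner g"] by (simp add: inner_add_right)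
  have "inner g x = t * inner (F U x) x" using sym[OF g xA] by simp
  hence e1: "(LINT s|mu x. indicator U s * s) = t * inner (F U x) x" using gx form_ind(1)[OF g U] by simp
  have indI: "integrable (mu x) (indicator U :: real => real)" using U by (simp add: smu emu)
  have "(LINT s|mu x. indicator U s) = inner (F U x) x" using U by (simp add: measure_def emu smu F_form)
  hence "(LINT s|mu x. k * (indicator U s * s - t * indicator U s)) = 0" using e1 form_ind(2)[OF g U] indI by simp
  hence z0: "(LINT s|mu x. indicator U s * (k * (s - t))) = 0" by (simp add: algebra_simps)
  have zi: "integrable (mu x) (%s. indicator U s * (k * (s - t)))"
  proof -
   have "integrable (mu x) (%s. k * (indicator U s * s - t * indicator U s))" using form_ind(2)[OF g U] indI by simp
   thus ?thesis by (simp add: algebra_simps)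
  qed
  have "AE s in mu x. indicator U s * (k * (s - t)) = 0" using z0 by (subst (asm) integral_nonneg_eq_0_iff_AE[OF zi]) (use k in \<open>auto simp: indicator_def less_imp_le\<close>)
  hence "AE s in mu x. s \<notin> U" by eventually_elim (use k in \<open>force simp: indicator_def\<close>)
  hence "emeasure (mu x) U = 0" by (subst (asm) AE_iff_measurable[of U]) (auto simp: smu U)
  thus "F U x = 0" by (simp add: emu U F_form)
 qed
 have zeroF: "F S e = 0" if e: "e \<in> B" and S: "S \<in> sets borel" and n: "ev e \<notin> S" for e S
 proof -
  have 1: "F (S \<inter> {..<ev e}) e = 0" by (rule key[OF eig[OF e], where k="-1"]) (use S in auto)
  have 2: "F (S \<inter> {ev e<..}) e = 0" by (rule key[OF eig[OF e], where k=1]) (use S in auto)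
  have "x < ev e | ev e < x" if "x \<in> S" for x using n that by (cases x "ev e" rule: linorder_cases) auto
  hence "S = (S \<inter> {..<ev e}) \<union> (S \<inter> {ev e<..})" by auto
  hence "F S e = F ((S \<inter> {..<ev e}) \<union> (S \<inter> {ev e<..})) e" by simp
  also have "... = 0" by (subst F_Un) (use S 1 2 in auto)
  finally show ?thesis .
 qed
 have Fe: "F S e = (if ev e \<in> S then e else 0)" if e: "e \<in> B" and S: "S \<in> sets borel" for e S using zeroF[OF e S] zeroF[OF e, of "- S"] F_compl(2)[OF S, of e] S by auto
 have "F S (mk u) = ES S (mk u)" by (rule B_eqI) (simp add: F_sym S Fe ES_coeff)
 thus ?thesis using mkE[OF S u] by simp
qed

text \<open>A complex orthonormal basis and its image under \<open>J\<close> form a real one, and a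
  basis vector and its image contribute equally (\<open>qJ\<close>). The real trace, which is the
  number of eigenvectors, is therefore twice the complex one.\<close>

lemma trace_spectral_projection:
 assumes I: "I \<in> sets borel" and fin: "finite {e \<in> B. ev e \<in> I}"
 shows "L2_trace MB (spectral_projection MB TG I) = ennreal (real (card {e \<in> B. ev e \<in> I}) / 2)"
proof -
 define G where "G = {e \<in> B. ev e \<in> I}"
 define Bc :: "('a cf) set" where "Bc = (SOME B. L2_orthonormal_basis MB B)"
 have Bc: "L2_orthonormal_basis MB Bc" unfolding Bc_def by (rule someI_ex[OF L2_orthonormal_basis_exists])
 define E where "E = (SOME E. spectral_resolution MB TG E)"
 have E: "spectral_resolution MB TG E" unfolding E_def by (rule someI_ex[OF spectral_resolution_exists])
 have BL: "e \<in> L2 MB" if "e \<in> Bc" for e using Bc that by (auto simp: L2_orthonormal_basis_def)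
 have EL: "E I u \<in> L2 MB" if "u \<in> L2 MB" for u using E I that by (simp add: spectral_resolution_def projection_valued_measure_def orth_projection_def)
 have Be: "inner (mk e) (mk f) = (if e = f then 1 else 0)" "inner (mk e) (J (mk f)) = 0" if "e \<in> Bc" "f \<in> Bc" for e f
 proof -
  have "L2_inner MB e f = (if e = f then 1 else 0)" using Bc that by (simp add: L2_orthonormal_basis_def)
  thus "inner (mk e) (mk f) = (if e = f then 1 else 0)" "inner (mk e) (J (mk f)) = 0" unfolding L2_inner_mk[OF BL[OF that(1)] BL[OF that(2)]] by (auto simp: complex_eq_iff split: if_splits)
 qed
 define w where "w i = (if snd i then J (mk (fst i)) else mk (fst i))" for i :: "('a cf) \<times> bool"
 let ?I = "Bc \<times> (UNIV :: bool set)"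
 have wi: "inner (w i) (w j) = (if i = j then 1 else 0)" if "i \<in> ?I" "j \<in> ?I" for i j using that Be[of "fst i" "fst j"] by (cases i; cases j) (auto simp: w_def inner_J J_J)
 have w_inj: "inj_on w ?I"
 proof (rule inj_onI, rule ccontr)
  fix i j assume "i \<in> ?I" "j \<in> ?I" "w i = w j" "i ~= j"
  thus False using wi[of i j] wi[of j j] by simp
 qed
 have wz: "u = 0" if z: "!!i. i \<in> ?I ==> inner u (w i) = 0" for u
 proof -
  have "L2_inner MB (rp u) e = 0" if "e \<in> Bc" for e using z[of "(e, False)"] z[of "(e, True)"] that by (simp add: L2_inner_mk rp_L2 BL mk_rp w_def complex_eq_iff)
  hence "AE x in MB. rp u x = 0" using Bc rp_L2[of u] by (simp add: L2_orthonormal_basis_def)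
  hence "mk (rp u) = mk (%_. 0)" by (simp add: mk_eq_iff rp_L2 L2_zero)
  thus ?thesis by (simp add: mk_rp mk_zero)
 qed
 have RB: "onb (w ` ?I)" unfolding onb_def using wi inj_on_eq_iff[OF w_inj] wz by auto
 have q: "inner (ES I x) x = (\<Sum>b\<in>G. (inner b x)^2)" for x
 proof (rule has_sum_unique[OF ES_has_sum])
  have "((%b. (inner b x)^2) has_sum (\<Sum>b\<in>G. (inner b x)^2)) G" using fin by (simp add: G_def has_sum_finite)
  moreover have "((%b. (inner b x)^2) has_sum s) G \<longleftrightarrow> ((%e. if ev e \<in> I then inner x e * inner x e else 0) has_sum s) B" for s
   by (rule has_sum_cong_neutral) (auto simp: G_def power2_eq_square inner_commute)
  ultimately show "((%e. if ev e \<in> I then inner x e * inner x e else 0) has_sum (\<Sum>b\<in>G. (inner b x)^2)) B" by blast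
 qed
 have qJ: "inner (ES I (J x)) (J x) = inner (ES I x) x" for x by (simp add: ES_form) (simp add: ES_J norm_J)
 have hb: "((%e. (inner b (mk e))^2 + (inner b (J (mk e)))^2) has_sum 1) Bc" if "b \<in> G" for b
 proof -
  have "((%r. (inner b r)^2) has_sum (norm b)^2) (w ` ?I)" by (rule parseval_norm[OF RB])
  hence h: "((%i. (inner b (w i))^2) has_sum (norm b)^2) ?I" by (simp add: has_sum_reindex[OF w_inj] comp_def)
  have "((%e. \<Sum>t\<in>UNIV. (inner b (w (e, t)))^2) has_sum (norm b)^2) Bc" by (rule has_sum_SigmaD[OF h]) (simp add: has_sum_finite)
  moreover have "(norm b)^2 = 1" using onbD(1)[OF B, of b b] that by (simp add: G_def power2_norm_eq_inner)
  moreover have "(\<Sum>t\<in>UNIV. (inner b (w (e, t)))^2) = (inner b (mk e))^2 + (inner b (J (mk e)))^2" for e by (simp add: UNIV_bool w_def)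
  ultimately show ?thesis by simp
 qed
 have "((%e. \<Sum>b\<in>G. (inner b (mk e))^2 + (inner b (J (mk e)))^2) has_sum (\<Sum>b\<in>G. 1)) Bc" by (rule has_sum_finite_sum) (use fin hb in \<open>auto simp: G_def\<close>)
 moreover have "(\<Sum>b\<in>G. (inner b (mk e))^2 + (inner b (J (mk e)))^2) = 2 * inner (ES I (mk e)) (mk e)" for e using q[of "mk e"] q[of "J (mk e)"] qJ[of "mk e"] by (simp add: sum.distrib)
 ultimately have "((%e. 2 * inner (ES I (mk e)) (mk e)) has_sum real (card G)) Bc" by simp
 from has_sum_cmult_right[OF this, of "1 / 2"]
 have "((%e. inner (ES I (mk e)) (mk e)) has_sum (real (card G) / 2)) Bc" by simp
 from has_sum_ennreal[OF this]
 have hs: "((%e. ennreal (inner (ES I (mk e)) (mk e))) has_sum ennreal (real (card G) / 2)) Bc" by (simp add: ES_form)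
 have "L2_trace MB (spectral_projection MB TG I) = (\<Sum>\<^sub>\<infinity>e\<in>Bc. ennreal (Re (L2_inner MB (E I e) e)))" by (simp add: L2_trace_def spectral_projection_def Bc_def E_def)
 also have "... = (\<Sum>\<^sub>\<infinity>e\<in>Bc. ennreal (inner (ES I (mk e)) (mk e)))" by (rule infsum_cong) (simp add: L2_inner_mk EL BL spectral_resolution_unique[OF E I])
 also have "... = ennreal (real (card G) / 2)" by (rule infsumI[OF hs])
 finally show ?thesis by (simp add: G_def)
qed

end

subsection \<open>Asymptotics of the counting functions\<close>

text \<open>Pascal's rule twice; the summands are written as \<open>(p + n) choose n\<close> to
  match the known growth \<open>n ^ p / fact p\<close>.\<close>

lemma Nd_diff: "Nd (Suc p) (m + 2) = Nd (Suc p) m + ((p + (m + 2)) choose (m + 2)) + ((p + (m + 1)) choose (m + 1))"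
proof -
 have "Nd (Suc p) (m + 2) = ((m + p + 2) choose p) + ((m + p + 1) choose p) + ((m + p + 1) choose Suc p)" by (simp add: Nd_def)
 moreover have "(m + p + 2) choose p = (p + (m + 2)) choose (m + 2)" "(m + p + 1) choose p = (p + (m + 1)) choose (m + 1)" by (simp_all add: binomial_symmetric[of p] add.commute add.left_commute del: binomial_Suc_Suc)
 ultimately show ?thesis by (simp add: Nd_def del: binomial_Suc_Suc)
qed

text \<open>For \<open>d = DIM('a)\<close> the real dimension of the space of harmonic polynomials
  of degree at most \<open>m + 2\<close>.\<close>

definition Dm :: "nat => nat => nat" where "Dm d m = 2 * (Nd d (m + 2) - Nd d m)"

text \<open>Both binomial coefficients in \<open>Nd_diff\<close> grow like
  \<open>m ^ p / fact p\<close>, since a shift of \<open>m\<close> does not affect the leading term,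
  and the real dimension doubles their sum.\<close>

lemma Dm_limit: "(%m. real (Dm (Suc p) m) / real m ^ p) ----> 4 / fact p"
proof -
 define ch where "ch n = real ((p + n) choose n)" for n
 have ch: "(%n. ch n / real n ^ p) ----> 1 / fact p" using fact_binomial_limit[where 'a=real, of p] unfolding ch_def by simp
 have sh: "(%m. ch (m + k) / real m ^ p) ----> 1 / fact p" for k
 proof -
  have "(%m. ch (m + k) / real (m + k) ^ p * (1 + real k / real m) ^ p) ----> 1 / fact p * (1 + 0) ^ p" by (intro tendsto_intros LIMSEQ_ignore_initial_segment[OF ch] lim_const_over_n)
  moreover have "\<forall>\<^sub>F m in sequentially. ch (m + k) / real (m + k) ^ p * (1 + real k / real m) ^ p = ch (m + k) / real m ^ p" using eventually_gt_at_top[of 0]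
  proof eventually_elim
   case (elim m)
   hence "1 + real k / real m = real (m + k) / real m" by (simp add: field_simps)
   thus ?case using elim by (simp add: power_divide)
  qed
  ultimately show ?thesis by (simp add: tendsto_cong)
 qed
 have "(%m. 2 * (ch (m + 2) / real m ^ p) + 2 * (ch (m + 1) / real m ^ p)) ----> 2 * (1 / fact p) + 2 * (1 / fact p)" by (intro tendsto_intros sh)
 moreover have "2 * (ch (m + 2) / real m ^ p) + 2 * (ch (m + 1) / real m ^ p) = real (Dm (Suc p) m) / real m ^ p" for m
 proof -
  have "Dm (Suc p) m = 2 * ((p + (m + 2)) choose (m + 2)) + 2 * ((p + (m + 1)) choose (m + 1))" unfolding Dm_def Nd_diff by simp
  hence "real (Dm (Suc p) m) = 2 * ch (m + 2) + 2 * ch (m + 1)" by (simp only: ch_def of_nat_add of_nat_mult of_nat_numeral)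
  thus ?thesis by (simp only: add_divide_distrib times_divide_eq_right)
 qed
 ultimately show ?thesis by simp
qed

text \<open>The bounded error \<open>M\<close> disappears against \<open>x ^ p\<close> because
  \<open>p > 0\<close>, which is dimension at least 2.\<close>

lemma scaled_limit:
 fixes D :: "nat => nat" and m :: "real => nat"
 assumes D: "(%m. real (D m) / real m ^ p) ----> kp" and p: "p > 0" and r: "r > 0"
  and m: "((%x. real (m x) / x) \<longlongrightarrow> 1 / r) at_top"
 shows "((%x. (real (D (m x)) + M) / x ^ p) \<longlongrightarrow> kp / r ^ p) at_top"
proof -
 have inf: "filterlim (%x. real (m x)) at_top at_top"
 proof -
  have "filterlim (%x. real (m x) / x * x) at_top at_top" by (rule filterlim_tendsto_pos_mult_at_top[OF m _ filterlim_ident]) (use r in simp)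
  moreover have "\<forall>\<^sub>F x in at_top. real (m x) / x * x = real (m x)" using eventually_gt_at_top[of "0::real"] by eventually_elim simp
  ultimately show ?thesis by (rule filterlim_mono_eventually[OF _ order_refl order_refl])
 qed
 have minf: "filterlim m at_top at_top" unfolding filterlim_at_top
 proof
  fix Z :: nat
  have "\<forall>\<^sub>F x in at_top. real Z <= real (m x)" using inf unfolding filterlim_at_top by blast
  thus "\<forall>\<^sub>F x in at_top. Z <= m x" by simp
 qed
 have "((%x. real (D (m x)) / real (m x) ^ p * (real (m x) / x) ^ p + M * inverse x ^ p) \<longlongrightarrow> kp * (1 / r) ^ p + M * 0 ^ p) at_top"
  by (intro tendsto_intros filterlim_compose[OF D minf] m tendsto_inverse_0_at_top filterlim_ident)
 moreover have "\<forall>\<^sub>F x in at_top. real (D (m x)) / real (m x) ^ p * (real (m x) / x) ^ p + M * inverse x ^ p = (real (D (m x)) + M) / x ^ p"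
  using filterlim_at_top_dense[THEN iffD1, rule_format, OF inf, of 0]
  by eventually_elim (simp add: power_divide add_divide_distrib power_inverse divide_inverse[of M])
 ultimately have "((%x. (real (D (m x)) + M) / x ^ p) \<longlongrightarrow> kp * (1 / r) ^ p + M * 0 ^ p) at_top" by (rule Lim_transform_eventually)
 thus ?thesis by (simp add: power_divide zero_power[OF p])
qed

lemma affine_limit:
 fixes r b :: real
 assumes r: "r > 0" and m: "\<forall>\<^sub>F x in at_top. (x + b) / r - k <= real (m x) & real (m x) <= (x + b) / r + k"
 shows "((%x. real (m x) / x) \<longlongrightarrow> 1 / r) at_top"
proof -
 have L: "((%x. ((x + b) / r + k) / x) \<longlongrightarrow> 1 / r) at_top" for k
 proof -
  have "((%x. 1 / r + (b / r + k) * inverse x) \<longlongrightarrow> 1 / r + (b / r + k) * 0) at_top" by (intro tendsto_intros tendsto_inverse_0_at_top filterlim_ident)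
  moreover have "\<forall>\<^sub>F x in at_top. 1 / r + (b / r + k) * inverse x = ((x + b) / r + k) / x" using eventually_gt_at_top[of "0::real"] by eventually_elim (use r in \<open>simp add: field_simps\<close>)
  ultimately show ?thesis by (simp add: tendsto_cong)
 qed
 show ?thesis
 proof (rule tendsto_sandwich[OF _ _ L[of "- k"] L[of k]])
  show "\<forall>\<^sub>F x in at_top. ((x + b) / r + - k) / x <= real (m x) / x" "\<forall>\<^sub>F x in at_top. real (m x) / x <= ((x + b) / r + k) / x"
   using m eventually_gt_at_top[of "0::real"] by (eventually_elim, simp add: divide_right_mono)+
 qed
qed

lemma at_right_0_exp: "filterlim (%l::real. - ln l) at_top (at_right 0)" using ln_at_0 by (simp add: filterlim_uminus_at_top)

lemma counting_upper:
 fixes n :: "real => nat" and D :: "nat => nat"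
 assumes D: "(%m. real (D m) / real m ^ p) ----> kp" and p: "p > 0" and c: "0 < c" "c < 1" and C: "C > 0"
  and up: "\<forall>\<^sub>F l in at_right 0. ALL m. C * c ^ (2 * m) <= l --> n l <= D m + M"
  and a: "kp / (2 * \<bar>ln c\<bar>) ^ p < a"
 shows "\<forall>\<^sub>F l in at_right 0. real (n l) / \<bar>ln l\<bar> ^ p < a"
proof -
 define r where "r = 2 * \<bar>ln c\<bar>"
 have r: "r > 0" using c by (simp add: r_def)
 \<comment> \<open>With \<open>x = - ln l\<close>, the condition \<open>C * c ^ (2 * m) <= l\<close>
   says \<open>m >= (x + ln C) / r\<close>; this is the least such natural number.\<close>
 define m where "m x = nat \<lceil>(x + ln C) / r\<rceil>" for x
 have "\<forall>\<^sub>F x in at_top. (x + ln C) / r - 1 <= real (m x) & real (m x) <= (x + ln C) / r + 1" using eventually_gt_at_top[of "- ln C"]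
 proof eventually_elim
  case (elim x)
  hence "0 <= (x + ln C) / r" using r by simp
  thus ?case unfolding m_def by linarith
 qed
 from order_tendstoD(2)[OF scaled_limit[OF D p r affine_limit[OF r this], of "real M"], of a]
 have "\<forall>\<^sub>F x in at_top. (real (D (m x)) + real M) / x ^ p < a" using a by (simp add: r_def)
 from eventually_compose_filterlim[OF this at_right_0_exp]
 have "\<forall>\<^sub>F l in at_right 0. (real (D (m (- ln l))) + real M) / (- ln l) ^ p < a" .
 moreover have "\<forall>\<^sub>F l in at_right 0. (0::real) < l & l < 1" by (simp add: eventually_at_right_field) (auto intro: exI[of _ 1])
 ultimately show ?thesis using up
 proof eventually_elim
  case (elim l)
  have ln: "ln l < 0" using elim by simp
  have "(- ln l + ln C) / r <= real (m (- ln l))" unfolding m_def by linarith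
  hence "- ln l + ln C <= real (m (- ln l)) * r" using r by (simp add: pos_divide_le_eq)
  hence "ln (C * c ^ (2 * m (- ln l))) <= ln l" using c C by (simp add: ln_mult ln_realpow r_def algebra_simps)
  hence "C * c ^ (2 * m (- ln l)) <= l" using elim c C by simp
  hence "real (n l) <= real (D (m (- ln l))) + real M" using elim(3) by (metis of_nat_add of_nat_le_iff)
  hence "real (n l) / (- ln l) ^ p <= (real (D (m (- ln l))) + real M) / (- ln l) ^ p" using ln by (intro divide_right_mono) auto
  thus ?case using elim ln by simp
 qed
qed

text \<open>The constants \<open>v\<close> and \<open>M\<close> depend on \<open>de\<close>, so
  \<open>de\<close> is fixed first, so close to \<open>c\<close> that the limit constant for
  \<open>de\<close> still exceeds \<open>a\<close>; then \<open>l\<close> tends to 0.\<close>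

lemma counting_lower:
 fixes n :: "real => nat" and D :: "nat => nat"
 assumes D: "(%m. real (D m) / real m ^ p) ----> kp" and p: "p > 0" and c: "0 < c" "c < 1"
  and low: "!!de. 0 < de ==> de < c ==> EX v>0. EX M. \<forall>\<^sub>F l in at_right 0. ALL m. l < v * de ^ (2 * m) --> D m <= n l + M"
  and a: "a < kp / (2 * \<bar>ln c\<bar>) ^ p"
 shows "\<forall>\<^sub>F l in at_right 0. a < real (n l) / \<bar>ln l\<bar> ^ p"
proof -
 have "((%de. kp / (2 * \<bar>ln de\<bar>) ^ p) \<longlongrightarrow> kp / (2 * \<bar>ln c\<bar>) ^ p) (at_left c)" by (rule tendsto_intros | use c in force)+
 from order_tendstoD(1)[OF this a] have "\<forall>\<^sub>F de in at_left c. a < kp / (2 * \<bar>ln de\<bar>) ^ p" .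
 moreover have "\<forall>\<^sub>F de in at_left c. 0 < de & de < c" by (simp add: eventually_at_left_field) (use c in \<open>auto intro: exI[of _ 0]\<close>)
 ultimately have "\<forall>\<^sub>F de in at_left c. a < kp / (2 * \<bar>ln de\<bar>) ^ p & 0 < de & de < c" by (rule eventually_conj)
 from eventually_happens[OF this] obtain de where d: "a < kp / (2 * \<bar>ln de\<bar>) ^ p" "0 < de" "de < c" using trivial_limit_at_left_real by blast
 obtain v M where v: "v > 0" and lo: "\<forall>\<^sub>F l in at_right 0. ALL m. l < v * de ^ (2 * m) --> D m <= n l + M" using low[OF d(2,3)] by blast
 define r where "r = 2 * \<bar>ln de\<bar>"
 have r: "r > 0" using c d by (simp add: r_def)
 \<comment> \<open>For large \<open>x\<close>, the largest integer strictly below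
   \<open>(x + ln v) / r\<close>, because the hypothesis on \<open>l\<close> is strict.\<close>
 define m where "m x = nat (\<lceil>(x + ln v) / r\<rceil> - 1)" for x
 have m_bounds: "\<forall>\<^sub>F x in at_top. (x + ln v) / r - 1 <= real (m x) & real (m x) < (x + ln v) / r" using eventually_gt_at_top[of "- ln v"]
 proof eventually_elim
  case (elim x)
  hence "0 < (x + ln v) / r" using r by simp
  thus ?case unfolding m_def by linarith
 qed
 hence "\<forall>\<^sub>F x in at_top. (x + ln v) / r - 1 <= real (m x) & real (m x) <= (x + ln v) / r + 1" by eventually_elim linarith
 from order_tendstoD(1)[OF scaled_limit[OF D p r affine_limit[OF r this], of "- real M"], of a]
 have "\<forall>\<^sub>F x in at_top. a < (real (D (m x)) + - real M) / x ^ p" using d(1) by (simp add: r_def)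
 from eventually_compose_filterlim[OF eventually_conj[OF this m_bounds] at_right_0_exp]
 have "\<forall>\<^sub>F l in at_right 0. a < (real (D (m (- ln l))) + - real M) / (- ln l) ^ p
   & (- ln l + ln v) / r - 1 <= real (m (- ln l)) & real (m (- ln l)) < (- ln l + ln v) / r" .
 moreover have "\<forall>\<^sub>F l in at_right 0. (0::real) < l & l < 1" by (simp add: eventually_at_right_field) (auto intro: exI[of _ 1])
 ultimately show ?thesis using lo
 proof eventually_elim
  case (elim l)
  have ln: "ln l < 0" using elim by simp
  have "real (m (- ln l)) * r < - ln l + ln v" using elim(1) r by (simp add: pos_less_divide_eq)
  hence "ln l < ln (v * de ^ (2 * m (- ln l)))" using d c v by (simp add: ln_mult ln_realpow r_def algebra_simps)
  hence "l < v * de ^ (2 * m (- ln l))" using elim d v by simp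
  hence "real (D (m (- ln l))) <= real (n l) + real M" using elim(3) by (metis of_nat_add of_nat_le_iff)
  hence "(real (D (m (- ln l))) + - real M) / (- ln l) ^ p <= real (n l) / (- ln l) ^ p" using ln by (intro divide_right_mono) auto
  thus ?case using elim ln by simp
 qed
qed

section \<open>From the abstract counts to the two limits\<close>

lemma finite_card_bound:
 assumes "!!G. finite G ==> G \<subseteq> S ==> card G <= k" shows "finite S & card S <= k"
proof -
 have "finite S" by (rule ccontr) (metis assms infinite_arbitrarily_large not_less_eq_eq order_refl)
 thus ?thesis using assms by blast
qed

lemma KS_J: "(w, f) \<in> KS ==> (J w, J f) \<in> KS"
proof -
 assume "(w, f) \<in> KS"
 then obtain fi where fi: "!!n::nat. tst (fi n)" "(%n. mk (fi n)) ----> w" "(%n. mk (lap (fi n))) ----> - f" using KS_seq by blast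
 have l: "lap (%x. \<i> * fi n x) = (%x. \<i> * lap (fi n) x)" for n by (rule lap_bl[OF tst_smooth[OF fi(1)] bounded_linear_mult_right])
 show ?thesis
 proof (rule KS_closedI[of "%n x. \<i> * fi n x"])
  show "tst (%x. \<i> * fi n x)" for n by (rule tst_cmult[OF fi(1)])
  show "(%n. mk (%x. \<i> * fi n x)) ----> J w" using bounded_linear.tendsto[OF cm_bl fi(2), of \<i>] by (simp add: cm_mk tst_L2 fi(1))
  have "J (- f) = - J f" using bounded_linear.linear[OF cm_bl, of \<i>] linear_neg by blast
  thus "(%n. mk (lap (%x. \<i> * fi n x))) ----> - J f" using bounded_linear.tendsto[OF cm_bl fi(3), of \<i>] by (simp add: l cm_mk tst_lap_L2 fi(1))
 qed
qed

context ball_potential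
begin

lemma A_diag_graph: assumes "eigenbasis sg B ev" shows "diag_graph (A sg) B ev"
proof
 show "onb B" by (rule EB_onb[OF assms])
 show "(e, ev e *\<^sub>R e) \<in> A sg" if "e \<in> B" for e by (rule EB_A[OF assms that])
 show "inner g u' = inner u g'" if "(u, g) \<in> A sg" "(u', g') \<in> A sg" for u g u' g' by (rule A_sym[OF that])
 show "(EX g. (u, g) \<in> A sg) \<longleftrightarrow> (%e. (ev e)^2 * (inner u e)^2) summable_on B" for u by (rule A_domain[OF assms])
 show "(J u, J g) \<in> A sg" if "(u, g) \<in> A sg" for u g
 proof -
  have "(u, g - sg *\<^sub>R mo V u) \<in> K" using that by (simp add: A_iff)
  then obtain h w where hw: "u = h + w" "h \<in> H" "(w, g - sg *\<^sub>R mo V u) \<in> KS" by (auto simp: K_def)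
  have "J g - sg *\<^sub>R mo V (J u) = J (g - sg *\<^sub>R mo V u)" by (simp add: mo_cm[OF bmV] linear_diff[OF bounded_linear.linear[OF cm_bl]] cm_scaleR)
  hence "(J w, J g - sg *\<^sub>R mo V (J u)) \<in> KS" using KS_J[OF hw(3)] by simp
  moreover have "J u = J h + J w" by (simp add: hw(1) cm_add)
  ultimately have "(J u, J g - sg *\<^sub>R mo V (J u)) \<in> K" using H_cm[OF hw(2)] by (auto simp: K_def)
  thus ?thesis by (simp add: A_iff)
 qed
 show "(u + u', g + g') \<in> A sg" if "(u, g) \<in> A sg" "(u', g') \<in> A sg" for u g u' g' using subspace_add[OF A_sub that] by simp
qed

lemma krein_perturbed_eq:
 assumes W: "!!x. W x = sg * V x"
 shows "krein_perturbed (ball 0 1) W = {(u, f). u \<in> L2 MB & f \<in> L2 MB & (mk u, mk f) \<in> A sg}"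
proof -
 have Wm: "(%x. cor (W x) * u x) \<in> L2 MB" "mk (%x. cor (W x) * u x) = sg *\<^sub>R mo V (mk u)" if "u \<in> L2 MB" for u
 proof -
  have eq: "(%x. cor (W x) * u x) = (%x. cor sg * (cor (V x) * u x))" by (simp add: W mult.assoc)
  show "(%x. cor (W x) * u x) \<in> L2 MB" "mk (%x. cor (W x) * u x) = sg *\<^sub>R mo V (mk u)" unfolding eq by (auto simp: mo_mk[OF bmV that] mk_scaleR bm_mult_L2[OF bmV that] L2_cmult)
 qed
 show ?thesis
 proof (intro set_eqI iffI)
  fix p assume "p \<in> krein_perturbed (ball 0 1) W"
  then obtain u f where p: "p = (u, %x. f x + cor (W x) * u x)" "(u, f) \<in> krein_laplacian (ball 0 1)" by (auto simp: krein_perturbed_def)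
  hence uf: "u \<in> L2 MB" "f \<in> L2 MB" "(mk u, mk f) \<in> K" by (simp_all add: krein_laplacian_iff)
  thus "p \<in> {(u, f). u \<in> L2 MB & f \<in> L2 MB & (mk u, mk f) \<in> A sg}" by (simp add: p(1) L2_add Wm mk_add A_iff)
 next
  fix p assume "p \<in> {(u, f). u \<in> L2 MB & f \<in> L2 MB & (mk u, mk f) \<in> A sg}"
  then obtain u g where p: "p = (u, g)" "u \<in> L2 MB" "g \<in> L2 MB" "(mk u, mk g) \<in> A sg" by auto
  define f where "f x = g x - cor (W x) * u x" for x
  have "f \<in> L2 MB" "mk f = mk g - sg *\<^sub>R mo V (mk u)" unfolding f_def[abs_def] using p Wm[OF p(2)] by (simp_all add: L2_diff mk_diff)
  hence "(u, f) \<in> krein_laplacian (ball 0 1)" using p by (simp add: krein_laplacian_iff A_iff)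
  moreover have "g = (%x. f x + cor (W x) * u x)" by (simp add: f_def fun_eq_iff)
  ultimately show "p \<in> krein_perturbed (ball 0 1) W" unfolding p(1) krein_perturbed_def by blast
 qed
qed

lemma trace_count:
 assumes EB: "eigenbasis sg B ev" and W: "!!x. W x = sg * V x" and I: "I \<in> sets borel" and fin: "finite {e \<in> B. ev e \<in> I}"
 shows "L2_trace MB (spectral_projection MB (krein_perturbed (ball 0 1) W) I) = ennreal (real (card {e \<in> B. ev e \<in> I}) / 2)"
proof -
 interpret dg: diag_graph "A sg" B ev by (rule A_diag_graph[OF EB])
 show ?thesis using dg.trace_spectral_projection[OF I fin] by (simp add: krein_perturbed_eq[OF W] dg.TG_def)
qed

text \<open>\<open>HP (m + 2)\<close> serves both bounds: as the space of constraints for the upper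
  one and as the space of test vectors for the lower one.\<close>

lemma test_space:
 "EX Y :: 'a l2 set. finite Y & Y \<subseteq> H & independent Y & card Y = Dm DIM('a) m & span Y = HP (m + 2)
  & (ALL h:H. (ALL y:Y. inner h y = 0) --> inner (mo V h) h <= M * c ^ (2 * (m + 2) + DIM('a)) * (norm h)^2)"
proof -
 obtain Y :: "'a l2 set" where Y: "finite Y" "ALL x:Y. norm x = 1" "pairwise orthogonal Y"
  "card Y + 2 * Nd DIM('a) m = 2 * Nd DIM('a) (m + 2)" "span Y = HP (m + 2)" using harmonic_basis[of m, where 'a='a] unfolding HP_def by blast
 have "Y \<subseteq> H" using span_superset[of Y] HP_H[of "m + 2"] Y(5) by auto
 moreover have "independent Y" by (rule pairwise_orthogonal_independent[OF Y(3)]) (use Y(2) in force)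
 moreover have "card Y = Dm DIM('a) m" using Y(4) by (simp add: Dm_def)
 ultimately show ?thesis using form_upper[OF _ Y(1-3,5)] Y(1,5) by (intro exI[of _ Y]) blast
qed

text \<open>Absorbs the degree shift by 2 and the volume exponent, so that only
  \<open>c ^ (2 * m)\<close> depends on \<open>m\<close>.\<close>

definition "Cu = M * c ^ (4 + DIM('a))"

lemma Cu_pos: "Cu > 0" using M c by (simp add: Cu_def)

lemma Cu_eq: "M * c ^ (2 * (m + 2) + DIM('a)) = Cu * c ^ (2 * m)"
proof -
 have "2 * (m + 2) + DIM('a) = (4 + DIM('a)) + 2 * m" by simp
 thus ?thesis by (simp only: Cu_def power_add mult.assoc)
qed

lemma lower_test_space:
 assumes "0 < de" "de < c"
 shows "EX v>0. ALL m l. l < v * de ^ (2 * m) --> (EX Y :: 'a l2 set. finite Y & Y \<subseteq> H & independent Y & card Y = Dm DIM('a) m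
  & (ALL h:span Y. h ~= 0 --> l * (norm h)^2 < inner (mo V h) h))"
proof -
 obtain v where v: "v > 0" "!!m h. h \<in> HP m ==> v * de ^ (2 * m + DIM('a)) * (norm h)^2 <= inner (mo V h) h" using form_lower[OF assms] by blast
 define v' where "v' = v * de ^ (4 + DIM('a))"
 have "v' > 0" using v assms by (simp add: v'_def)
 moreover have "EX Y :: 'a l2 set. finite Y & Y \<subseteq> H & independent Y & card Y = Dm DIM('a) m
  & (ALL h:span Y. h ~= 0 --> l * (norm h)^2 < inner (mo V h) h)" if l: "l < v' * de ^ (2 * m)" for m l
 proof -
  obtain Y :: "'a l2 set" where Y: "finite Y" "Y \<subseteq> H" "independent Y" "card Y = Dm DIM('a) m" "span Y = HP (m + 2)" using test_space[of m] by blast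
  have "l * (norm h)^2 < inner (mo V h) h" if h: "h \<in> span Y" "h ~= 0" for h
  proof -
   have "l * (norm h)^2 < v' * de ^ (2 * m) * (norm h)^2" using l h(2) by (intro mult_strict_right_mono) auto
   also have "v' * de ^ (2 * m) = v * de ^ (2 * (m + 2) + DIM('a))"
   proof -
    have "2 * (m + 2) + DIM('a) = (4 + DIM('a)) + 2 * m" by simp
    thus ?thesis by (simp only: v'_def power_add mult.assoc)
   qed
   also have "... * (norm h)^2 <= inner (mo V h) h" by (rule v(2)) (use h Y(5) in auto)
   finally show ?thesis .
  qed
  thus ?thesis using Y by blast
 qed
 ultimately show ?thesis by blast
qed

lemma upper_test_space:
 assumes k: "k > 0" and l: "k * Cu * c ^ (2 * m) <= l"
 shows "EX Y :: 'a l2 set. finite Y & Y \<subseteq> H & card Y = Dm DIM('a) m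
  & (ALL h:H. (ALL y:Y. inner h y = 0) --> k * inner (mo V h) h <= l * (norm h)^2)"
proof -
 obtain Y :: "'a l2 set" where Y: "finite Y" "Y \<subseteq> H" "card Y = Dm DIM('a) m"
  "!!h. h \<in> H ==> (ALL y:Y. inner h y = 0) ==> inner (mo V h) h <= Cu * c ^ (2 * m) * (norm h)^2" using test_space[of m] unfolding Cu_eq by blast
 have "k * inner (mo V h) h <= l * (norm h)^2" if h: "h \<in> H" "ALL y:Y. inner h y = 0" for h
 proof -
  have "k * inner (mo V h) h <= k * (Cu * c ^ (2 * m) * (norm h)^2)" using Y(4)[OF h] k by (intro mult_left_mono) auto
  also have "... <= l * (norm h)^2" using mult_right_mono[OF l, of "(norm h)^2"] by (simp add: mult.assoc)
  finally show ?thesis .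
 qed
 thus ?thesis using Y(1-3) by blast
qed

definition "lim_const p = (4 / fact p) / (2 * \<bar>ln c\<bar>) ^ p"

lemma limit_from_bounds:
 assumes d: "DIM('a) = Suc p" "p > 0" and k: "k > 0"
  and up: "\<forall>\<^sub>F l in at_right 0. ALL m. k * Cu * c ^ (2 * m) <= l --> n l <= Dm DIM('a) m + M1"
  and low: "!!de. 0 < de ==> de < c ==> EX v>0. EX M2. \<forall>\<^sub>F l in at_right 0. ALL m. l < v * de ^ (2 * m) --> Dm DIM('a) m <= n l + M2"
 shows "((%l. real (n l) / \<bar>ln l\<bar> ^ p) \<longlongrightarrow> lim_const p) (at_right 0)"
proof (rule order_tendstoI)
 fix a assume "a < lim_const p"
 thus "\<forall>\<^sub>F l in at_right 0. a < real (n l) / \<bar>ln l\<bar> ^ p" using counting_lower[OF Dm_limit d(2) c low[unfolded d(1)]] by (simp add: lim_const_def)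
next
 fix a assume "lim_const p < a"
 thus "\<forall>\<^sub>F l in at_right 0. real (n l) / \<bar>ln l\<bar> ^ p < a" using counting_upper[OF Dm_limit d(2) c mult_pos_pos[OF k Cu_pos] up[unfolded d(1)]] by (simp add: lim_const_def)
qed

lemma ex_m: assumes "l > 0" "k > 0" shows "EX m. k * Cu * c ^ (2 * m) <= l"
proof -
 obtain n where "c ^ n < l / (k * Cu)" using real_arch_pow_inv[of "l / (k * Cu)" c] assms Cu_pos c by auto
 hence "k * Cu * c ^ n <= l" using assms Cu_pos by (simp add: field_simps)
 moreover have "c ^ (2 * n) <= c ^ n" by (rule power_decreasing) (use c in auto)
 hence "k * Cu * c ^ (2 * n) <= k * Cu * c ^ n" using assms Cu_pos by (intro mult_left_mono) auto
 ultimately show ?thesis using order_trans by blast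
qed

text \<open>Common to both signs. \<open>U\<close> bounds the cardinality of every finite subset of
  \<open>S l\<close>, which also yields the finiteness that \<open>W\<close> presupposes.\<close>

lemma count_asymptotics:
 fixes S :: "real => 'b set"
 assumes d: "DIM('a) = Suc p" "p > 0" and k: "k > 0" "k' > 0" and L: "Lm > 0"
  and U: "ALL l Y G. l > 0 --> finite Y --> Y \<subseteq> H -->
  (ALL h:H. (ALL y:Y. inner h y = 0) --> k * inner (mo V h) h <= l * (norm h)^2) -->
  finite G --> G \<subseteq> S l --> card G <= card Y + M1"
  and W: "ALL l Y. 0 < l --> l < Lm --> finite Y --> Y \<subseteq> H --> independent Y -->
  (ALL h:span Y. h ~= 0 --> k' * l * (norm h)^2 < inner (mo V h) h) --> finite (S l) --> card Y <= card (S l) + M2"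
 shows "((%l. real (card (S l)) / \<bar>ln l\<bar> ^ p) \<longlongrightarrow> lim_const p) (at_right 0)" "l > 0 ==> finite (S l)"
proof -
 have up: "finite (S l) & card (S l) <= Dm DIM('a) m + M1" if l: "l > 0" "k * Cu * c ^ (2 * m) <= l" for l m
 proof (rule finite_card_bound)
  fix G assume G: "finite G" "G \<subseteq> S l"
  obtain Y :: "'a l2 set" where Y: "finite Y" "Y \<subseteq> H" "card Y = Dm DIM('a) m"
   "ALL h:H. (ALL y:Y. inner h y = 0) --> k * inner (mo V h) h <= l * (norm h)^2" using upper_test_space[OF k(1) l(2)] by auto
  from U[rule_format, OF l(1) Y(1,2) Y(4)[rule_format] G] show "card G <= Dm DIM('a) m + M1" by (simp add: Y(3))
 qed
 show fin: "finite (S l)" if "l > 0" for l using ex_m[OF that k(1)] up[OF that] by auto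
 show "((%l. real (card (S l)) / \<bar>ln l\<bar> ^ p) \<longlongrightarrow> lim_const p) (at_right 0)"
 proof (rule limit_from_bounds[OF d k(1)])
  show "\<forall>\<^sub>F l in at_right 0. ALL m. k * Cu * c ^ (2 * m) <= l --> card (S l) <= Dm DIM('a) m + M1" using eventually_at_right_less[of 0] by eventually_elim (use up in blast)
  fix de :: real assume dl: "0 < de" "de < c"
  obtain v where v: "v > 0" "!!m l. l < v * de ^ (2 * m) ==> (EX Y :: 'a l2 set. finite Y & Y \<subseteq> H & independent Y & card Y = Dm DIM('a) m
    & (ALL h:span Y. h ~= 0 --> l * (norm h)^2 < inner (mo V h) h))" using lower_test_space[OF dl] by blast
  have "\<forall>\<^sub>F l in at_right 0. 0 < l & l < Lm" by (simp add: eventually_at_right_field) (use L in \<open>auto intro: exI[of _ Lm]\<close>)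
  hence "\<forall>\<^sub>F l in at_right 0. ALL m. l < v / k' * de ^ (2 * m) --> Dm DIM('a) m <= card (S l) + M2"
  proof eventually_elim
   case (elim l)
   hence l: "0 < l" "l < Lm" by auto
   show ?case
   proof (intro allI impI)
    fix m assume "l < v / k' * de ^ (2 * m)"
    hence "k' * l < v * de ^ (2 * m)" using k(2) by (simp add: field_simps)
    from v(2)[OF this] obtain Y :: "'a l2 set" where Y: "finite Y" "Y \<subseteq> H" "independent Y" "card Y = Dm DIM('a) m"
     "!!h. h \<in> span Y ==> h ~= 0 ==> k' * l * (norm h)^2 < inner (mo V h) h" by blast
    from W[rule_format, OF l Y(1-3) Y(5) fin[OF l(1)]] show "Dm DIM('a) m <= card (S l) + M2" by (simp add: Y(4))
   qed
  qed
  thus "EX v>0. EX M2. \<forall>\<^sub>F l in at_right 0. ALL m. l < v * de ^ (2 * m) --> Dm DIM('a) m <= card (S l) + M2" using v(1) k(2) by (intro exI[of _ "v / k'"]) auto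
 qed
qed

lemma minus_asymptotics:
 assumes d: "DIM('a) = Suc p" "p > 0"
 shows "EX n :: real => nat. ((%l. real (n l) / \<bar>ln l\<bar> ^ p) \<longlongrightarrow> lim_const p) (at_right 0) &
  (ALL l>0. N_minus (ball 0 1) V l = ennreal (real (n l) / 2))"
proof -
 obtain B ev where EB: "eigenbasis (-1) B ev" using A_eigenbasis[of "-1"] unfolding eigenbasis_def by auto
 define S where "S l = {e \<in> B. ev e < - l}" for l
 obtain M1 where U: "ALL l Y G. l > 0 --> finite Y --> Y \<subseteq> H -->
  (ALL h:H. (ALL y:Y. inner h y = 0) --> 2 * inner (mo V h) h <= l * (norm h)^2) -->
  finite G --> G \<subseteq> S l --> card G <= card Y + M1" using upper_count_minus EB by (elim exE) (drule spec[of _ B], drule spec[of _ ev], drule (1) mp, rule that[unfolded S_def])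
 \<comment> \<open>The bound \<open>l < 1\<close>, the factor 1 and the error 0 bring
   \<open>lower_count_minus\<close> into the form of the window case.\<close>
 have W: "ALL l Y. 0 < l --> l < 1 --> finite Y --> Y \<subseteq> H --> independent Y -->
  (ALL h:span Y. h ~= 0 --> 1 * l * (norm h)^2 < inner (mo V h) h) --> finite (S l) --> card Y <= card (S l) + 0" using lower_count_minus[OF EB] unfolding S_def by simp
 note ca = count_asymptotics[OF d _ _ _ U W]
 have "N_minus (ball 0 1) V l = ennreal (real (card (S l)) / 2)" if "l > 0" for l using trace_count[OF EB, of "%x. - V x" "{..< - l}"] ca(2)[OF _ _ _ that] by (simp add: N_minus_def S_def)
 thus ?thesis using ca(1) by (intro exI[of _ "%l. card (S l)"]) simp
qed

lemma plus_asymptotics: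
 assumes d: "DIM('a) = Suc p" "p > 0"
 shows "EX n :: real => nat. ((%l. real (n l) / \<bar>ln l\<bar> ^ p) \<longlongrightarrow> lim_const p) (at_right 0) &
  (ALL l>0. N_plus (ball 0 1) V l = ennreal (real (n l) / 2))"
proof -
 define Lm where "Lm = lambda0 (ball (0::'a) 1)"
 have L: "Lm > 0" unfolding Lm_def by (rule lambda0_pos)
 obtain B ev where EB: "eigenbasis 1 B ev" using A_eigenbasis[of 1] unfolding eigenbasis_def by auto
 define S where "S l = {e \<in> B. l < ev e & ev e < Lm}" for l
 obtain M1 where U: "ALL l Y G. l > 0 --> finite Y --> Y \<subseteq> H -->
  (ALL h:H. (ALL y:Y. inner h y = 0) --> 16 * inner (mo V h) h <= l * (norm h)^2) -->
  finite G --> G \<subseteq> S l --> card G <= card Y + M1" using upper_count_plus[OF L] EB by (elim exE) (drule spec[of _ B], drule spec[of _ ev], drule (1) mp, rule that[unfolded S_def])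
 obtain M2 where W: "ALL l Y. 0 < l --> l < Lm --> finite Y --> Y \<subseteq> H --> independent Y -->
  (ALL h:span Y. h ~= 0 --> 8 * l * (norm h)^2 < inner (mo V h) h) --> finite (S l) --> card Y <= card (S l) + M2"
  using lower_count_plus[OF L] EB by (elim exE) (drule spec[of _ B], drule spec[of _ ev], drule (1) mp, rule that[unfolded S_def])
 note ca = count_asymptotics[OF d _ _ L U W]
 have "N_plus (ball 0 1) V l = ennreal (real (card (S l)) / 2)" if "l > 0" for l using trace_count[OF EB, of V "{l<..<Lm}"] ca(2)[OF _ _ that] by (simp add: N_plus_def S_def Lm_def)
 thus ?thesis using ca(1) by (intro exI[of _ "%l. card (S l)"]) simp
qed

lemma ennreal_limit:
 assumes d: "DIM('a) = Suc p" and n: "((%l. real (n l) / \<bar>ln l\<bar> ^ p) \<longlongrightarrow> lim_const p) (at_right 0)"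
  and N: "ALL l>0. N l = ennreal (real (n l) / 2)"
 shows "((%l. ennreal (\<bar>ln l\<bar> powi (1 - int DIM('a))) * N l)
  \<longlongrightarrow> ennreal (2 powi (2 - int DIM('a)) / (fact (DIM('a) - 1) * \<bar>ln c\<bar> ^ (DIM('a) - 1)))) (at_right 0)"
proof -
 have L: "((%l. ennreal (real (n l) / \<bar>ln l\<bar> ^ p / 2)) \<longlongrightarrow> ennreal (lim_const p / 2)) (at_right 0)" by (intro tendsto_ennrealI tendsto_divide n tendsto_const) simp
 \<comment> \<open>\<open>lim_const\<close> counts real dimensions; halving it leaves
   \<open>2 / (2 ^ p * fact p * \<bar>ln c\<bar> ^ p)\<close>.\<close>
 have e: "lim_const p / 2 = 2 powi (2 - int DIM('a)) / (fact (DIM('a) - 1) * \<bar>ln c\<bar> ^ (DIM('a) - 1))"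
 proof -
  have "(2::real) powi (2 - int DIM('a)) = 2 / 2 ^ p" using d by (simp add: power_int_diff)
  thus ?thesis using d by (simp add: lim_const_def power_mult_distrib)
 qed
 have "\<forall>\<^sub>F l in at_right 0. ennreal (real (n l) / \<bar>ln l\<bar> ^ p / 2) = ennreal (\<bar>ln l\<bar> powi (1 - int DIM('a))) * N l" using eventually_at_right_less[of "0::real"]
 proof eventually_elim
  case (elim l)
  have "\<bar>ln l\<bar> powi (1 - int DIM('a)) = 1 / \<bar>ln l\<bar> ^ p" using d by (simp add: power_int_minus field_simps)
  hence "ennreal (\<bar>ln l\<bar> powi (1 - int DIM('a))) * N l = ennreal (1 / \<bar>ln l\<bar> ^ p) * ennreal (real (n l) / 2)" using N elim by simp
  also have "... = ennreal (1 / \<bar>ln l\<bar> ^ p * (real (n l) / 2))" by (rule ennreal_mult[symmetric]) auto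
  also have "1 / \<bar>ln l\<bar> ^ p * (real (n l) / 2) = real (n l) / \<bar>ln l\<bar> ^ p / 2" by simp
  finally show ?case by (rule HOL.sym)
 qed
 from Lim_transform_eventually[OF L this] show ?thesis unfolding e .
qed

end

text \<open>Beyond radius \<open>c\<close> the support condition applies directly; on the sphere of
  radius \<open>c\<close> continuity does, along points \<open>y n\<close> that approach
  \<open>x\<close> radially from outside.\<close>

lemma potential_zero_outside:
 fixes V :: "'a::euclidean_space => real"
 assumes V: "continuous_on (cball 0 1) V" and c: "0 < c" "c < 1"
  and supp: "closure {x \<in> cball 0 1. V x ~= 0} = cball 0 c" and x: "x \<in> ball 0 1" "x \<notin> ball 0 c"
 shows "V x = 0"
proof -
 have out: "V y = 0" if "y \<in> cball 0 1" "norm y > c" for y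
 proof (rule ccontr)
  assume "V y ~= 0"
  hence "y \<in> closure {x \<in> cball 0 1. V x ~= 0}" using that by (intro subsetD[OF closure_subset]) auto
  hence "y \<in> cball 0 c" unfolding supp .
  thus False using that by simp
 qed
 show ?thesis
 proof (cases "norm x > c")
  case True thus ?thesis using out x by simp
 next
  case False
  hence nx: "norm x = c" using x by simp
  \<comment> \<open>The factors keep \<open>y n\<close> in the closed unit ball, where
    \<open>V\<close> is continuous, because \<open>(2 - c) * c <= 1\<close>.\<close>
  define y where "y n = (1 + (1 - c) / real (Suc n)) *\<^sub>R x" for n
  have yn: "norm (y n) = (1 + (1 - c) / real (Suc n)) * c" for n using c by (simp add: y_def nx)
  have y1: "y n \<in> cball 0 1" for n
  proof -
   have "(1 - c) / real (Suc n) <= 1 - c" using c by (simp add: divide_le_eq mult_le_cancel_left1)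
   hence "norm (y n) <= (2 - c) * c" unfolding yn using c by (intro mult_right_mono) auto
   also have "... = 1 - (1 - c)^2" by (simp add: power2_eq_square algebra_simps)
   also have "... <= 1" by simp
   finally show ?thesis by simp
  qed
  have "norm (y n) > c" for n unfolding yn using c by simp
  hence z: "V (y n) = 0" for n using out y1 by blast
  have "y ----> (1 + 0) *\<^sub>R x" unfolding y_def by (intro tendsto_intros LIMSEQ_Suc[OF lim_const_over_n])
  hence "(%n. V (y n)) ----> V x" using continuous_on_tendsto_compose[OF V, of y x sequentially] y1 x by simp
  thus ?thesis by (simp add: z LIMSEQ_const_iff)
 qed
qed

theorem corollary5p2:
  fixes V :: "'a::euclidean_space \<Rightarrow> real" and c :: real
  assumes dim: "DIM('a) \<ge> 2"
    and V_cont: "continuous_on (cball 0 1) V"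
    and V_nonneg: "\<forall>x\<in>cball 0 1. 0 \<le> V x"
    and c: "0 < c" "c < 1"
    and V_supp: "closure {x \<in> cball 0 1. V x \<noteq> 0} = cball 0 c"
    and V_pos: "\<forall>\<delta>. 0 < \<delta> \<and> \<delta> < c \<longrightarrow> (INF x\<in>ball 0 \<delta>. V x) > 0"
  shows "((\<lambda>l. ennreal (\<bar>ln l\<bar> powi (1 - int DIM('a))) * N_minus (ball (0::'a) 1) V l)
           \<longlongrightarrow> ennreal (2 powi (2 - int DIM('a)) / (fact (DIM('a) - 1) * \<bar>ln c\<bar> ^ (DIM('a) - 1))))
           (at_right 0)
       \<and> ((\<lambda>l. ennreal (\<bar>ln l\<bar> powi (1 - int DIM('a))) * N_plus (ball (0::'a) 1) V l)
           \<longlongrightarrow> ennreal (2 powi (2 - int DIM('a)) / (fact (DIM('a) - 1) * \<bar>ln c\<bar> ^ (DIM('a) - 1))))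
           (at_right 0)"
proof -
 have "compact (V ` cball 0 1)" by (intro compact_continuous_image V_cont) auto
 then obtain M where M: "M > 0" "!!x. x \<in> cball 0 1 ==> norm (V x) <= M" using compact_imp_bounded[THEN bounded_pos[THEN iffD1]] by (metis image_eqI)
 interpret ball_potential V c M
 proof
  have "V \<in> borel_measurable MB" by (rule continuous_imp_measurable_on_sets_lebesgue[OF continuous_on_subset[OF V_cont]]) auto
  thus "bm V M" using V_nonneg M(2) by (force simp: bm_def)
  show "V x = 0" if "x \<in> ball 0 1" "x \<notin> ball 0 c" for x by (rule potential_zero_outside[OF V_cont c V_supp that])
  fix de assume d: "0 < de" "de < c"
  have "(INF x\<in>ball 0 de. V x) <= V x" if "x \<in> ball 0 de" for x by (rule cINF_lower[OF _ that]) (use V_nonneg d c in \<open>auto intro!: bdd_belowI2[of _ 0]\<close>)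
  thus "EX v>0. ALL x:ball 0 de. v <= V x" using V_pos d by blast
 qed (use M c in auto)
 obtain p where p: "DIM('a) = Suc p" "p > 0" using dim by (cases "DIM('a)") auto
 obtain n1 :: "real => nat" where n1: "((%l. real (n1 l) / \<bar>ln l\<bar> ^ p) \<longlongrightarrow> lim_const p) (at_right 0)"
  "ALL l>0. N_minus (ball 0 1) V l = ennreal (real (n1 l) / 2)" using minus_asymptotics[OF p] by blast
 obtain n2 :: "real => nat" where n2: "((%l. real (n2 l) / \<bar>ln l\<bar> ^ p) \<longlongrightarrow> lim_const p) (at_right 0)"
  "ALL l>0. N_plus (ball 0 1) V l = ennreal (real (n2 l) / 2)" using plus_asymptotics[OF p] by blast
 show ?thesis using ennreal_limit[OF p(1) n1] ennreal_limit[OF p(1) n2] by blast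
qed

end
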